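(* Let $\mathcal T\in\mathbb T$ and $\mathcal T_\star\in\widehat{\mathbb T}$ with $\mathcal T_\star\ge\mathcal T$. Then $$\mathcal G(\mathcal T)-\mathcal G(\mathcal T_\star)\eqsim\|\nabla_{NC}(u_{\mathcal T_\star}-u_{\mathcal T})\|_\Omega^2+\|h_{\mathcal T}f\|_{\Omega(\mathcal T\setminus\mathcal T_\star)}^2.$$ Moreover, $$\mathcal G(\mathcal T)-\mathcal G(\mathcal T^\top)\eqsim\|\nabla_{NC}(u-u_{\mathcal T})\|_\Omega^2+\operatorname{osc}(\mathcal T)^2,$$ where $\operatorname{osc}(\mathcal T)^2:=\sum_{T\in\mathcal T}\int_Th_{\mathcal T}^2|f-f_T|^2\,dx$ with $f_T:=\frac1{|T|}\int_Tf\,dx$.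
   Context: $\Omega\subset\mathbb R^2$ is a bounded polygonal domain and $\mathcal T_\bot$ a conforming triangulation of $\Omega$ into closed triangles, each triangle having a designated refinement edge (the edge opposite its newest vertex), such that the matching assumption holds: if $T,T'\in\mathcal T_\bot$ and $T\cap T'$ is the refinement edge of $T$, then it is the refinement edge of $T'$. Newest vertex bisection splits a triangle by joining its newest vertex to the midpoint of its refinement edge; this midpoint is the newest vertex of both children. $\mathbb T$ is the set of all conforming triangulations obtained from $\mathcal T_\bot$ by finitely many newest vertex bisections; $\mathcal T\le\mathcal T_\star$ means that $\mathcal T_\star$ is a refinement of $\mathcal T$. $\mathcal T^\top$ is a formal largest element and $\widehat{\mathbb T}=\mathbb T\cup\{\mathcal T^\top\}$; $\mathcal T\setminus\mathcal T^\top:=\mathcal T$. $\mathcal S(\mathcal T)$ is the set of sides (edges, including boundary edges) of $\mathcal T$. $h_{\mathcal T}|_T:=|T|^{1/2}$ for $T\in\mathcal T$; $\Omega(\mathcal U):=\operatorname{interior}\bigcup_{T\in\mathcal U}T$ for $\mathcal U\subset\mathcal T$. $\|\cdot\|_\omega$ is the $L^2(\omega)$ norm. For interior $S=T_1\cap T_2$, $[\![v]\!]|_S:=(v|_{T_1}-v|_{T_2})|_S$, and $[\![v]\!]|_S:=v|_S$ for $S\subset\partial\Omega$. $\mathrm{CR}^1_0(\mathcal T)$ is the space of $v\in L^2(\Omega)$ with $v|_T$ affine for each $T\in\mathcal T$ and $\int_S[\![v]\!]\,ds=0$ for all $S\in\mathcal S(\mathcal T)$. $\nabla_{NC}$ is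 the piecewise gradient. Let $f\in L^2(\Omega)$; $u\in H^1_0(\Omega)$ is the weak solution of $-\Delta u=f$, and $u_{\mathcal T}\in\mathrm{CR}^1_0(\mathcal T)$ solves $\int_\Omega\nabla_{NC}u_{\mathcal T}\cdot\nabla_{NC}v\,dx=\int_\Omega fv\,dx$ for all $v\in\mathrm{CR}^1_0(\mathcal T)$; $u_{\mathcal T^\top}:=u$. For $v\in H^1_0(\Omega)$ or $v\in\mathrm{CR}^1_0(\mathcal T_\star)$ with $\mathcal T_\star\ge\mathcal T$ (and linear combinations), $\mathcal I_{\mathcal T}v\in\mathrm{CR}^1_0(\mathcal T)$ is defined by $\int_S\mathcal I_{\mathcal T}v\,ds=\int_Sv\,ds$ for all $S\in\mathcal S(\mathcal T)$. $\Lambda>0$ is a fixed constant with $\|h_{\mathcal T}^{-1}(v-\mathcal I_{\mathcal T}v)\|_T\le\Lambda\|\nabla_{NC}(v-\mathcal I_{\mathcal T}v)\|_T$ for all such $v$, all $\mathcal T\in\mathbb T$, $T\in\mathcal T$. Fix $\gamma>2\Lambda^2$ and set $\mathcal G(\mathcal T):=-\int_\Omega\big(\frac12|\nabla_{NC}u_{\mathcal T}|^2-fu_{\mathcal T}\big)dx+\gamma\|h_{\mathcal T}f\|_\Omega^2$ for $\mathcal T\in\mathbb T$, $\mathcal G(\mathcal T^\top):=-\int_\Omega\big(\frac12|\nabla u|^2-fu\big)dx$. $A\eqsim B$ means $c^{-1}A\le B\le cA$ with a constant $c>0$ depending only on $\gamma$, $\Lambda$ and $\mathcal T_\bot$. 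*)

theory Defs
  imports "HOL-Analysis.Analysis"
begin

type_synonym R2 = "real ^ 2"

text \<open>
  Elements of function spaces over a set \<open>U\<close> are represented by functions on the whole plane;
  only their values almost everywhere on \<open>U\<close> matter.
\<close>

definition L2 :: "R2 set \<Rightarrow> (R2 \<Rightarrow> 'b::euclidean_space) set" where
  "L2 U = {f. set_borel_measurable lebesgue U f \<and>
              set_integrable lebesgue U (\<lambda>x. (norm (f x))\<^sup>2)}"

definition L2_norm :: "R2 set \<Rightarrow> (R2 \<Rightarrow> 'b::euclidean_space) \<Rightarrow> real" where
  "L2_norm U f = sqrt (LINT x:U|lebesgue. (norm (f x))\<^sup>2)"

primrec C_k :: "nat \<Rightarrow> (R2 \<Rightarrow> real) \<Rightarrow> bool" where
  "C_k 0 f \<longleftrightarrow> continuous_on UNIV f"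
| "C_k (Suc k) f \<longleftrightarrow> (\<exists>g. (\<forall>x. GDERIV f x :> g x) \<and> (\<forall>i. C_k k (\<lambda>x. g x $ i)))"

definition smooth :: "(R2 \<Rightarrow> real) \<Rightarrow> bool" where
  "smooth f \<longleftrightarrow> (\<forall>k. C_k k f)"

definition test_fun :: "R2 set \<Rightarrow> (R2 \<Rightarrow> real) \<Rightarrow> bool" where
  "test_fun U \<phi> \<longleftrightarrow> smooth \<phi> \<and> compact (closure {x. \<phi> x \<noteq> 0}) \<and> closure {x. \<phi> x \<noteq> 0} \<subseteq> U"

definition grad :: "(R2 \<Rightarrow> real) \<Rightarrow> R2 \<Rightarrow> R2" where
  "grad \<phi> x = (THE D. GDERIV \<phi> x :> D)"

definition has_weak_grad :: "R2 set \<Rightarrow> (R2 \<Rightarrow> real) \<Rightarrow> (R2 \<Rightarrow> R2) \<Rightarrow> bool" where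
  "has_weak_grad U v g \<longleftrightarrow>
     (\<forall>K. compact K \<and> K \<subseteq> U \<longrightarrow> set_integrable lebesgue K v \<and> set_integrable lebesgue K g) \<and>
     (\<forall>\<phi>. test_fun U \<phi> \<longrightarrow>
        (LINT x:U|lebesgue. v x *\<^sub>R grad \<phi> x) = - (LINT x:U|lebesgue. \<phi> x *\<^sub>R g x))"

text \<open>The weak gradient is unique up to null subsets of the open set \<open>U\<close>.\<close>

definition weak_grad :: "R2 set \<Rightarrow> (R2 \<Rightarrow> real) \<Rightarrow> R2 \<Rightarrow> R2" where
  "weak_grad U v = (SOME g. has_weak_grad U v g)"

definition H1 :: "R2 set \<Rightarrow> (R2 \<Rightarrow> real) set" where
  "H1 U = {v \<in> L2 U. \<exists>g \<in> L2 U. has_weak_grad U v g}"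

definition H1_norm :: "R2 set \<Rightarrow> (R2 \<Rightarrow> real) \<Rightarrow> real" where
  "H1_norm U v = sqrt ((L2_norm U v)\<^sup>2 + (L2_norm U (weak_grad U v))\<^sup>2)"

definition H10 :: "R2 set \<Rightarrow> (R2 \<Rightarrow> real) set" where
  "H10 U = {v \<in> H1 U. \<exists>\<phi>. (\<forall>n. test_fun U (\<phi> n)) \<and>
                          (\<lambda>n. H1_norm U (\<lambda>x. \<phi> n x - v x)) \<longlonglongrightarrow> 0}"

text \<open>
  \<open>seg_integral S g\<close> is the integral of \<open>g\<close> over the segment \<open>S\<close> with respect to arc length.
  The two admissible choices of the end points give the same value.
\<close>

definition seg_ends :: "R2 set \<Rightarrow> R2 \<times> R2" where
  "seg_ends S = (SOME p. S = closed_segment (fst p) (snd p))"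

definition seg_param :: "R2 set \<Rightarrow> real \<Rightarrow> R2" where
  "seg_param S = linepath (fst (seg_ends S)) (snd (seg_ends S))"

definition seg_integral :: "R2 set \<Rightarrow> (R2 \<Rightarrow> real) \<Rightarrow> real" where
  "seg_integral S g =
     dist (fst (seg_ends S)) (snd (seg_ends S)) *
     (LINT t:{0..1}|lebesgue. g (seg_param S t))"

definition seg_L2 :: "R2 set \<Rightarrow> (R2 \<Rightarrow> real) set" where
  "seg_L2 S = {g. set_borel_measurable lebesgue {0..1} (\<lambda>t. g (seg_param S t)) \<and>
                  set_integrable lebesgue {0..1} (\<lambda>t. (g (seg_param S t))\<^sup>2)}"

text \<open>
  The trace on the edge \<open>S\<close> of the closed triangle \<open>T\<close>: the continuous extension to
  \<open>H1 (interior T)\<close>, with values in the square integrable functions on \<open>S\<close>, of the restriction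
  to \<open>S\<close> of functions that are smooth up to the boundary of \<open>T\<close>.
\<close>

definition is_trace :: "R2 set \<Rightarrow> R2 set \<Rightarrow> (R2 \<Rightarrow> real) \<Rightarrow> (R2 \<Rightarrow> real) \<Rightarrow> bool" where
  "is_trace T S v g \<longleftrightarrow> v \<in> H1 (interior T) \<and> g \<in> seg_L2 S \<and>
     (\<exists>\<phi>. (\<forall>n. smooth (\<phi> n)) \<and>
          (\<lambda>n. H1_norm (interior T) (\<lambda>x. \<phi> n x - v x)) \<longlonglongrightarrow> 0 \<and>
          (\<lambda>n. seg_integral S (\<lambda>x. (\<phi> n x - g x)\<^sup>2)) \<longlonglongrightarrow> 0)"

definition trace_on :: "R2 set \<Rightarrow> R2 set \<Rightarrow> (R2 \<Rightarrow> real) \<Rightarrow> R2 \<Rightarrow> real" where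
  "trace_on T S v = (SOME g. is_trace T S v g)"

text \<open>
  A marked triangle \<open>(z, T)\<close> is a closed triangle \<open>T\<close> together with its newest vertex \<open>z\<close>.
\<close>

type_synonym mtri = "R2 \<times> R2 set"
type_synonym mesh = "mtri set"

abbreviation tris :: "mesh \<Rightarrow> R2 set set" where
  "tris \<T> \<equiv> snd ` \<T>"

definition conforming :: "mesh \<Rightarrow> bool" where
  "conforming \<T> \<longleftrightarrow> triangulation (tris \<T>) \<and> (\<forall>T \<in> tris \<T>. 2 simplex T)"

definition ref_edge :: "mtri \<Rightarrow> R2 set" where
  "ref_edge t = convex hull ({x. x extreme_point_of (snd t)} - {fst t})"

definition matching :: "mesh \<Rightarrow> bool" where
  "matching \<T> \<longleftrightarrow>
     (\<forall>t \<in> \<T>. \<forall>t' \<in> \<T>. snd t \<inter> snd t' = ref_edge t \<longrightarrow> snd t \<inter> snd t' = ref_edge t')"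

text \<open>Slits are excluded: sides of a triangulation are either shared or on the boundary.\<close>

definition polygonal_domain :: "R2 set \<Rightarrow> bool" where
  "polygonal_domain \<Omega> \<longleftrightarrow> \<Omega> \<noteq> {} \<and> open \<Omega> \<and> connected \<Omega> \<and> bounded \<Omega> \<and>
     \<Omega> = interior (closure \<Omega>) \<and>
     (\<exists>\<P>. finite \<P> \<and> (\<forall>P \<in> \<P>. polytope P) \<and> closure \<Omega> = \<Union>\<P>)"

definition initial_mesh :: "R2 set \<Rightarrow> mesh \<Rightarrow> bool" where
  "initial_mesh \<Omega> \<T> \<longleftrightarrow> finite \<T> \<and> inj_on snd \<T> \<and> conforming \<T> \<and> \<Union>(tris \<T>) = closure \<Omega> \<and>
     (\<forall>t \<in> \<T>. fst t extreme_point_of (snd t)) \<and> matching \<T>"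

text \<open>
  Each of the two orderings of the end points \<open>a\<close>, \<open>b\<close> of the refinement edge contributes one child.
\<close>

definition children :: "mtri \<Rightarrow> mtri set" where
  "children t =
     {(midpoint a b, convex hull {fst t, a, midpoint a b}) | a b.
        card {fst t, a, b} = 3 \<and> \<not> affine_dependent {fst t, a, b} \<and>
        snd t = convex hull {fst t, a, b}}"

definition bisection :: "mesh \<Rightarrow> mesh \<Rightarrow> bool" where
  "bisection \<T> \<T>' \<longleftrightarrow> (\<exists>t \<in> \<T>. \<T>' = (\<T> - {t}) \<union> children t)"

text \<open>Intermediate partitions need not be conforming.\<close>

definition refinement :: "mesh \<Rightarrow> mesh \<Rightarrow> bool" where
  "refinement \<T> \<T>' \<longleftrightarrow> bisection\<^sup>*\<^sup>* \<T> \<T>'"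

definition meshes :: "mesh \<Rightarrow> mesh set" where
  "meshes \<T>0 = {\<T>. refinement \<T>0 \<T> \<and> conforming \<T>}"

datatype xmesh = Mesh mesh | Top

definition xmeshes :: "mesh \<Rightarrow> xmesh set" where
  "xmeshes \<T>0 = Mesh ` meshes \<T>0 \<union> {Top}"

fun xrefinement :: "mesh \<Rightarrow> xmesh \<Rightarrow> bool" where
  "xrefinement \<T> (Mesh \<T>') \<longleftrightarrow> refinement \<T> \<T>'"
| "xrefinement \<T> Top \<longleftrightarrow> True"

fun refined_tris :: "mesh \<Rightarrow> xmesh \<Rightarrow> R2 set set" where
  "refined_tris \<T> (Mesh \<T>') = tris \<T> - tris \<T>'"
| "refined_tris \<T> Top = tris \<T>"

definition region :: "R2 set set \<Rightarrow> R2 set" where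
  "region \<U> = interior (\<Union>\<U>)"

definition sides :: "mesh \<Rightarrow> R2 set set" where
  "sides \<T> = {S. \<exists>T \<in> tris \<T>. S edge_of T}"

definition mesh_size :: "mesh \<Rightarrow> R2 \<Rightarrow> real" where
  "mesh_size \<T> x = sqrt (measure lebesgue (THE T. T \<in> tris \<T> \<and> x \<in> interior T))"

text \<open>The piecewise gradient is the weak gradient on the union of the open triangles.\<close>

definition nc_grad :: "mesh \<Rightarrow> (R2 \<Rightarrow> real) \<Rightarrow> R2 \<Rightarrow> R2" where
  "nc_grad \<T> v = weak_grad (\<Union>T \<in> tris \<T>. interior T) v"

definition CR :: "R2 set \<Rightarrow> mesh \<Rightarrow> (R2 \<Rightarrow> real) set" where
  "CR \<Omega> \<T> = {v \<in> L2 \<Omega>.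
     (\<forall>T \<in> tris \<T>. \<exists>a b. AE x in lebesgue. x \<in> T \<longrightarrow> v x = a \<bullet> x + b) \<and>
     (\<forall>T1 \<in> tris \<T>. \<forall>T2 \<in> tris \<T>. \<forall>S \<in> sides \<T>. T1 \<noteq> T2 \<and> S = T1 \<inter> T2 \<longrightarrow>
        seg_integral S (\<lambda>x. trace_on T1 S v x - trace_on T2 S v x) = 0) \<and>
     (\<forall>T \<in> tris \<T>. \<forall>S. S edge_of T \<and> S \<subseteq> frontier \<Omega> \<longrightarrow>
        seg_integral S (trace_on T S v) = 0)}"

definition CR_solution :: "R2 set \<Rightarrow> mesh \<Rightarrow> (R2 \<Rightarrow> real) \<Rightarrow> (R2 \<Rightarrow> real) \<Rightarrow> bool" where
  "CR_solution \<Omega> \<T> f w \<longleftrightarrow> w \<in> CR \<Omega> \<T> \<and>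
     (\<forall>v \<in> CR \<Omega> \<T>. (LINT x:\<Omega>|lebesgue. nc_grad \<T> w x \<bullet> nc_grad \<T> v x) =
                    (LINT x:\<Omega>|lebesgue. f x * v x))"

definition weak_solution :: "R2 set \<Rightarrow> (R2 \<Rightarrow> real) \<Rightarrow> (R2 \<Rightarrow> real) \<Rightarrow> bool" where
  "weak_solution \<Omega> f w \<longleftrightarrow> w \<in> H10 \<Omega> \<and>
     (\<forall>v \<in> H10 \<Omega>. (LINT x:\<Omega>|lebesgue. weak_grad \<Omega> w x \<bullet> weak_grad \<Omega> v x) =
                    (LINT x:\<Omega>|lebesgue. f x * v x))"

fun solves :: "R2 set \<Rightarrow> (R2 \<Rightarrow> real) \<Rightarrow> xmesh \<Rightarrow> (R2 \<Rightarrow> real) \<Rightarrow> bool" where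
  "solves \<Omega> f (Mesh \<T>) w \<longleftrightarrow> CR_solution \<Omega> \<T> f w"
| "solves \<Omega> f Top w \<longleftrightarrow> weak_solution \<Omega> f w"

text \<open>
  \<open>H10_plus_CR \<Omega> \<T>'\<close> is the algebraic sum of the two spaces.  For \<open>v\<close> in it and a segment \<open>S\<close>
  that is a union of sides of \<open>\<T>'\<close>, the integral of \<open>v\<close> over \<open>S\<close> is the sum of the integrals over
  these sides, where the trace may be taken from either adjacent triangle of \<open>\<T>'\<close>: jumps across
  sides of \<open>\<T>'\<close> have mean zero.
\<close>

definition H10_plus_CR :: "R2 set \<Rightarrow> mesh \<Rightarrow> (R2 \<Rightarrow> real) set" where
  "H10_plus_CR \<Omega> \<T>' = {\<lambda>x. v x + w x | v w. v \<in> H10 \<Omega> \<and> w \<in> CR \<Omega> \<T>'}"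

definition side_integral :: "mesh \<Rightarrow> R2 set \<Rightarrow> (R2 \<Rightarrow> real) \<Rightarrow> real" where
  "side_integral \<T>' S v =
     (\<Sum>S' \<in> {S' \<in> sides \<T>'. S' \<subseteq> S}.
        seg_integral S' (trace_on (SOME T. T \<in> tris \<T>' \<and> S' edge_of T) S' v))"

text \<open>
  \<open>is_interpolant \<Omega> \<T> \<T>' v w\<close>: \<open>w\<close> is the interpolant of \<open>v\<close> (a function on the refinement \<open>\<T>'\<close>) on
  the mesh \<open>\<T>\<close>; it is determined up to null sets.
\<close>

definition is_interpolant ::
    "R2 set \<Rightarrow> mesh \<Rightarrow> mesh \<Rightarrow> (R2 \<Rightarrow> real) \<Rightarrow> (R2 \<Rightarrow> real) \<Rightarrow> bool" where
  "is_interpolant \<Omega> \<T> \<T>' v w \<longleftrightarrow> w \<in> CR \<Omega> \<T> \<and>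
     (\<forall>S \<in> sides \<T>. side_integral \<T> S w = side_integral \<T>' S v)"

definition interpolation_constant :: "R2 set \<Rightarrow> mesh \<Rightarrow> real \<Rightarrow> bool" where
  "interpolation_constant \<Omega> \<T>0 \<Lambda> \<longleftrightarrow> \<Lambda> > 0 \<and>
     (\<forall>\<T> \<in> meshes \<T>0. \<forall>\<T>' \<in> meshes \<T>0. refinement \<T> \<T>' \<longrightarrow>
        (\<forall>v \<in> H10_plus_CR \<Omega> \<T>'. \<forall>w. is_interpolant \<Omega> \<T> \<T>' v w \<longrightarrow>
          (\<forall>T \<in> tris \<T>.
             L2_norm T (\<lambda>x. inverse (mesh_size \<T> x) * (v x - w x))
               \<le> \<Lambda> * L2_norm T (nc_grad \<T>' (\<lambda>x. v x - w x)))))"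

text \<open>The argument \<open>u\<close> maps each mesh, and \<open>Top\<close>, to the corresponding solution.\<close>

fun energy :: "R2 set \<Rightarrow> real \<Rightarrow> (R2 \<Rightarrow> real) \<Rightarrow> (xmesh \<Rightarrow> R2 \<Rightarrow> real) \<Rightarrow> xmesh \<Rightarrow> real" where
  "energy \<Omega> \<gamma> f u (Mesh \<T>) =
     - (LINT x:\<Omega>|lebesgue. (1/2) * (norm (nc_grad \<T> (u (Mesh \<T>)) x))\<^sup>2 - f x * u (Mesh \<T>) x)
     + \<gamma> * (L2_norm \<Omega> (\<lambda>x. mesh_size \<T> x * f x))\<^sup>2"
| "energy \<Omega> \<gamma> f u Top =
     - (LINT x:\<Omega>|lebesgue. (1/2) * (norm (weak_grad \<Omega> (u Top) x))\<^sup>2 - f x * u Top x)"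

text \<open>
  The mesh on which differences of a function on the first and a function on the second argument
  are piecewise regular; \<open>H10\<close> functions are regular with respect to every mesh.
\<close>

fun finer_mesh :: "mesh \<Rightarrow> xmesh \<Rightarrow> mesh" where
  "finer_mesh \<T> (Mesh \<T>') = \<T>'"
| "finer_mesh \<T> Top = \<T>"

definition mean_value :: "R2 set \<Rightarrow> (R2 \<Rightarrow> real) \<Rightarrow> real" where
  "mean_value T f = (LINT x:T|lebesgue. f x) / measure lebesgue T"

definition osc_sq :: "mesh \<Rightarrow> (R2 \<Rightarrow> real) \<Rightarrow> real" where
  "osc_sq \<T> f =
     (\<Sum>T \<in> tris \<T>. LINT x:T|lebesgue. (mesh_size \<T> x)\<^sup>2 * \<bar>f x - mean_value T f\<bar>\<^sup>2)"

definition equiv_upto :: "real \<Rightarrow> real \<Rightarrow> real \<Rightarrow> bool" where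
  "equiv_upto c A B \<longleftrightarrow> inverse c * A \<le> B \<and> B \<le> c * A"

end

theory Submission
  imports Defs
begin

text \<open>
  Let \<open>u\<close> be the solution on the coarse mesh, let \<open>v\<close> be the solution on a refinement or the
  continuous solution, and let \<open>g\<close> be the (piecewise) gradient of \<open>v\<close>.  Both are compared with
  the interpolant \<open>w\<close> of \<open>v\<close> on the coarse mesh.  Since \<open>v\<close> and \<open>w\<close> have the same integrals over
  all coarse sides, Green's formula shows that \<open>g - \<nabla> w\<close> has integral zero over every coarse
  triangle (\<open>interpolant_mean_grad\<close>); it is therefore orthogonal to all vector fields that are
  constant on the coarse triangles, in particular to the piecewise gradients of coarse functions.
  Testing the coarse problem with \<open>w\<close>, and the other one with \<open>v\<close>, turns the energy difference into
  \<open>D\<^sup>2 / 2 - X + \<gamma> * B\<close>, where \<open>D\<close> is the norm of \<open>g - \<nabla> u\<close>, \<open>X\<close> is the integral of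
  \<open>f * (v - w)\<close>, and \<open>B\<close> is the loss of the squared norm of \<open>f\<close> weighted with the mesh size.

  On a triangle that is not refined, \<open>g - \<nabla> w\<close> is a constant with integral zero, so the
  interpolation estimate forces \<open>v = w\<close> there.  Hence only the refined triangles contribute to
  \<open>X\<close>, and \<open>\<bar>X\<bar> \<le> \<Lambda> * H * D\<close> with \<open>H\<close> the weighted norm of \<open>f\<close> over these triangles
  (\<open>energy_comparison\<close>).  A bisection halves the area, so \<open>H\<^sup>2 / 2 \<le> B \<le> H\<^sup>2\<close>
  (\<open>mesh_size_drop\<close>); in the continuous problem \<open>B = H\<^sup>2\<close>.  The lower bound on \<open>\<gamma>\<close> then lets
  the squares absorb the mixed term, so that the energy difference is comparable to
  \<open>D\<^sup>2 + H\<^sup>2\<close> (\<open>energy_difference_equiv\<close>).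

  For the oscillation, subtracting means decreases norms (\<open>osc_le\<close>).  Conversely, testing the
  continuous problem with a bubble function supported in one triangle bounds the mean of \<open>f\<close> on it
  by the error and the oscillation (\<open>tri_efficiency\<close>).  The constant depends on the shape of the
  triangle; the quotient of the squared lengths of the two edges at the newest vertex by the area
  does not change under bisection (\<open>shaped_children\<close>), so finitely many initial triangles bound it
  for all meshes.

  The analysis behind this consists of three facts.  Weak gradients are determined almost
  everywhere because test functions approximate indicators of boxes (\<open>AE_zero_of_test_fun\<close>).
  Traces exist by a trace inequality and the completeness of the space of square integrable
  functions (\<open>trace_exists\<close>), and Green's formula passes to the limit (\<open>green_H1\<close>).  Finally, a
  fine function has traces only from the fine triangles, so Green's formula on a coarse triangle is
  assembled along its bisection tree (\<open>green_tree\<close>).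
\<close>

section \<open>Square integrable functions\<close>

text \<open>
  Completeness of Lebesgue measure makes a function measurable as soon as it agrees almost everywhere
  with a measurable one.  Nonintegrable functions have integral \<open>0\<close>, so the congruence rules for
  integrals below hold without measurability assumptions.
\<close>

lemma lebesgue_measurable_cong_AE:
  fixes f g :: "'a::euclidean_space \<Rightarrow> 'b::euclidean_space"
  assumes "AE x in lebesgue. f x = g x" "f \<in> borel_measurable lebesgue"
  shows "g \<in> borel_measurable lebesgue"
proof -
  have N: "negligible {x. f x \<noteq> g x}"
    using assms(1) by (simp add: negligible_iff_null_sets eventually_ae_filter)
      (metis (no_types, lifting) completion.complete2 mem_Collect_eq negligible_iff_null_sets subsetI)
  show ?thesis
  proof (rule measurableI)
    fix A :: "'b set" assume A: "A \<in> sets borel"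
    have 1: "f -` A \<in> sets lebesgue"
      using measurable_sets[OF assms(2) A] by simp
    have "sym_diff (f -` A) (g -` A) \<subseteq> {x. f x \<noteq> g x}" by auto
    then have "negligible (sym_diff (f -` A) (g -` A))"
      using N negligible_subset by blast
    then have "g -` A \<in> sets lebesgue"
      using sets_negligible_symdiff[OF 1] by blast
    then show "g -` A \<inter> space lebesgue \<in> sets lebesgue" by simp
  qed simp
qed

lemma integrable_lebesgue_cong_AE:
  fixes f g :: "'a::euclidean_space \<Rightarrow> 'b::euclidean_space"
  assumes "AE x in lebesgue. f x = g x"
  shows "integrable lebesgue f \<longleftrightarrow> integrable lebesgue g"
proof -
  have "AE x in lebesgue. g x = f x" using assms by auto
  then show ?thesis
    using lebesgue_measurable_cong_AE[OF assms] lebesgue_measurable_cong_AE[of g f]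
      integrable_cong_AE[OF _ _ assms] borel_measurable_integrable by blast
qed

lemma integral_lebesgue_cong_AE:
  fixes f g :: "'a::euclidean_space \<Rightarrow> 'b::euclidean_space"
  assumes "AE x in lebesgue. f x = g x"
  shows "integral\<^sup>L lebesgue f = integral\<^sup>L lebesgue g"
proof (cases "integrable lebesgue f")
  case True
  then have "f \<in> borel_measurable lebesgue" "g \<in> borel_measurable lebesgue"
    using integrable_lebesgue_cong_AE[OF assms] by auto
  then show ?thesis using assms by (intro integral_cong_AE) auto
next
  case False
  then show ?thesis
    using integrable_lebesgue_cong_AE[OF assms] by (simp add: not_integrable_integral_eq)
qed

lemma set_LINT_cong_AE:
  fixes f g :: "'a::euclidean_space \<Rightarrow> 'b::euclidean_space"
  assumes "AE x in lebesgue. x \<in> A \<longrightarrow> f x = g x"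
  shows "(LINT x:A|lebesgue. f x) = (LINT x:A|lebesgue. g x)"
  unfolding set_lebesgue_integral_def
  by (intro integral_lebesgue_cong_AE) (use assms in \<open>auto simp: indicator_def\<close>)

lemma set_integrable_cong_AE':
  fixes f g :: "'a::euclidean_space \<Rightarrow> 'b::euclidean_space"
  assumes "AE x in lebesgue. x \<in> A \<longrightarrow> f x = g x"
  shows "set_integrable lebesgue A f \<longleftrightarrow> set_integrable lebesgue A g"
  unfolding set_integrable_def
  by (intro integrable_lebesgue_cong_AE) (use assms in \<open>auto simp: indicator_def\<close>)

lemma set_LINT_cong_set_AE:
  fixes f :: "'a::euclidean_space \<Rightarrow> 'b::euclidean_space"
  assumes "AE x in lebesgue. x \<in> A \<longleftrightarrow> x \<in> B"
  shows "(LINT x:A|lebesgue. f x) = (LINT x:B|lebesgue. f x)"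
  unfolding set_lebesgue_integral_def
  by (intro integral_lebesgue_cong_AE) (use assms in \<open>auto simp: indicator_def\<close>)

lemma set_integrable_cong_set_AE:
  fixes f :: "'a::euclidean_space \<Rightarrow> 'b::euclidean_space"
  assumes "AE x in lebesgue. x \<in> A \<longleftrightarrow> x \<in> B"
  shows "set_integrable lebesgue A f \<longleftrightarrow> set_integrable lebesgue B f"
  unfolding set_integrable_def
  by (intro integrable_lebesgue_cong_AE) (use assms in \<open>auto simp: indicator_def\<close>)

lemma set_borel_measurable_cong_AE':
  fixes f g :: "'a::euclidean_space \<Rightarrow> 'b::euclidean_space"
  assumes "AE x in lebesgue. x \<in> A \<longrightarrow> f x = g x" "set_borel_measurable lebesgue A f"
  shows "set_borel_measurable lebesgue A g"
  using assms(2) unfolding set_borel_measurable_def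
  by (rule lebesgue_measurable_cong_AE[rotated]) (use assms in \<open>auto simp: indicator_def\<close>)

lemma AE_not_in_negligible: "negligible N \<Longrightarrow> AE x in lebesgue. x \<notin> N"
  by (simp add: AE_not_in negligible_iff_null_sets)

lemma L2_cong_AE:
  fixes f g :: "R2 \<Rightarrow> 'b::euclidean_space"
  assumes "AE x in lebesgue. x \<in> U \<longrightarrow> f x = g x" "f \<in> L2 U"
  shows "g \<in> L2 U"
proof -
  have "AE x in lebesgue. x \<in> U \<longrightarrow> (norm (f x))\<^sup>2 = (norm (g x))\<^sup>2"
    using assms(1) by auto
  from set_integrable_cong_AE'[OF this] show ?thesis
    using assms set_borel_measurable_cong_AE'[OF assms(1)] by (auto simp: L2_def)
qed

lemma L2_norm_cong_AE:
  fixes f g :: "R2 \<Rightarrow> 'b::euclidean_space"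
  assumes "AE x in lebesgue. x \<in> U \<longrightarrow> f x = g x"
  shows "L2_norm U f = L2_norm U g"
  unfolding L2_norm_def
  by (rule arg_cong[where f=sqrt], rule set_LINT_cong_AE) (use assms in auto)

lemma L2_inner_integrable:
  fixes f g :: "R2 \<Rightarrow> 'b::euclidean_space"
  assumes "f \<in> L2 U" "g \<in> L2 U"
  shows "set_integrable lebesgue U (\<lambda>x. f x \<bullet> g x)"
proof -
  have f: "(\<lambda>x. indicator U x *\<^sub>R f x) \<in> borel_measurable lebesgue"
    and g: "(\<lambda>x. indicator U x *\<^sub>R g x) \<in> borel_measurable lebesgue"
    using assms by (auto simp: L2_def set_borel_measurable_def)
  show ?thesis
  proof (rule set_integrable_bound)
    show "set_integrable lebesgue U (\<lambda>x. (norm (f x))\<^sup>2 + (norm (g x))\<^sup>2)"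
      using assms by (auto simp: L2_def)
    have "(\<lambda>x. (indicator U x *\<^sub>R f x) \<bullet> (indicator U x *\<^sub>R g x)) \<in> borel_measurable lebesgue"
      using f g by (rule borel_measurable_inner)
    moreover have "(\<lambda>x. (indicator U x *\<^sub>R f x) \<bullet> (indicator U x *\<^sub>R g x))
        = (\<lambda>x. indicator U x *\<^sub>R (f x \<bullet> g x))"
      by (auto simp: indicator_def)
    ultimately show "set_borel_measurable lebesgue U (\<lambda>x. f x \<bullet> g x)"
      by (simp add: set_borel_measurable_def)
    have "norm (f x \<bullet> g x) \<le> norm ((norm (f x))\<^sup>2 + (norm (g x))\<^sup>2)" for x
    proof -
      have "\<bar>f x \<bullet> g x\<bar> \<le> norm (f x) * norm (g x)" by (rule Cauchy_Schwarz_ineq2)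
      also have "\<dots> \<le> (norm (f x))\<^sup>2 + (norm (g x))\<^sup>2"
        using sum_squares_bound[of "norm (f x)" "norm (g x)"]
          mult_nonneg_nonneg[OF norm_ge_zero norm_ge_zero, of "f x" "g x"] by linarith
      finally show ?thesis by simp
    qed
    then show "AE x in lebesgue. x \<in> U \<longrightarrow> norm (f x \<bullet> g x) \<le> norm ((norm (f x))\<^sup>2 + (norm (g x))\<^sup>2)"
      by simp
  qed
qed

lemma L2_norm_integrable:
  "f \<in> L2 U \<Longrightarrow> set_integrable lebesgue U (\<lambda>x. (norm (f x))\<^sup>2)"
  by (simp add: L2_def)

lemma L2_norm_power2:
  "(L2_norm U f)\<^sup>2 = (LINT x:U|lebesgue. (norm (f x))\<^sup>2)"
proof -
  have "0 \<le> (LINT x:U|lebesgue. (norm (f x))\<^sup>2)"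
    unfolding set_lebesgue_integral_def by (rule integral_nonneg_AE) simp
  then show ?thesis by (simp add: L2_norm_def)
qed

lemma L2_norm_nonneg [simp]: "0 \<le> L2_norm U f"
  unfolding L2_norm_def set_lebesgue_integral_def
  by (intro real_sqrt_ge_zero integral_nonneg_AE) simp

lemma L2_add:
  fixes f g :: "R2 \<Rightarrow> 'b::euclidean_space"
  assumes "f \<in> L2 U" "g \<in> L2 U"
  shows "(\<lambda>x. f x + g x) \<in> L2 U"
proof -
  have "(\<lambda>x. indicator U x *\<^sub>R f x + indicator U x *\<^sub>R g x) \<in> borel_measurable lebesgue"
    using assms by (intro borel_measurable_add) (auto simp: L2_def set_borel_measurable_def)
  moreover have "set_integrable lebesgue U (\<lambda>x. (norm (f x))\<^sup>2 + (norm (g x))\<^sup>2 + 2 * (f x \<bullet> g x))"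
    using L2_inner_integrable[OF assms] assms by (auto simp: L2_def)
  moreover have "(\<lambda>x. (norm (f x + g x))\<^sup>2) = (\<lambda>x. (norm (f x))\<^sup>2 + (norm (g x))\<^sup>2 + 2 * (f x \<bullet> g x))"
    by (simp add: fun_eq_iff power2_norm_eq_inner inner_add_left inner_add_right inner_commute)
  ultimately show ?thesis
    by (auto simp: L2_def set_borel_measurable_def scaleR_add_right)
qed

lemma L2_scaleR:
  fixes f :: "R2 \<Rightarrow> 'b::euclidean_space"
  assumes "f \<in> L2 U"
  shows "(\<lambda>x. c *\<^sub>R f x) \<in> L2 U"
proof -
  have "(\<lambda>x. c *\<^sub>R (indicator U x *\<^sub>R f x)) \<in> borel_measurable lebesgue"
    using assms by (intro borel_measurable_scaleR[of "\<lambda>x. c", OF borel_measurable_const])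
      (simp add: L2_def set_borel_measurable_def)
  then show ?thesis
    using assms by (auto simp: L2_def set_borel_measurable_def power_mult_distrib mult.commute)
qed

lemma L2_diff:
  fixes f g :: "R2 \<Rightarrow> 'b::euclidean_space"
  assumes "f \<in> L2 U" "g \<in> L2 U"
  shows "(\<lambda>x. f x - g x) \<in> L2 U"
  using L2_add[OF assms(1) L2_scaleR[OF assms(2), of "-1"]] by simp

lemma L2_zero: "(\<lambda>x. 0) \<in> L2 U"
  by (simp add: L2_def set_borel_measurable_def set_integrable_def)

lemma L2_subset:
  assumes "f \<in> L2 U" "V \<subseteq> U" "V \<in> sets lebesgue"
  shows "f \<in> L2 V"
  using assms set_integrable_subset set_borel_measurable_subset by (auto simp: L2_def)

lemma L2_cong_set_AE:
  fixes f :: "R2 \<Rightarrow> 'b::euclidean_space"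
  assumes ae: "AE x in lebesgue. x \<in> A \<longleftrightarrow> x \<in> B" and "f \<in> L2 A"
  shows "f \<in> L2 B"
proof -
  have "(\<lambda>x. indicator B x *\<^sub>R f x) \<in> borel_measurable lebesgue"
    by (rule lebesgue_measurable_cong_AE[of "\<lambda>x. indicator A x *\<^sub>R f x"])
      (use assms in \<open>auto simp: L2_def set_borel_measurable_def indicator_def\<close>)
  then show ?thesis using assms set_integrable_cong_set_AE[OF ae]
    by (auto simp: L2_def set_borel_measurable_def)
qed

lemma L2_norm_cong_set_AE:
  fixes f :: "R2 \<Rightarrow> 'b::euclidean_space"
  assumes ae: "AE x in lebesgue. x \<in> A \<longleftrightarrow> x \<in> B"
  shows "L2_norm A f = L2_norm B f"
  unfolding L2_norm_def using set_LINT_cong_set_AE[OF ae] by metis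

lemma L2_norm_add_power2:
  fixes f g :: "R2 \<Rightarrow> 'b::euclidean_space"
  assumes "f \<in> L2 U" "g \<in> L2 U"
  shows "(L2_norm U (\<lambda>x. f x + g x))\<^sup>2
    = (L2_norm U f)\<^sup>2 + 2 * (LINT x:U|lebesgue. f x \<bullet> g x) + (L2_norm U g)\<^sup>2"
proof -
  have "(\<lambda>x. (norm (f x + g x))\<^sup>2) = (\<lambda>x. (norm (f x))\<^sup>2 + 2 * (f x \<bullet> g x) + (norm (g x))\<^sup>2)"
    by (simp add: fun_eq_iff power2_norm_eq_inner inner_add_left inner_add_right inner_commute)
  then show ?thesis
    unfolding L2_norm_power2
    using L2_norm_integrable[OF assms(1)] L2_norm_integrable[OF assms(2)] L2_inner_integrable[OF assms]
    by (simp add: set_integral_add)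
qed

lemma L2_norm_scaleR:
  "L2_norm U (\<lambda>x. c *\<^sub>R f x) = \<bar>c\<bar> * L2_norm U f"
  by (simp add: L2_norm_def power_mult_distrib real_sqrt_mult)

lemma L2_norm_diff_power2:
  fixes f g :: "R2 \<Rightarrow> 'b::euclidean_space"
  assumes "f \<in> L2 U" "g \<in> L2 U"
  shows "(L2_norm U (\<lambda>x. f x - g x))\<^sup>2
    = (L2_norm U f)\<^sup>2 - 2 * (LINT x:U|lebesgue. f x \<bullet> g x) + (L2_norm U g)\<^sup>2"
proof -
  have "(\<lambda>x. indicator U x *\<^sub>R - (f x \<bullet> g x)) = (\<lambda>x. - (indicator U x *\<^sub>R (f x \<bullet> g x)))" by auto
  then have "(LINT x:U|lebesgue. f x \<bullet> ((-1) *\<^sub>R g x)) = - (LINT x:U|lebesgue. f x \<bullet> g x)"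
    by (simp add: set_lebesgue_integral_def)
  then show ?thesis
    using L2_norm_add_power2[OF assms(1) L2_scaleR[OF assms(2), of "-1"]] L2_norm_scaleR[of U "-1" g]
    by simp
qed

lemma L2_Cauchy_Schwarz:
  fixes f g :: "R2 \<Rightarrow> 'b::euclidean_space"
  assumes "f \<in> L2 U" "g \<in> L2 U"
  shows "\<bar>LINT x:U|lebesgue. f x \<bullet> g x\<bar> \<le> L2_norm U f * L2_norm U g"
proof -
  define I where "I = (LINT x:U|lebesgue. f x \<bullet> g x)"
  define F where "F = L2_norm U f"
  define G where "G = L2_norm U g"
  have *: "0 \<le> F\<^sup>2 + 2 * t * I + t\<^sup>2 * G\<^sup>2" for t
  proof -
    have "(\<lambda>x. indicator U x *\<^sub>R (f x \<bullet> t *\<^sub>R g x)) = (\<lambda>x. t * (indicator U x *\<^sub>R (f x \<bullet> g x)))" by auto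
    then have I: "(LINT x:U|lebesgue. f x \<bullet> (t *\<^sub>R g x)) = t * I"
      by (simp only: I_def set_lebesgue_integral_def) simp
    show ?thesis
      using I[simplified] L2_norm_add_power2[OF assms(1) L2_scaleR[OF assms(2), of t]] L2_norm_scaleR[of U t g]
        zero_le_power2[of "L2_norm U (\<lambda>x. f x + t *\<^sub>R g x)"]
      by (simp add: F_def G_def I_def power_mult_distrib)
  qed
  have FG: "0 \<le> F" "0 \<le> G" by (simp_all add: F_def G_def)
  have "I\<^sup>2 \<le> F\<^sup>2 * G\<^sup>2"
  proof (cases "G = 0")
    case True
    then have "I = 0" using *[of "- (F\<^sup>2 + 1) / (2 * I)"] by (cases "I = 0") (auto simp: field_simps)
    then show ?thesis using True by simp
  next
    case False
    then have "0 < G\<^sup>2" by simp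
    have "0 \<le> F\<^sup>2 + 2 * (- I / G\<^sup>2) * I + (- I / G\<^sup>2)\<^sup>2 * G\<^sup>2" by (rule *)
    also have "\<dots> = F\<^sup>2 - I\<^sup>2 / G\<^sup>2" using \<open>0 < G\<^sup>2\<close>
      by (simp add: field_simps power2_eq_square)
    finally show ?thesis using \<open>0 < G\<^sup>2\<close> by (simp add: field_simps)
  qed
  then have "I\<^sup>2 \<le> (F * G)\<^sup>2" by (simp add: power_mult_distrib)
  then show ?thesis using FG abs_le_square_iff[of I "F * G"] by (simp add: I_def F_def G_def)
qed

lemma L2_norm_triangle:
  fixes f g :: "R2 \<Rightarrow> 'b::euclidean_space"
  assumes "f \<in> L2 U" "g \<in> L2 U"
  shows "L2_norm U (\<lambda>x. f x + g x) \<le> L2_norm U f + L2_norm U g"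
proof -
  have "(L2_norm U (\<lambda>x. f x + g x))\<^sup>2 \<le> (L2_norm U f + L2_norm U g)\<^sup>2"
    using L2_norm_add_power2[OF assms] L2_Cauchy_Schwarz[OF assms] by (simp add: power2_sum)
  then show ?thesis by (rule power2_le_imp_le) simp
qed

lemma L2_norm_triangle_diff:
  fixes f g :: "R2 \<Rightarrow> 'b::euclidean_space"
  assumes "f \<in> L2 U" "g \<in> L2 U"
  shows "L2_norm U (\<lambda>x. f x - g x) \<le> L2_norm U f + L2_norm U g"
  using L2_norm_triangle[OF assms(1) L2_scaleR[OF assms(2), of "-1"]] L2_norm_scaleR[of U "-1" g]
  by simp

lemma L2_norm_mono:
  assumes "f \<in> L2 U" "V \<subseteq> U" "V \<in> sets lebesgue"
  shows "L2_norm V f \<le> L2_norm U f"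
  unfolding L2_norm_def
proof (rule real_sqrt_le_mono)
  show "(LINT x:V|lebesgue. (norm (f x))\<^sup>2) \<le> (LINT x:U|lebesgue. (norm (f x))\<^sup>2)"
    unfolding set_lebesgue_integral_def
    by (rule integral_mono)
      (use assms L2_subset[OF assms] in \<open>auto simp: L2_def set_integrable_def indicator_def\<close>)
qed

lemma L2_AE_zero:
  fixes f :: "R2 \<Rightarrow> 'b::euclidean_space"
  assumes "f \<in> L2 U" "L2_norm U f = 0"
  shows "AE x in lebesgue. x \<in> U \<longrightarrow> f x = 0"
proof -
  have "(LINT x:U|lebesgue. (norm (f x))\<^sup>2) = 0"
    using assms(2) L2_norm_power2[of U f] by simp
  then have "AE x in lebesgue. indicat_real U x *\<^sub>R (norm (f x))\<^sup>2 = 0"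
    using assms(1) unfolding set_lebesgue_integral_def L2_def set_integrable_def
    by (subst (asm) integral_nonneg_eq_0_iff_AE) auto
  then show ?thesis by eventually_elim (auto simp: indicator_def split: if_splits)
qed

lemma L2_bounded:
  fixes f :: "R2 \<Rightarrow> 'b::euclidean_space"
  assumes "U \<in> lmeasurable" "set_borel_measurable lebesgue U f"
    and B: "AE x in lebesgue. x \<in> U \<longrightarrow> norm (f x) \<le> B"
  shows "f \<in> L2 U"
proof -
  have [measurable]: "U \<in> sets lebesgue" using assms by auto
  have "set_integrable lebesgue U (\<lambda>x. B\<^sup>2)"
    using assms by (simp add: set_integrable_def fmeasurable_def less_top[symmetric])
  then have "set_integrable lebesgue U (\<lambda>x. (norm (f x))\<^sup>2)"
  proof (rule set_integrable_bound)
    have "(\<lambda>x. (norm (indicator U x *\<^sub>R f x))\<^sup>2) \<in> borel_measurable lebesgue"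
      using assms(2) unfolding set_borel_measurable_def
      by (intro borel_measurable_power) (rule measurable_compose[OF _ borel_measurable_norm])
    moreover have "(\<lambda>x. (norm (indicator U x *\<^sub>R f x))\<^sup>2) = (\<lambda>x. indicator U x *\<^sub>R (norm (f x))\<^sup>2)"
      by (auto simp: indicator_def)
    ultimately show "set_borel_measurable lebesgue U (\<lambda>x. (norm (f x))\<^sup>2)"
      by (simp add: set_borel_measurable_def)
    show "AE x in lebesgue. x \<in> U \<longrightarrow> norm ((norm (f x))\<^sup>2) \<le> norm (B\<^sup>2)"
      using B by eventually_elim (auto intro!: power_mono)
  qed
  then show ?thesis using assms by (simp add: L2_def)
qed

lemma L2_mult_bounded:
  fixes f :: "R2 \<Rightarrow> 'b::euclidean_space" and c :: "R2 \<Rightarrow> real"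
  assumes "U \<in> sets lebesgue" "f \<in> L2 U" "set_borel_measurable lebesgue U c"
    and B: "AE x in lebesgue. x \<in> U \<longrightarrow> \<bar>c x\<bar> \<le> B"
  shows "(\<lambda>x. c x *\<^sub>R f x) \<in> L2 U"
proof -
  have "(\<lambda>x. (indicator U x *\<^sub>R c x) *\<^sub>R (indicator U x *\<^sub>R f x)) \<in> borel_measurable lebesgue"
    using assms unfolding L2_def set_borel_measurable_def
    by (intro borel_measurable_scaleR[of "\<lambda>x. indicator U x *\<^sub>R c x"]) auto
  moreover have "(\<lambda>x. (indicator U x *\<^sub>R c x) *\<^sub>R (indicator U x *\<^sub>R f x))
      = (\<lambda>x. indicator U x *\<^sub>R (c x *\<^sub>R f x))" by (auto simp: indicator_def)
  ultimately have m: "(\<lambda>x. indicator U x *\<^sub>R (c x *\<^sub>R f x)) \<in> borel_measurable lebesgue" by simp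
  have "set_integrable lebesgue U (\<lambda>x. B\<^sup>2 * (norm (f x))\<^sup>2)"
    using assms by (auto simp: L2_def)
  then have "set_integrable lebesgue U (\<lambda>x. (norm (c x *\<^sub>R f x))\<^sup>2)"
  proof (rule set_integrable_bound)
    have "(\<lambda>x. (norm (indicator U x *\<^sub>R (c x *\<^sub>R f x)))\<^sup>2) \<in> borel_measurable lebesgue"
      using m by (intro borel_measurable_power) (rule measurable_compose[OF _ borel_measurable_norm])
    moreover have "(\<lambda>x. (norm (indicator U x *\<^sub>R (c x *\<^sub>R f x)))\<^sup>2)
        = (\<lambda>x. indicator U x *\<^sub>R (norm (c x *\<^sub>R f x))\<^sup>2)"
      by (auto simp: indicator_def)
    ultimately show "set_borel_measurable lebesgue U (\<lambda>x. (norm (c x *\<^sub>R f x))\<^sup>2)"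
      by (simp add: set_borel_measurable_def)
    show "AE x in lebesgue. x \<in> U \<longrightarrow> norm ((norm (c x *\<^sub>R f x))\<^sup>2) \<le> norm (B\<^sup>2 * (norm (f x))\<^sup>2)"
      using B
    proof eventually_elim
      fix x assume h: "x \<in> U \<longrightarrow> \<bar>c x\<bar> \<le> B"
      show "x \<in> U \<longrightarrow> norm ((norm (c x *\<^sub>R f x))\<^sup>2) \<le> norm (B\<^sup>2 * (norm (f x))\<^sup>2)"
      proof
        assume "x \<in> U"
        with h have "\<bar>c x\<bar>\<^sup>2 \<le> B\<^sup>2" by (intro power_mono) auto
        then show "norm ((norm (c x *\<^sub>R f x))\<^sup>2) \<le> norm (B\<^sup>2 * (norm (f x))\<^sup>2)"
          by (auto simp: power_mult_distrib abs_mult intro!: mult_right_mono)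
      qed
    qed
  qed
  then show ?thesis using m by (simp add: L2_def set_borel_measurable_def)
qed

lemma L2_const:
  assumes "U \<in> lmeasurable"
  shows "(\<lambda>x. c) \<in> L2 U"
  by (rule L2_bounded[OF assms, of _ "norm c"])
    (use assms in \<open>auto simp: set_borel_measurable_def intro!: borel_measurable_scaleR borel_measurable_indicator\<close>)

lemma L2_imp_set_integrable:
  fixes f :: "R2 \<Rightarrow> 'b::euclidean_space"
  assumes "U \<in> lmeasurable" "f \<in> L2 U"
  shows "set_integrable lebesgue U f"
proof (rule set_integrable_bound)
  have "set_integrable lebesgue U (\<lambda>x. (norm (f x))\<^sup>2)" "set_integrable lebesgue U (\<lambda>x. 1::real)"
    using L2_const[OF assms(1), of "1::real"] assms(2) by (auto simp: L2_def)
  then show "set_integrable lebesgue U (\<lambda>x. (norm (f x))\<^sup>2 + 1)" by (rule set_integral_add(1))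
  show "set_borel_measurable lebesgue U f" using assms(2) by (simp add: L2_def)
  have "norm (f x) \<le> norm ((norm (f x))\<^sup>2 + 1)" for x
    using sum_squares_bound[of "norm (f x)" 1] by (simp add: power2_eq_square)
      (smt (verit) norm_ge_zero)
  then show "AE x in lebesgue. x \<in> U \<longrightarrow> norm (f x) \<le> norm ((norm (f x))\<^sup>2 + 1)" by simp
qed

subsection \<open>Completeness\<close>

text \<open>
  The Riesz--Fischer theorem.  Along a subsequence whose consecutive distances are summable in the
  \<open>L1\<close> norm, the functions converge almost everywhere; Fatou's lemma shows that the pointwise limit
  is also the limit in the square mean.
\<close>

lemma (in finite_measure) L2_Cauchy_limit:
  fixes X :: "nat \<Rightarrow> 'a \<Rightarrow> real"
  assumes m[measurable]: "\<And>n. X n \<in> borel_measurable M"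
    and i: "\<And>n. integrable M (\<lambda>x. (X n x)\<^sup>2)"
    and C: "\<And>e. e > 0 \<Longrightarrow> \<exists>N. \<forall>m\<ge>N. \<forall>n\<ge>N. (\<integral>x. (X m x - X n x)\<^sup>2 \<partial>M) < e"
  obtains g where "g \<in> borel_measurable M" "integrable M (\<lambda>x. (g x)\<^sup>2)"
    "(\<lambda>n. \<integral>x. (X n x - g x)\<^sup>2 \<partial>M) \<longlonglongrightarrow> 0"
proof -
  have id: "integrable M (\<lambda>x. (X m x - X n x)\<^sup>2)" for m n
  proof (rule Bochner_Integration.integrable_bound)
    show "integrable M (\<lambda>x. 2 * (X m x)\<^sup>2 + 2 * (X n x)\<^sup>2)" using i by auto
    have "(X m x - X n x)\<^sup>2 \<le> 2 * (X m x)\<^sup>2 + 2 * (X n x)\<^sup>2" for x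
      using zero_le_power2[of "X m x + X n x"] by (simp add: power2_sum power2_diff)
    then show "AE x in M. norm ((X m x - X n x)\<^sup>2) \<le> norm (2 * (X m x)\<^sup>2 + 2 * (X n x)\<^sup>2)"
      by simp
  qed measurable
  have "\<exists>N. \<forall>m\<ge>N. \<forall>n\<ge>N. (\<integral>x. (X m x - X n x)\<^sup>2 \<partial>M) < (1/4)^k" for k
    using C[of "(1/4)^k"] by simp
  then obtain N0 where N0: "\<And>k m n. m \<ge> N0 k \<Longrightarrow> n \<ge> N0 k \<Longrightarrow> (\<integral>x. (X m x - X n x)\<^sup>2 \<partial>M) < (1/4)^k"
    by metis
  define N where "N k = Max (N0 ` {..k})" for k
  have N_ge: "N0 j \<le> N k" if "j \<le> k" for j k using that by (auto simp: N_def)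
  define Y where "Y k x = \<bar>X (N (Suc k)) x - X (N k) x\<bar>" for k x
  have Ym[measurable]: "Y k \<in> borel_measurable M" for k unfolding Y_def by measurable
  define c where "c = (1 + measure M (space M)) / 2"
  have c: "0 \<le> c" by (simp add: c_def)
  have Y_le: "(\<integral>\<^sup>+x. ennreal (Y k x) \<partial>M) \<le> ennreal (c * (1/2)^k)" for k
  proof -
    \<comment> \<open>the weight \<open>2^k\<close> turns the bound \<open>(1/4)^k\<close> in the square mean into \<open>(1/2)^k\<close> in the mean\<close>
    have le: "Y k x \<le> (2^k * (X (N (Suc k)) x - X (N k) x)\<^sup>2 + (1/2)^k) / 2" for x
    proof -
      define a where "a = Y k x"
      have "0 \<le> (2^k * a - 1)\<^sup>2" by simp
      then have "2 * 2^k * a \<le> 2^k * (2^k * a\<^sup>2) + 1" by (simp add: power2_diff power2_eq_square algebra_simps)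
      also have "1 = 2^k * (1/2::real)^k" by (simp add: power_mult_distrib[symmetric])
      finally have "2^k * (2 * a) \<le> 2^k * (2^k * a\<^sup>2 + (1/2)^k)"
        by (simp add: algebra_simps)
      then have "2 * a \<le> 2^k * a\<^sup>2 + (1/2)^k" by (simp only: mult_le_cancel_left_pos zero_less_power zero_less_numeral)
      then show ?thesis by (simp add: a_def Y_def)
    qed
    have intg: "integrable M (\<lambda>x. (2^k * (X (N (Suc k)) x - X (N k) x)\<^sup>2 + (1/2)^k) / 2)"
      using id by auto
    have "(\<integral>\<^sup>+x. ennreal (Y k x) \<partial>M)
        \<le> (\<integral>\<^sup>+x. ennreal ((2^k * (X (N (Suc k)) x - X (N k) x)\<^sup>2 + (1/2)^k) / 2) \<partial>M)"
      using le by (intro nn_integral_mono) (auto intro: ennreal_leI)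
    also have "\<dots> = ennreal (\<integral>x. (2^k * (X (N (Suc k)) x - X (N k) x)\<^sup>2 + (1/2)^k) / 2 \<partial>M)"
      using intg by (intro nn_integral_eq_integral) auto
    also have "(\<integral>x. (2^k * (X (N (Suc k)) x - X (N k) x)\<^sup>2 + (1/2)^k) / 2 \<partial>M)
        = (2^k * (\<integral>x. (X (N (Suc k)) x - X (N k) x)\<^sup>2 \<partial>M) + (1/2)^k * measure M (space M)) / 2"
      using id by simp
    also have "\<dots> \<le> (2^k * (1/4)^k + (1/2)^k * measure M (space M)) / 2"
      using N0[OF N_ge N_ge, of k "Suc k" k] by (auto intro!: divide_right_mono mult_left_mono)
    also have "2^k * (1/4::real)^k = (1/2)^k" by (simp add: power_mult_distrib[symmetric])
    also have "((1/2)^k + (1/2)^k * measure M (space M)) / 2 = c * (1/2)^k"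
      by (simp add: c_def algebra_simps)
    finally show ?thesis by (simp add: ennreal_leI)
  qed
  have "(\<integral>\<^sup>+x. (\<Sum>k. ennreal (Y k x)) \<partial>M) = (\<Sum>k. \<integral>\<^sup>+x. ennreal (Y k x) \<partial>M)"
    by (rule nn_integral_suminf) measurable
  also have "\<dots> \<le> (\<Sum>k. ennreal (c * (1/2)^k))"
    by (intro suminf_le Y_le) auto
  also have "\<dots> = ennreal (\<Sum>k. c * (1/2)^k)"
    using c by (intro suminf_ennreal2) (auto intro!: summable_mult summable_geometric)
  finally have "(\<integral>\<^sup>+x. (\<Sum>k. ennreal (Y k x)) \<partial>M) \<noteq> \<infinity>"
    by (auto simp: top_unique)
  then have "AE x in M. (\<Sum>k. ennreal (Y k x)) \<noteq> \<infinity>"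
    by (intro nn_integral_noteq_infinite) auto
  then have "AE x in M. summable (\<lambda>k. Y k x)"
  proof eventually_elim
    fix x assume "(\<Sum>k. ennreal (Y k x)) \<noteq> \<infinity>"
    then show "summable (\<lambda>k. Y k x)"
      by (intro summable_suminf_not_top) (auto simp: Y_def)
  qed
  then have conv: "AE x in M. convergent (\<lambda>k. X (N k) x)"
  proof eventually_elim
    fix x assume "summable (\<lambda>k. Y k x)"
    then have "summable (\<lambda>k. X (N (Suc k)) x - X (N k) x)"
      unfolding Y_def by (rule summable_rabs_cancel)
    then have "convergent (\<lambda>n. \<Sum>k<n. X (N (Suc k)) x - X (N k) x)"
      by (simp add: summable_iff_convergent)
    then have "convergent (\<lambda>n. X (N n) x - X (N 0) x)"
      by (simp add: sum_lessThan_telescope[of "\<lambda>k. X (N k) x"])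
    then have "convergent (\<lambda>n. (X (N n) x - X (N 0) x) + X (N 0) x)"
      by (intro convergent_add convergent_const)
    then show "convergent (\<lambda>k. X (N k) x)" by simp
  qed
  define g where "g x = lim (\<lambda>k. X (N k) x)" for x
  have gm[measurable]: "g \<in> borel_measurable M" unfolding g_def by measurable
  have lim: "AE x in M. (\<lambda>k. X (N k) x) \<longlonglongrightarrow> g x"
    using conv by eventually_elim (simp add: g_def convergent_LIMSEQ_iff)
  have fatou: "(\<integral>\<^sup>+x. ennreal ((X n x - g x)\<^sup>2) \<partial>M) \<le> ennreal ((1/4)^j)" if n: "n \<ge> N0 j" for n j
  proof -
    have "(\<integral>\<^sup>+x. ennreal ((X n x - g x)\<^sup>2) \<partial>M)
        = (\<integral>\<^sup>+x. liminf (\<lambda>k. ennreal ((X n x - X (N k) x)\<^sup>2)) \<partial>M)"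
    proof (rule nn_integral_cong_AE)
      show "AE x in M. ennreal ((X n x - g x)\<^sup>2) = liminf (\<lambda>k. ennreal ((X n x - X (N k) x)\<^sup>2))"
        using lim
      proof eventually_elim
        fix x assume "(\<lambda>k. X (N k) x) \<longlonglongrightarrow> g x"
        then have "(\<lambda>k. ennreal ((X n x - X (N k) x)\<^sup>2)) \<longlonglongrightarrow> ennreal ((X n x - g x)\<^sup>2)"
          by (intro tendsto_intros)
        then show "ennreal ((X n x - g x)\<^sup>2) = liminf (\<lambda>k. ennreal ((X n x - X (N k) x)\<^sup>2))"
          by (rule lim_imp_Liminf[OF sequentially_bot, symmetric])
      qed
    qed
    also have "\<dots> \<le> liminf (\<lambda>k. \<integral>\<^sup>+x. ennreal ((X n x - X (N k) x)\<^sup>2) \<partial>M)"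
      by (rule nn_integral_liminf) measurable
    also have "\<dots> \<le> ennreal ((1/4)^j)"
    proof -
      have "(\<integral>\<^sup>+x. ennreal ((X n x - X (N k) x)\<^sup>2) \<partial>M) \<le> ennreal ((1/4)^j)" if "k \<ge> j" for k
      proof -
        have "(\<integral>\<^sup>+x. ennreal ((X n x - X (N k) x)\<^sup>2) \<partial>M) = ennreal (\<integral>x. (X n x - X (N k) x)\<^sup>2 \<partial>M)"
          by (rule nn_integral_eq_integral) (use id in auto)
        then show ?thesis using N0[OF n N_ge, of k] that by (auto intro!: ennreal_leI less_imp_le)
      qed
      then have "\<forall>\<^sub>F k in sequentially. (\<integral>\<^sup>+x. ennreal ((X n x - X (N k) x)\<^sup>2) \<partial>M) \<le> ennreal ((1/4)^j)"
        unfolding eventually_sequentially by blast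
      then have "liminf (\<lambda>k. \<integral>\<^sup>+x. ennreal ((X n x - X (N k) x)\<^sup>2) \<partial>M)
          \<le> liminf (\<lambda>k. ennreal ((1/4)^j))" by (rule Liminf_mono)
      then show ?thesis by (simp add: Liminf_const)
    qed
    finally show ?thesis .
  qed
  have intd: "integrable M (\<lambda>x. (X n x - g x)\<^sup>2)" if "n \<ge> N0 j" for n j
    using fatou[OF that] by (intro integrableI_bounded) (auto simp: le_less_trans)
  have bnd: "(\<integral>x. (X n x - g x)\<^sup>2 \<partial>M) \<le> (1/4)^j" if "n \<ge> N0 j" for n j
  proof -
    have "ennreal (\<integral>x. (X n x - g x)\<^sup>2 \<partial>M) \<le> ennreal ((1/4)^j)"
      using fatou[OF that] by (subst nn_integral_eq_integral[OF intd[OF that], symmetric]) auto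
    then show ?thesis by (subst (asm) ennreal_le_iff) auto
  qed
  have "integrable M (\<lambda>x. (g x)\<^sup>2)"
  proof (rule Bochner_Integration.integrable_bound)
    show "integrable M (\<lambda>x. 2 * (X (N0 0) x)\<^sup>2 + 2 * (X (N0 0) x - g x)\<^sup>2)" using i intd[of 0] by auto
    have "(g x)\<^sup>2 \<le> 2 * (X (N0 0) x)\<^sup>2 + 2 * (X (N0 0) x - g x)\<^sup>2" for x
      using zero_le_power2[of "X (N0 0) x + (X (N0 0) x - g x)"]
      by (simp add: power2_eq_square algebra_simps)
    then show "AE x in M. norm ((g x)\<^sup>2) \<le> norm (2 * (X (N0 0) x)\<^sup>2 + 2 * (X (N0 0) x - g x)\<^sup>2)"
      by simp
  qed measurable
  moreover have "(\<lambda>n. \<integral>x. (X n x - g x)\<^sup>2 \<partial>M) \<longlonglongrightarrow> 0"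
  proof (rule LIMSEQ_I)
    fix r :: real assume "0 < r"
    then obtain j where j: "(1/4::real)^j < r" using real_arch_pow_inv[of r "1/4"] by auto
    have "norm ((\<integral>x. (X n x - g x)\<^sup>2 \<partial>M) - 0) < r" if "n \<ge> N0 j" for n
      using bnd[OF that] j by (simp add: integral_nonneg_AE)
    then show "\<exists>no. \<forall>n\<ge>no. norm ((\<integral>x. (X n x - g x)\<^sup>2 \<partial>M) - 0) < r" by blast
  qed
  ultimately show ?thesis using that gm by blast
qed

section \<open>Smooth functions\<close>

lemma C_k_SucI:
  "(\<And>x. GDERIV f x :> g x) \<Longrightarrow> (\<And>i. C_k k (\<lambda>x. g x $ i)) \<Longrightarrow> C_k (Suc k) f"
  unfolding C_k.simps by blast

lemma C_k_SucD: "C_k (Suc k) f \<Longrightarrow> C_k k f"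
proof (induction k arbitrary: f)
  case 0
  then obtain g where "\<And>x. GDERIV f x :> g x" by auto
  then have "isCont f x" for x
    unfolding gderiv_def by (rule has_derivative_continuous)
  then show ?case by (simp add: continuous_on_eq_continuous_at)
next
  case (Suc k)
  then show ?case by (metis C_k.simps(2))
qed

lemma C_k_const: "C_k k (\<lambda>x. c)"
proof (induction k arbitrary: c)
  case (Suc k)
  have "\<forall>x::R2. GDERIV (\<lambda>x. c) x :> 0" by (simp add: GDERIV_const)
  then show ?case using Suc by auto
qed simp

lemma C_k_add: "C_k k f \<Longrightarrow> C_k k g \<Longrightarrow> C_k k (\<lambda>x. f x + g x)"
proof (induction k arbitrary: f g)
  case 0 then show ?case by (simp add: continuous_on_add)
next
  case (Suc k)
  then obtain df dg where "\<And>x. GDERIV f x :> df x" "\<And>i. C_k k (\<lambda>x. df x $ i)"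
    "\<And>x. GDERIV g x :> dg x" "\<And>i. C_k k (\<lambda>x. dg x $ i)" by auto
  then have "\<And>x. GDERIV (\<lambda>x. f x + g x) x :> df x + dg x"
    "\<And>i. C_k k (\<lambda>x. (df x + dg x) $ i)"
    using Suc.IH by (auto intro: GDERIV_add)
  then show ?case by (rule C_k_SucI)
qed

lemma C_k_mult: "C_k k f \<Longrightarrow> C_k k g \<Longrightarrow> C_k k (\<lambda>x. f x * g x)"
proof (induction k arbitrary: f g)
  case 0 then show ?case by (simp add: continuous_on_mult)
next
  case (Suc k)
  then obtain df dg where *: "\<And>x. GDERIV f x :> df x" "\<And>i. C_k k (\<lambda>x. df x $ i)"
    "\<And>x. GDERIV g x :> dg x" "\<And>i. C_k k (\<lambda>x. dg x $ i)" by auto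
  have fg: "C_k k f" "C_k k g" using Suc.prems C_k_SucD by auto
  have "\<And>x. GDERIV (\<lambda>x. f x * g x) x :> f x *\<^sub>R dg x + g x *\<^sub>R df x"
    using * by (auto intro: GDERIV_mult)
  moreover have "C_k k (\<lambda>x. (f x *\<^sub>R dg x + g x *\<^sub>R df x) $ i)" for i
    using C_k_add[OF Suc.IH[OF fg(1) *(4)] Suc.IH[OF fg(2) *(2)]] by simp
  ultimately show ?case by (rule C_k_SucI)
qed

lemma GDERIV_affine: "GDERIV (\<lambda>x. a \<bullet> x + b) x :> a"
  unfolding gderiv_def by (auto intro!: derivative_eq_intros simp: inner_commute)

lemma C_k_affine: "C_k k (\<lambda>x. a \<bullet> x + b)"
proof (cases k)
  case 0 then show ?thesis by (auto intro!: continuous_intros)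
next
  case (Suc n)
  show ?thesis unfolding Suc by (rule C_k_SucI[OF GDERIV_affine C_k_const])
qed

subsection \<open>A flat function\<close>

text \<open>
  The factor \<open>1 / t ^ n\<close> closes the family under differentiation (\<open>flat_DERIV\<close>), so that an
  induction on the order of differentiability, for all \<open>n\<close> at once, proves smoothness.
\<close>

definition flat :: "nat \<Rightarrow> real \<Rightarrow> real" where
  "flat n t = (if t > 0 then exp (- (1 / t)) / t ^ n else 0)"

lemma flat_tendsto_0: "(flat n \<longlongrightarrow> 0) (at 0)"
proof (rule filterlim_split_at)
  have "\<forall>\<^sub>F t in at_left 0. t < (0::real)" by (simp add: eventually_at_filter)
  then have "\<forall>\<^sub>F t in at_left 0. flat n t = 0"
    by eventually_elim (simp add: flat_def)
  then show "(flat n \<longlongrightarrow> 0) (at_left 0)" by (simp add: tendsto_eventually)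
  have "((\<lambda>t::real. inverse t ^ n / exp (inverse t)) \<longlongrightarrow> 0) (at_right 0)"
    using filterlim_compose[OF tendsto_power_div_exp_0 filterlim_inverse_at_top_right] by simp
  moreover have "\<forall>\<^sub>F t in at_right 0. (0::real) < t" by (simp add: eventually_at_filter)
  then have "\<forall>\<^sub>F t in at_right 0. inverse t ^ n / exp (inverse t) = flat n t"
    by eventually_elim (simp add: flat_def exp_minus field_simps)
  ultimately show "(flat n \<longlongrightarrow> 0) (at_right 0)" by (rule Lim_transform_eventually)
qed

lemma flat_DERIV: "(flat n has_real_derivative (- real n * flat (n + 1) t + flat (n + 2) t)) (at t)"
proof -
  consider "t < 0" | "t = 0" | "t > 0" by linarith
  then show ?thesis
  proof cases
    case 1
    have "((\<lambda>t. 0) has_real_derivative 0) (at t)" by simp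
    then have "(flat n has_real_derivative 0) (at t)"
      by (rule has_field_derivative_transform_within_open[of _ _ _ "{..<0}"])
        (use 1 in \<open>auto simp: flat_def\<close>)
    then show ?thesis using 1 by (simp add: flat_def)
  next
    case 2
    have "((\<lambda>y. (flat n y - flat n 0) / (y - 0)) \<longlongrightarrow> 0) (at 0)"
    proof -
      have "(flat n y - flat n 0) / (y - 0) = flat (n + 1) y" for y
        by (simp add: flat_def)
      then show ?thesis using flat_tendsto_0[of "n+1"] by simp
    qed
    then show ?thesis using 2 by (simp add: has_field_derivative_iff flat_def)
  next
    case 3
    have "((\<lambda>t. exp (- (1 / t)) / t ^ n) has_real_derivative
       (exp (- (1/t)) * (1 / t\<^sup>2) * t ^ n - exp (- (1/t)) * (real n * t ^ (n - 1))) / (t ^ n * t ^ n)) (at t)"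
      using 3 by (auto intro!: derivative_eq_intros simp: power2_eq_square)
    moreover have "(exp (- (1/t)) * (1 / t\<^sup>2) * t ^ n - exp (- (1/t)) * (real n * t ^ (n - 1))) / (t ^ n * t ^ n)
       = - real n * flat (n + 1) t + flat (n + 2) t"
      using 3 by (cases n) (auto simp: flat_def field_simps power2_eq_square)
    ultimately have "((\<lambda>t. exp (- (1 / t)) / t ^ n) has_real_derivative
        (- real n * flat (n + 1) t + flat (n + 2) t)) (at t)" by simp
    then show ?thesis
      by (rule has_field_derivative_transform_within_open[of _ _ _ "{0<..}"])
        (use 3 in \<open>auto simp: flat_def\<close>)
  qed
qed

lemma flat_nonneg: "0 \<le> flat n t" by (simp add: flat_def)
lemma flat_le_1: "flat 0 t \<le> 1" by (simp add: flat_def)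
lemma flat_pos: "t > 0 \<Longrightarrow> 0 < flat n t" by (simp add: flat_def)
lemma flat_eq_0: "t \<le> 0 \<Longrightarrow> flat n t = 0" by (simp add: flat_def)

lemma C_k_flat: "C_k k (\<lambda>x. flat n (a \<bullet> x + b))"
proof (induction k arbitrary: n)
  case 0
  have "isCont (flat n) t" for t using flat_DERIV[of n t] by (rule DERIV_isCont)
  then have "continuous_on UNIV (flat n)" by (simp add: continuous_on_eq_continuous_at)
  then have "continuous_on UNIV (\<lambda>x. flat n (a \<bullet> x + b))"
    by (rule continuous_on_compose2) (auto intro!: continuous_intros)
  then show ?case by simp
next
  case (Suc k)
  let ?g = "\<lambda>x. (- real n * flat (n + 1) (a \<bullet> x + b) + flat (n + 2) (a \<bullet> x + b)) *\<^sub>R a"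
  have "GDERIV (\<lambda>x. flat n (a \<bullet> x + b)) x :> ?g x" for x
    by (rule GDERIV_DERIV_compose[OF GDERIV_affine flat_DERIV])
  moreover have "C_k k (\<lambda>x. ?g x $ i)" for i
    unfolding vector_scaleR_component real_scaleR_def
    by (intro C_k_mult C_k_add C_k_const Suc.IH)
  ultimately show ?case by (rule C_k_SucI)
qed

lemma smooth_const [intro]: "smooth (\<lambda>x. c)" by (simp add: smooth_def C_k_const)
lemma smooth_add [intro]: "smooth f \<Longrightarrow> smooth g \<Longrightarrow> smooth (\<lambda>x. f x + g x)"
  by (simp add: smooth_def C_k_add)
lemma smooth_mult [intro]: "smooth f \<Longrightarrow> smooth g \<Longrightarrow> smooth (\<lambda>x. f x * g x)"
  by (simp add: smooth_def C_k_mult)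
lemma smooth_affine [intro]: "smooth (\<lambda>x. a \<bullet> x + b)" by (simp add: smooth_def C_k_affine)
lemma smooth_flat [intro]: "smooth (\<lambda>x. flat n (a \<bullet> x + b))" by (simp add: smooth_def C_k_flat)
lemma smooth_diff [intro]: "smooth f \<Longrightarrow> smooth g \<Longrightarrow> smooth (\<lambda>x. f x - g x)"
  using smooth_add[OF _ smooth_mult[OF smooth_const[of "-1"]], of f g] by simp

lemma smooth_prod: "finite I \<Longrightarrow> (\<And>i. i \<in> I \<Longrightarrow> smooth (f i)) \<Longrightarrow> smooth (\<lambda>x. \<Prod>i\<in>I. f i x)"
  by (induction rule: finite_induct) auto

lemma GDERIV_unique:
  assumes "GDERIV f x :> a" "GDERIV f x :> b" shows "a = b"
proof -
  have "(\<lambda>h. h \<bullet> a) = (\<lambda>h. h \<bullet> b)"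
    using assms unfolding gderiv_def by (rule has_derivative_unique)
  then have "h \<bullet> a = h \<bullet> b" for h by (rule fun_cong)
  then show ?thesis using vector_eq_rdot[of a b] by (simp add: inner_commute)
qed

lemma grad_eqI: "GDERIV f x :> a \<Longrightarrow> grad f x = a"
  unfolding grad_def by (blast intro: GDERIV_unique)

lemma smooth_GDERIV:
  assumes "smooth f"
  shows "GDERIV f x :> grad f x" "continuous_on UNIV f" "continuous_on UNIV (grad f)"
proof -
  have "C_k (Suc 0) f" "C_k 0 f" using assms by (simp_all only: smooth_def)
  then obtain g where g: "\<And>x. GDERIV f x :> g x" "\<And>i. continuous_on UNIV (\<lambda>x. g x $ i)"
    by auto
  then have "grad f = g" using grad_eqI by blast
  then show "GDERIV f x :> grad f x" using g by simp
  have "continuous_on UNIV (\<lambda>x. \<chi> i. g x $ i)"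
    using g(2) by (intro continuous_on_vec_lambda) auto
  then show "continuous_on UNIV (grad f)" using \<open>grad f = g\<close> by (simp add: vec_nth_inverse)
  show "continuous_on UNIV f" using \<open>C_k 0 f\<close> by simp
qed

lemma GDERIV_vanish:
  assumes "GDERIV f x :> D" "open V" "x \<in> V" "\<And>y. y \<in> V \<Longrightarrow> f y = 0"
  shows "D = 0"
proof -
  have "((\<lambda>x. 0) has_derivative (\<lambda>h. 0)) (at x)" by simp
  then have "(f has_derivative (\<lambda>h. 0)) (at x)"
    by (rule has_derivative_transform_within_open[OF _ assms(2,3)]) (use assms in auto)
  then have "GDERIV f x :> 0" by (simp add: gderiv_def)
  then show ?thesis using assms(1) GDERIV_unique by blast
qed

lemma compact_set_integrable:
  fixes f :: "'a::euclidean_space \<Rightarrow> 'b::euclidean_space"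
  assumes "compact K" "continuous_on K f"
  shows "set_integrable lebesgue K f"
  using borel_integrable_compact[OF assms] unfolding set_integrable_def
  by (simp add: integrable_completion borel_measurable_integrable)

text \<open>
  The integral of \<open>\<psi>\<close> is invariant under translation, so difference quotients of \<open>\<psi>\<close> integrate to
  zero.  They are bounded by the Lipschitz constant and vanish outside a fixed ball, so the
  integrals converge to that of the directional derivative.
\<close>

lemma integral_GDERIV_eq_0:
  fixes \<psi> :: "'a::euclidean_space \<Rightarrow> real"
  assumes D: "\<And>x. GDERIV \<psi> x :> G x" and G: "continuous_on UNIV G"
    and K: "compact K" "\<And>x. x \<notin> K \<Longrightarrow> \<psi> x = 0"
  shows "integrable lebesgue G" "(LINT x|lebesgue. G x) = 0"
proof -
  have G0: "G x = 0" if "x \<notin> K" for x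
    using GDERIV_vanish[OF D, of "- K" x] K compact_imp_closed[OF K(1)] that by auto
  have G_ind: "(\<lambda>x. indicator K x *\<^sub>R G x) = G" using G0 by (auto simp: indicator_def)
  have "isCont \<psi> x" for x using D[of x] unfolding gderiv_def by (rule has_derivative_continuous)
  then have cont: "continuous_on UNIV \<psi>" by (simp add: continuous_on_eq_continuous_at)
  have \<psi>_ind: "(\<lambda>x. indicator K x *\<^sub>R \<psi> x) = \<psi>" using K by (auto simp: indicator_def fun_eq_iff)
  have Gi: "integrable lborel G"
    using borel_integrable_compact[OF K(1) continuous_on_subset[OF G]] G_ind by simp
  have \<psi>i: "integrable lborel \<psi>"
    using borel_integrable_compact[OF K(1) continuous_on_subset[OF cont]] \<psi>_ind by simp
  show "integrable lebesgue G"
    using Gi by (simp add: integrable_completion borel_measurable_integrable)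
  obtain R where R: "\<And>x. x \<in> K \<Longrightarrow> norm x \<le> R"
    using compact_imp_bounded[OF K(1)] by (auto simp: bounded_iff)
  have "bounded (G ` K)"
    using compact_continuous_image[OF continuous_on_subset[OF G subset_UNIV] K(1)] compact_imp_bounded by blast
  then obtain M0 where M0: "\<And>x. x \<in> K \<Longrightarrow> norm (G x) \<le> M0" by (auto simp: bounded_iff)
  define M where "M = \<bar>M0\<bar>"
  have M: "norm (G x) \<le> M" for x using M0[of x] G0[of x] by (cases "x \<in> K") (auto simp: M_def)
  have lip: "\<bar>\<psi> y - \<psi> x\<bar> \<le> M * norm (y - x)" for x y
  proof -
    have "norm (\<psi> y - \<psi> x) \<le> M * norm (y - x)"
    proof (rule differentiable_bound[of UNIV \<psi> "\<lambda>x h. h \<bullet> G x"])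
      show "(\<psi> has_derivative (\<lambda>h. h \<bullet> G x)) (at x)" for x
        using D[of x] by (simp add: gderiv_def)
      show "onorm (\<lambda>h. h \<bullet> G x) \<le> M" for x
      proof (rule onorm_le)
        fix h :: 'a
        have "norm (h \<bullet> G x) \<le> norm h * norm (G x)" using Cauchy_Schwarz_ineq2[of h "G x"] by simp
        also have "\<dots> \<le> norm h * M" using M by (intro mult_left_mono) auto
        finally show "norm (h \<bullet> G x) \<le> M * norm h" by (simp add: mult.commute)
      qed
    qed auto
    then show ?thesis by simp
  qed
  have "(LINT x|lborel. G x) \<bullet> e = 0" for e
  proof -
    define q where "q n x = (\<psi> (inverse (real (Suc n)) *\<^sub>R e + x) - \<psi> x) * real (Suc n)" for n x
    define h where "h = (\<lambda>n. inverse (real (Suc n)))"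
    have h0: "h \<longlonglongrightarrow> 0" unfolding h_def by (rule LIMSEQ_inverse_real_of_nat)
    have int_shift: "integrable lborel (\<lambda>x. \<psi> (v + x))" "(LINT x|lborel. \<psi> (v + x)) = (LINT x|lborel. \<psi> x)" for v
    proof -
      have [measurable]: "\<psi> \<in> borel_measurable borel" using \<psi>i by (simp add: borel_measurable_integrable)
      show "integrable lborel (\<lambda>x. \<psi> (v + x))"
        using \<psi>i integrable_distr_eq[of "(+) v" lborel borel \<psi>] by (simp add: lborel_distr_plus)
      show "(LINT x|lborel. \<psi> (v + x)) = (LINT x|lborel. \<psi> x)"
        using integral_distr[of "(+) v" lborel borel \<psi>] by (simp add: lborel_distr_plus)
    qed
    have q0: "(LINT x|lborel. q n x) = 0" for n
      unfolding q_def using int_shift \<psi>i by simp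
    have qlim: "(\<lambda>n. q n x) \<longlonglongrightarrow> G x \<bullet> e" for x
    proof -
      have "((\<lambda>t. \<psi> (x + t *\<^sub>R e)) has_real_derivative (G x \<bullet> e)) (at 0)"
      proof -
        have "((\<lambda>t. x + t *\<^sub>R e) has_derivative (\<lambda>t. t *\<^sub>R e)) (at 0)"
          by (auto intro!: derivative_eq_intros)
        moreover have "(\<psi> has_derivative (\<lambda>h. h \<bullet> G x)) (at (x + 0 *\<^sub>R e))"
          using D[of x] by (simp add: gderiv_def)
        ultimately have "((\<lambda>t. \<psi> (x + t *\<^sub>R e)) has_derivative (\<lambda>t. (t *\<^sub>R e) \<bullet> G x)) (at 0)"
          by (rule has_derivative_compose)
        then show ?thesis
          by (simp add: has_field_derivative_def inner_commute mult_commute_abs)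
      qed
      then have "((\<lambda>t. (\<psi> (x + t *\<^sub>R e) - \<psi> x) / t) \<longlongrightarrow> G x \<bullet> e) (at 0)"
        by (simp add: has_field_derivative_iff)
      moreover have "filterlim h (at 0) sequentially"
        using h0 by (intro filterlim_atI) (auto simp: h_def)
      ultimately have "(\<lambda>n. (\<psi> (x + h n *\<^sub>R e) - \<psi> x) / h n) \<longlonglongrightarrow> G x \<bullet> e"
        by (rule filterlim_compose)
      then show ?thesis by (simp add: q_def h_def divide_inverse add.commute)
    qed
    define C where "C = M * norm e"
    define B where "B = cball (0::'a) (R + norm e)"
    have bound: "norm (q n x) \<le> indicator B x *\<^sub>R C" for n x
    proof (cases "x \<in> B")
      case True
      have "\<bar>q n x\<bar> \<le> (M * norm (inverse (real (Suc n)) *\<^sub>R e)) * real (Suc n)"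
        unfolding q_def abs_mult using lip[of "inverse (real (Suc n)) *\<^sub>R e + x" x]
        by (intro mult_mono) auto
      also have "\<dots> = C" by (simp add: C_def)
      finally show ?thesis using True by simp
    next
      case False
      then have nx: "norm x > R + norm e" by (simp add: B_def)
      have "norm (inverse (real (Suc n)) *\<^sub>R e) \<le> norm e"
        using mult_left_mono[of 1 "1 + real n" "norm e"] by (simp add: inverse_eq_divide divide_le_eq)
      then have "norm (inverse (real (Suc n)) *\<^sub>R e + x) > R"
        using nx norm_triangle_ineq2[of x "- (inverse (real (Suc n)) *\<^sub>R e)"] by (simp add: add.commute)
      moreover have "norm x > R" using nx norm_ge_zero[of e] by linarith
      ultimately have "x \<notin> K" "inverse (real (Suc n)) *\<^sub>R e + x \<notin> K" using R by force+
      then have "q n x = 0" using K by (simp add: q_def)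
      then show ?thesis using False by simp
    qed
    have "(\<lambda>n. LINT x|lborel. q n x) \<longlonglongrightarrow> (LINT x|lborel. G x \<bullet> e)"
    proof (rule integral_dominated_convergence)
      show "(\<lambda>x. G x \<bullet> e) \<in> borel_measurable lborel" using Gi by (auto simp: borel_measurable_integrable)
      show "q n \<in> borel_measurable lborel" for n
        unfolding q_def using int_shift(1) \<psi>i by (intro borel_measurable_times borel_measurable_diff) (auto simp: borel_measurable_integrable)
      show "integrable lborel (\<lambda>x. indicator B x *\<^sub>R C)"
        by (rule borel_integrable_compact) (auto simp: B_def)
      show "AE x in lborel. (\<lambda>n. q n x) \<longlonglongrightarrow> G x \<bullet> e" using qlim by simp
      show "AE x in lborel. norm (q n x) \<le> indicator B x *\<^sub>R C" for n using bound by simp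
    qed
    then have "(LINT x|lborel. G x \<bullet> e) = 0" using q0 by (simp add: LIMSEQ_const_iff)
    then show ?thesis using Gi by simp
  qed
  then have "(LINT x|lborel. G x) = 0" by (metis inner_eq_zero_iff)
  then show "(LINT x|lebesgue. G x) = 0"
    using Gi by (simp add: integral_completion borel_measurable_integrable)
qed

section \<open>Weak gradients\<close>

lemma test_fun_support:
  assumes "test_fun U \<phi>"
  shows "\<exists>K. compact K \<and> K \<subseteq> U \<and> (\<forall>x. x \<notin> K \<longrightarrow> \<phi> x = 0) \<and> (\<forall>x. x \<notin> K \<longrightarrow> grad \<phi> x = 0) \<and> smooth \<phi>"
proof (intro exI conjI)
  let ?K = "closure {x. \<phi> x \<noteq> 0}"
  show "compact ?K" "?K \<subseteq> U" and s: "smooth \<phi>" using assms unfolding test_fun_def by blast+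
  have 0: "\<phi> x = 0" if "x \<notin> ?K" for x using that closure_subset[of "{x. \<phi> x \<noteq> 0}"] by blast
  then show "\<forall>x. x \<notin> ?K \<longrightarrow> \<phi> x = 0" by blast
  have "grad \<phi> x = 0" if "x \<notin> ?K" for x
  proof (rule GDERIV_vanish[OF smooth_GDERIV(1)[OF s]])
    show "open (- ?K)" by (rule open_Compl, rule closed_closure)
    show "x \<in> - ?K" using that by simp
    show "\<phi> y = 0" if "y \<in> - ?K" for y using 0[of y] that by blast
  qed
  then show "\<forall>x. x \<notin> ?K \<longrightarrow> grad \<phi> x = 0" by blast
qed

lemma test_funI:
  assumes "smooth \<phi>" "compact K" "K \<subseteq> U" "\<And>x. x \<notin> K \<Longrightarrow> \<phi> x = 0"
  shows "test_fun U \<phi>"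
proof -
  have "{x. \<phi> x \<noteq> 0} \<subseteq> K" using assms(4) by auto
  then have c: "closure {x. \<phi> x \<noteq> 0} \<subseteq> K"
    using assms(2) by (simp add: closure_minimal compact_imp_closed)
  then have "compact (closure {x. \<phi> x \<noteq> 0})"
    using assms(2) by (metis closed_Int_compact closed_closure inf.absorb_iff1)
  then show ?thesis using assms c by (auto simp: test_fun_def)
qed

lemma test_fun_mono: "test_fun V \<phi> \<Longrightarrow> V \<subseteq> U \<Longrightarrow> test_fun U \<phi>"
  by (auto simp: test_fun_def)

lemma grad_mult: "smooth f \<Longrightarrow> smooth g \<Longrightarrow> grad (\<lambda>x. f x * g x) x = f x *\<^sub>R grad g x + g x *\<^sub>R grad f x"
  by (intro grad_eqI GDERIV_mult smooth_GDERIV(1))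
lemma grad_diff: "smooth f \<Longrightarrow> smooth g \<Longrightarrow> grad (\<lambda>x. f x - g x) x = grad f x - grad g x"
  by (intro grad_eqI GDERIV_diff smooth_GDERIV(1))
lemma grad_affine: "grad (\<lambda>x. a \<bullet> x + b) x = a"
  by (intro grad_eqI GDERIV_affine)

lemma set_LINT_outside_0:
  fixes f :: "'a::euclidean_space \<Rightarrow> 'b::euclidean_space"
  assumes "\<And>x. x \<in> A \<Longrightarrow> x \<notin> B \<Longrightarrow> f x = 0" "B \<subseteq> A"
  shows "(LINT x:A|lebesgue. f x) = (LINT x:B|lebesgue. f x)"
  unfolding set_lebesgue_integral_def
  by (rule arg_cong[where f="integral\<^sup>L lebesgue"]) (use assms in \<open>auto simp: indicator_def fun_eq_iff\<close>)

lemma set_integrable_outside_0: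
  fixes f :: "'a::euclidean_space \<Rightarrow> 'b::euclidean_space"
  assumes "\<And>x. x \<in> A \<Longrightarrow> x \<notin> B \<Longrightarrow> f x = 0" "B \<subseteq> A"
  shows "set_integrable lebesgue A f \<longleftrightarrow> set_integrable lebesgue B f"
  unfolding set_integrable_def
  by (rule arg_cong[where f="integrable lebesgue"]) (use assms in \<open>auto simp: indicator_def fun_eq_iff\<close>)

lemma set_integrable_mult_bounded:
  fixes f :: "'a::euclidean_space \<Rightarrow> 'b::euclidean_space" and c :: "'a \<Rightarrow> real"
  assumes "compact K" "set_integrable lebesgue K f" "continuous_on K c"
  shows "set_integrable lebesgue K (\<lambda>x. c x *\<^sub>R f x)"
proof -
  have cm: "(\<lambda>x. indicator K x *\<^sub>R c x) \<in> borel_measurable lebesgue"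
    and fm: "(\<lambda>x. indicator K x *\<^sub>R f x) \<in> borel_measurable lebesgue"
    using compact_set_integrable[OF assms(1,3)] assms(2) unfolding set_integrable_def
    by (auto simp: borel_measurable_integrable)
  obtain M where M: "\<And>x. x \<in> K \<Longrightarrow> \<bar>c x\<bar> \<le> M"
    using compact_imp_bounded[OF compact_continuous_image[OF assms(3,1)]] by (auto simp: bounded_iff)
  show ?thesis
  proof (rule set_integrable_bound)
    show "set_integrable lebesgue K (\<lambda>x. M *\<^sub>R f x)" using assms(2) by simp
    have "(\<lambda>x. (indicator K x *\<^sub>R c x) *\<^sub>R (indicator K x *\<^sub>R f x)) \<in> borel_measurable lebesgue"
      using cm fm by (rule borel_measurable_scaleR)
    moreover have "(\<lambda>x. (indicator K x *\<^sub>R c x) *\<^sub>R (indicator K x *\<^sub>R f x))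
        = (\<lambda>x. indicator K x *\<^sub>R (c x *\<^sub>R f x))" by (auto simp: indicator_def)
    ultimately show "set_borel_measurable lebesgue K (\<lambda>x. c x *\<^sub>R f x)"
      by (simp add: set_borel_measurable_def)
    show "AE x in lebesgue. x \<in> K \<longrightarrow> norm (c x *\<^sub>R f x) \<le> norm (M *\<^sub>R f x)"
      using M by (fastforce intro!: AE_I2 mult_right_mono)
  qed
qed

text \<open>The product with a test function has compact support, so its gradient integrates to zero.\<close>

lemma smooth_has_weak_grad:
  assumes "smooth v"
  shows "has_weak_grad U v (grad v)"
  unfolding has_weak_grad_def
proof (intro conjI allI impI)
  fix K assume "compact K \<and> K \<subseteq> U"
  then show "set_integrable lebesgue K v" "set_integrable lebesgue K (grad v)"
    using smooth_GDERIV(2,3)[OF assms]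
    by (auto intro!: compact_set_integrable intro: continuous_on_subset)
next
  fix \<phi> assume t: "test_fun U \<phi>"
  obtain K where K: "compact K" "K \<subseteq> U" "\<forall>x. x \<notin> K \<longrightarrow> \<phi> x = 0" "\<forall>x. x \<notin> K \<longrightarrow> grad \<phi> x = 0" "smooth \<phi>"
    using test_fun_support[OF t] by (elim exE conjE) (rule that)
  note v = smooth_GDERIV[OF assms] and p = smooth_GDERIV[OF K(5)]
  have i: "set_integrable lebesgue K (\<lambda>x. v x *\<^sub>R grad \<phi> x)" "set_integrable lebesgue K (\<lambda>x. \<phi> x *\<^sub>R grad v x)"
    using v p by (auto intro!: compact_set_integrable[OF K(1)] continuous_intros intro: continuous_on_subset)
  have s: "smooth (\<lambda>x. v x * \<phi> x)" using assms K by auto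
  have "(LINT x|lebesgue. grad (\<lambda>x. v x * \<phi> x) x) = 0"
    by (rule integral_GDERIV_eq_0(2)[OF smooth_GDERIV(1)[OF s] smooth_GDERIV(3)[OF s] K(1)]) (simp add: K)
  also have "(LINT x|lebesgue. grad (\<lambda>x. v x * \<phi> x) x) = (LINT x:K|lebesgue. v x *\<^sub>R grad \<phi> x + \<phi> x *\<^sub>R grad v x)"
    unfolding set_lebesgue_integral_def
    by (rule arg_cong[where f="integral\<^sup>L lebesgue"])
      (use K in \<open>auto simp: indicator_def fun_eq_iff grad_mult[OF assms K(5)]\<close>)
  also have "\<dots> = (LINT x:K|lebesgue. v x *\<^sub>R grad \<phi> x) + (LINT x:K|lebesgue. \<phi> x *\<^sub>R grad v x)"
    by (rule set_integral_add(2)[OF i])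
  also have "(LINT x:K|lebesgue. v x *\<^sub>R grad \<phi> x) = (LINT x:U|lebesgue. v x *\<^sub>R grad \<phi> x)"
    by (rule set_LINT_outside_0[symmetric]) (use K in auto)
  also have "(LINT x:K|lebesgue. \<phi> x *\<^sub>R grad v x) = (LINT x:U|lebesgue. \<phi> x *\<^sub>R grad v x)"
    by (rule set_LINT_outside_0[symmetric]) (use K in auto)
  finally show "(LINT x:U|lebesgue. v x *\<^sub>R grad \<phi> x) = - (LINT x:U|lebesgue. \<phi> x *\<^sub>R grad v x)"
    by (simp add: eq_neg_iff_add_eq_0)
qed

lemma has_weak_grad_subset:
  assumes "has_weak_grad U v g" "V \<subseteq> U"
  shows "has_weak_grad V v g"
  unfolding has_weak_grad_def
proof (intro conjI allI impI)
  fix K assume "compact K \<and> K \<subseteq> V"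
  then show "set_integrable lebesgue K v" "set_integrable lebesgue K g"
    using assms by (auto simp: has_weak_grad_def)
next
  fix \<phi> assume t: "test_fun V \<phi>"
  obtain K where K: "compact K" "K \<subseteq> V" "\<forall>x. x \<notin> K \<longrightarrow> \<phi> x = 0" "\<forall>x. x \<notin> K \<longrightarrow> grad \<phi> x = 0" "smooth \<phi>"
    using test_fun_support[OF t] by (elim exE conjE) (rule that)
  have "(LINT x:U|lebesgue. v x *\<^sub>R grad \<phi> x) = - (LINT x:U|lebesgue. \<phi> x *\<^sub>R g x)"
    using assms test_fun_mono[OF t] by (auto simp: has_weak_grad_def)
  moreover have "(LINT x:U|lebesgue. v x *\<^sub>R grad \<phi> x) = (LINT x:V|lebesgue. v x *\<^sub>R grad \<phi> x)"
    "(LINT x:U|lebesgue. \<phi> x *\<^sub>R g x) = (LINT x:V|lebesgue. \<phi> x *\<^sub>R g x)"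
    by (rule set_LINT_outside_0; use K assms in auto)+
  ultimately show "(LINT x:V|lebesgue. v x *\<^sub>R grad \<phi> x) = - (LINT x:V|lebesgue. \<phi> x *\<^sub>R g x)" by simp
qed

lemma has_weak_grad_cong_AE:
  assumes "has_weak_grad U v g"
    and "AE x in lebesgue. x \<in> U \<longrightarrow> v x = w x" "AE x in lebesgue. x \<in> U \<longrightarrow> g x = h x"
  shows "has_weak_grad U w h"
  unfolding has_weak_grad_def
proof (intro conjI allI impI)
  fix K assume K: "compact K \<and> K \<subseteq> U"
  have "AE x in lebesgue. x \<in> K \<longrightarrow> v x = w x" "AE x in lebesgue. x \<in> K \<longrightarrow> g x = h x"
    subgoal using assms(2) by eventually_elim (use K in auto)
    subgoal using assms(3) by eventually_elim (use K in auto)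
    done
  from set_integrable_cong_AE'[OF this(1)] set_integrable_cong_AE'[OF this(2)]
  show "set_integrable lebesgue K w" "set_integrable lebesgue K h"
    using assms(1) K by (auto simp: has_weak_grad_def)
next
  fix \<phi> assume t: "test_fun U \<phi>"
  have "(LINT x:U|lebesgue. v x *\<^sub>R grad \<phi> x) = (LINT x:U|lebesgue. w x *\<^sub>R grad \<phi> x)"
    by (rule set_LINT_cong_AE) (use assms(2) in auto)
  moreover have "(LINT x:U|lebesgue. \<phi> x *\<^sub>R g x) = (LINT x:U|lebesgue. \<phi> x *\<^sub>R h x)"
    by (rule set_LINT_cong_AE) (use assms(3) in auto)
  ultimately show "(LINT x:U|lebesgue. w x *\<^sub>R grad \<phi> x) = - (LINT x:U|lebesgue. \<phi> x *\<^sub>R h x)"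
    using assms(1) t by (simp add: has_weak_grad_def)
qed

lemma weak_grad_test_integrable:
  assumes "has_weak_grad U v g" "test_fun U \<phi>"
  shows "set_integrable lebesgue U (\<lambda>x. v x *\<^sub>R grad \<phi> x)" "set_integrable lebesgue U (\<lambda>x. \<phi> x *\<^sub>R g x)"
proof -
  obtain K where K: "compact K" "K \<subseteq> U" "\<forall>x. x \<notin> K \<longrightarrow> \<phi> x = 0" "\<forall>x. x \<notin> K \<longrightarrow> grad \<phi> x = 0" "smooth \<phi>"
    using test_fun_support[OF assms(2)] by (elim exE conjE) (rule that)
  have i: "set_integrable lebesgue K v" "set_integrable lebesgue K g"
    using assms(1) K by (auto simp: has_weak_grad_def)
  note p = smooth_GDERIV[OF K(5)]
  have "set_integrable lebesgue K (\<lambda>x. \<phi> x *\<^sub>R g x)"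
    by (rule set_integrable_mult_bounded[OF K(1) i(2)]) (use p continuous_on_subset in blast)
  then show "set_integrable lebesgue U (\<lambda>x. \<phi> x *\<^sub>R g x)"
    by (subst set_integrable_outside_0[of _ K]) (use K in auto)
  have "set_integrable lebesgue K (\<lambda>x. ((grad \<phi> x \<bullet> e) *\<^sub>R v x) *\<^sub>R e)" for e
    by (intro set_integrable_scaleR_left set_integrable_mult_bounded[OF K(1) i(1)])
      (intro continuous_intros continuous_on_subset[OF p(3)], simp)
  then have "set_integrable lebesgue K (\<lambda>x. \<Sum>e\<in>Basis. ((grad \<phi> x \<bullet> e) *\<^sub>R v x) *\<^sub>R e)"
    unfolding set_integrable_def scaleR_sum_right by (intro Bochner_Integration.integrable_sum)
  moreover have "(\<Sum>e\<in>Basis. ((grad \<phi> x \<bullet> e) *\<^sub>R v x) *\<^sub>R e) = v x *\<^sub>R grad \<phi> x" for x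
  proof -
    have "(\<Sum>e\<in>Basis. ((grad \<phi> x \<bullet> e) *\<^sub>R v x) *\<^sub>R e) = v x *\<^sub>R (\<Sum>e\<in>Basis. (grad \<phi> x \<bullet> e) *\<^sub>R e)"
      by (simp add: scaleR_sum_right mult.commute)
    then show ?thesis by (simp add: euclidean_representation)
  qed
  ultimately have "set_integrable lebesgue K (\<lambda>x. v x *\<^sub>R grad \<phi> x)" by simp
  then show "set_integrable lebesgue U (\<lambda>x. v x *\<^sub>R grad \<phi> x)"
    by (subst set_integrable_outside_0[of _ K]) (use K in auto)
qed

lemma has_weak_grad_lincomb:
  assumes "has_weak_grad U v g" "has_weak_grad U w h"
  shows "has_weak_grad U (\<lambda>x. a * v x + b * w x) (\<lambda>x. a *\<^sub>R g x + b *\<^sub>R h x)"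
  unfolding has_weak_grad_def
proof (intro conjI allI impI)
  fix K assume "compact K \<and> K \<subseteq> U"
  then have "set_integrable lebesgue K v" "set_integrable lebesgue K g"
    "set_integrable lebesgue K w" "set_integrable lebesgue K h"
    using assms by (auto simp: has_weak_grad_def)
  then show "set_integrable lebesgue K (\<lambda>x. a * v x + b * w x)"
    "set_integrable lebesgue K (\<lambda>x. a *\<^sub>R g x + b *\<^sub>R h x)"
    by (intro set_integral_add(1) set_integrable_mult_right set_integrable_scaleR_right; simp)+
next
  fix \<phi> assume t: "test_fun U \<phi>"
  note 1 = weak_grad_test_integrable[OF assms(1) t] and 2 = weak_grad_test_integrable[OF assms(2) t]
  have e: "(LINT x:U|lebesgue. v x *\<^sub>R grad \<phi> x) = - (LINT x:U|lebesgue. \<phi> x *\<^sub>R g x)"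
    "(LINT x:U|lebesgue. w x *\<^sub>R grad \<phi> x) = - (LINT x:U|lebesgue. \<phi> x *\<^sub>R h x)"
    using assms t by (auto simp: has_weak_grad_def)
  have "(LINT x:U|lebesgue. (a * v x + b * w x) *\<^sub>R grad \<phi> x)
      = (LINT x:U|lebesgue. a *\<^sub>R (v x *\<^sub>R grad \<phi> x) + b *\<^sub>R (w x *\<^sub>R grad \<phi> x))"
    by (simp add: scaleR_add_left)
  also have "\<dots> = a *\<^sub>R (LINT x:U|lebesgue. v x *\<^sub>R grad \<phi> x) + b *\<^sub>R (LINT x:U|lebesgue. w x *\<^sub>R grad \<phi> x)"
    using 1 2 by (subst set_integral_add(2)) (auto simp del: scaleR_scaleR)
  also have "\<dots> = - (a *\<^sub>R (LINT x:U|lebesgue. \<phi> x *\<^sub>R g x) + b *\<^sub>R (LINT x:U|lebesgue. \<phi> x *\<^sub>R h x))"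
    by (simp add: e)
  also have "\<dots> = - (LINT x:U|lebesgue. a *\<^sub>R (\<phi> x *\<^sub>R g x) + b *\<^sub>R (\<phi> x *\<^sub>R h x))"
    using 1 2 by (subst set_integral_add(2)) (auto simp del: scaleR_scaleR)
  also have "\<dots> = - (LINT x:U|lebesgue. \<phi> x *\<^sub>R (a *\<^sub>R g x + b *\<^sub>R h x))"
    by (simp add: scaleR_add_right mult.commute)
  finally show "(LINT x:U|lebesgue. (a * v x + b * w x) *\<^sub>R grad \<phi> x)
      = - (LINT x:U|lebesgue. \<phi> x *\<^sub>R (a *\<^sub>R g x + b *\<^sub>R h x))" .
qed

lemma has_weak_grad_diff:
  "has_weak_grad U v g \<Longrightarrow> has_weak_grad U w h \<Longrightarrow> has_weak_grad U (\<lambda>x. v x - w x) (\<lambda>x. g x - h x)"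
  using has_weak_grad_lincomb[of U v g w h 1 "-1"] by simp

subsection \<open>Uniqueness\<close>

text \<open>
  A product over the faces of the box of flat functions of the distance to the face; scaling the
  distances by \<open>n\<close> makes each factor tend to \<open>1\<close> inside the box.
\<close>

lemma box_bump:
  fixes a b :: R2
  assumes "box a b \<noteq> {}"
  obtains \<phi> where "\<And>n. test_fun (cbox a b) (\<phi> n)" "\<And>n x. 0 \<le> \<phi> n x \<and> \<phi> n x \<le> 1"
    "\<And>x. (\<lambda>n. \<phi> n x) \<longlonglongrightarrow> indicator (box a b) x"
proof -
  define F where "F n i x = flat 0 (real (Suc n) * (x $ i - a $ i)) * flat 0 (real (Suc n) * (b $ i - x $ i))"
    for n i and x :: R2
  define \<phi> where "\<phi> n x = (\<Prod>i\<in>UNIV. F n i x)" for n x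
  have F01: "0 \<le> F n i x" "F n i x \<le> 1" for n i x
    by (auto simp: F_def flat_nonneg flat_le_1 intro!: mult_le_one)
  have F0: "F n i x = 0" if "\<not> (a $ i < x $ i \<and> x $ i < b $ i)" for n i x
    using that by (auto simp: F_def not_less intro!: flat_eq_0 mult_nonneg_nonpos)
  have out: "\<phi> n x = 0" if "x \<notin> box a b" for n x
  proof -
    have "\<exists>i. \<not> (a $ i < x $ i \<and> x $ i < b $ i)" using that unfolding mem_box_cart by simp
    then obtain i where "\<not> (a $ i < x $ i \<and> x $ i < b $ i)" by (rule exE)
    then show ?thesis unfolding \<phi>_def using F0 by (intro prod_zero) auto
  qed
  have "smooth (F n i)" for n i
  proof -
    have "smooth (\<lambda>x. flat 0 ((real (Suc n) *\<^sub>R axis i 1) \<bullet> x + (- real (Suc n) * a $ i))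
       * flat 0 ((- real (Suc n) *\<^sub>R axis i 1) \<bullet> x + (real (Suc n) * b $ i)))"
      by (intro smooth_mult smooth_flat)
    moreover have "(real (Suc n) *\<^sub>R axis i 1) \<bullet> x + (- real (Suc n) * a $ i) = real (Suc n) * (x $ i - a $ i)"
      "(- real (Suc n) *\<^sub>R axis i 1) \<bullet> x + (real (Suc n) * b $ i) = real (Suc n) * (b $ i - x $ i)" for x :: R2
      by (simp_all add: inner_axis' algebra_simps)
    ultimately show ?thesis unfolding F_def by simp
  qed
  then have "smooth (\<phi> n)" for n unfolding \<phi>_def by (intro smooth_prod) auto
  then have "test_fun (cbox a b) (\<phi> n)" for n
    by (rule test_funI[of _ "cbox a b"]) (use out box_subset_cbox[of a b] in auto)
  moreover have "0 \<le> \<phi> n x \<and> \<phi> n x \<le> 1" for n x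
    unfolding \<phi>_def using F01 by (auto intro: prod_nonneg prod_le_1)
  moreover have "(\<lambda>n. \<phi> n x) \<longlonglongrightarrow> indicator (box a b) x" for x
  proof (cases "x \<in> box a b")
    case False then show ?thesis using out by simp
  next
    case True
    have lim: "(\<lambda>n. flat 0 (real (Suc n) * c)) \<longlonglongrightarrow> 1" if "c > 0" for c
    proof -
      have "(\<lambda>n. exp (- (inverse (real (Suc n)) * inverse c))) \<longlonglongrightarrow> exp (- (0 * inverse c))"
        by (intro tendsto_intros LIMSEQ_inverse_real_of_nat)
      moreover have "exp (- (inverse (real (Suc n)) * inverse c)) = flat 0 (real (Suc n) * c)" for n
        using that by (simp add: flat_def field_simps add_pos_nonneg)
      ultimately show ?thesis by simp
    qed
    have "(\<lambda>n. \<phi> n x) \<longlonglongrightarrow> (\<Prod>i\<in>(UNIV::2 set). 1 * 1)"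
      unfolding \<phi>_def F_def using True
      by (intro tendsto_prod tendsto_mult lim) (auto simp: mem_box_cart)
    then show ?thesis using True by simp
  qed
  ultimately show ?thesis by (rule that)
qed

text \<open>
  Boxes are an intersection-stable generator of the Borel sets, so the integral vanishes over all
  measurable sets; the sets where \<open>h\<close> is positive and where it is negative are then null sets.
\<close>

lemma AE_zero_of_box_integrals:
  fixes h :: "R2 \<Rightarrow> real"
  assumes i: "set_integrable lebesgue (box a b) h"
    and z: "\<And>c d. box c d \<subseteq> box a b \<Longrightarrow> (LINT x:box c d|lebesgue. h x) = 0"
  shows "AE x in lebesgue. x \<in> box a b \<longrightarrow> h x = 0"
proof -
  define B where "B = box a b"
  define H where "H x = indicator B x *\<^sub>R h x" for x
  have Hi: "integrable lebesgue H" using i unfolding set_integrable_def H_def B_def .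
  have Hs: "set_integrable lebesgue A H" if "A \<in> sets lebesgue" for A
    using Hi that integrable_mult_indicator unfolding set_integrable_def by blast
  have borel0: "(LINT x:A|lebesgue. H x) = 0" if "A \<in> sets borel" for A
  proof -
    have "Int_stable (range (\<lambda>(a, b). box a b :: R2 set))"
      by (auto simp: Int_stable_def box_Int_box)
    moreover have "range (\<lambda>(a, b). box a b :: R2 set) \<subseteq> Pow UNIV" by auto
    moreover have "A \<in> sigma_sets UNIV (range (\<lambda>(a, b). box a b :: R2 set))"
      using that unfolding borel_eq_box by simp
    ultimately show ?thesis
    proof (induction rule: sigma_sets_induct_disjoint)
      case (basic A)
      then obtain c d where A: "A = box c d" by auto
      obtain c' d' where cd: "box c d \<inter> box a b = box c' d'" using box_Int_box by blast
      have "(LINT x:A|lebesgue. H x) = (LINT x:box c' d'|lebesgue. h x)"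
        unfolding set_lebesgue_integral_def H_def A cd[symmetric] B_def
        by (rule arg_cong[where f="integral\<^sup>L lebesgue"]) (auto simp: indicator_def fun_eq_iff)
      also have "\<dots> = 0" by (rule z) (use cd in auto)
      finally show ?case .
    next
      case empty show ?case by (simp add: set_lebesgue_integral_def)
    next
      case (compl A)
      have A: "A \<in> sets lebesgue"
        using compl(1) by (intro sets_completionI_sets) (simp add: borel_eq_box)
      have "(LINT x|lebesgue. H x) = (LINT x:B|lebesgue. h x)"
        by (simp add: H_def set_lebesgue_integral_def)
      also have "\<dots> = 0" unfolding B_def by (rule z) auto
      finally have U: "(LINT x:A \<union> (UNIV - A)|lebesgue. H x) = 0" by (simp add: set_lebesgue_integral_def)
      have "(LINT x:A \<union> (UNIV - A)|lebesgue. H x) = (LINT x:A|lebesgue. H x) + (LINT x:UNIV - A|lebesgue. H x)"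
        by (rule set_integral_Un) (use A sets.compl_sets[OF A] in \<open>auto intro: Hs\<close>)
      then show ?case using compl U by simp
    next
      case (union F)
      have F: "F n \<in> sets lebesgue" for n
        using union(2) by (intro sets_completionI_sets) (auto simp: borel_eq_box)
      have "(LINT x:(\<Union>i. F i)|lebesgue. H x) = (\<Sum>i. LINT x:F i|lebesgue. H x)"
        by (rule lebesgue_integral_countable_add)
          (use union F Hs in \<open>auto simp: disjoint_family_on_def\<close>)
      then show ?case using union by simp
    qed
  qed
  have leb0: "(LINT x:A|lebesgue. H x) = 0" if A: "A \<in> sets lebesgue" for A
  proof -
    obtain S N N' where S: "A = S \<union> N" "N \<subseteq> N'" "N' \<in> null_sets lborel" "S \<in> sets lborel"
      using A by (auto elim: sets_completionE)
    have "AE x in lebesgue. x \<notin> N'"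
      using S(3) by (intro AE_not_in) (simp add: null_sets_completionI)
    then have "AE x in lebesgue. x \<in> A \<longleftrightarrow> x \<in> S" using S by (auto elim!: eventually_mono)
    from set_LINT_cong_set_AE[OF this, of H] show ?thesis using borel0[of S] S by simp
  qed
  have Hm[measurable]: "H \<in> borel_measurable lebesgue" using Hi by simp
  \<comment> \<open>the sign \<open>s = 1\<close> excludes positive values of \<open>H\<close>, and \<open>s = - 1\<close> negative ones\<close>
  have one: "AE x in lebesgue. s * H x \<le> 0" for s
  proof -
    have A: "{x \<in> space lebesgue. 0 < s * H x} \<in> sets lebesgue" by measurable
    let ?A = "{x. 0 < s * H x}"
    have "(LINT x|lebesgue. indicator ?A x *\<^sub>R (s * H x)) = s * (LINT x:?A|lebesgue. H x)"
      unfolding set_lebesgue_integral_def by (simp flip: integral_mult_right_zero add: mult.left_commute)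
    also have "\<dots> = 0" using leb0[of ?A] A by simp
    finally have "(LINT x|lebesgue. indicator ?A x *\<^sub>R (s * H x)) = 0" .
    moreover have "integrable lebesgue (\<lambda>x. indicator ?A x *\<^sub>R (s * H x))"
      using A Hi by (intro integrable_mult_indicator) auto
    ultimately have "AE x in lebesgue. indicator ?A x *\<^sub>R (s * H x) = 0"
      by (subst (asm) integral_nonneg_eq_0_iff_AE) (auto simp: indicator_def)
    then show ?thesis by eventually_elim (auto simp: indicator_def split: if_splits)
  qed
  from one[of 1] one[of "-1"] show ?thesis
    by eventually_elim (auto simp: H_def B_def)
qed

text \<open>
  The fundamental lemma of the calculus of variations.  Test functions approximating the indicator
  of a box show that the integral of \<open>d\<close> over it vanishes, and countably many boxes exhaust \<open>U\<close>.
\<close>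

lemma AE_zero_of_test_fun:
  fixes d :: "R2 \<Rightarrow> R2"
  assumes U: "open U" and i: "\<And>K. compact K \<Longrightarrow> K \<subseteq> U \<Longrightarrow> set_integrable lebesgue K d"
    and z: "\<And>\<phi>. test_fun U \<phi> \<Longrightarrow> (LINT x:U|lebesgue. \<phi> x *\<^sub>R d x) = 0"
  shows "AE x in lebesgue. x \<in> U \<longrightarrow> d x = 0"
proof -
  have box0: "(LINT x:box a b|lebesgue. d x) = 0" if ab: "cbox a b \<subseteq> U" "box a b \<noteq> {}" for a b
  proof -
    obtain \<phi> where \<phi>: "\<And>n. test_fun (cbox a b) (\<phi> n)" "\<And>n x. 0 \<le> \<phi> n x \<and> \<phi> n x \<le> 1"
      "\<And>x. (\<lambda>n. \<phi> n x) \<longlonglongrightarrow> indicator (box a b) x" using box_bump[OF ab(2)] by metis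
    have di: "set_integrable lebesgue (cbox a b) d" using i ab by auto
    have out: "\<phi> n x = 0" if "x \<notin> cbox a b" for n x
      using \<phi>(1)[of n] that closure_subset[of "{x. \<phi> n x \<noteq> 0}"] unfolding test_fun_def by blast
    have eq: "(LINT x:U|lebesgue. \<phi> n x *\<^sub>R d x) = (LINT x|lebesgue. \<phi> n x *\<^sub>R (indicator (cbox a b) x *\<^sub>R d x))" for n
      unfolding set_lebesgue_integral_def
      by (rule arg_cong[where f="integral\<^sup>L lebesgue"]) (use out ab in \<open>auto simp: indicator_def fun_eq_iff\<close>)
    have pm: "\<phi> n \<in> borel_measurable lebesgue" for n
    proof -
      have "continuous_on UNIV (\<phi> n)" using \<phi>(1)[of n] smooth_GDERIV(2) by (auto simp: test_fun_def)
      then have "\<phi> n \<in> borel_measurable borel" by (rule borel_measurable_continuous_onI)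
      then show ?thesis by (simp add: measurable_completion)
    qed
    have "(\<lambda>n. LINT x|lebesgue. \<phi> n x *\<^sub>R (indicator (cbox a b) x *\<^sub>R d x))
        \<longlonglongrightarrow> (LINT x|lebesgue. indicator (box a b) x *\<^sub>R (indicator (cbox a b) x *\<^sub>R d x))"
    proof (rule integral_dominated_convergence)
      have dm: "(\<lambda>x. indicator (cbox a b) x *\<^sub>R d x) \<in> borel_measurable lebesgue"
        using di by (simp add: set_integrable_def borel_measurable_integrable)
      show "(\<lambda>x. indicat_real (box a b) x *\<^sub>R indicat_real (cbox a b) x *\<^sub>R d x) \<in> borel_measurable lebesgue"
        by (intro borel_measurable_scaleR[OF _ dm] borel_measurable_indicator) auto
      show "(\<lambda>x. \<phi> n x *\<^sub>R indicat_real (cbox a b) x *\<^sub>R d x) \<in> borel_measurable lebesgue" for n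
        by (intro borel_measurable_scaleR[OF pm dm])
      show "integrable lebesgue (\<lambda>x. norm (indicat_real (cbox a b) x *\<^sub>R d x))"
        using di by (intro integrable_norm) (simp add: set_integrable_def)
      show "AE x in lebesgue. (\<lambda>n. \<phi> n x *\<^sub>R indicat_real (cbox a b) x *\<^sub>R d x)
          \<longlonglongrightarrow> indicat_real (box a b) x *\<^sub>R indicat_real (cbox a b) x *\<^sub>R d x"
        by (intro AE_I2 tendsto_intros \<phi>(3))
      show "AE x in lebesgue. norm (\<phi> n x *\<^sub>R indicat_real (cbox a b) x *\<^sub>R d x)
          \<le> norm (indicat_real (cbox a b) x *\<^sub>R d x)" for n

      proof (rule AE_I2)
        fix x
        show "norm (\<phi> n x *\<^sub>R indicat_real (cbox a b) x *\<^sub>R d x) \<le> norm (indicat_real (cbox a b) x *\<^sub>R d x)"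
          using \<phi>(2)[of n x] mult_left_le_one_le[of "norm (indicat_real (cbox a b) x *\<^sub>R d x)" "\<phi> n x"]
          by (simp only: norm_scaleR[of "\<phi> n x"]) simp
      qed
    qed
    moreover have "(LINT x|lebesgue. \<phi> n x *\<^sub>R (indicator (cbox a b) x *\<^sub>R d x)) = 0" for n
      using z[of "\<phi> n"] \<phi>(1)[of n] ab eq[of n] test_fun_mono by metis
    ultimately have "(LINT x|lebesgue. indicator (box a b) x *\<^sub>R (indicator (cbox a b) x *\<^sub>R d x)) = 0"
      by (simp add: LIMSEQ_const_iff)
    moreover have "(\<lambda>x. indicator (box a b) x *\<^sub>R (indicator (cbox a b) x *\<^sub>R d x)) = (\<lambda>x. indicator (box a b) x *\<^sub>R d x)"
      using box_subset_cbox[of a b] by (auto simp: indicator_def fun_eq_iff)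
    ultimately show ?thesis by (simp add: set_lebesgue_integral_def)
  qed
  have one: "AE x in lebesgue. x \<in> box a b \<longrightarrow> d x = 0" if ab: "cbox a b \<subseteq> U" for a b
  proof -
    have sub: "(LINT x:box c e|lebesgue. d x) = 0" if "box c e \<subseteq> box a b" for c e
    proof (cases "box c e = {}")
      case True then show ?thesis by (simp add: set_lebesgue_integral_def)
    next
      case False
      have "cbox c e \<subseteq> closure (box a b)" using that closure_mono closure_box[OF False] by metis
      also have "\<dots> \<subseteq> cbox a b" by (rule closure_minimal[OF box_subset_cbox closed_cbox])
      finally show ?thesis using box0 False ab by blast
    qed
    have di: "set_integrable lebesgue (box a b) d"
      using i[OF compact_cbox ab] by (rule set_integrable_subset) (auto simp: box_subset_cbox)
    have "AE x in lebesgue. x \<in> box a b \<longrightarrow> d x $ j = 0" for j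
    proof (rule AE_zero_of_box_integrals)
      have ind: "(\<lambda>x. indicator A x *\<^sub>R (d x $ j)) = (\<lambda>x. (indicator A x *\<^sub>R d x) \<bullet> axis j 1)" for A
        by (simp add: fun_eq_iff inner_axis)
      show "set_integrable lebesgue (box a b) (\<lambda>x. d x $ j)"
        using di unfolding set_integrable_def ind by (rule integrable_inner_left)
      fix c e assume ce: "box c e \<subseteq> box a b"
      have "set_integrable lebesgue (box c e) d" using di ce by (auto intro: set_integrable_subset)
      then have "(LINT x:box c e|lebesgue. d x $ j) = (LINT x:box c e|lebesgue. d x) \<bullet> axis j 1"
        unfolding set_lebesgue_integral_def set_integrable_def ind by (intro integral_inner_left)
      then show "(LINT x:box c e|lebesgue. d x $ j) = 0" using sub[OF ce] by simp
    qed
    from this[of 1] this[of 2] show ?thesis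
    proof eventually_elim
      case (elim x)
      then show ?case by (auto simp: vec_eq_iff forall_2)
    qed
  qed
  obtain \<D> where D: "countable \<D>" "\<D> \<subseteq> Pow U" "\<And>X. X \<in> \<D> \<Longrightarrow> \<exists>a b. X = cbox a b" "\<Union>\<D> = U"
    using open_countable_Union_open_cbox[OF U] by metis
  have "AE x in lebesgue. x \<in> X \<longrightarrow> d x = 0" if "X \<in> \<D>" for X
  proof -
    from D(3)[OF that] obtain a b where X: "X = cbox a b" by blast
    have "AE x in lebesgue. x \<notin> cbox a b - box a b"
      by (rule AE_not_in_negligible) (rule negligible_frontier_interval)
    moreover have "AE x in lebesgue. x \<in> box a b \<longrightarrow> d x = 0"
      by (rule one) (use D(2) that X in blast)
    ultimately show ?thesis by eventually_elim (use X in auto)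
  qed
  then have "AE x in lebesgue. \<forall>X\<in>\<D>. x \<in> X \<longrightarrow> d x = 0"
    by (subst AE_ball_countable[OF D(1)]) blast
  then show ?thesis by eventually_elim (use D(4) in auto)
qed

lemma has_weak_grad_unique:
  assumes "open U" "has_weak_grad U v g" "has_weak_grad U v h"
  shows "AE x in lebesgue. x \<in> U \<longrightarrow> g x = h x"
proof -
  have "AE x in lebesgue. x \<in> U \<longrightarrow> g x - h x = 0"
  proof (rule AE_zero_of_test_fun[OF assms(1)])
    show "set_integrable lebesgue K (\<lambda>x. g x - h x)" if "compact K" "K \<subseteq> U" for K
      using assms that by (intro set_integral_diff) (auto simp: has_weak_grad_def)
    show "(LINT x:U|lebesgue. \<phi> x *\<^sub>R (g x - h x)) = 0" if t: "test_fun U \<phi>" for \<phi>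
    proof -
      have "(LINT x:U|lebesgue. \<phi> x *\<^sub>R (g x - h x))
          = (LINT x:U|lebesgue. \<phi> x *\<^sub>R g x) - (LINT x:U|lebesgue. \<phi> x *\<^sub>R h x)"
        unfolding scaleR_diff_right
        by (rule set_integral_diff(2)) (use weak_grad_test_integrable assms t in blast)+
      then show ?thesis using assms t by (auto simp: has_weak_grad_def)
    qed
  qed
  then show ?thesis by simp
qed

lemma weak_grad_AE_eq:
  assumes "open U" "has_weak_grad U v g"
  shows "AE x in lebesgue. x \<in> U \<longrightarrow> weak_grad U v x = g x"
    and "has_weak_grad U v (weak_grad U v)"
proof -
  show *: "has_weak_grad U v (weak_grad U v)"
    unfolding weak_grad_def using assms(2) by (rule someI[of "has_weak_grad U v"])
  show "AE x in lebesgue. x \<in> U \<longrightarrow> weak_grad U v x = g x"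
    using has_weak_grad_unique[OF assms(1) * assms(2)] .
qed

lemma H1_weak_grad:
  assumes "open U" "v \<in> H1 U"
  shows "weak_grad U v \<in> L2 U" "has_weak_grad U v (weak_grad U v)" "v \<in> L2 U"
proof -
  obtain g where g: "g \<in> L2 U" "has_weak_grad U v g" using assms by (auto simp: H1_def)
  have "AE x in lebesgue. x \<in> U \<longrightarrow> g x = weak_grad U v x"
    using weak_grad_AE_eq(1)[OF assms(1) g(2)] by auto
  then show "weak_grad U v \<in> L2 U" using g(1) L2_cong_AE by blast
  show "has_weak_grad U v (weak_grad U v)" using weak_grad_AE_eq(2)[OF assms(1) g(2)] .
  show "v \<in> L2 U" using assms by (simp add: H1_def)
qed

section \<open>Triangles\<close>

text \<open>
  For edges \<open>p\<close>, \<open>q\<close> of a triangle at a common vertex this is twice the signed area; it is nonzero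
  exactly for nondegenerate triangles.
\<close>

definition cross2 :: "R2 \<Rightarrow> R2 \<Rightarrow> real" where
  "cross2 p q = p $ 1 * q $ 2 - p $ 2 * q $ 1"

text \<open>
  Rotation by a right angle.  By \<open>inner_perp\<close> it turns \<open>cross2\<close> into an inner product, so that
  barycentric coordinates become affine functions with an explicit gradient.
\<close>

definition perp :: "R2 \<Rightarrow> R2" where
  "perp q = vector [q $ 2, - q $ 1]"

lemma perp_nth [simp]: "perp q $ 1 = q $ 2" "perp q $ 2 = - q $ 1"
  by (simp_all add: perp_def)

lemma inner_2: "(x::R2) \<bullet> y = x $ 1 * y $ 1 + x $ 2 * y $ 2"
  by (simp add: inner_vec_def sum_2)

lemma inner_perp: "perp q \<bullet> p = cross2 p q"
  by (simp add: inner_2 cross2_def)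

lemma norm_perp [simp]: "norm (perp q) = norm q"
  by (simp add: norm_eq_sqrt_inner inner_2)

definition ptv :: "real \<times> real \<Rightarrow> R2" where "ptv v = vector [fst v, snd v]"

lemma ptv_nth [simp]: "ptv v $ 1 = fst v" "ptv v $ 2 = snd v"
  by (simp_all add: ptv_def)

lemma continuous_on_ptv: "continuous_on UNIV ptv"
proof -
  have *: "ptv = (\<lambda>v. fst v *\<^sub>R axis 1 1 + snd v *\<^sub>R axis 2 1)"
    by (simp add: fun_eq_iff vec_eq_iff forall_2 axis_def)
  show ?thesis unfolding * by (intro continuous_intros)
qed

lemma measurable_ptv [measurable]: "ptv \<in> borel_measurable borel"
  by (rule borel_measurable_continuous_onI[OF continuous_on_ptv])

text \<open>Fubini's theorem is stated for pairs; this transports it to vectors with two components.\<close>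

lemma lborel_distr_ptv: "distr lborel borel ptv = (lborel :: R2 measure)"
proof (rule sym, rule lborel_eqI)
  fix l u :: R2 assume lu: "\<And>b. b \<in> Basis \<Longrightarrow> l \<bullet> b \<le> u \<bullet> b"
  have le: "l $ i \<le> u $ i" for i using lu[of "axis i 1"] by (simp add: inner_axis)
  have pre: "ptv -` box l u \<inter> space lborel = {l $ 1 <..< u $ 1} \<times> {l $ 2 <..< u $ 2}"
    by (auto simp: mem_box_cart forall_2)
  have "emeasure (distr lborel borel ptv) (box l u) = emeasure lborel ({l $ 1 <..< u $ 1} \<times> {l $ 2 <..< u $ 2})"
    by (subst emeasure_distr) (simp_all add: pre[simplified])
  also have "\<dots> = emeasure lborel {l $ 1 <..< u $ 1} * emeasure lborel {l $ 2 <..< u $ 2}"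
    by (subst lborel_prod[symmetric], rule lborel.emeasure_pair_measure_Times) auto
  also have "\<dots> = ennreal ((u $ 1 - l $ 1) * (u $ 2 - l $ 2))"
    using le by (simp add: ennreal_mult)
  also have "(u $ 1 - l $ 1) * (u $ 2 - l $ 2) = (\<Prod>b\<in>Basis. (u - l) \<bullet> b)"
  proof -
    have B: "(Basis :: R2 set) = range (\<lambda>i. axis i 1)" by (auto simp: Basis_vec_def)
    have "inj (\<lambda>i::2. axis i (1::real))" by (auto simp: inj_on_def axis_eq_axis)
    then show ?thesis unfolding B by (subst prod.reindex) (auto simp: UNIV_2 inner_axis)
  qed
  finally show "emeasure (distr lborel borel ptv) (box l u) = ennreal (\<Prod>b\<in>Basis. (u - l) \<bullet> b)" .
qed simp

definition ref_tri :: "R2 set" where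
  "ref_tri = {v. 0 \<le> v $ 1 \<and> 0 \<le> v $ 2 \<and> v $ 1 + v $ 2 \<le> 1}"

lemma compact_ref_tri: "compact ref_tri"
proof -
  have "closed ref_tri" unfolding ref_tri_def
    by (intro closed_Collect_conj closed_Collect_le continuous_intros)
  moreover have "bounded ref_tri"
    by (rule bounded_subset[OF bounded_cbox[of "vector [0,0]" "vector [1,1]"]])
      (auto simp: ref_tri_def mem_box_cart forall_2)
  ultimately show ?thesis by (simp add: compact_eq_bounded_closed)
qed

lemma ref_tri_integral:
  fixes \<psi> :: "R2 \<Rightarrow> real"
  assumes c: "continuous_on UNIV \<psi>"
  shows "(LINT v:ref_tri|lebesgue. \<psi> v)
    = (LINT t|lborel. indicator {0..1} t *\<^sub>R (LINT s|lborel. indicator {0..1 - t} s *\<^sub>R \<psi> (ptv (s, t))))"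
proof -
  let ?h = "\<lambda>v. indicator ref_tri v *\<^sub>R \<psi> v"
  have i: "integrable lborel ?h"
    by (rule borel_integrable_compact[OF compact_ref_tri continuous_on_subset[OF c]]) simp
  then have hm: "?h \<in> borel_measurable borel" using borel_measurable_integrable by fastforce
  have "(LINT v:ref_tri|lebesgue. \<psi> v) = integral\<^sup>L lborel ?h"
    unfolding set_lebesgue_integral_def using i by (simp add: integral_completion borel_measurable_integrable)
  also have "\<dots> = (\<integral>v. ?h (ptv v) \<partial>lborel)"
    by (subst lborel_distr_ptv[symmetric], rule integral_distr) (use hm in auto)
  also have "\<dots> = (\<integral>v. ?h (ptv v) \<partial>(lborel \<Otimes>\<^sub>M lborel))" by (simp add: lborel_prod)
  also have "\<dots> = (LINT t|lborel. LINT s|lborel. ?h (ptv (s, t)))"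
  proof -
    have "integrable (lborel \<Otimes>\<^sub>M lborel) (\<lambda>v. ?h (ptv v))"
      unfolding lborel_prod
      using i integrable_distr_eq[of ptv lborel borel ?h] hm by (simp add: lborel_distr_ptv)
    then have "integrable (lborel \<Otimes>\<^sub>M lborel) (\<lambda>(s, t). ?h (ptv (s, t)))" by (simp add: case_prod_unfold)
    from lborel_pair.integral_snd[OF this] show ?thesis by (simp add: case_prod_unfold)
  qed
  also have "\<dots> = (LINT t|lborel. indicator {0..1} t *\<^sub>R (LINT s|lborel. indicator {0..1 - t} s *\<^sub>R \<psi> (ptv (s, t))))"
  proof (rule Bochner_Integration.integral_cong[OF refl])
    fix t :: real
    have "indicator ref_tri (ptv (s, t)) = (indicator {0..1} t * indicator {0..1 - t} s :: real)" for s
      by (auto simp: ref_tri_def indicator_def)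
    then show "(LINT s|lborel. ?h (ptv (s, t)))
        = indicator {0..1} t *\<^sub>R (LINT s|lborel. indicator {0..1 - t} s *\<^sub>R \<psi> (ptv (s, t)))"
      by (simp add: mult.assoc)
  qed
  finally show ?thesis .
qed

definition tri_map :: "R2 \<Rightarrow> R2 \<Rightarrow> R2 \<Rightarrow> R2 \<Rightarrow> R2" where
  "tri_map z a b v = z + v $ 1 *\<^sub>R (a - z) + v $ 2 *\<^sub>R (b - z)"

abbreviation tri :: "R2 \<Rightarrow> R2 \<Rightarrow> R2 \<Rightarrow> R2 set" where "tri z a b \<equiv> convex hull {z, a, b}"

lemma tri_image: "tri z a b = tri_map z a b ` ref_tri"
proof -
  have "tri z a b = {z + u *\<^sub>R (a - z) + v *\<^sub>R (b - z) | u v. 0 \<le> u \<and> 0 \<le> v \<and> u + v \<le> 1}"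
    by (rule convex_hull_3_alt)
  also have "\<dots> = tri_map z a b ` ref_tri"
  proof (intro equalityI subsetI)
    fix x assume "x \<in> {z + u *\<^sub>R (a - z) + v *\<^sub>R (b - z) | u v. 0 \<le> u \<and> 0 \<le> v \<and> u + v \<le> 1}"
    then obtain u v where "x = tri_map z a b (ptv (u, v))" "ptv (u, v) \<in> ref_tri"
      by (auto simp: tri_map_def ref_tri_def)
    then show "x \<in> tri_map z a b ` ref_tri" by blast
  qed (auto simp: tri_map_def ref_tri_def)
  finally show ?thesis .
qed

lemma compact_tri [simp]: "compact (tri z a b)"
  by (simp add: compact_convex_hull finite_imp_compact)
lemma closed_tri [simp]: "closed (tri z a b)" by (simp add: compact_imp_closed)
lemma lmeasurable_tri [simp]: "tri z a b \<in> lmeasurable" by (simp add: lmeasurable_compact)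
lemma sets_tri [simp]: "tri z a b \<in> sets lebesgue" using lmeasurable_tri by (rule fmeasurableD)

lemma cross2_independent:
  assumes "cross2 p q \<noteq> 0" "s *\<^sub>R p + t *\<^sub>R q = 0"
  shows "s = 0" "t = 0"
proof -
  have "s * p $ 1 + t * q $ 1 = 0" "s * p $ 2 + t * q $ 2 = 0"
    using assms(2) by (auto simp: vec_eq_iff forall_2)
  then have "s * cross2 p q = 0" "t * cross2 p q = 0"
    unfolding cross2_def by algebra+
  then show "s = 0" "t = 0" using assms(1) by auto
qed

lemma inj_tri_map: "cross2 (a - z) (b - z) \<noteq> 0 \<Longrightarrow> inj (tri_map z a b)"
proof (rule injI)
  fix v w assume c: "cross2 (a - z) (b - z) \<noteq> 0" and e: "tri_map z a b v = tri_map z a b w"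
  have "(v $ 1 - w $ 1) *\<^sub>R (a - z) + (v $ 2 - w $ 2) *\<^sub>R (b - z) = 0"
    using e by (simp add: tri_map_def algebra_simps)
  from cross2_independent[OF c this] show "v = w" by (simp add: vec_eq_iff forall_2)
qed

lemma continuous_on_tri_map: "continuous_on UNIV (tri_map z a b)"
  unfolding tri_map_def by (intro continuous_intros)

text \<open>
  Twice the signed area is the determinant of the linear part of the affine map from the reference
  triangle.
\<close>

lemma tri_integral:
  fixes h :: "R2 \<Rightarrow> real"
  assumes c: "cross2 (a - z) (b - z) \<noteq> 0" and h: "continuous_on UNIV h"
  shows "(LINT x:tri z a b|lebesgue. h x)
    = \<bar>cross2 (a - z) (b - z)\<bar> * (LINT v:ref_tri|lebesgue. h (tri_map z a b v))"
proof -
  define A where "A = (\<lambda>v::R2. v $ 1 *\<^sub>R (a - z) + v $ 2 *\<^sub>R (b - z))"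
  \<comment> \<open>the change of variables formula is stated for functions between spaces of vectors\<close>
  define f where "f x = h x *\<^sub>R (axis 1 1 :: R2)" for x
  have det: "det (matrix A) = cross2 (a - z) (b - z)"
    by (simp add: det_2 matrix_def A_def cross2_def axis_def)
  have lin: "linear A" unfolding A_def
    by (intro linearI) (auto simp: algebra_simps scaleR_add_left)
  have der: "(tri_map z a b has_derivative A) (at x within ref_tri)" for x
  proof -
    have "(A has_derivative A) (at x within ref_tri)" by (rule linear_imp_has_derivative[OF lin])
    then have "((\<lambda>v. z + A v) has_derivative A) (at x within ref_tri)" by (auto intro!: derivative_eq_intros)
    moreover have "tri_map z a b = (\<lambda>v. z + A v)" by (simp add: tri_map_def A_def fun_eq_iff)
    ultimately show ?thesis by simp
  qed
  have fc: "continuous_on UNIV f" unfolding f_def by (intro continuous_intros h)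
  have fi: "set_integrable lebesgue (tri z a b) f"
    by (rule compact_set_integrable[OF compact_tri continuous_on_subset[OF fc]]) simp
  have gi: "set_integrable lebesgue ref_tri (\<lambda>v. f (tri_map z a b v))"
    by (rule compact_set_integrable[OF compact_ref_tri])
      (rule continuous_on_compose2[OF fc continuous_on_subset[OF continuous_on_tri_map]], auto)
  have "(\<lambda>x. \<bar>det (matrix A)\<bar> *\<^sub>R f (tri_map z a b x)) absolutely_integrable_on ref_tri \<and>
      integral ref_tri (\<lambda>x. \<bar>det (matrix A)\<bar> *\<^sub>R f (tri_map z a b x)) = integral (tri z a b) f"
    by (subst has_absolute_integral_change_of_variables[where g="tri_map z a b" and g'="\<lambda>_. A", OF _ der])
      (use fmeasurableD[OF lmeasurable_compact[OF compact_ref_tri]] inj_tri_map[OF c] fi in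
        \<open>auto simp: tri_image[symmetric] intro: inj_on_subset\<close>)
  then have "integral (tri z a b) f = \<bar>cross2 (a - z) (b - z)\<bar> *\<^sub>R integral ref_tri (\<lambda>x. f (tri_map z a b x))"
    by (simp add: det)
  then have e: "(LINT x:tri z a b|lebesgue. f x) = \<bar>cross2 (a - z) (b - z)\<bar> *\<^sub>R (LINT v:ref_tri|lebesgue. f (tri_map z a b v))"
    using set_lebesgue_integral_eq_integral(2)[OF fi] set_lebesgue_integral_eq_integral(2)[OF gi] by simp
  have comp: "(LINT x:S|lebesgue. k x *\<^sub>R (axis 1 1 :: R2)) = (LINT x:S|lebesgue. k x) *\<^sub>R axis 1 1"
    if "set_integrable lebesgue S k" for S and k :: "R2 \<Rightarrow> real"
    using that unfolding set_lebesgue_integral_def set_integrable_def scaleR_scaleR[symmetric] real_scaleR_def[symmetric]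
    by (subst integral_scaleR_left[symmetric]) (simp_all add: mult.commute)
  have hi: "set_integrable lebesgue (tri z a b) h"
    by (rule compact_set_integrable[OF compact_tri continuous_on_subset[OF h]]) simp
  have hgi: "set_integrable lebesgue ref_tri (\<lambda>v. h (tri_map z a b v))"
    by (rule compact_set_integrable[OF compact_ref_tri])
      (rule continuous_on_compose2[OF h continuous_on_subset[OF continuous_on_tri_map]], auto)
  have "(LINT x:tri z a b|lebesgue. h x) *\<^sub>R (axis 1 1 :: R2)
      = (\<bar>cross2 (a - z) (b - z)\<bar> * (LINT v:ref_tri|lebesgue. h (tri_map z a b v))) *\<^sub>R axis 1 1"
    using e unfolding f_def comp[OF hi] comp[OF hgi] by simp
  then show ?thesis by (simp add: axis_eq_0_iff)
qed

subsection \<open>Means over segments\<close>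

text \<open>
  Integrals over edges are normalised by the length of the edge: in this form Green's formula on
  a triangle needs neither lengths nor normal vectors.
\<close>

definition lin_mean :: "R2 \<Rightarrow> R2 \<Rightarrow> (R2 \<Rightarrow> real) \<Rightarrow> real" where
  "lin_mean a b g = (LINT t:{0..1}|lebesgue. g (linepath a b t))"

lemma linepath_reverse: "linepath a b (1 - t) = linepath b a t"
  by (simp add: linepath_def)

lemma reflect_interval:
  fixes f :: "real \<Rightarrow> real"
  shows "set_integrable lebesgue {0..1} (\<lambda>t. f (1 - t)) \<longleftrightarrow> set_integrable lebesgue {0..1} f"
    "(LINT t:{0..1}|lebesgue. f (1 - t)) = (LINT t:{0..1}|lebesgue. f t)"
proof -
  have im: "(\<lambda>t. 1 - t) ` {0..1} = {0..1::real}"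
    by (rule set_eqI, rule iffI, force, rule_tac x="1-x" in image_eqI, auto)
  have *: "(\<lambda>x. \<bar>-1\<bar> *\<^sub>R f (1 - x)) absolutely_integrable_on {0..1} \<and> integral {0..1} (\<lambda>x. \<bar>-1\<bar> *\<^sub>R f (1 - x)) = b
      \<longleftrightarrow> f absolutely_integrable_on (\<lambda>t. 1 - t) ` {0..1} \<and> integral ((\<lambda>t. 1 - t) ` {0..1}) f = b" for b
    by (rule has_absolute_integral_change_of_variables_real) (auto intro!: derivative_eq_intros simp: inj_on_def)
  show 1: "set_integrable lebesgue {0..1} (\<lambda>t. f (1 - t)) \<longleftrightarrow> set_integrable lebesgue {0..1} f"
    using * unfolding im by auto
  show "(LINT t:{0..1}|lebesgue. f (1 - t)) = (LINT t:{0..1}|lebesgue. f t)"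
  proof (cases "set_integrable lebesgue {0..1} f")
    case True
    then show ?thesis using * 1 unfolding im
      by (simp add: set_lebesgue_integral_eq_integral(2))
  next
    case False
    then show ?thesis using 1
      by (simp add: set_lebesgue_integral_def set_integrable_def not_integrable_integral_eq)
  qed
qed

lemma lin_mean_commute: "lin_mean a b g = lin_mean b a g"
  unfolding lin_mean_def using reflect_interval(2)[of "\<lambda>t. g (linepath b a t)"] by (simp add: linepath_reverse)

lemma lin_mean_cong: "(\<And>x. x \<in> closed_segment a b \<Longrightarrow> f x = g x) \<Longrightarrow> lin_mean a b f = lin_mean a b g"
  unfolding lin_mean_def
  by (rule set_lebesgue_integral_cong) (use linepath_in_path in auto)

lemma seg_ends_cases:
  assumes "S = closed_segment a b"
  shows "seg_ends S = (a, b) \<or> seg_ends S = (b, a)"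
proof -
  have "S = closed_segment (fst (seg_ends S)) (snd (seg_ends S))"
    unfolding seg_ends_def by (rule someI[of "\<lambda>p. S = closed_segment (fst p) (snd p)" "(a, b)"]) (simp add: assms)
  then have "closed_segment (fst (seg_ends S)) (snd (seg_ends S)) = closed_segment a b" using assms by simp
  then show ?thesis by (auto simp: closed_segment_eq doubleton_eq_iff prod_eq_iff)
qed

lemma seg_integral_lin_mean: "seg_integral (closed_segment a b) g = dist a b * lin_mean a b g"
  using seg_ends_cases[OF refl, of a b] lin_mean_commute[of a b g]
  unfolding seg_integral_def seg_param_def lin_mean_def by (auto simp: dist_commute)

lemma lin_mean_integrable:
  fixes g :: "R2 \<Rightarrow> real"
  assumes "continuous_on UNIV g"
  shows "set_integrable lebesgue {0..1} (\<lambda>t. g (linepath a b t))"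
  by (rule compact_set_integrable)
    (auto intro!: continuous_on_compose2[OF assms] continuous_on_subset[OF continuous_on_linepath])

subsection \<open>Green's formula\<close>

text \<open>
  In the coordinates of the reference triangle, integrating along lines parallel to \<open>a - z\<close> is an
  application of the fundamental theorem of calculus; the lines run from \<open>[z, b]\<close> to \<open>[a, b]\<close>.
\<close>

lemma green_tri:
  assumes c: "cross2 (a - z) (b - z) \<noteq> 0"
    and D: "\<And>x. GDERIV \<phi> x :> G x" and G: "continuous_on UNIV G"
  shows "(LINT x:tri z a b|lebesgue. G x \<bullet> (a - z))
    = \<bar>cross2 (a - z) (b - z)\<bar> * (lin_mean a b \<phi> - lin_mean z b \<phi>)"
proof -
  have "isCont \<phi> x" for x using D[of x] unfolding gderiv_def by (rule has_derivative_continuous)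
  then have \<phi>c: "continuous_on UNIV \<phi>" by (simp add: continuous_on_eq_continuous_at)
  let ?\<psi> = "\<lambda>v. G (tri_map z a b v) \<bullet> (a - z)"
  have Gc: "continuous_on UNIV (\<lambda>x. G x \<bullet> (a - z))" by (intro continuous_intros G)
  have \<psi>c: "continuous_on UNIV ?\<psi>"
    by (rule continuous_on_compose2[OF Gc continuous_on_tri_map]) auto
  have inner_int: "(LINT s|lborel. indicator {0..1 - t} s *\<^sub>R ?\<psi> (ptv (s, t)))
      = \<phi> (linepath a b t) - \<phi> (linepath z b t)" if t: "t \<in> {0..1}" for t
  proof -
    let ?F = "\<lambda>s. \<phi> (z + s *\<^sub>R (a - z) + t *\<^sub>R (b - z))"
    have der: "(?F has_vector_derivative ?\<psi> (ptv (s, t))) (at s within {0..1-t})" for s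
    proof -
      have "((\<lambda>s. z + s *\<^sub>R (a - z) + t *\<^sub>R (b - z)) has_derivative (\<lambda>h. h *\<^sub>R (a - z))) (at s)"
        by (auto intro!: derivative_eq_intros)
      moreover have "(\<phi> has_derivative (\<lambda>h. h \<bullet> G (z + s *\<^sub>R (a - z) + t *\<^sub>R (b - z)))) (at (z + s *\<^sub>R (a - z) + t *\<^sub>R (b - z)))"
        using D by (simp add: gderiv_def)
      ultimately have "(?F has_derivative (\<lambda>h. (h *\<^sub>R (a - z)) \<bullet> G (z + s *\<^sub>R (a - z) + t *\<^sub>R (b - z)))) (at s)"
        by (rule has_derivative_compose)
      then have "(?F has_vector_derivative ?\<psi> (ptv (s, t))) (at s)"
        by (simp add: has_vector_derivative_def tri_map_def inner_commute)
      then show ?thesis by (rule has_vector_derivative_at_within)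
    qed
    have cont: "continuous_on {0..1-t} (\<lambda>s. ?\<psi> (ptv (s, t)))"
      by (rule continuous_on_compose2[OF \<psi>c continuous_on_compose2[OF continuous_on_ptv]])
        (auto intro!: continuous_intros)
    have "(LINT s|lborel. indicator {0..1 - t} s *\<^sub>R ?\<psi> (ptv (s, t))) = ?F (1 - t) - ?F 0"
      by (rule integral_FTC_atLeastAtMost) (use t der cont in auto)
    moreover have "z + (1 - t) *\<^sub>R (a - z) + t *\<^sub>R (b - z) = linepath a b t"
      "z + 0 *\<^sub>R (a - z) + t *\<^sub>R (b - z) = linepath z b t"
      by (auto simp: linepath_def algebra_simps)
    ultimately show ?thesis by simp
  qed
  have leb: "(LINT t|lborel. indicator {0..1} t *\<^sub>R k t) = (LINT t:{0..1}|lebesgue. k t)"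
    if "continuous_on {0..1} k" for k :: "real \<Rightarrow> real"
    unfolding set_lebesgue_integral_def
    by (subst integral_completion) (use borel_integrable_compact[OF compact_Icc that] in \<open>auto simp: borel_measurable_integrable\<close>)
  have cl: "continuous_on {0..1} (\<lambda>t. \<phi> (linepath p q t))" for p q
    by (rule continuous_on_compose2[OF \<phi>c]) (auto intro: continuous_on_linepath)
  have "(LINT x:tri z a b|lebesgue. G x \<bullet> (a - z))
      = \<bar>cross2 (a - z) (b - z)\<bar> * (LINT v:ref_tri|lebesgue. ?\<psi> v)"
    by (rule tri_integral[OF c Gc])
  also have "(LINT v:ref_tri|lebesgue. ?\<psi> v)
      = (LINT t|lborel. indicator {0..1} t *\<^sub>R (LINT s|lborel. indicator {0..1 - t} s *\<^sub>R ?\<psi> (ptv (s, t))))"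
    by (rule ref_tri_integral[OF \<psi>c])
  also have "\<dots> = (LINT t|lborel. indicator {0..1} t *\<^sub>R (\<phi> (linepath a b t) - \<phi> (linepath z b t)))"
    by (rule Bochner_Integration.integral_cong[OF refl]) (use inner_int in \<open>auto simp: indicator_def\<close>)
  also have "\<dots> = (LINT t:{0..1}|lebesgue. \<phi> (linepath a b t) - \<phi> (linepath z b t))"
    by (rule leb) (intro continuous_intros cl)
  also have "\<dots> = lin_mean a b \<phi> - lin_mean z b \<phi>"
    unfolding lin_mean_def by (rule set_integral_diff(2)) (intro lin_mean_integrable[OF \<phi>c])+
  finally show ?thesis .
qed

lemma negligible_frontier_tri: "negligible (frontier (tri z a b))"
  by (rule negligible_convex_frontier) (rule convex_convex_hull)

lemma AE_interior_tri: "AE x in lebesgue. x \<in> interior (tri z a b) \<longleftrightarrow> x \<in> tri z a b"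
  using AE_not_in_negligible[OF negligible_frontier_tri[of z a b]]
  by eventually_elim (use interior_subset in \<open>auto simp: frontier_def closure_closed\<close>)

lemma measure_tri:
  assumes c: "cross2 (a - z) (b - z) \<noteq> 0"
  shows "measure lebesgue (tri z a b) = \<bar>cross2 (a - z) (b - z)\<bar> / 2"
proof -
  have k: "(LINT t|lborel. indicator {0..1} t *\<^sub>R (LINT s|lborel. indicator {0..1 - t} (s::real) *\<^sub>R (1::real))) = (1/2::real)"
  proof -
    have "(LINT t|lborel. indicator {0..1} t *\<^sub>R (LINT s|lborel. indicator {0..1 - t} (s::real) *\<^sub>R (1::real)))
       = (LINT t|lborel. indicator {0..1} t *\<^sub>R (1 - t))"
    proof (rule Bochner_Integration.integral_cong[OF refl])
      fix t :: real
      show "indicator {0..1} t *\<^sub>R (LINT s|lborel. indicator {0..1 - t} (s::real) *\<^sub>R (1::real)) = indicator {0..1} t *\<^sub>R (1 - t)"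
        by (cases "t \<in> {0..1}") auto
    qed
    also have "\<dots> = (1 - 1\<^sup>2 / 2) - (0 - 0\<^sup>2 / 2)"
      by (rule integral_FTC_atLeastAtMost)
        (auto intro!: derivative_eq_intros continuous_intros simp: has_real_derivative_iff_has_vector_derivative[symmetric])
    finally show ?thesis by simp
  qed
  have "measure lebesgue (tri z a b) = (LINT x:tri z a b|lebesgue. 1)"
    using lmeasurable_tri[of z a b] by (simp add: set_lebesgue_integral_def fmeasurableD)
  also have "\<dots> = \<bar>cross2 (a - z) (b - z)\<bar> * (LINT v:ref_tri|lebesgue. 1)"
    by (rule tri_integral[OF c]) auto
  also have "(LINT v:ref_tri|lebesgue. 1) = (1/2::real)"
    using ref_tri_integral[of "\<lambda>_. 1"] k by simp
  finally show ?thesis by simp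
qed

text \<open>
  Green's formula is applied to \<open>\<phi>\<^sup>2\<close> times the barycentric coordinate of \<open>a\<close>, in direction
  \<open>a - z\<close>: the term on \<open>[z, b]\<close> vanishes because the coordinate does.  The same holds with \<open>b\<close> in
  place of \<open>a\<close>, and on \<open>[a, b]\<close> the two coordinates add up to \<open>1\<close>.
\<close>

lemma trace_inequality:
  assumes c: "cross2 (a - z) (b - z) \<noteq> 0"
  shows "\<exists>C. \<forall>\<phi>. smooth \<phi> \<longrightarrow> lin_mean a b (\<lambda>x. (\<phi> x)\<^sup>2)
    \<le> C * ((L2_norm (tri z a b) \<phi>)\<^sup>2 + (L2_norm (tri z a b) (grad \<phi>))\<^sup>2)"
proof -
  let ?T = "tri z a b"
  define d where "d = cross2 (a - z) (b - z)"
  have d: "d \<noteq> 0" using c d_def by simp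
  \<comment> \<open>the barycentric coordinates of \<open>a\<close> and \<open>b\<close>\<close>
  define la where "la = (\<lambda>x. (perp (b - z) /\<^sub>R d) \<bullet> x + - (((perp (b - z) /\<^sub>R d) \<bullet> z)))"
  define lb where "lb = (\<lambda>x. (- perp (a - z) /\<^sub>R d) \<bullet> x + (((perp (a - z) /\<^sub>R d) \<bullet> z)))"
  have la_eq: "la x = cross2 (x - z) (b - z) / d" and lb_eq: "lb x = cross2 (a - z) (x - z) / d" for x
    using d by (auto simp: la_def lb_def inner_perp cross2_def field_simps)
  have sla: "smooth la" "smooth lb" unfolding la_def lb_def by (rule smooth_affine)+
  have ga: "grad la x = perp (b - z) /\<^sub>R d" "grad lb x = - perp (a - z) /\<^sub>R d" for x
    unfolding la_def lb_def by (rule grad_affine)+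
  have la_ab: "la (linepath a b t) = 1 - t" and lb_ab: "lb (linepath a b t) = t" for t
    using d unfolding la_eq lb_eq by (auto simp: linepath_def d_def cross2_def field_simps)
  have la_zb: "la (linepath z b t) = 0" and lb_za: "lb (linepath z a t) = 0" for t
    unfolding la_eq lb_eq by (auto simp: linepath_def cross2_def algebra_simps)
  obtain L where L: "\<And>x. x \<in> ?T \<Longrightarrow> \<bar>la x\<bar> \<le> L \<and> \<bar>lb x\<bar> \<le> L"
  proof -
    have "bounded (la ` ?T)" "bounded (lb ` ?T)"
      using smooth_GDERIV(2)[OF sla(1)] smooth_GDERIV(2)[OF sla(2)]
      by (auto intro!: compact_imp_bounded compact_continuous_image intro: continuous_on_subset)
    then obtain L1 L2 where "\<forall>x\<in>?T. \<bar>la x\<bar> \<le> L1" "\<forall>x\<in>?T. \<bar>lb x\<bar> \<le> L2" by (auto simp: bounded_iff)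
    then show ?thesis by (intro that[of "max L1 L2"]) (auto simp: le_max_iff_disj)
  qed
  have L0: "0 \<le> L" using L[of z] hull_inc[of z "{z,a,b}" convex] by force
  define M where "M = (norm (a - z) + norm (b - z)) / \<bar>d\<bar>"
  define E where "E = norm (a - z) + norm (b - z)"
  define C where "C = 2 * E * (L + M) / \<bar>d\<bar>"
  have M0: "0 \<le> M" and E0: "0 \<le> E" by (auto simp: M_def E_def)
  show ?thesis
  proof (intro exI[of _ C] allI impI)
    fix \<phi> assume s: "smooth \<phi>"
    have s2: "smooth (\<lambda>x. \<phi> x * \<phi> x)" using s by auto
    have g2: "grad (\<lambda>x. \<phi> x * \<phi> x) x = (2 * \<phi> x) *\<^sub>R grad \<phi> x" for x
      by (simp add: grad_mult[OF s s] scaleR_left_distrib[symmetric])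
    have cont: "continuous_on S \<phi>" "continuous_on S (grad \<phi>)" for S
      using smooth_GDERIV[OF s] continuous_on_subset by blast+
    have gen: "(LINT x:?T|lebesgue. grad (\<lambda>x. \<phi> x * \<phi> x * l x) x \<bullet> e)
        \<le> E * (L + M) * ((L2_norm ?T \<phi>)\<^sup>2 + (L2_norm ?T (grad \<phi>))\<^sup>2)"
      if l: "smooth l" "\<And>x. x \<in> ?T \<Longrightarrow> \<bar>l x\<bar> \<le> L" "\<And>x. norm (grad l x) \<le> M" and e: "norm e \<le> E" for l e
    proof -
      have eq: "grad (\<lambda>x. \<phi> x * \<phi> x * l x) x = (\<phi> x * \<phi> x) *\<^sub>R grad l x + (2 * \<phi> x * l x) *\<^sub>R grad \<phi> x" for x
        using grad_mult[OF s2 l(1)] by (simp add: g2 mult.commute mult.assoc)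
      have bnd: "grad (\<lambda>x. \<phi> x * \<phi> x * l x) x \<bullet> e \<le> E * (L + M) * ((norm (\<phi> x))\<^sup>2 + (norm (grad \<phi> x))\<^sup>2)"
        if x: "x \<in> ?T" for x
      proof -
        have "grad (\<lambda>x. \<phi> x * \<phi> x * l x) x \<bullet> e \<le> norm (grad (\<lambda>x. \<phi> x * \<phi> x * l x) x) * norm e"
          by (rule norm_cauchy_schwarz)
        also have "\<dots> \<le> norm (grad (\<lambda>x. \<phi> x * \<phi> x * l x) x) * E" using e by (intro mult_left_mono) auto
        also have "norm (grad (\<lambda>x. \<phi> x * \<phi> x * l x) x) \<le> (\<phi> x)\<^sup>2 * M + (2 * \<bar>\<phi> x\<bar> * norm (grad \<phi> x)) * L"
        proof -
          have "norm ((\<phi> x * \<phi> x) *\<^sub>R grad l x) \<le> (\<phi> x)\<^sup>2 * M"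
            using l(3) by (auto simp: power2_eq_square intro!: mult_left_mono)
          moreover have "norm ((2 * \<phi> x * l x) *\<^sub>R grad \<phi> x) \<le> (2 * \<bar>\<phi> x\<bar> * norm (grad \<phi> x)) * L"
          proof -
            have "norm ((2 * \<phi> x * l x) *\<^sub>R grad \<phi> x) = (2 * \<bar>\<phi> x\<bar> * norm (grad \<phi> x)) * \<bar>l x\<bar>"
              by (simp add: abs_mult)
            also have "\<dots> \<le> (2 * \<bar>\<phi> x\<bar> * norm (grad \<phi> x)) * L" using l(2)[OF x] by (intro mult_left_mono) auto
            finally show ?thesis .
          qed
          ultimately show ?thesis unfolding eq by (rule order_trans[OF norm_triangle_ineq add_mono])
        qed
        also have "(2 * \<bar>\<phi> x\<bar> * norm (grad \<phi> x)) * L \<le> ((\<phi> x)\<^sup>2 + (norm (grad \<phi> x))\<^sup>2) * L"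
          using sum_squares_bound[of "\<bar>\<phi> x\<bar>" "norm (grad \<phi> x)"] L0 by (intro mult_right_mono) auto
        also have "((\<phi> x)\<^sup>2 * M + ((\<phi> x)\<^sup>2 + (norm (grad \<phi> x))\<^sup>2) * L) * E
            \<le> E * (L + M) * ((norm (\<phi> x))\<^sup>2 + (norm (grad \<phi> x))\<^sup>2)"
        proof -
          have "0 \<le> (norm (grad \<phi> x))\<^sup>2 * M * E" using M0 E0 by simp
          then show ?thesis by (simp add: algebra_simps)
        qed
        finally show ?thesis using E0 by (simp add: mult_right_mono)
      qed
      have sl: "smooth (\<lambda>x. \<phi> x * \<phi> x * l x)" using s2 l(1) by auto
      have i1: "set_integrable lebesgue ?T (\<lambda>x. grad (\<lambda>x. \<phi> x * \<phi> x * l x) x \<bullet> e)"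
        by (intro compact_set_integrable compact_tri continuous_intros
            continuous_on_subset[OF smooth_GDERIV(3)[OF sl]]) simp
      have i2: "set_integrable lebesgue ?T (\<lambda>x. (norm (\<phi> x))\<^sup>2)" "set_integrable lebesgue ?T (\<lambda>x. (norm (grad \<phi> x))\<^sup>2)"
        by (intro compact_set_integrable compact_tri continuous_intros cont)+
      have "(LINT x:?T|lebesgue. grad (\<lambda>x. \<phi> x * \<phi> x * l x) x \<bullet> e)
          \<le> (LINT x:?T|lebesgue. E * (L + M) * ((norm (\<phi> x))\<^sup>2 + (norm (grad \<phi> x))\<^sup>2))"
        by (rule set_integral_mono) (use i1 i2 bnd in auto)
      also have "\<dots> = E * (L + M) * ((L2_norm ?T \<phi>)\<^sup>2 + (L2_norm ?T (grad \<phi>))\<^sup>2)"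
        unfolding L2_norm_power2 using set_integral_add(2)[OF i2] by simp
      finally show ?thesis .
    qed
    have n: "norm (grad la x) \<le> M" "norm (grad lb x) \<le> M" for x
      by (auto simp: ga M_def divide_inverse mult.commute intro!: mult_left_mono)
    have smf: "smooth (\<lambda>x. \<phi> x * \<phi> x * la x)" "smooth (\<lambda>x. \<phi> x * \<phi> x * lb x)" using s2 sla by auto
    have A: "(LINT x:?T|lebesgue. grad (\<lambda>x. \<phi> x * \<phi> x * la x) x \<bullet> (a - z))
        = \<bar>d\<bar> * lin_mean a b (\<lambda>x. \<phi> x * \<phi> x * la x)"
    proof -
      have "lin_mean z b (\<lambda>x. \<phi> x * \<phi> x * la x) = 0" unfolding lin_mean_def by (simp add: la_zb)
      then show ?thesis
        using green_tri[OF c smooth_GDERIV(1)[OF smf(1)] smooth_GDERIV(3)[OF smf(1)]] by (simp add: d_def)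
    qed
    have c': "cross2 (b - z) (a - z) \<noteq> 0" using c by (simp add: cross2_def algebra_simps)
    have B: "(LINT x:?T|lebesgue. grad (\<lambda>x. \<phi> x * \<phi> x * lb x) x \<bullet> (b - z))
        = \<bar>d\<bar> * lin_mean a b (\<lambda>x. \<phi> x * \<phi> x * lb x)"
    proof -
      have "lin_mean z a (\<lambda>x. \<phi> x * \<phi> x * lb x) = 0" unfolding lin_mean_def by (simp add: lb_za)
      moreover have "\<bar>cross2 (b - z) (a - z)\<bar> = \<bar>d\<bar>" by (simp add: d_def cross2_def algebra_simps)
      moreover have "tri z b a = ?T" by (simp add: insert_commute)
      ultimately show ?thesis
        using green_tri[OF c' smooth_GDERIV(1)[OF smf(2)] smooth_GDERIV(3)[OF smf(2)]]
        by (simp add: lin_mean_commute[of b a])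
    qed
    have "lin_mean a b (\<lambda>x. (\<phi> x)\<^sup>2) = lin_mean a b (\<lambda>x. \<phi> x * \<phi> x * la x) + lin_mean a b (\<lambda>x. \<phi> x * \<phi> x * lb x)"
    proof -
      have "set_integrable lebesgue {0..1} (\<lambda>t. \<phi> (linepath a b t) * \<phi> (linepath a b t) * la (linepath a b t))"
        "set_integrable lebesgue {0..1} (\<lambda>t. \<phi> (linepath a b t) * \<phi> (linepath a b t) * lb (linepath a b t))"
        using lin_mean_integrable[OF smooth_GDERIV(2)[OF smf(1)]] lin_mean_integrable[OF smooth_GDERIV(2)[OF smf(2)]] by auto
      from set_integral_add(2)[OF this] show ?thesis
        unfolding lin_mean_def by (simp add: la_ab lb_ab power2_eq_square algebra_simps)
    qed
    then have "\<bar>d\<bar> * lin_mean a b (\<lambda>x. (\<phi> x)\<^sup>2)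
       = (LINT x:?T|lebesgue. grad (\<lambda>x. \<phi> x * \<phi> x * la x) x \<bullet> (a - z)) + (LINT x:?T|lebesgue. grad (\<lambda>x. \<phi> x * \<phi> x * lb x) x \<bullet> (b - z))"
      using A B by (simp add: algebra_simps)
    also have "\<dots> \<le> E * (L + M) * ((L2_norm ?T \<phi>)\<^sup>2 + (L2_norm ?T (grad \<phi>))\<^sup>2)
        + E * (L + M) * ((L2_norm ?T \<phi>)\<^sup>2 + (L2_norm ?T (grad \<phi>))\<^sup>2)"
      by (intro add_mono gen sla n) (use L in \<open>auto simp: E_def\<close>)
    finally have "\<bar>d\<bar> * lin_mean a b (\<lambda>x. (\<phi> x)\<^sup>2) \<le> \<bar>d\<bar> * (C * ((L2_norm ?T \<phi>)\<^sup>2 + (L2_norm ?T (grad \<phi>))\<^sup>2))"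
      using d by (simp add: C_def)
    then show "lin_mean a b (\<lambda>x. (\<phi> x)\<^sup>2) \<le> C * ((L2_norm ?T \<phi>)\<^sup>2 + (L2_norm ?T (grad \<phi>))\<^sup>2)"
      by (rule mult_left_le_imp_le) (use d in simp)
  qed
qed

section \<open>Traces\<close>

lemma smooth_L2:
  assumes "smooth \<phi>" "bounded U" "U \<in> sets lebesgue"
  shows "\<phi> \<in> L2 U" "grad \<phi> \<in> L2 U"
proof -
  have K: "compact (closure U)" using assms(2) by (simp add: compact_closure)
  have "set_integrable lebesgue (closure U) \<phi>" "set_integrable lebesgue (closure U) (\<lambda>x. (norm (\<phi> x))\<^sup>2)"
    "set_integrable lebesgue (closure U) (grad \<phi>)" "set_integrable lebesgue (closure U) (\<lambda>x. (norm (grad \<phi> x))\<^sup>2)"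
    by (intro compact_set_integrable[OF K] continuous_intros continuous_on_subset[OF smooth_GDERIV(2)[OF assms(1)]]
        continuous_on_subset[OF smooth_GDERIV(3)[OF assms(1)]]; simp)+
  then have "\<phi> \<in> L2 (closure U)" "grad \<phi> \<in> L2 (closure U)"
    by (auto simp: L2_def set_borel_measurable_def set_integrable_def borel_measurable_integrable)
  then show "\<phi> \<in> L2 U" "grad \<phi> \<in> L2 U" using assms(3) closure_subset by (blast intro: L2_subset)+
qed

lemma H1_norm_nonneg [simp]: "0 \<le> H1_norm U v" by (simp add: H1_norm_def)

text \<open>
  The weak gradient in \<open>H1_norm\<close> is an arbitrary choice; uniqueness allows to replace it by the
  weak gradient at hand.
\<close>

lemma H1_norm_diff_power2:
  assumes "open U" "smooth \<phi>" "has_weak_grad U v g"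
  shows "(H1_norm U (\<lambda>x. \<phi> x - v x))\<^sup>2
    = (L2_norm U (\<lambda>x. \<phi> x - v x))\<^sup>2 + (L2_norm U (\<lambda>x. grad \<phi> x - g x))\<^sup>2"
proof -
  have "AE x in lebesgue. x \<in> U \<longrightarrow> weak_grad U (\<lambda>x. \<phi> x - v x) x = grad \<phi> x - g x"
    by (rule weak_grad_AE_eq(1)[OF assms(1) has_weak_grad_diff[OF smooth_has_weak_grad[OF assms(2)] assms(3)]])
  from L2_norm_cong_AE[OF this] show ?thesis by (simp add: H1_norm_def)
qed

lemma H1_norm_diff_bounds:
  assumes "open U" "smooth \<phi>" "has_weak_grad U v g"
  shows "L2_norm U (\<lambda>x. \<phi> x - v x) \<le> H1_norm U (\<lambda>x. \<phi> x - v x)"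
    "L2_norm U (\<lambda>x. grad \<phi> x - g x) \<le> H1_norm U (\<lambda>x. \<phi> x - v x)"
  by (rule power2_le_imp_le; simp add: H1_norm_diff_power2[OF assms])+

text \<open>
  The mean for a segment given as a set, hence with the arbitrarily oriented parametrisation used
  in \<open>seg_L2\<close>; by \<open>seg_mean_eq\<close> the orientation does not matter.
\<close>

definition seg_mean :: "R2 set \<Rightarrow> (R2 \<Rightarrow> real) \<Rightarrow> real" where
  "seg_mean S g = (LINT t:{0..1}|lebesgue. g (seg_param S t))"

lemma seg_mean_eq: "seg_mean (closed_segment a b) g = lin_mean a b g"
  using seg_ends_cases[OF refl, of a b] lin_mean_commute[of a b g]
  unfolding seg_mean_def seg_param_def lin_mean_def by (auto simp: dist_commute)

lemma seg_integral_eq: "seg_integral (closed_segment a b) g = dist a b * seg_mean (closed_segment a b) g"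
  by (simp add: seg_integral_lin_mean seg_mean_eq)

lemma continuous_on_seg_param: "continuous_on A (seg_param S)"
  unfolding seg_param_def by (rule continuous_on_linepath)

lemma inj_linepath: "p \<noteq> q \<Longrightarrow> inj (linepath p q)"
proof (rule injI)
  fix s t assume "p \<noteq> q" "linepath p q s = linepath p q t"
  then have "(s - t) *\<^sub>R (q - p) = 0" by (simp add: linepath_def algebra_simps)
  then show "s = t" using \<open>p \<noteq> q\<close> by simp
qed

lemma inj_seg_param: "a \<noteq> b \<Longrightarrow> inj (seg_param (closed_segment a b))"
  using seg_ends_cases[OF refl, of a b] inj_linepath[of a b] inj_linepath[of b a]
  unfolding seg_param_def by auto

lemma smooth_seg_L2: "smooth \<phi> \<Longrightarrow> \<phi> \<in> seg_L2 S"
proof -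
  assume s: "smooth \<phi>"
  have c: "continuous_on {0..1} (\<lambda>t. \<phi> (seg_param S t))"
    by (rule continuous_on_compose2[OF smooth_GDERIV(2)[OF s] continuous_on_seg_param]) simp
  then have "set_integrable lebesgue {0..1} (\<lambda>t. \<phi> (seg_param S t))"
    "set_integrable lebesgue {0..1} (\<lambda>t. (\<phi> (seg_param S t))\<^sup>2)"
    by (auto intro!: compact_set_integrable continuous_intros)
  then show ?thesis
    by (auto simp: seg_L2_def set_borel_measurable_def set_integrable_def borel_measurable_integrable)
qed

lemma seg_L2_mult_integrable:
  assumes "f \<in> seg_L2 S" "g \<in> seg_L2 S"
  shows "set_integrable lebesgue {0..1} (\<lambda>t. f (seg_param S t) * g (seg_param S t))"
proof (rule set_integrable_bound)
  show "set_integrable lebesgue {0..1} (\<lambda>t. (f (seg_param S t))\<^sup>2 + (g (seg_param S t))\<^sup>2)"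
    using assms by (auto simp: seg_L2_def)
  have "(\<lambda>t. (indicator {0..1} t *\<^sub>R f (seg_param S t)) * (indicator {0..1} t *\<^sub>R g (seg_param S t))) \<in> borel_measurable lebesgue"
    using assms unfolding seg_L2_def set_borel_measurable_def by (intro borel_measurable_times) auto
  moreover have "(\<lambda>t. (indicator {0..1} t *\<^sub>R f (seg_param S t)) * (indicator {0..1} t *\<^sub>R g (seg_param S t)))
      = (\<lambda>t. indicator {0..1} t *\<^sub>R (f (seg_param S t) * g (seg_param S t)))"
    by (auto simp: indicator_def fun_eq_iff)
  ultimately show "set_borel_measurable lebesgue {0..1} (\<lambda>t. f (seg_param S t) * g (seg_param S t))"
    by (simp add: set_borel_measurable_def)
  have "\<bar>x * y\<bar> \<le> \<bar>x\<^sup>2 + y\<^sup>2\<bar>" for x y :: real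
  proof -
    have "0 \<le> \<bar>x\<bar> * \<bar>y\<bar>" by simp
    moreover have "2 * \<bar>x\<bar> * \<bar>y\<bar> \<le> x\<^sup>2 + y\<^sup>2" using sum_squares_bound[of "\<bar>x\<bar>" "\<bar>y\<bar>"] by simp
    ultimately show ?thesis unfolding abs_mult using abs_ge_self[of "x\<^sup>2 + y\<^sup>2"] by linarith
  qed
  then show "AE x in lebesgue. x \<in> {0..1} \<longrightarrow> norm (f (seg_param S x) * g (seg_param S x))
      \<le> norm ((f (seg_param S x))\<^sup>2 + (g (seg_param S x))\<^sup>2)" by simp
qed

lemma seg_L2_integrable:
  assumes "f \<in> seg_L2 S"
  shows "set_integrable lebesgue {0..1} (\<lambda>t. f (seg_param S t))"
  using seg_L2_mult_integrable[OF assms smooth_seg_L2[OF smooth_const[of 1]]] by simp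

lemma seg_mean_diff:
  assumes "f \<in> seg_L2 S" "g \<in> seg_L2 S"
  shows "seg_mean S (\<lambda>x. f x - g x) = seg_mean S f - seg_mean S g"
  unfolding seg_mean_def using seg_L2_integrable[OF assms(1)] seg_L2_integrable[OF assms(2)]
  by (rule set_integral_diff(2))

lemma seg_mean_power2_triangle:
  assumes "f \<in> seg_L2 S" "g \<in> seg_L2 S" "h \<in> seg_L2 S"
  shows "seg_mean S (\<lambda>x. (f x - h x)\<^sup>2) \<le> 2 * seg_mean S (\<lambda>x. (f x - g x)\<^sup>2) + 2 * seg_mean S (\<lambda>x. (g x - h x)\<^sup>2)"
proof -
  have i: "set_integrable lebesgue {0..1} (\<lambda>t. (p (seg_param S t) - q (seg_param S t))\<^sup>2)"
    if "p \<in> seg_L2 S" "q \<in> seg_L2 S" for p q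
  proof -
    have "set_integrable lebesgue {0..1} (\<lambda>t. (p (seg_param S t))\<^sup>2 + (q (seg_param S t))\<^sup>2 - 2 * (p (seg_param S t) * q (seg_param S t)))"
      using that seg_L2_mult_integrable[OF that] by (auto simp: seg_L2_def)
    then show ?thesis by (simp add: power2_diff mult.assoc)
  qed
  have "seg_mean S (\<lambda>x. (f x - h x)\<^sup>2) \<le> (LINT t:{0..1}|lebesgue. 2 * (f (seg_param S t) - g (seg_param S t))\<^sup>2 + 2 * (g (seg_param S t) - h (seg_param S t))\<^sup>2)"
    unfolding seg_mean_def
  proof (rule set_integral_mono)
    fix t
    have "(x - z)\<^sup>2 \<le> 2 * (x - y)\<^sup>2 + 2 * (y - z)\<^sup>2" for x y z :: real
      using zero_le_power2[of "(x - y) - (y - z)"] by (simp add: power2_eq_square algebra_simps)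
    then show "(f (seg_param S t) - h (seg_param S t))\<^sup>2
        \<le> 2 * (f (seg_param S t) - g (seg_param S t))\<^sup>2 + 2 * (g (seg_param S t) - h (seg_param S t))\<^sup>2" .
  qed (use assms i in auto)
  also have "\<dots> = 2 * seg_mean S (\<lambda>x. (f x - g x)\<^sup>2) + 2 * seg_mean S (\<lambda>x. (g x - h x)\<^sup>2)"
    unfolding seg_mean_def using i assms by (simp add: set_integral_add)
  finally show ?thesis .
qed

lemma seg_mean_square_le:
  assumes "f \<in> seg_L2 S"
  shows "(seg_mean S f)\<^sup>2 \<le> seg_mean S (\<lambda>x. (f x)\<^sup>2)"
proof -
  let ?m = "seg_mean S f"
  have i: "set_integrable lebesgue {0..1} (\<lambda>t. (f (seg_param S t))\<^sup>2)" "set_integrable lebesgue {0..1} (\<lambda>t. f (seg_param S t))"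
    "set_integrable lebesgue {0..1::real} (\<lambda>t. ?m\<^sup>2)"
    using assms seg_L2_integrable[OF assms] by (auto simp: seg_L2_def intro: compact_set_integrable)
  have one: "(LINT t:{0..1::real}|lebesgue. ?m\<^sup>2) = ?m\<^sup>2"
    by (simp add: set_lebesgue_integral_def)
  have "0 \<le> (LINT t:{0..1}|lebesgue. (f (seg_param S t) - ?m)\<^sup>2)"
    unfolding set_lebesgue_integral_def by (rule integral_nonneg_AE) simp
  also have "\<dots> = (LINT t:{0..1}|lebesgue. ((f (seg_param S t))\<^sup>2 - (2 * ?m) * f (seg_param S t)) + ?m\<^sup>2)"
    by (simp add: power2_diff algebra_simps)
  also have "\<dots> = seg_mean S (\<lambda>x. (f x)\<^sup>2) - 2 * ?m * ?m + ?m\<^sup>2"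
    using i one by (subst set_integral_add(2)) (auto simp: set_integral_diff seg_mean_def)
  finally show ?thesis by (simp add: power2_eq_square)
qed

lemma seg_L2_diff: "f \<in> seg_L2 S \<Longrightarrow> g \<in> seg_L2 S \<Longrightarrow> (\<lambda>x. f x - g x) \<in> seg_L2 S"
proof -
  assume fg: "f \<in> seg_L2 S" "g \<in> seg_L2 S"
  have "set_integrable lebesgue {0..1} (\<lambda>t. (f (seg_param S t))\<^sup>2 + (g (seg_param S t))\<^sup>2 - 2 * (f (seg_param S t) * g (seg_param S t)))"
    using fg seg_L2_mult_integrable[OF fg] by (auto simp: seg_L2_def)
  then have "set_integrable lebesgue {0..1} (\<lambda>t. (f (seg_param S t) - g (seg_param S t))\<^sup>2)"
    by (simp add: power2_diff mult.assoc)
  moreover have "set_integrable lebesgue {0..1} (\<lambda>t. f (seg_param S t) - g (seg_param S t))"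
    using seg_L2_integrable[OF fg(1)] seg_L2_integrable[OF fg(2)] by (rule set_integral_diff(1))
  ultimately show ?thesis
    by (auto simp: seg_L2_def set_borel_measurable_def set_integrable_def borel_measurable_integrable)
qed

text \<open>
  A single approximating sequence on the triangle serves all three edges, whereas \<open>is_trace\<close> allows
  a different one for each edge.
\<close>

definition H1_approx :: "R2 set \<Rightarrow> (R2 \<Rightarrow> real) \<Rightarrow> (nat \<Rightarrow> R2 \<Rightarrow> real) \<Rightarrow> bool" where
  "H1_approx T v \<phi> \<longleftrightarrow> v \<in> H1 (interior T) \<and> (\<forall>n. smooth (\<phi> n)) \<and>
     (\<lambda>n. H1_norm (interior T) (\<lambda>x. \<phi> n x - v x)) \<longlonglongrightarrow> 0"

lemma is_trace_iff:
  "is_trace T S v g \<longleftrightarrow> g \<in> seg_L2 S \<and> (\<exists>\<phi>. H1_approx T v \<phi> \<and> (\<lambda>n. seg_integral S (\<lambda>x. (\<phi> n x - g x)\<^sup>2)) \<longlonglongrightarrow> 0)"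
  by (auto simp: is_trace_def H1_approx_def)

lemma AE_interior_tri': "AE x in lebesgue. x \<in> tri z a b \<longleftrightarrow> x \<in> interior (tri z a b)"
  using AE_interior_tri[of z a b] by auto

lemma interior_tri_facts: "bounded (interior (tri z a b))" "interior (tri z a b) \<in> sets lebesgue"
  using bounded_subset[OF compact_imp_bounded[OF compact_tri] interior_subset] by auto

text \<open>
  The trace inequality for \<open>\<phi> - \<psi>\<close>; inserting \<open>v\<close> shows that approximations of the same function
  are close to each other on the edge.
\<close>

lemma trace_diff_bound:
  assumes c: "cross2 (a - z) (b - z) \<noteq> 0"
  defines "U \<equiv> interior (tri z a b)"
  shows "\<exists>C\<ge>0. \<forall>\<phi> \<psi> v. smooth \<phi> \<longrightarrow> smooth \<psi> \<longrightarrow> v \<in> H1 U \<longrightarrow>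
    lin_mean a b (\<lambda>x. (\<phi> x - \<psi> x)\<^sup>2) \<le> C * (H1_norm U (\<lambda>x. \<phi> x - v x) + H1_norm U (\<lambda>x. \<psi> x - v x))\<^sup>2"
proof -
  obtain C where C: "\<And>\<phi>. smooth \<phi> \<Longrightarrow> lin_mean a b (\<lambda>x. (\<phi> x)\<^sup>2)
    \<le> C * ((L2_norm (tri z a b) \<phi>)\<^sup>2 + (L2_norm (tri z a b) (grad \<phi>))\<^sup>2)"
    using trace_inequality[OF c] by blast
  have U: "open U" "bounded U" "U \<in> sets lebesgue" unfolding U_def by (simp_all add: interior_tri_facts)
  note TU = L2_norm_cong_set_AE[OF AE_interior_tri', of z a b, folded U_def]
  show ?thesis
  proof (intro exI[of _ "2 * \<bar>C\<bar>"] conjI allI impI)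
    fix \<phi> \<psi> v assume s: "smooth \<phi>" "smooth \<psi>" and v: "v \<in> H1 U"
    note W = H1_weak_grad[OF U(1) v]
    define h where "h = H1_norm U (\<lambda>x. \<phi> x - v x) + H1_norm U (\<lambda>x. \<psi> x - v x)"
    have h0: "0 \<le> h" by (simp add: h_def)
    note b\<phi> = H1_norm_diff_bounds[OF U(1) s(1) W(2)] and b\<psi> = H1_norm_diff_bounds[OF U(1) s(2) W(2)]
    note L\<phi> = smooth_L2[OF s(1) U(2,3)] and L\<psi> = smooth_L2[OF s(2) U(2,3)]
    have "L2_norm U (\<lambda>x. (\<phi> x - v x) - (\<psi> x - v x)) \<le> L2_norm U (\<lambda>x. \<phi> x - v x) + L2_norm U (\<lambda>x. \<psi> x - v x)"
      by (intro L2_norm_triangle_diff L2_diff L\<phi> L\<psi> W)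
    then have 1: "L2_norm U (\<lambda>x. \<phi> x - \<psi> x) \<le> h" using b\<phi>(1) b\<psi>(1) by (simp add: h_def)
    have "L2_norm U (\<lambda>x. (grad \<phi> x - weak_grad U v x) - (grad \<psi> x - weak_grad U v x))
        \<le> L2_norm U (\<lambda>x. grad \<phi> x - weak_grad U v x) + L2_norm U (\<lambda>x. grad \<psi> x - weak_grad U v x)"
      by (intro L2_norm_triangle_diff L2_diff L\<phi> L\<psi> W)
    then have 2: "L2_norm U (\<lambda>x. grad \<phi> x - grad \<psi> x) \<le> h" using b\<phi>(2) b\<psi>(2) by (simp add: h_def)
    have gd: "grad (\<lambda>x. \<phi> x - \<psi> x) = (\<lambda>x. grad \<phi> x - grad \<psi> x)" using grad_diff[OF s] by (simp add: fun_eq_iff)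
    have "lin_mean a b (\<lambda>x. (\<phi> x - \<psi> x)\<^sup>2) \<le> C * ((L2_norm U (\<lambda>x. \<phi> x - \<psi> x))\<^sup>2 + (L2_norm U (\<lambda>x. grad \<phi> x - grad \<psi> x))\<^sup>2)"
      using C[OF smooth_diff[OF s]] unfolding gd TU .
    also have "\<dots> \<le> \<bar>C\<bar> * (h\<^sup>2 + h\<^sup>2)"
      using 1 2 by (intro mult_mono add_mono power_mono) auto
    finally show "lin_mean a b (\<lambda>x. (\<phi> x - \<psi> x)\<^sup>2) \<le> 2 * \<bar>C\<bar> * (H1_norm U (\<lambda>x. \<phi> x - v x) + H1_norm U (\<lambda>x. \<psi> x - v x))\<^sup>2"
      by (simp add: h_def)
  qed simp
qed

text \<open>
  The restrictions of \<open>\<phi> n\<close> to the edge are a Cauchy sequence by the trace inequality; their limit in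
  the parameter interval is carried to the edge by the injective parametrisation.
\<close>

lemma trace_exists:
  assumes c: "cross2 (a - z) (b - z) \<noteq> 0" and ap: "H1_approx (tri z a b) v \<phi>"
  shows "\<exists>g. is_trace (tri z a b) (closed_segment a b) v g"
proof -
  define S where "S = closed_segment a b"
  define U where "U = interior (tri z a b)"
  define h where "h n = H1_norm U (\<lambda>x. \<phi> n x - v x)" for n
  have v: "v \<in> H1 U" and s: "\<And>n. smooth (\<phi> n)" and h0: "h \<longlonglongrightarrow> 0"
    using ap by (auto simp: H1_approx_def U_def h_def[abs_def])
  obtain C where C0: "C \<ge> 0" and C1: "\<forall>\<phi> \<psi> v. smooth \<phi> \<longrightarrow> smooth \<psi> \<longrightarrow> v \<in> H1 U \<longrightarrow>
    lin_mean a b (\<lambda>x. (\<phi> x - \<psi> x)\<^sup>2) \<le> C * (H1_norm U (\<lambda>x. \<phi> x - v x) + H1_norm U (\<lambda>x. \<psi> x - v x))\<^sup>2"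
    using trace_diff_bound[OF c, folded U_def] by (elim exE conjE) (rule that)
  have "lin_mean a b (\<lambda>x. (\<phi> m x - \<phi> n x)\<^sup>2) \<le> C * (h m + h n)\<^sup>2" for m n
    unfolding h_def using C1[rule_format, OF s s v] .
  note C = C0 this
  have hn: "0 \<le> h n" for n by (simp add: h_def)
  let ?M = "lebesgue_on {0..1::real}"
  interpret M: finite_measure ?M by (rule finite_measure_lebesgue_on) auto
  let ?X = "\<lambda>n t. \<phi> n (seg_param S t)"
  have Xc: "continuous_on UNIV (?X n)" for n
    by (rule continuous_on_compose2[OF smooth_GDERIV(2)[OF s] continuous_on_seg_param]) simp
  have conv: "(\<integral>t. k t \<partial>?M) = (LINT t:{0..1}|lebesgue. k t)" for k :: "real \<Rightarrow> real"
    by (simp add: integral_restrict_space set_lebesgue_integral_def)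
  have convi: "integrable ?M k \<longleftrightarrow> set_integrable lebesgue {0..1} k" for k :: "real \<Rightarrow> real"
    by (simp add: integrable_restrict_space set_integrable_def)
  obtain G where G: "G \<in> borel_measurable ?M" "integrable ?M (\<lambda>x. (G x)\<^sup>2)"
    "(\<lambda>n. \<integral>x. (?X n x - G x)\<^sup>2 \<partial>?M) \<longlonglongrightarrow> 0"
  proof (rule M.L2_Cauchy_limit[of ?X])
    show "?X n \<in> borel_measurable ?M" for n
      using borel_measurable_continuous_onI[OF Xc[of n]]
      by (intro measurable_restrict_space1) (simp add: measurable_completion)
    show "integrable ?M (\<lambda>x. (?X n x)\<^sup>2)" for n
      unfolding convi by (intro compact_set_integrable continuous_intros continuous_on_subset[OF Xc]) auto
    fix e :: real assume e: "e > 0"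
    \<comment> \<open>chosen such that \<open>C * (d + d)\<^sup>2 < e\<close>\<close>
    define d where "d = sqrt (e / (4 * (C + 1)))"
    have d: "d > 0" "d\<^sup>2 = e / (4 * (C + 1))" using e C(1) by (auto simp: d_def)
    obtain N where N: "\<And>n. n \<ge> N \<Longrightarrow> h n < d"
      using LIMSEQ_D[OF h0 d(1)] hn by auto
    have "(\<integral>x. (?X m x - ?X n x)\<^sup>2 \<partial>?M) < e" if mn: "m \<ge> N" "n \<ge> N" for m n
    proof -
      have "(\<integral>x. (?X m x - ?X n x)\<^sup>2 \<partial>?M) = lin_mean a b (\<lambda>x. (\<phi> m x - \<phi> n x)\<^sup>2)"
        unfolding conv seg_mean_eq[symmetric] seg_mean_def S_def ..
      also have "\<dots> \<le> C * (h m + h n)\<^sup>2" by (rule C(2))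
      also have "\<dots> \<le> C * (d + d)\<^sup>2"
        using N[OF mn(1)] N[OF mn(2)] hn C(1) by (intro mult_left_mono power_mono add_mono) (auto simp: less_imp_le)
      also have "\<dots> = C * (e / (C + 1))" using d(2) C(1) by (simp add: power2_eq_square field_simps)
      also have "\<dots> < e" using e C(1) by (simp add: field_simps)
      finally show ?thesis .
    qed
    then show "\<exists>N. \<forall>m\<ge>N. \<forall>n\<ge>N. (\<integral>x. (?X m x - ?X n x)\<^sup>2 \<partial>?M) < e" by blast
  qed blast
  have "a \<noteq> b" using c by (auto simp: cross2_def)
  define g where "g x = G (inv (seg_param S) x)" for x
  have gG: "g (seg_param S t) = G t" for t
    using inj_seg_param[OF \<open>a \<noteq> b\<close>] by (simp add: g_def S_def)
  have "g \<in> seg_L2 S"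
    using G(1,2) unfolding convi
    by (auto simp: seg_L2_def gG set_borel_measurable_def borel_measurable_restrict_space_iff)
  moreover have "(\<lambda>n. seg_integral S (\<lambda>x. (\<phi> n x - g x)\<^sup>2)) \<longlonglongrightarrow> 0"
  proof -
    have "seg_integral S (\<lambda>x. (\<phi> n x - g x)\<^sup>2) = dist a b * (\<integral>x. (?X n x - G x)\<^sup>2 \<partial>?M)" for n
      unfolding S_def seg_integral_eq conv seg_mean_def gG[unfolded S_def] ..
    then show ?thesis using tendsto_mult_left[OF G(3), of "dist a b"] by simp
  qed
  ultimately have "is_trace (tri z a b) S v g" using ap unfolding is_trace_iff by blast
  then show ?thesis unfolding S_def by blast
qed

text \<open>
  The sequence that witnesses the trace and the given sequence \<open>\<phi>\<close> approximate the same \<open>v\<close>, so their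
  restrictions to the edge have the same limit.  In particular, means of traces do not depend on
  the choice made in \<open>trace_on\<close>.
\<close>

lemma trace_mean_limit:
  assumes c: "cross2 (a - z) (b - z) \<noteq> 0" and ap: "H1_approx (tri z a b) v \<phi>"
    and tr: "is_trace (tri z a b) (closed_segment a b) v g"
  shows "(\<lambda>n. lin_mean a b (\<phi> n)) \<longlonglongrightarrow> seg_mean (closed_segment a b) g"
proof -
  define S where "S = closed_segment a b"
  define U where "U = interior (tri z a b)"
  obtain \<psi> where \<psi>: "H1_approx (tri z a b) v \<psi>" "(\<lambda>n. seg_integral S (\<lambda>x. (\<psi> n x - g x)\<^sup>2)) \<longlonglongrightarrow> 0"
    and g: "g \<in> seg_L2 S" using tr unfolding is_trace_iff S_def by blast
  define h where "h n = H1_norm U (\<lambda>x. \<phi> n x - v x)" for n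
  define k where "k n = H1_norm U (\<lambda>x. \<psi> n x - v x)" for n
  have v: "v \<in> H1 U" and s: "\<And>n. smooth (\<phi> n)" "\<And>n. smooth (\<psi> n)" and h0: "h \<longlonglongrightarrow> 0" "k \<longlonglongrightarrow> 0"
    using ap \<psi> by (auto simp: H1_approx_def U_def h_def[abs_def] k_def[abs_def])
  obtain C where C0: "C \<ge> 0" and C1: "\<forall>\<phi> \<psi> v. smooth \<phi> \<longrightarrow> smooth \<psi> \<longrightarrow> v \<in> H1 U \<longrightarrow>
    lin_mean a b (\<lambda>x. (\<phi> x - \<psi> x)\<^sup>2) \<le> C * (H1_norm U (\<lambda>x. \<phi> x - v x) + H1_norm U (\<lambda>x. \<psi> x - v x))\<^sup>2"
    using trace_diff_bound[OF c, folded U_def] by (elim exE conjE) (rule that)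
  have "lin_mean a b (\<lambda>x. (\<phi> n x - \<psi> n x)\<^sup>2) \<le> C * (h n + k n)\<^sup>2" for n
    unfolding h_def k_def using C1[rule_format, OF s v] .
  note C = C0 this
  have ab: "a \<noteq> b" using c by (auto simp: cross2_def)
  have lim1: "(\<lambda>n. C * (h n + k n)\<^sup>2) \<longlonglongrightarrow> 0"
    using tendsto_mult_left[OF tendsto_power[OF tendsto_add[OF h0], of 2], of C] by simp
  have lim2: "(\<lambda>n. seg_mean S (\<lambda>x. (\<psi> n x - g x)\<^sup>2)) \<longlonglongrightarrow> 0"
    using tendsto_mult_left[OF \<psi>(2), of "inverse (dist a b)"] ab unfolding S_def seg_integral_eq
    by (simp add: field_simps)
  have le: "(lin_mean a b (\<phi> n) - seg_mean S g)\<^sup>2 \<le> 2 * (C * (h n + k n)\<^sup>2) + 2 * seg_mean S (\<lambda>x. (\<psi> n x - g x)\<^sup>2)" for n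
  proof -
    note L = smooth_seg_L2[OF s(1)[of n], of S] smooth_seg_L2[OF s(2)[of n], of S]
    have "(lin_mean a b (\<phi> n) - seg_mean S g)\<^sup>2 = (seg_mean S (\<lambda>x. \<phi> n x - g x))\<^sup>2"
      using seg_mean_diff[OF L(1) g] by (simp add: S_def seg_mean_eq)
    also have "\<dots> \<le> seg_mean S (\<lambda>x. (\<phi> n x - g x)\<^sup>2)"
      by (rule seg_mean_square_le[OF seg_L2_diff[OF L(1) g]])
    also have "\<dots> \<le> 2 * seg_mean S (\<lambda>x. (\<phi> n x - \<psi> n x)\<^sup>2) + 2 * seg_mean S (\<lambda>x. (\<psi> n x - g x)\<^sup>2)"
      by (rule seg_mean_power2_triangle[OF L g])
    also have "seg_mean S (\<lambda>x. (\<phi> n x - \<psi> n x)\<^sup>2) \<le> C * (h n + k n)\<^sup>2"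
      using C(2) by (simp add: S_def seg_mean_eq)
    finally show ?thesis by simp
  qed
  have "(\<lambda>n. (lin_mean a b (\<phi> n) - seg_mean S g)\<^sup>2) \<longlonglongrightarrow> 0"
  proof (rule tendsto_sandwich[of "\<lambda>_. 0"])
    show "(\<lambda>n. 2 * (C * (h n + k n)\<^sup>2) + 2 * seg_mean S (\<lambda>x. (\<psi> n x - g x)\<^sup>2)) \<longlonglongrightarrow> 0"
      using tendsto_add[OF tendsto_mult_left[OF lim1, of 2] tendsto_mult_left[OF lim2, of 2]] by simp
  qed (use le in auto)
  then have "(\<lambda>n. sqrt ((lin_mean a b (\<phi> n) - seg_mean S g)\<^sup>2)) \<longlonglongrightarrow> sqrt 0" by (rule tendsto_real_sqrt)
  then have "(\<lambda>n. lin_mean a b (\<phi> n) - seg_mean S g) \<longlonglongrightarrow> 0" by (simp add: tendsto_rabs_zero_iff)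
  then show ?thesis using LIM_zero_iff[of "\<lambda>n. lin_mean a b (\<phi> n)" "seg_mean S g"] by (simp add: S_def)
qed

text \<open>The triangle \<open>T\<close> is part of the data since traces from different sides of an edge may differ.\<close>

definition edge_mean :: "R2 set \<Rightarrow> (R2 \<Rightarrow> real) \<Rightarrow> R2 \<Rightarrow> R2 \<Rightarrow> real" where
  "edge_mean T v a b = seg_mean (closed_segment a b) (trace_on T (closed_segment a b) v)"

lemma edge_mean_commute: "edge_mean T v a b = edge_mean T v b a"
  by (simp add: edge_mean_def closed_segment_commute)

lemma trace_on_is_trace:
  assumes "cross2 (a - z) (b - z) \<noteq> 0" "H1_approx (tri z a b) v \<phi>"
  shows "is_trace (tri z a b) (closed_segment a b) v (trace_on (tri z a b) (closed_segment a b) v)"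
  unfolding trace_on_def using trace_exists[OF assms] by (rule someI_ex)

lemma edge_mean_limit:
  assumes "cross2 (a - z) (b - z) \<noteq> 0" "H1_approx (tri z a b) v \<phi>"
  shows "(\<lambda>n. lin_mean a b (\<phi> n)) \<longlonglongrightarrow> edge_mean (tri z a b) v a b"
  unfolding edge_mean_def by (rule trace_mean_limit[OF assms trace_on_is_trace[OF assms]])

lemma cross2_rotate: "cross2 (b - a) (z - a) = cross2 (a - z) (b - z)"
  by (simp add: cross2_def algebra_simps)
lemma cross2_swap: "cross2 (b - z) (a - z) = - cross2 (a - z) (b - z)"
  by (simp add: cross2_def algebra_simps)

lemma tri_rotate: "tri a b z = tri z a b" by (simp add: insert_commute)
lemma tri_swap: "tri z b a = tri z a b" by (simp add: insert_commute)

text \<open>Both sides of Green's formula for the smooth approximations converge.\<close>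

lemma green_H1:
  assumes c: "cross2 (a - z) (b - z) \<noteq> 0" and ap: "H1_approx (tri z a b) v \<phi>"
    and wg: "has_weak_grad (interior (tri z a b)) v g"
  shows "(LINT x:tri z a b|lebesgue. g x \<bullet> (a - z))
    = 2 * measure lebesgue (tri z a b) * (edge_mean (tri z a b) v a b - edge_mean (tri z a b) v z b)"
proof -
  let ?T = "tri z a b"
  define U where "U = interior ?T"
  have U: "open U" "bounded U" "U \<in> sets lebesgue" unfolding U_def by (simp_all add: interior_tri_facts)
  have v: "v \<in> H1 U" and s: "\<And>n. smooth (\<phi> n)" and h0: "(\<lambda>n. H1_norm U (\<lambda>x. \<phi> n x - v x)) \<longlonglongrightarrow> 0"
    using ap by (auto simp: H1_approx_def U_def)
  have gL: "g \<in> L2 U"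
    using L2_cong_AE[OF has_weak_grad_unique[OF U(1) H1_weak_grad(2)[OF U(1) v] wg[folded U_def]] H1_weak_grad(1)[OF U(1) v]] .
  have Um: "U \<in> lmeasurable" using U by (simp add: bounded_set_imp_lmeasurable)
  have eL: "(\<lambda>x. a - z) \<in> L2 U" by (rule L2_const[OF Um])
  have l1: "(\<lambda>n. lin_mean a b (\<phi> n)) \<longlonglongrightarrow> edge_mean ?T v a b" by (rule edge_mean_limit[OF c ap])
  \<comment> \<open>the edge \<open>[z, b]\<close>, seen with \<open>a\<close> as the opposite vertex\<close>
  have "(\<lambda>n. lin_mean b z (\<phi> n)) \<longlonglongrightarrow> edge_mean (tri a b z) v b z"
    by (rule edge_mean_limit) (use c ap in \<open>simp_all add: cross2_rotate tri_rotate\<close>)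
  then have l2: "(\<lambda>n. lin_mean z b (\<phi> n)) \<longlonglongrightarrow> edge_mean ?T v z b"
    by (simp add: tri_rotate lin_mean_commute[of b z] edge_mean_commute[of _ _ b z])
  have L: "(\<lambda>n. 2 * measure lebesgue ?T * (lin_mean a b (\<phi> n) - lin_mean z b (\<phi> n)))
      \<longlonglongrightarrow> 2 * measure lebesgue ?T * (edge_mean ?T v a b - edge_mean ?T v z b)"
    by (intro tendsto_intros l1 l2)
  have green: "2 * measure lebesgue ?T * (lin_mean a b (\<phi> n) - lin_mean z b (\<phi> n))
      = (LINT x:U|lebesgue. grad (\<phi> n) x \<bullet> (a - z))" for n
    using green_tri[OF c smooth_GDERIV(1)[OF s] smooth_GDERIV(3)[OF s], of n]
      set_LINT_cong_set_AE[OF AE_interior_tri', of z a b "\<lambda>x. grad (\<phi> n) x \<bullet> (a - z)"]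
    by (simp add: measure_tri[OF c] U_def)
  have "(\<lambda>n. (LINT x:U|lebesgue. grad (\<phi> n) x \<bullet> (a - z))) \<longlonglongrightarrow> (LINT x:U|lebesgue. g x \<bullet> (a - z))"
  proof (rule LIM_zero_cancel, rule Lim_null_comparison)
    show "(\<lambda>n. H1_norm U (\<lambda>x. \<phi> n x - v x) * L2_norm U (\<lambda>x. a - z)) \<longlonglongrightarrow> 0"
      using tendsto_mult_right[OF h0] by simp
    show "\<forall>\<^sub>F n in sequentially. norm ((LINT x:U|lebesgue. grad (\<phi> n) x \<bullet> (a - z)) - (LINT x:U|lebesgue. g x \<bullet> (a - z)))
        \<le> H1_norm U (\<lambda>x. \<phi> n x - v x) * L2_norm U (\<lambda>x. a - z)"
    proof (rule always_eventually, rule allI)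
      fix n
      note pL = smooth_L2[OF s[of n] U(2,3)]
      have "(LINT x:U|lebesgue. grad (\<phi> n) x \<bullet> (a - z)) - (LINT x:U|lebesgue. g x \<bullet> (a - z))
          = (LINT x:U|lebesgue. (grad (\<phi> n) x - g x) \<bullet> (a - z))"
        using set_integral_diff(2)[OF L2_inner_integrable[OF pL(2) eL] L2_inner_integrable[OF gL eL]]
        by (simp add: inner_diff_left)
      also have "\<bar>\<dots>\<bar> \<le> L2_norm U (\<lambda>x. grad (\<phi> n) x - g x) * L2_norm U (\<lambda>x. a - z)"
        by (rule L2_Cauchy_Schwarz[OF L2_diff[OF pL(2) gL] eL])
      also have "\<dots> \<le> H1_norm U (\<lambda>x. \<phi> n x - v x) * L2_norm U (\<lambda>x. a - z)"
        using H1_norm_diff_bounds(2)[OF U(1) s wg[folded U_def]] by (intro mult_right_mono) auto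
      finally show "norm ((LINT x:U|lebesgue. grad (\<phi> n) x \<bullet> (a - z)) - (LINT x:U|lebesgue. g x \<bullet> (a - z)))
        \<le> H1_norm U (\<lambda>x. \<phi> n x - v x) * L2_norm U (\<lambda>x. a - z)" by simp
    qed
  qed
  with L have "2 * measure lebesgue ?T * (edge_mean ?T v a b - edge_mean ?T v z b) = (LINT x:U|lebesgue. g x \<bullet> (a - z))"
    unfolding green by (rule LIMSEQ_unique)
  then show ?thesis using set_LINT_cong_set_AE[OF AE_interior_tri', of z a b "\<lambda>x. g x \<bullet> (a - z)"]
    by (simp add: U_def)
qed

subsection \<open>Affine functions\<close>

text \<open>
  The mean of an affine function over a segment is its value at the midpoint: this is why functions
  in \<open>CR\<close> are determined by their values at the midpoints of sides.
\<close>

lemma lin_mean_affine: "lin_mean a b (\<lambda>x. \<alpha> \<bullet> x + \<beta>) = \<alpha> \<bullet> midpoint a b + \<beta>"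
proof -
  let ?l = "\<lambda>x. \<alpha> \<bullet> x + \<beta>"
  have i: "set_integrable lebesgue {0..1} (\<lambda>t. ?l (linepath p q t))" for p q
    by (rule lin_mean_integrable) (intro continuous_intros)
  have "lin_mean a b ?l + lin_mean b a ?l = (LINT t:{0..1}|lebesgue. ?l (linepath a b t) + ?l (linepath b a t))"
    unfolding lin_mean_def by (rule set_integral_add(2)[OF i i, symmetric])
  also have "(\<lambda>t. ?l (linepath a b t) + ?l (linepath b a t)) = (\<lambda>t. 2 * ?l (midpoint a b))"
    by (simp add: fun_eq_iff linepath_def midpoint_def inner_add_right algebra_simps)
  also have "(LINT t:{0..1::real}|lebesgue. 2 * ?l (midpoint a b)) = 2 * ?l (midpoint a b)"
    by (simp add: set_lebesgue_integral_def)
  finally show ?thesis using lin_mean_commute[of a b ?l] by simp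
qed

lemma affine_H1_approx:
  assumes ae: "AE x in lebesgue. x \<in> tri z a b \<longrightarrow> v x = \<alpha> \<bullet> x + \<beta>"
  shows "H1_approx (tri z a b) v (\<lambda>n x. \<alpha> \<bullet> x + \<beta>)" "has_weak_grad (interior (tri z a b)) v (\<lambda>x. \<alpha>)"
    "v \<in> H1 (interior (tri z a b))"
proof -
  define U where "U = interior (tri z a b)"
  have U: "open U" "bounded U" "U \<in> sets lebesgue" unfolding U_def by (simp_all add: interior_tri_facts)
  have aeU: "AE x in lebesgue. x \<in> U \<longrightarrow> \<alpha> \<bullet> x + \<beta> = v x"
    using ae by eventually_elim (use interior_subset in \<open>auto simp: U_def\<close>)
  have s: "smooth (\<lambda>x. \<alpha> \<bullet> x + \<beta>)" by (rule smooth_affine)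
  show wg: "has_weak_grad U v (\<lambda>x. \<alpha>)"
    by (rule has_weak_grad_cong_AE[OF smooth_has_weak_grad[OF s] aeU]) (simp add: grad_affine)
  have vL: "v \<in> L2 U" by (rule L2_cong_AE[OF aeU smooth_L2(1)[OF s U(2,3)]])
  have "(\<lambda>x. \<alpha>) \<in> L2 U" using smooth_L2(2)[OF s U(2,3)] grad_affine[of \<alpha> \<beta>]
    by (simp add: fun_eq_iff[symmetric] ext[of "grad (\<lambda>x. \<alpha> \<bullet> x + \<beta>)" "\<lambda>x. \<alpha>"])
  then show v: "v \<in> H1 U" using vL wg by (auto simp: H1_def)
  have "L2_norm U (\<lambda>x. \<alpha> \<bullet> x + \<beta> - v x) = L2_norm U (\<lambda>x. 0::real)"
    by (rule L2_norm_cong_AE) (use aeU in auto)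
  then have "(H1_norm U (\<lambda>x. \<alpha> \<bullet> x + \<beta> - v x))\<^sup>2 = 0"
    using H1_norm_diff_power2[OF U(1) s wg] by (simp add: grad_affine L2_norm_def)
  then show "H1_approx (tri z a b) v (\<lambda>n x. \<alpha> \<bullet> x + \<beta>)"
    using v s by (simp add: H1_approx_def U_def)
qed

lemma edge_mean_affine:
  assumes c: "cross2 (a - z) (b - z) \<noteq> 0"
    and ae: "AE x in lebesgue. x \<in> tri z a b \<longrightarrow> v x = \<alpha> \<bullet> x + \<beta>"
  shows "edge_mean (tri z a b) v a b = \<alpha> \<bullet> midpoint a b + \<beta>"
  using edge_mean_limit[OF c affine_H1_approx(1)[OF ae]] by (simp add: lin_mean_affine LIMSEQ_const_iff)

section \<open>Newest vertex bisection\<close>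

lemma distinct_of_cross2:
  assumes "cross2 (a - z) (b - z) \<noteq> 0" shows "z \<noteq> a" "z \<noteq> b" "a \<noteq> b"
  using assms by (auto simp: cross2_def)

text \<open>
  The bridge between the determinant used in integrals and the affine independence used in
  \<open>children\<close> and for simplices.
\<close>

lemma cross2_iff_independent:
  "cross2 (a - z) (b - z) \<noteq> 0 \<longleftrightarrow> card {z, a, b} = 3 \<and> \<not> affine_dependent {z, a, b}"
proof
  assume c: "cross2 (a - z) (b - z) \<noteq> 0"
  note d = distinct_of_cross2[OF c]
  have "\<not> affine_dependent {z, a, b}"
  proof
    assume "affine_dependent {z, a, b}"
    then obtain U where U: "sum U {z,a,b} = 0" "\<exists>v\<in>{z,a,b}. U v \<noteq> 0" "(\<Sum>v\<in>{z,a,b}. U v *\<^sub>R v) = 0"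
      using affine_dependent_explicit_finite[of "{z,a,b}"] by auto
    have s: "U z = - U a - U b" using U(1) d by (simp add: insert_absorb)
    have "U z *\<^sub>R z + (U a *\<^sub>R a + U b *\<^sub>R b) = 0" using U(3) d by simp
    then have "U a *\<^sub>R (a - z) + U b *\<^sub>R (b - z) = 0" unfolding s by (simp add: algebra_simps)
    from cross2_independent[OF c this] s U(2) show False by auto
  qed
  then show "card {z, a, b} = 3 \<and> \<not> affine_dependent {z, a, b}" using d by simp
next
  assume h: "card {z, a, b} = 3 \<and> \<not> affine_dependent {z, a, b}"
  have d: "z \<noteq> a" "z \<noteq> b" "a \<noteq> b" using h by (auto simp: card_insert_if split: if_splits)
  show "cross2 (a - z) (b - z) \<noteq> 0"
  proof
    assume c: "cross2 (a - z) (b - z) = 0"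
    have "a - z \<noteq> 0" using d(1) by simp
    then have "\<exists>i. (a - z) $ i \<noteq> 0" unfolding vec_eq_iff by simp
    then obtain i where i: "(a - z) $ i \<noteq> 0" by (rule exE)
    define U where "U v = (if v = a then (b - z) $ i else if v = b then - ((a - z) $ i) else (a - z) $ i - (b - z) $ i)" for v
    have "(b - z) $ i *\<^sub>R (a - z) = (a - z) $ i *\<^sub>R (b - z)"
    proof -
      have "i = 1 \<or> i = 2" using exhaust_2 by blast
      then show ?thesis using c by (auto simp: vec_eq_iff forall_2 cross2_def algebra_simps)
    qed
    then have "(\<Sum>v\<in>{z,a,b}. U v *\<^sub>R v) = 0" using d
      by (simp add: U_def algebra_simps)
    moreover have "sum U {z,a,b} = 0" using d by (simp add: U_def)
    moreover have "\<exists>v\<in>{z,a,b}. U v \<noteq> 0" using d i by (intro bexI[of _ b]) (auto simp: U_def)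
    ultimately have "affine_dependent {z,a,b}" using affine_dependent_explicit_finite[of "{z,a,b}"] by auto
    then show False using h by simp
  qed
qed

lemma independent_of_cross2:
  assumes "cross2 (a - z) (b - z) \<noteq> 0"
  shows "\<not> affine_dependent {z, a, b}" "card {z, a, b} = 3"
  using assms[unfolded cross2_iff_independent] by (rule conjunct2, rule conjunct1)

text \<open>The vertices are the extreme points, hence determined by the triangle as a set.\<close>

lemma tri_vertices_unique:
  assumes "cross2 (a - z) (b - z) \<noteq> 0" "cross2 (a' - z') (b' - z') \<noteq> 0" "tri z a b = tri z' a' b'"
  shows "{z, a, b} = {z', a', b'}"
proof -
  have *: "{x. x extreme_point_of (tri p q r)} = {p, q, r}" if "cross2 (q - p) (r - p) \<noteq> 0" for p q r
  proof -
    have "\<not> affine_dependent {p, q, r}" by (rule independent_of_cross2(1)[OF that])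
    from extreme_point_of_convex_hull_affine_independent[OF this] show ?thesis by auto
  qed
  show ?thesis using *[OF assms(2)] unfolding assms(3)[symmetric] *[OF assms(1)] .
qed

lemma aff_dim_tri:
  assumes "cross2 (a - z) (b - z) \<noteq> 0" shows "aff_dim (tri z a b) = 2"
proof -
  have "aff_dim {z, a, b} = 2"
    using aff_dim_affine_independent[OF independent_of_cross2(1)[OF assms]]
    unfolding independent_of_cross2(2)[OF assms] by linarith
  then show ?thesis by (simp only: aff_dim_convex_hull)
qed

lemma edge_of_tri_iff:
  assumes c: "cross2 (a - z) (b - z) \<noteq> 0"
  shows "S edge_of (tri z a b) \<longleftrightarrow> S = closed_segment z a \<or> S = closed_segment z b \<or> S = closed_segment a b"
proof -
  note d = distinct_of_cross2[OF c]
  have ind: "\<not> affine_dependent {z,a,b}" by (rule independent_of_cross2(1)[OF c])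
  note face = face_of_convex_hull_affine_independent[OF ind]
  show ?thesis
  proof
    assume S: "S edge_of (tri z a b)"
    then obtain C where C: "C \<subseteq> {z,a,b}" "S = convex hull C" using face by (auto simp: edge_of_def)
    have "\<not> affine_dependent C" using affine_dependent_subset C(1) ind by blast
    then have "int (card C) = 2"
      using aff_dim_affine_independent[of C] S C(2) by (simp add: edge_of_def aff_dim_convex_hull)
    then have card: "card C = 2" by simp
    have "C \<in> Pow {z,a,b}" using C(1) by simp
    then have "C = {z,a} \<or> C = {z,b} \<or> C = {a,b}" using card d
      by (auto simp: Pow_insert)
    then show "S = closed_segment z a \<or> S = closed_segment z b \<or> S = closed_segment a b"
      using C(2) by (auto simp: segment_convex_hull)
  next
    have *: "closed_segment p q edge_of (tri z a b)" if "{p, q} \<subseteq> {z,a,b}" "p \<noteq> q" for p q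
    proof -
      have "convex hull {p,q} face_of (tri z a b)" using face that(1) by blast
      then show ?thesis using that(2) by (simp add: edge_of_def segment_convex_hull aff_dim_convex_hull aff_dim_2)
    qed
    assume "S = closed_segment z a \<or> S = closed_segment z b \<or> S = closed_segment a b"
    then show "S edge_of (tri z a b)" using *[of z a] *[of z b] *[of a b] d by auto
  qed
qed

text \<open>
  A scale invariant bound, up to a constant factor, of the squared diameter by the area.  Only the
  edges at the newest vertex enter, because in this form the children inherit the bound with the
  same \<open>\<sigma>\<close>.
\<close>

definition shaped :: "real \<Rightarrow> R2 \<Rightarrow> R2 \<Rightarrow> R2 \<Rightarrow> bool" where
  "shaped \<sigma> z a b \<longleftrightarrow> cross2 (a - z) (b - z) \<noteq> 0 \<and>
     (norm (a - z))\<^sup>2 + (norm (b - z))\<^sup>2 \<le> \<sigma> * \<bar>cross2 (a - z) (b - z)\<bar>"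

definition marked_shape :: "real \<Rightarrow> mtri \<Rightarrow> bool" where
  "marked_shape \<sigma> t \<longleftrightarrow> (\<exists>a b. snd t = tri (fst t) a b \<and> shaped \<sigma> (fst t) a b)"

lemma midpoint_nth: "midpoint a b $ i = ((a::R2) $ i + b $ i) / 2"
  by (simp add: midpoint_def)

lemma norm_R2_power2: "(norm (x::R2))\<^sup>2 = (x $ 1)\<^sup>2 + (x $ 2)\<^sup>2"
  by (simp add: norm_eq_sqrt_inner inner_2 power2_eq_square)

lemma cross2_children:
  "cross2 (z - midpoint a b) (a - midpoint a b) = cross2 (a - z) (b - z) / 2"
  "cross2 (z - midpoint a b) (b - midpoint a b) = - cross2 (a - z) (b - z) / 2"
  by (simp_all add: cross2_def midpoint_nth field_simps)

lemma children_norms: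
  fixes z a b :: R2
  shows
  "(norm (z - midpoint a b))\<^sup>2 + (norm (a - midpoint a b))\<^sup>2 = ((norm (a - z))\<^sup>2 + (norm (b - z))\<^sup>2) / 2"
  "(norm (z - midpoint a b))\<^sup>2 + (norm (b - midpoint a b))\<^sup>2 = ((norm (a - z))\<^sup>2 + (norm (b - z))\<^sup>2) / 2"
  unfolding norm_R2_power2 vector_minus_component midpoint_nth
  by (simp_all add: power2_eq_square field_simps)

text \<open>
  With \<open>p\<close>, \<open>q\<close> the edges at the newest vertex, the edges of a child at its newest vertex are
  \<open>(p + q) / 2\<close> and \<open>(p - q) / 2\<close> up to sign.  By the parallelogram law the sum of squares is halved,
  and so is the area.
\<close>

lemma shaped_children:
  assumes "shaped \<sigma> z a b"
  shows "shaped \<sigma> (midpoint a b) z a" "shaped \<sigma> (midpoint a b) z b"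
  using assms unfolding shaped_def cross2_children children_norms by auto

text \<open>The vertices other than \<open>z\<close> are determined up to order, and the two orders give the two children.\<close>

lemma children_eq:
  assumes c: "cross2 (a - z) (b - z) \<noteq> 0"
  shows "children (z, tri z a b) = {(midpoint a b, tri (midpoint a b) z a), (midpoint a b, tri (midpoint a b) z b)}"
proof -
  have perm: "tri z p (midpoint a b) = tri (midpoint a b) z p" for p by (simp add: insert_commute)
  have d: "z \<noteq> a" "z \<noteq> b" "a \<noteq> b" using distinct_of_cross2[OF c] .
  show ?thesis
  proof (intro equalityI subsetI)
    fix t assume "t \<in> children (z, tri z a b)"
    then obtain p q where t: "t = (midpoint p q, tri z p (midpoint p q))"
      and h: "card {z, p, q} = 3" "\<not> affine_dependent {z, p, q}" "tri z a b = tri z p q"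
      unfolding children_def by auto
    have c': "cross2 (p - z) (q - z) \<noteq> 0" unfolding cross2_iff_independent using h(1,2) by simp
    have "{z, a, b} = {z, p, q}" by (rule tri_vertices_unique[OF c c' h(3)])
    then have "(p = a \<and> q = b) \<or> (p = b \<and> q = a)"
      using d distinct_of_cross2[OF c'] by (auto simp: doubleton_eq_iff insert_eq_iff)
    then show "t \<in> {(midpoint a b, tri (midpoint a b) z a), (midpoint a b, tri (midpoint a b) z b)}"
      using t perm by (auto simp: midpoint_sym[of b a])
  next
    have c': "cross2 (b - z) (a - z) \<noteq> 0" using c cross2_swap[of b z a] by simp
    have ch: "(midpoint p q, tri z p (midpoint p q)) \<in> children (z, tri z a b)"
      if "cross2 (p - z) (q - z) \<noteq> 0" "tri z a b = tri z p q" for p q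
      using that(2) independent_of_cross2[OF that(1)] unfolding children_def by auto
    fix t assume "t \<in> {(midpoint a b, tri (midpoint a b) z a), (midpoint a b, tri (midpoint a b) z b)}"
    then show "t \<in> children (z, tri z a b)"
      using ch[OF c refl] ch[OF c' tri_swap[symmetric]] perm by (auto simp: midpoint_sym[of b a])
  qed
qed

lemma tri_memI:
  "x = u *\<^sub>R p + v *\<^sub>R q + w *\<^sub>R r \<Longrightarrow> 0 \<le> u \<Longrightarrow> 0 \<le> v \<Longrightarrow> 0 \<le> w \<Longrightarrow> u + v + w = 1 \<Longrightarrow> x \<in> tri p q r"
  unfolding convex_hull_3 by blast

text \<open>A point belongs to the child at the vertex with the larger barycentric coordinate.\<close>

lemma tri_eq_Un_children:
  "tri z a b = tri (midpoint a b) z a \<union> tri (midpoint a b) z b"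
proof (intro equalityI subsetI)
  fix x assume "x \<in> tri z a b"
  then obtain u v w where x: "x = u *\<^sub>R z + v *\<^sub>R a + w *\<^sub>R b" "0 \<le> u" "0 \<le> v" "0 \<le> w" "u + v + w = 1"
    unfolding convex_hull_3 by auto
  show "x \<in> tri (midpoint a b) z a \<union> tri (midpoint a b) z b"
  proof (cases "w \<le> v")
    case True
    have "x = (2 * w) *\<^sub>R midpoint a b + u *\<^sub>R z + (v - w) *\<^sub>R a"
      unfolding x(1) by (simp add: vec_eq_iff midpoint_nth algebra_simps)
    then have "x \<in> tri (midpoint a b) z a" by (rule tri_memI) (use True x in auto)
    then show ?thesis by blast
  next
    case False
    have "x = (2 * v) *\<^sub>R midpoint a b + u *\<^sub>R z + (w - v) *\<^sub>R b"
      unfolding x(1) by (simp add: vec_eq_iff midpoint_nth algebra_simps)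
    then have "x \<in> tri (midpoint a b) z b" by (rule tri_memI) (use False x in auto)
    then show ?thesis by blast
  qed
next
  have m: "midpoint a b \<in> tri z a b"
  proof -
    have "midpoint a b \<in> closed_segment a b" by simp
    also have "\<dots> \<subseteq> tri z a b" unfolding segment_convex_hull by (rule hull_mono) auto
    finally show ?thesis .
  qed
  have "tri (midpoint a b) z p \<subseteq> tri z a b" if "p = a \<or> p = b" for p
    by (rule hull_minimal) (use m that in \<open>auto intro: hull_inc\<close>)
  then show "x \<in> tri z a b" if "x \<in> tri (midpoint a b) z a \<union> tri (midpoint a b) z b" for x
    using that by blast
qed

text \<open>
  The sets of triangles that arise from one triangle by bisections, organised by the
  first bisection, so that statements about a triangle follow from those about its children.
\<close>

inductive tree :: "R2 \<Rightarrow> R2 \<Rightarrow> R2 \<Rightarrow> mesh \<Rightarrow> bool" where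
  leaf: "tree z a b {(z, tri z a b)}"
| node: "tree (midpoint a b) z a Q1 \<Longrightarrow> tree (midpoint a b) z b Q2 \<Longrightarrow> tree z a b (Q1 \<union> Q2)"

text \<open>
  The triangle \<open>t\<close> may occur in both subtrees or in one of them only; the conditional form makes the
  statement apply to each subtree.
\<close>

lemma tree_bisect:
  assumes "tree z a b Q" "cross2 (a - z) (b - z) \<noteq> 0"
  shows "tree z a b (if t \<in> Q then Q - {t} \<union> children t else Q)"
  using assms
proof (induction rule: tree.induct)
  case (leaf z a b)
  show ?case
  proof (cases "t = (z, tri z a b)")
    case True
    have "tree z a b ({(midpoint a b, tri (midpoint a b) z a)} \<union> {(midpoint a b, tri (midpoint a b) z b)})"
      by (intro tree.intros)
    then show ?thesis using True children_eq[OF leaf] by (simp add: insert_commute)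
  next
    case False
    then show ?thesis using tree.leaf by simp
  qed
next
  case (node a b z Q1 Q2)
  have c: "cross2 (z - midpoint a b) (a - midpoint a b) \<noteq> 0" "cross2 (z - midpoint a b) (b - midpoint a b) \<noteq> 0"
    using node.prems unfolding cross2_children by auto
  have "tree z a b ((if t \<in> Q1 then Q1 - {t} \<union> children t else Q1) \<union> (if t \<in> Q2 then Q2 - {t} \<union> children t else Q2))"
    by (rule tree.node[OF node.IH(1)[OF c(1)] node.IH(2)[OF c(2)]])
  moreover have "(if t \<in> Q1 then Q1 - {t} \<union> children t else Q1) \<union> (if t \<in> Q2 then Q2 - {t} \<union> children t else Q2)
      = (if t \<in> Q1 \<union> Q2 then Q1 \<union> Q2 - {t} \<union> children t else Q1 \<union> Q2)"
    by auto
  ultimately show ?case by simp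
qed

lemma tree_finite: "tree z a b Q \<Longrightarrow> finite Q"
  by (induction rule: tree.induct) auto

lemma tree_union: "tree z a b Q \<Longrightarrow> \<Union>(tris Q) = tri z a b"
proof (induction rule: tree.induct)
  case (node a b z Q1 Q2)
  then show ?case using tri_eq_Un_children[of z a b] by (simp add: image_Un)
qed simp

lemma tree_shape: "tree z a b Q \<Longrightarrow> shaped \<sigma> z a b \<Longrightarrow> t \<in> Q \<Longrightarrow> marked_shape \<sigma> t"
proof (induction arbitrary: t rule: tree.induct)
  case (leaf z a b)
  then show ?case by (auto simp: marked_shape_def)
next
  case (node a b z Q1 Q2)
  then show ?case using shaped_children[OF node.prems(1)] by blast
qed

lemma measure_children:
  assumes c: "cross2 (a - z) (b - z) \<noteq> 0"
  shows "measure lebesgue (tri (midpoint a b) z a) = measure lebesgue (tri z a b) / 2"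
    "measure lebesgue (tri (midpoint a b) z b) = measure lebesgue (tri z a b) / 2"
  using c by (subst (1 2) measure_tri; simp add: cross2_children)+

lemma tree_measure:
  assumes "tree z a b Q" "cross2 (a - z) (b - z) \<noteq> 0"
  shows "Q = {(z, tri z a b)} \<or> (\<forall>T\<in>tris Q. measure lebesgue T \<le> measure lebesgue (tri z a b) / 2)"
  using assms
proof (induction rule: tree.induct)
  case (node a b z Q1 Q2)
  have c: "cross2 (z - midpoint a b) (a - midpoint a b) \<noteq> 0" "cross2 (z - midpoint a b) (b - midpoint a b) \<noteq> 0"
    using node.prems unfolding cross2_children by auto
  have le: "measure lebesgue T \<le> measure lebesgue X"
    if "Q = {(y, X)} \<or> (\<forall>T\<in>tris Q. measure lebesgue T \<le> measure lebesgue X / 2)" "T \<in> tris Q" for Q y X T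
    using that(1)
  proof
    assume "Q = {(y, X)}" then show ?thesis using that(2) by simp
  next
    assume "\<forall>T\<in>tris Q. measure lebesgue T \<le> measure lebesgue X / 2"
    then have "measure lebesgue T \<le> measure lebesgue X / 2" using that(2) by (rule bspec)
    then show ?thesis using measure_nonneg[of lebesgue X] by linarith
  qed
  have "measure lebesgue T \<le> measure lebesgue (tri z a b) / 2" if "T \<in> tris Q1" for T
    using le[OF node.IH(1)[OF c(1)] that] unfolding measure_children(1)[OF node.prems] .
  moreover have "measure lebesgue T \<le> measure lebesgue (tri z a b) / 2" if "T \<in> tris Q2" for T
    using le[OF node.IH(2)[OF c(2)] that] unfolding measure_children(2)[OF node.prems] .
  ultimately show ?case by blast
qed simp

text \<open>
  Each bisection happens inside a single triangle of the coarse mesh, so a refinement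
  splits into one tree for each of these.
\<close>

lemma refinement_trees:
  assumes r: "refinement \<T> \<T>'"
    and AB: "\<And>t. t \<in> \<T> \<Longrightarrow> snd t = tri (fst t) (A t) (B t)"
      "\<And>t. t \<in> \<T> \<Longrightarrow> cross2 (A t - fst t) (B t - fst t) \<noteq> 0"
  shows "\<exists>F. \<T>' = (\<Union>t\<in>\<T>. F t) \<and> (\<forall>t\<in>\<T>. tree (fst t) (A t) (B t) (F t))"
  using r unfolding refinement_def
proof (induction rule: rtranclp_induct)
  case base
  have "tree (fst t) (A t) (B t) {t}" if "t \<in> \<T>" for t
    using tree.leaf[of "fst t" "A t" "B t"] AB(1)[OF that] by (metis prod.collapse)
  then show ?case by (intro exI[of _ "\<lambda>t. {t}"]) auto
next
  case (step \<T>1 \<T>2)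
  then obtain F where F: "\<T>1 = (\<Union>t\<in>\<T>. F t)" "\<forall>t\<in>\<T>. tree (fst t) (A t) (B t) (F t)" by blast
  obtain t' where t': "t' \<in> \<T>1" "\<T>2 = \<T>1 - {t'} \<union> children t'" using step.hyps(2) by (auto simp: bisection_def)
  define G where "G t = (if t' \<in> F t then F t - {t'} \<union> children t' else F t)" for t
  have "tree (fst t) (A t) (B t) (G t)" if "t \<in> \<T>" for t
    unfolding G_def by (rule tree_bisect) (use F(2) AB(2) that in auto)
  moreover have "\<T>2 = (\<Union>t\<in>\<T>. G t)"
    using t' unfolding F(1) G_def by (auto split: if_splits)
  ultimately show ?case by blast
qed

section \<open>Meshes of a domain\<close>

text \<open>
  The parameter \<open>\<sigma>\<close> bounds the shape of all triangles; it is shared by all refinements of an initial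
  mesh, so constants that depend on \<open>\<sigma>\<close> only are uniform.
\<close>

locale domain_mesh =
  fixes \<Omega> :: "R2 set" and \<sigma> :: real and \<T> :: mesh
  assumes open_domain: "open \<Omega>" and bounded_domain: "bounded \<Omega>" and regular_domain: "\<Omega> = interior (closure \<Omega>)"
    and finite_mesh: "finite \<T>" and shape: "\<And>t. t \<in> \<T> \<Longrightarrow> marked_shape \<sigma> t"
    and cover: "\<Union>(tris \<T>) = closure \<Omega>" and conf: "conforming \<T>"
begin

lemma domain_lmeasurable: "\<Omega> \<in> lmeasurable"
  using open_domain bounded_domain by (simp add: bounded_set_imp_lmeasurable)

lemma domain_sets: "\<Omega> \<in> sets lebesgue" using open_domain by simp

lemma tris_shape:
  assumes "T \<in> tris \<T>" shows "\<exists>z a b. T = tri z a b \<and> shaped \<sigma> z a b"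
proof -
  obtain t where "t \<in> \<T>" "T = snd t" using assms by (rule imageE)
  then show ?thesis using shape[of t] unfolding marked_shape_def by blast
qed

lemma tris_finite: "finite (tris \<T>)" using finite_mesh by simp

lemma face: "T \<in> tris \<T> \<Longrightarrow> T' \<in> tris \<T> \<Longrightarrow> (T \<inter> T') face_of T"
  using conf unfolding conforming_def triangulation_def by blast

lemma interior_nonempty:
  assumes "T \<in> tris \<T>" shows "interior T \<noteq> {}"
proof -
  obtain z a b where T: "T = tri z a b" "cross2 (a - z) (b - z) \<noteq> 0"
    using tris_shape[OF assms] unfolding shaped_def by blast
  have "aff_dim T = int DIM(R2)" unfolding T(1) aff_dim_tri[OF T(2)] by simp
  then have "rel_interior T = interior T" unfolding aff_dim_eq_full by (rule rel_interior_interior)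
  moreover have "rel_interior T \<noteq> {}" unfolding T(1)
    by (subst rel_interior_eq_empty) auto
  ultimately show ?thesis by simp
qed

text \<open>
  The intersection of two triangles is a face of both, and a face that contains an interior point is
  the whole triangle.
\<close>

lemma interior_unique:
  assumes "T \<in> tris \<T>" "T' \<in> tris \<T>" "x \<in> interior T" "x \<in> T'"
  shows "T = T'"
proof -
  have "x \<in> T \<inter> T'" using assms interior_subset by blast
  then have "T \<inter> T' = T" using face_of_disjoint_interior[OF face[OF assms(1,2)]] assms(3) by blast
  then have sub: "T \<subseteq> T'" by blast
  have "T \<inter> T' face_of T'" using face[OF assms(2,1)] by (simp add: Int_commute)
  then have f: "T face_of T'" using \<open>T \<inter> T' = T\<close> by simp
  have "x \<in> interior T'" using assms(3) interior_mono[OF sub] by blast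
  then show ?thesis using face_of_disjoint_interior[OF f] assms(3) interior_subset by blast
qed

lemma tris_facts:
  assumes "T \<in> tris \<T>"
  shows "compact T" "T \<in> lmeasurable" "T \<in> sets lebesgue" "negligible (frontier T)" "convex T"
    "AE x in lebesgue. x \<in> interior T \<longleftrightarrow> x \<in> T" "aff_dim T = 2" "T \<subseteq> closure \<Omega>"
proof -
  obtain z a b where T: "T = tri z a b" "cross2 (a - z) (b - z) \<noteq> 0"
    using tris_shape[OF assms] unfolding shaped_def by blast
  show "compact T" "T \<in> lmeasurable" "T \<in> sets lebesgue" "negligible (frontier T)" "convex T"
    "AE x in lebesgue. x \<in> interior T \<longleftrightarrow> x \<in> T" "aff_dim T = 2"
    unfolding T(1) using aff_dim_tri[OF T(2)] negligible_frontier_tri AE_interior_tri by auto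
  show "T \<subseteq> closure \<Omega>" using assms cover by blast
qed

lemma interior_subset_domain: "T \<in> tris \<T> \<Longrightarrow> interior T \<subseteq> \<Omega>"
  using interior_mono[OF tris_facts(8)] regular_domain by blast

definition cells :: "R2 set" where "cells = (\<Union>T\<in>tris \<T>. interior T)"

lemma open_cells: "open cells" unfolding cells_def by auto

lemma AE_interior_all: "AE x in lebesgue. \<forall>T\<in>tris \<T>. x \<in> interior T \<longleftrightarrow> x \<in> T"
  using tris_facts(6) by (subst AE_ball_countable[OF countable_finite[OF tris_finite]]) blast

text \<open>The frontiers of the finitely many triangles are null sets.\<close>

lemma AE_cells: "AE x in lebesgue. x \<in> cells \<longleftrightarrow> x \<in> \<Omega>"
  using AE_interior_all
proof eventually_elim
  fix x assume h: "\<forall>T\<in>tris \<T>. x \<in> interior T \<longleftrightarrow> x \<in> T"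
  show "x \<in> cells \<longleftrightarrow> x \<in> \<Omega>"
  proof
    assume "x \<in> cells"
    then obtain T where "T \<in> tris \<T>" "x \<in> interior T" unfolding cells_def by (rule UN_E)
    then show "x \<in> \<Omega>" using interior_subset_domain by (rule_tac subsetD)
  next
    assume "x \<in> \<Omega>"
    then have "x \<in> \<Union>(tris \<T>)" unfolding cover by (rule subsetD[OF closure_subset])
    then obtain T where T: "T \<in> tris \<T>" "x \<in> T" by (rule UnionE)
    then have "x \<in> interior T" using bspec[OF h T(1)] by simp
    then show "x \<in> cells" unfolding cells_def using T(1) by (rule_tac UN_I)
  qed
qed

lemma cells_subset: "cells \<subseteq> \<Omega>" unfolding cells_def using interior_subset_domain by blast

lemma the_cell:
  assumes "T \<in> tris \<T>" "x \<in> interior T"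
  shows "(THE T. T \<in> tris \<T> \<and> x \<in> interior T) = T"
proof (rule the_equality)
  fix T' assume "T' \<in> tris \<T> \<and> x \<in> interior T'"
  then show "T' = T" using interior_unique[of T' T x] assms subsetD[OF interior_subset assms(2)] by simp
qed (use assms in simp)

lemma mesh_size_eq: "T \<in> tris \<T> \<Longrightarrow> x \<in> interior T \<Longrightarrow> mesh_size \<T> x = sqrt (measure lebesgue T)"
  by (simp add: mesh_size_def the_cell)

lemma disjoint_interiors: "\<U> \<subseteq> tris \<T> \<Longrightarrow> disjoint_family_on interior \<U>"
  unfolding disjoint_family_on_def
proof (intro ballI impI equals0I)
  fix T T' x assume "\<U> \<subseteq> tris \<T>" "T \<in> \<U>" "T' \<in> \<U>" "T \<noteq> T'" "x \<in> interior T \<inter> interior T'"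
  then show False
    using interior_unique[of T T' x] subsetD[of \<U> "tris \<T>" T] subsetD[of \<U> "tris \<T>" T']
      subsetD[OF interior_subset, of x T'] by simp
qed

lemma measure_pos: "T \<in> tris \<T> \<Longrightarrow> 0 < measure lebesgue T"
proof -
  assume "T \<in> tris \<T>"
  from tris_shape[OF this] obtain z a b where "T = tri z a b" "cross2 (a - z) (b - z) \<noteq> 0"
    unfolding shaped_def by blast
  then show "0 < measure lebesgue T" using measure_tri[of a z b] by simp
qed

text \<open>The intersection is a proper face of \<open>T1\<close>, hence of dimension at most one, and contains the edge.\<close>

lemma common_edge:
  assumes "T1 \<in> tris \<T>" "T2 \<in> tris \<T>" "T1 \<noteq> T2" "S edge_of T1" "S edge_of T2"
  shows "S = T1 \<inter> T2"
proof (rule ccontr)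
  assume ne: "S \<noteq> T1 \<inter> T2"
  have S: "S face_of T1" "aff_dim S = 1" "S \<subseteq> T1 \<inter> T2"
    using assms edge_of_imp_subset by (auto simp: edge_of_def)
  have F: "T1 \<inter> T2 face_of T1" using face assms by blast
  have "T1 \<inter> T2 \<noteq> T1"
  proof
    assume "T1 \<inter> T2 = T1"
    then have "interior T1 \<subseteq> T2" using interior_subset by blast
    then show False using interior_nonempty[OF assms(1)] interior_unique assms by blast
  qed
  then have "aff_dim (T1 \<inter> T2) < 2"
    using face_of_aff_dim_lt[OF tris_facts(5)[OF assms(1)] F] tris_facts(7)[OF assms(1)] by simp
  moreover have "S face_of (T1 \<inter> T2)" using face_of_subset[OF S(1,3)] by blast
  then have "aff_dim S < aff_dim (T1 \<inter> T2)"
    using face_of_aff_dim_lt ne convex_Int[OF tris_facts(5) tris_facts(5)] assms by blast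
  ultimately show False using S(2) by simp
qed

text \<open>
  One of the finitely many covering triangles contains infinitely many points of the edge.  Its
  intersection with the edge is a face of the edge, and a face of a segment with more than
  one point is the whole segment.
\<close>

lemma edge_of_some_in_cover:
  assumes T: "T \<in> tris \<T>" "S edge_of T" and Q: "Q \<subseteq> \<T>" "S \<subseteq> \<Union>(tris Q)"
  shows "\<exists>T'\<in>tris Q. S edge_of T'"
proof -
  have S: "S face_of T" "aff_dim S = 1" using T by (auto simp: edge_of_def)
  have cS: "convex S" using S(1) face_of_imp_convex by blast
  have fQ: "finite (tris Q)" using finite_subset[OF Q(1) finite_mesh] by simp
  have "infinite S"
  proof
    assume f: "finite S"
    have "connected S" using cS by (rule convex_connected)
    then have "S = {} \<or> (\<exists>x. S = {x})" using f connected_finite_iff_sing by blast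
    then show False using S(2) by auto
  qed
  moreover have "S = (\<Union>T'\<in>tris Q. S \<inter> T')" using Q(2) by blast
  ultimately obtain T' where T': "T' \<in> tris Q" "infinite (S \<inter> T')"
    using fQ by (metis (no_types, lifting) finite_UN_I)
  have T'T: "T' \<in> tris \<T>" using T' Q(1) by blast
  define F where "F = T \<inter> T'"
  have F: "F face_of T" "F face_of T'"
    using face[OF T(1) T'T] face[OF T'T T(1)] by (auto simp: F_def Int_commute)
  have "S \<inter> F face_of S"
    using face_of_Int[OF S(1) F(1)] face_of_subset[of "S \<inter> F" T S] face_of_imp_subset[OF S(1)] by blast
  moreover have "S \<inter> T' = S \<inter> F" using face_of_imp_subset[OF S(1)] by (auto simp: F_def)
  ultimately have SF: "S \<inter> F face_of S" "infinite (S \<inter> F)" using T'(2) by auto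
  have "S \<inter> F = S"
  proof (rule ccontr)
    assume "S \<inter> F \<noteq> S"
    then have "aff_dim (S \<inter> F) < 1" using face_of_aff_dim_lt[OF cS SF(1)] S(2) by simp
    then have "aff_dim (S \<inter> F) = -1 \<or> aff_dim (S \<inter> F) = 0" using aff_dim_geq[of "S \<inter> F"] by linarith
    then have "finite (S \<inter> F)" using aff_dim_eq_0[of "S \<inter> F"] aff_dim_empty[of "S \<inter> F"] by auto
    then show False using SF(2) by simp
  qed
  then have "S face_of F" using face_of_subset[OF S(1), of F] F(1) face_of_imp_subset by blast
  then have "S face_of T'" using F(2) face_of_trans by blast
  then show ?thesis using T'(1) S(2) by (auto simp: edge_of_def)
qed

text \<open>
  Green's formula and the trace lemmas single out the edge opposite to the first vertex; rotating
  the vertices gives any edge this role.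
\<close>

lemma edge_segment:
  assumes "T \<in> tris \<T>" "S edge_of T"
  obtains z a b where "T = tri z a b" "S = closed_segment a b" "cross2 (a - z) (b - z) \<noteq> 0"
proof -
  obtain x y w where T: "T = tri x y w" "cross2 (y - x) (w - x) \<noteq> 0"
    using tris_shape[OF assms(1)] unfolding shaped_def by blast
  consider "S = closed_segment x y" | "S = closed_segment x w" | "S = closed_segment y w"
    using assms(2) edge_of_tri_iff[OF T(2)] T(1) by auto
  then show ?thesis
  proof cases
    case 1
    have "cross2 (x - w) (y - w) \<noteq> 0" using T(2) cross2_rotate[of y x w] cross2_rotate[of w y x] by metis
    then show ?thesis using that[of w x y] 1 T(1) tri_rotate[of x y w] by auto
  next
    case 2
    have "cross2 (w - y) (x - y) \<noteq> 0" using T(2) cross2_rotate[of w y x] cross2_rotate by metis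
    then show ?thesis using that[of y w x] 2 T(1) tri_rotate[of y w x] closed_segment_commute by metis
  next
    case 3 then show ?thesis using that T by blast
  qed
qed

text \<open>
  Conformity excludes hanging nodes, so the sum in \<open>side_integral\<close> over the sides inside a
  side of the same mesh has a single term.
\<close>

lemma sides_in_edge:
  assumes T: "T \<in> tris \<T>" "S edge_of T"
  shows "{S' \<in> sides \<T>. S' \<subseteq> S} = {S}"
proof (intro equalityI subsetI)
  fix S' assume "S' \<in> {S' \<in> sides \<T>. S' \<subseteq> S}"
  then obtain T' where S': "T' \<in> tris \<T>" "S' edge_of T'" "S' \<subseteq> S" by (auto simp: sides_def)
  obtain t where t: "t \<in> \<T>" "snd t = T" using T(1) by auto
  have "S' edge_of T"
    using edge_of_some_in_cover[OF S'(1,2), of "{t}"] t S'(3) edge_of_imp_subset[OF T(2)] by auto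
  then have "S' face_of S" using face_of_subset[of S' T S] S'(3) edge_of_imp_subset[OF T(2)] by (auto simp: edge_of_def)
  then have "S' = S"
    using face_of_aff_dim_lt[of S S'] T(2) \<open>S' edge_of T\<close> face_of_imp_convex by (force simp: edge_of_def)
  then show "S' \<in> {S}" by simp
qed (use T in \<open>auto simp: sides_def\<close>)

lemma sides_finite: "finite (sides \<T>)"
proof -
  have "finite {S. S edge_of T}" if T: "T \<in> tris \<T>" for T
  proof -
    obtain z a b where T: "T = tri z a b" "cross2 (a - z) (b - z) \<noteq> 0"
      using tris_shape[OF T] unfolding shaped_def by blast
    have "{S. S edge_of T} = {closed_segment z a, closed_segment z b, closed_segment a b}"
      unfolding T(1) edge_of_tri_iff[OF T(2)] by auto
    then show ?thesis by simp
  qed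
  then have "finite (\<Union>T\<in>tris \<T>. {S. S edge_of T})" using tris_finite by blast
  moreover have "sides \<T> = (\<Union>T\<in>tris \<T>. {S. S edge_of T})" by (auto simp: sides_def)
  ultimately show ?thesis by simp
qed

text \<open>The two sets differ at most by the frontiers of finitely many triangles.\<close>

lemma AE_region:
  assumes "\<U> \<subseteq> tris \<T>"
  shows "AE x in lebesgue. x \<in> region \<U> \<longleftrightarrow> x \<in> (\<Union>T\<in>\<U>. interior T)"
  using AE_interior_all
proof eventually_elim
  fix x assume h: "\<forall>T\<in>tris \<T>. x \<in> interior T \<longleftrightarrow> x \<in> T"
  have "(\<Union>T\<in>\<U>. interior T) \<subseteq> region \<U>"
    unfolding region_def by (intro UN_least interior_mono) blast
  moreover have "x \<in> (\<Union>T\<in>\<U>. interior T)" if "x \<in> region \<U>"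
  proof -
    have "x \<in> \<Union>\<U>" using that unfolding region_def by (rule subsetD[OF interior_subset])
    then obtain T where T: "T \<in> \<U>" "x \<in> T" by (rule UnionE)
    then have "x \<in> interior T" using bspec[OF h subsetD[OF assms T(1)]] by simp
    then show ?thesis using T(1) by (rule_tac UN_I)
  qed
  ultimately show "x \<in> region \<U> \<longleftrightarrow> x \<in> (\<Union>T\<in>\<U>. interior T)" by (rule_tac iffI) (rule_tac [2] subsetD)
qed

lemma region_integral:
  fixes f :: "R2 \<Rightarrow> 'b::euclidean_space"
  assumes U: "\<U> \<subseteq> tris \<T>" and f: "\<And>T. T \<in> \<U> \<Longrightarrow> set_integrable lebesgue T f"
  shows "(LINT x:region \<U>|lebesgue. f x) = (\<Sum>T\<in>\<U>. LINT x:T|lebesgue. f x)"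
    "set_integrable lebesgue (region \<U>) f"
proof -
  have fin: "finite \<U>" using U tris_finite finite_subset by blast
  have i: "set_integrable lebesgue (interior T) f" "(LINT x:interior T|lebesgue. f x) = (LINT x:T|lebesgue. f x)" if "T \<in> \<U>" for T
    using set_integrable_cong_set_AE[of "interior T" T f] set_LINT_cong_set_AE[of "interior T" T f] tris_facts(6)[of T] f[OF that] U that by auto
  have "(LINT x:region \<U>|lebesgue. f x) = (LINT x:(\<Union>T\<in>\<U>. interior T)|lebesgue. f x)"
    by (rule set_LINT_cong_set_AE[OF AE_region[OF U]])
  also have "\<dots> = (\<Sum>T\<in>\<U>. LINT x:interior T|lebesgue. f x)"
    by (rule set_integral_finite_Union[OF fin disjoint_interiors[OF U] i(1)]) simp_all
  also have "\<dots> = (\<Sum>T\<in>\<U>. LINT x:T|lebesgue. f x)" by (intro sum.cong refl i)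
  finally show "(LINT x:region \<U>|lebesgue. f x) = (\<Sum>T\<in>\<U>. LINT x:T|lebesgue. f x)" .
  have "set_integrable lebesgue (\<Union>T\<in>\<U>. interior T) f"
    by (rule set_integrable_UN[OF fin]) (use i in auto)
  then show "set_integrable lebesgue (region \<U>) f"
    using set_integrable_cong_set_AE[OF AE_region[OF U], of f] by simp
qed

lemma region_all: "region (tris \<T>) = \<Omega>"
  unfolding region_def cover using regular_domain by simp

lemmas domain_integral = region_integral[OF order_refl, unfolded region_all]

end

text \<open>There are finitely many triangles, and the sum of their quotients bounds each of them.\<close>

lemma initial_shapes:
  assumes "initial_mesh \<Omega> \<T>0"
  shows "\<exists>\<sigma>. \<forall>t\<in>\<T>0. marked_shape \<sigma> t"
proof -
  have ex: "\<exists>a b. snd t = tri (fst t) a b \<and> cross2 (a - fst t) (b - fst t) \<noteq> 0" if t: "t \<in> \<T>0" for t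
  proof -
    have "2 simplex (snd t)" and e: "fst t extreme_point_of (snd t)"
      using assms t by (auto simp: initial_mesh_def conforming_def)
    then obtain C where C: "\<not> affine_dependent C" "int (card C) = 2 + 1" "snd t = convex hull C"
      by (auto simp: simplex_def)
    have "fst t \<in> C" using e extreme_point_of_convex_hull_affine_independent[OF C(1)] C(3) by simp
    moreover have "card C = 3" using C(2) by simp
    ultimately have "card (C - {fst t}) = 2" by simp
    then obtain a b where "C - {fst t} = {a, b}" by (auto simp: card_2_iff)
    then have "C = {fst t, a, b}" using \<open>fst t \<in> C\<close> by blast
    then have "snd t = tri (fst t) a b \<and> cross2 (a - fst t) (b - fst t) \<noteq> 0"
      unfolding cross2_iff_independent using C(1,3) \<open>card C = 3\<close> by simp
    then show ?thesis by blast
  qed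
  then obtain A B where AB: "\<And>t. t \<in> \<T>0 \<Longrightarrow> snd t = tri (fst t) (A t) (B t)"
    "\<And>t. t \<in> \<T>0 \<Longrightarrow> cross2 (A t - fst t) (B t - fst t) \<noteq> 0" by metis
  define r where "r t = ((norm (A t - fst t))\<^sup>2 + (norm (B t - fst t))\<^sup>2) / \<bar>cross2 (A t - fst t) (B t - fst t)\<bar>" for t
  have fin: "finite \<T>0" using assms by (simp add: initial_mesh_def)
  have "marked_shape (\<Sum>t\<in>\<T>0. r t) t" if t: "t \<in> \<T>0" for t
  proof -
    have "r t \<le> (\<Sum>t\<in>\<T>0. r t)" by (rule member_le_sum[OF t _ fin]) (auto simp: r_def)
    then have "r t * \<bar>cross2 (A t - fst t) (B t - fst t)\<bar> \<le> (\<Sum>t\<in>\<T>0. r t) * \<bar>cross2 (A t - fst t) (B t - fst t)\<bar>"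
      by (intro mult_right_mono) auto
    then have "shaped (\<Sum>t\<in>\<T>0. r t) (fst t) (A t) (B t)"
      using AB(2)[OF t] by (simp add: shaped_def r_def)
    then show ?thesis using AB(1)[OF t] unfolding marked_shape_def by blast
  qed
  then show ?thesis by blast
qed

lemma marked_shape_choice:
  assumes "\<forall>t\<in>\<T>. marked_shape \<sigma> t"
  shows "\<exists>A B. \<forall>t\<in>\<T>. snd t = tri (fst t) (A t) (B t) \<and> shaped \<sigma> (fst t) (A t) (B t)"
  using assms unfolding marked_shape_def by metis

lemma domain_mesh_of_mesh:
  assumes "polygonal_domain \<Omega>" "initial_mesh \<Omega> \<T>0" "\<forall>t\<in>\<T>0. marked_shape \<sigma> t" "\<T> \<in> meshes \<T>0"
  shows "domain_mesh \<Omega> \<sigma> \<T>"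
proof -
  obtain A B where AB: "\<forall>t\<in>\<T>0. snd t = tri (fst t) (A t) (B t) \<and> shaped \<sigma> (fst t) (A t) (B t)"
    using marked_shape_choice[OF assms(3)] by blast
  obtain F where F: "\<T> = (\<Union>t\<in>\<T>0. F t)" "\<forall>t\<in>\<T>0. tree (fst t) (A t) (B t) (F t)"
    using refinement_trees[of \<T>0 \<T> A B] assms(4) AB by (auto simp: meshes_def shaped_def)
  show ?thesis
  proof
    show "open \<Omega>" "bounded \<Omega>" "\<Omega> = interior (closure \<Omega>)" using assms(1) unfolding polygonal_domain_def by blast+
    show "finite \<T>" using F tree_finite assms(2) by (auto simp: initial_mesh_def)
    show "marked_shape \<sigma> t" if "t \<in> \<T>" for t using that F AB tree_shape by blast
    show "conforming \<T>" using assms(4) by (simp add: meshes_def)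
    have "\<Union>(tris \<T>) = (\<Union>t\<in>\<T>0. \<Union>(tris (F t)))" unfolding F(1) by blast
    also have "\<dots> = (\<Union>t\<in>\<T>0. snd t)"
      using tree_union F(2) AB by (intro SUP_cong refl) auto
    also have "\<dots> = closure \<Omega>" using assms(2) by (simp add: initial_mesh_def)
    finally show "\<Union>(tris \<T>) = closure \<Omega>" .
  qed
qed

section \<open>Green's formula on bisected triangles\<close>

lemma set_LINT_inner:
  fixes g :: "R2 \<Rightarrow> R2"
  assumes "set_integrable lebesgue T g"
  shows "(LINT x:T|lebesgue. g x \<bullet> e) = (LINT x:T|lebesgue. g x) \<bullet> e"
proof -
  have "(\<lambda>x. indicator T x *\<^sub>R (g x \<bullet> e)) = (\<lambda>x. (indicator T x *\<^sub>R g x) \<bullet> e)" by (simp add: fun_eq_iff)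
  then show ?thesis using assms unfolding set_lebesgue_integral_def set_integrable_def
    by (simp only:) (rule integral_inner_left, simp)
qed

lemma negligible_segment: "negligible (closed_segment a (b::R2))"
  by (simp add: negligible_convex_interior interior_closed_segment_ge2)

text \<open>A side that lies on the base and in one child thus lies in the corresponding half of the base.\<close>

lemma child_Int_base:
  assumes c: "cross2 (a - z) (b - z) \<noteq> 0"
  shows "tri (midpoint a b) z a \<inter> closed_segment a b \<subseteq> closed_segment a (midpoint a b)"
proof
  let ?m = "midpoint a b"
  fix x assume x: "x \<in> tri ?m z a \<inter> closed_segment a b"
  obtain u v w where uvw: "x = u *\<^sub>R ?m + v *\<^sub>R z + w *\<^sub>R a" "0 \<le> u" "0 \<le> v" "0 \<le> w" "u + v + w = 1"
    using x unfolding convex_hull_3 by auto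
  have "x \<in> closed_segment a b" using x by simp
  then obtain t where t: "x = (1 - t) *\<^sub>R a + t *\<^sub>R b" unfolding in_segment by blast
  have "cross2 (x - ?m) (a - ?m) = 0"
    unfolding t by (simp add: cross2_def midpoint_nth field_simps)
  moreover have eq: "x - ?m = v *\<^sub>R (z - ?m) + w *\<^sub>R (a - ?m)"
  proof -
    have u: "u = 1 - v - w" using uvw(5) by simp
    show ?thesis unfolding uvw(1) u by (simp add: algebra_simps)
  qed
  have "cross2 (x - ?m) (a - ?m) = v * cross2 (z - ?m) (a - ?m)"
    unfolding eq by (simp add: cross2_def algebra_simps)
  ultimately have "v = 0" using c by (simp add: cross2_children)
  then have w: "w = 1 - u" using uvw(5) by simp
  have "x = (1 - u) *\<^sub>R a + u *\<^sub>R ?m" unfolding uvw(1) \<open>v = 0\<close> w by simp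
  moreover have "0 \<le> u" "u \<le> 1" using uvw(2,4) w by simp_all
  ultimately show "x \<in> closed_segment a ?m" unfolding in_segment by blast
qed

text \<open>The segment is a null set, so integrals over the two children add up.\<close>

lemma children_Int:
  assumes c: "cross2 (a - z) (b - z) \<noteq> 0"
  shows "tri (midpoint a b) z a \<inter> tri (midpoint a b) z b \<subseteq> closed_segment z (midpoint a b)"
proof
  let ?m = "midpoint a b"
  fix x assume x: "x \<in> tri ?m z a \<inter> tri ?m z b"
  obtain u v w where uvw: "x = u *\<^sub>R ?m + v *\<^sub>R z + w *\<^sub>R a" "0 \<le> u" "0 \<le> v" "0 \<le> w" "u + v + w = 1"
    using x unfolding convex_hull_3 by auto
  obtain u' v' w' where uvw': "x = u' *\<^sub>R ?m + v' *\<^sub>R z + w' *\<^sub>R b" "0 \<le> u'" "0 \<le> v'" "0 \<le> w'" "u' + v' + w' = 1"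
    using x unfolding convex_hull_3 by auto
  have eq: "x - ?m = v *\<^sub>R (z - ?m) + w *\<^sub>R (a - ?m)"
  proof -
    have u: "u = 1 - v - w" using uvw(5) by simp
    show ?thesis unfolding uvw(1) u by (simp add: algebra_simps)
  qed
  have 1: "cross2 (z - ?m) (x - ?m) = w * cross2 (z - ?m) (a - ?m)" unfolding eq by (simp add: cross2_def algebra_simps)
  have eq': "x - ?m = v' *\<^sub>R (z - ?m) + w' *\<^sub>R (b - ?m)"
  proof -
    have u': "u' = 1 - v' - w'" using uvw'(5) by simp
    show ?thesis unfolding uvw'(1) u' by (simp add: algebra_simps)
  qed
  have 2: "cross2 (z - ?m) (x - ?m) = w' * cross2 (z - ?m) (b - ?m)" unfolding eq' by (simp add: cross2_def algebra_simps)
  have "(w + w') * cross2 (a - z) (b - z) = 0" using 1 2 unfolding cross2_children by (simp add: algebra_simps)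
  then have "w = 0" using c uvw(4) uvw'(4) by simp
  then have v: "v = 1 - u" using uvw(5) by simp
  have "x = (1 - u) *\<^sub>R z + u *\<^sub>R ?m" unfolding uvw(1) \<open>w = 0\<close> v by simp
  moreover have "0 \<le> u" "u \<le> 1" using uvw(2,3) v by simp_all
  ultimately show "x \<in> closed_segment z ?m" unfolding in_segment by blast
qed

context domain_mesh
begin

text \<open>
  The properties shared by the functions in \<open>CR\<close> and in \<open>H10\<close>: Green's formula on each triangle, means
  that agree on both sides of an edge, and vanishing means on the boundary.  They suffice for
  interpolation and allow to treat the discrete and the continuous problem together.
\<close>

definition regular :: "(R2 \<Rightarrow> real) \<Rightarrow> (R2 \<Rightarrow> R2) \<Rightarrow> bool" where
  "regular v g \<longleftrightarrow>
    (\<forall>T\<in>tris \<T>. set_integrable lebesgue T g) \<and>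
    (\<forall>z a b. tri z a b \<in> tris \<T> \<longrightarrow> cross2 (a - z) (b - z) \<noteq> 0 \<longrightarrow>
      (LINT x:tri z a b|lebesgue. g x \<bullet> (a - z))
        = 2 * measure lebesgue (tri z a b) * (edge_mean (tri z a b) v a b - edge_mean (tri z a b) v z b)) \<and>
    (\<forall>T1\<in>tris \<T>. \<forall>T2\<in>tris \<T>. \<forall>S. S edge_of T1 \<longrightarrow> S edge_of T2 \<longrightarrow>
      seg_integral S (trace_on T1 S v) = seg_integral S (trace_on T2 S v)) \<and>
    (\<forall>T\<in>tris \<T>. \<forall>S. S edge_of T \<longrightarrow> S \<subseteq> frontier \<Omega> \<longrightarrow> seg_integral S (trace_on T S v) = 0)"

definition side_mean :: "(R2 \<Rightarrow> real) \<Rightarrow> R2 \<Rightarrow> R2 \<Rightarrow> real" where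
  "side_mean v a b = side_integral \<T> (closed_segment a b) v / dist a b"

lemma side_mean_commute: "side_mean v a b = side_mean v b a"
  by (simp add: side_mean_def closed_segment_commute dist_commute)

lemma chosen_tri:
  assumes "S \<in> sides \<T>"
  shows "(SOME T. T \<in> tris \<T> \<and> S edge_of T) \<in> tris \<T>" "S edge_of (SOME T. T \<in> tris \<T> \<and> S edge_of T)"
proof -
  have "\<exists>T. T \<in> tris \<T> \<and> S edge_of T" using assms unfolding sides_def by blast
  from someI_ex[OF this] show "(SOME T. T \<in> tris \<T> \<and> S edge_of T) \<in> tris \<T>" "S edge_of (SOME T. T \<in> tris \<T> \<and> S edge_of T)"
    by blast+
qed

lemma side_integral_edge:
  assumes "regular v g" "T \<in> tris \<T>" "S edge_of T"
  shows "side_integral \<T> S v = seg_integral S (trace_on T S v)"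
proof -
  have S: "S \<in> sides \<T>" using assms(2,3) unfolding sides_def by blast
  have "side_integral \<T> S v = seg_integral S (trace_on (SOME T. T \<in> tris \<T> \<and> S edge_of T) S v)"
    unfolding side_integral_def sides_in_edge[OF assms(2,3)] by simp
  also have "\<dots> = seg_integral S (trace_on T S v)"
    using assms chosen_tri[OF S] unfolding regular_def by blast
  finally show ?thesis .
qed

lemma side_mean_edge:
  assumes "regular v g" "tri z a b \<in> tris \<T>" "cross2 (a - z) (b - z) \<noteq> 0"
  shows "side_mean v a b = edge_mean (tri z a b) v a b"
proof -
  have "closed_segment a b edge_of (tri z a b)" using edge_of_tri_iff[OF assms(3)] by simp
  from side_integral_edge[OF assms(1,2) this] show ?thesis
    using distinct_of_cross2[OF assms(3)] by (simp add: side_mean_def seg_integral_eq edge_mean_def)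
qed

lemma side_integral_boundary:
  assumes "regular v g" "S \<subseteq> frontier \<Omega>"
  shows "side_integral \<T> S v = 0"
  unfolding side_integral_def
proof (rule sum.neutral, rule ballI)
  fix S' assume S': "S' \<in> {S' \<in> sides \<T>. S' \<subseteq> S}"
  then have "S' \<subseteq> frontier \<Omega>" using assms(2) by blast
  moreover have "S' \<in> sides \<T>" using S' by blast
  ultimately show "seg_integral S' (trace_on (SOME T. T \<in> tris \<T> \<and> S' edge_of T) S' v) = 0"
    using assms(1) chosen_tri[of S'] unfolding regular_def by blast
qed

text \<open>
  No side of the mesh inside \<open>[a, b]\<close> crosses the midpoint: it is an edge of a triangle inside one of
  the two children.
\<close>

lemma side_mean_halves:
  assumes c: "cross2 (a - z) (b - z) \<noteq> 0"
    and Q: "Q1 \<subseteq> \<T>" "Q2 \<subseteq> \<T>" "\<Union>(tris Q1) = tri (midpoint a b) z a" "\<Union>(tris Q2) = tri (midpoint a b) z b"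
  shows "side_mean v a b = (side_mean v a (midpoint a b) + side_mean v (midpoint a b) b) / 2"
proof -
  let ?m = "midpoint a b"
  let ?A = "{S' \<in> sides \<T>. S' \<subseteq> closed_segment a ?m}"
  let ?B = "{S' \<in> sides \<T>. S' \<subseteq> closed_segment ?m b}"
  have ab: "a \<noteq> b" using distinct_of_cross2[OF c] by simp
  have segs: "closed_segment a ?m \<subseteq> closed_segment a b" "closed_segment ?m b \<subseteq> closed_segment a b"
    by (simp_all add: subset_closed_segment)
  have c': "cross2 (b - z) (a - z) \<noteq> 0" using c cross2_swap[of b z a] by simp
  have base: "closed_segment a b \<subseteq> \<Union>(tris (Q1 \<union> Q2))"
  proof -
    have "closed_segment a b \<subseteq> tri z a b" unfolding segment_convex_hull by (rule hull_mono) auto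
    then show ?thesis using Q(3,4) tri_eq_Un_children[of z a b] by (simp add: image_Un)
  qed
  have split: "{S' \<in> sides \<T>. S' \<subseteq> closed_segment a b} = ?A \<union> ?B"
  proof (intro equalityI subsetI)
    fix S assume S: "S \<in> {S' \<in> sides \<T>. S' \<subseteq> closed_segment a b}"
    then obtain T where T: "T \<in> tris \<T>" "S edge_of T" by (auto simp: sides_def)
    have "S \<subseteq> \<Union>(tris (Q1 \<union> Q2))" using S base by blast
    moreover have "Q1 \<union> Q2 \<subseteq> \<T>" using Q(1,2) by simp
    ultimately obtain T' where T': "T' \<in> tris (Q1 \<union> Q2)" "S edge_of T'"
      using edge_of_some_in_cover[OF T, of "Q1 \<union> Q2"] by blast
    have ST': "S \<subseteq> T'" using T'(2) by (rule edge_of_imp_subset)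
    have "S \<subseteq> tri ?m z a \<or> S \<subseteq> tri ?m z b"
      using T'(1) ST' Q(3,4) unfolding image_Un by blast
    then have "S \<subseteq> closed_segment a ?m \<or> S \<subseteq> closed_segment ?m b"
      using S child_Int_base[OF c] child_Int_base[OF c', unfolded midpoint_sym[of b a]]
      by (auto simp: closed_segment_commute[of b])
    then show "S \<in> ?A \<union> ?B" using S by blast
  qed (use segs in auto)
  have disj: "?A \<inter> ?B = {}"
  proof (rule equals0I)
    fix S assume S: "S \<in> ?A \<inter> ?B"
    then have "S \<subseteq> closed_segment a ?m \<inter> closed_segment ?m b" by blast
    also have "\<dots> = {?m}" by (rule Int_closed_segment) simp
    finally have "aff_dim S \<le> 0" using aff_dim_subset[of S "{?m}"] by simp
    moreover have "S \<in> sides \<T>" using S by blast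
    then have "aff_dim S = 1" by (auto simp: sides_def edge_of_def)
    ultimately show False by simp
  qed
  have "side_integral \<T> (closed_segment a b) v
      = side_integral \<T> (closed_segment a ?m) v + side_integral \<T> (closed_segment ?m b) v"
    unfolding side_integral_def split
    by (rule sum.union_disjoint) (use disj sides_finite in auto)
  then have sum: "side_integral \<T> (closed_segment a b) v
      = side_integral \<T> (closed_segment a ?m) v + side_integral \<T> (closed_segment ?m b) v" .
  have dm: "dist a ?m = dist a b / 2" "dist ?m b = dist a b / 2"
    by (simp_all add: dist_midpoint)
  show ?thesis unfolding side_mean_def dm sum using ab by (simp add: field_simps)
qed

text \<open>
  By induction on the tree.  The formulas on the two children are added; the mean over their common
  edge depends only on the edge, so it cancels, and the means over the two halves of the base
  combine to the mean over the base.  At the leaves this is Green's formula for regular functions.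
\<close>

lemma green_tree:
  assumes r: "regular v g" and t: "tree z a b Q" and "Q \<subseteq> \<T>" "cross2 (a - z) (b - z) \<noteq> 0"
  shows "set_integrable lebesgue (tri z a b) g
    \<and> (LINT x:tri z a b|lebesgue. g x) \<bullet> (a - z) = 2 * measure lebesgue (tri z a b) * (side_mean v a b - side_mean v z b)
    \<and> (LINT x:tri z a b|lebesgue. g x) \<bullet> (b - z) = 2 * measure lebesgue (tri z a b) * (side_mean v a b - side_mean v z a)"
  using t assms(3,4)
proof (induction rule: tree.induct)
  case (leaf z a b)
  have T: "tri z a b \<in> tris \<T>" using leaf(1) by force
  have c': "cross2 (b - z) (a - z) \<noteq> 0" using leaf(2) cross2_swap[of b z a] by simp
  have cab: "cross2 (b - a) (z - a) \<noteq> 0" "cross2 (z - b) (a - b) \<noteq> 0" "cross2 (a - b) (z - b) \<noteq> 0"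
    using leaf(2) by (auto simp: cross2_def algebra_simps)
  have i: "set_integrable lebesgue (tri z a b) g" using r T unfolding regular_def by blast
  have G: "\<And>z a b. tri z a b \<in> tris \<T> \<Longrightarrow> cross2 (a - z) (b - z) \<noteq> 0 \<Longrightarrow>
      (LINT x:tri z a b|lebesgue. g x \<bullet> (a - z))
        = 2 * measure lebesgue (tri z a b) * (edge_mean (tri z a b) v a b - edge_mean (tri z a b) v z b)"
    using r unfolding regular_def by blast
  have m1: "edge_mean (tri z a b) v a b = side_mean v a b" using side_mean_edge[OF r T leaf(2)] by simp
  have m2: "edge_mean (tri z a b) v z b = side_mean v z b"
    using side_mean_edge[OF r, of a b z] T cab(1) tri_rotate[of a b z]
    by (simp add: edge_mean_commute[of _ v b z] side_mean_commute[of v b z])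
  have m3: "edge_mean (tri z a b) v z a = side_mean v z a"
    using side_mean_edge[OF r, of b z a] T cab(2) tri_rotate[of z a b] by simp
  have "(LINT x:tri z a b|lebesgue. g x) \<bullet> (a - z) = 2 * measure lebesgue (tri z a b) * (side_mean v a b - side_mean v z b)"
    using G[OF T leaf(2)] unfolding set_LINT_inner[OF i] m1 m2 .
  moreover have "(LINT x:tri z a b|lebesgue. g x) \<bullet> (b - z) = 2 * measure lebesgue (tri z a b) * (side_mean v a b - side_mean v z a)"
    using G[of z b a] T c' unfolding tri_swap[of z b a] set_LINT_inner[OF i] edge_mean_commute[of _ v b a] m1 m3 by blast
  ultimately show ?case using i by blast
next
  case (node a b z Q1 Q2)
  let ?m = "midpoint a b"
  let ?T1 = "tri ?m z a" and ?T2 = "tri ?m z b"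
  define \<mu> where "\<mu> = measure lebesgue (tri z a b)"
  have c: "cross2 (z - ?m) (a - ?m) \<noteq> 0" "cross2 (z - ?m) (b - ?m) \<noteq> 0"
    using node.prems(2) unfolding cross2_children by auto
  have Q: "Q1 \<subseteq> \<T>" "Q2 \<subseteq> \<T>" using node.prems(1) by auto
  note IH1 = node.IH(1)[OF Q(1) c(1)] and IH2 = node.IH(2)[OF Q(2) c(2)]
  note mm = measure_children[OF node.prems(2), folded \<mu>_def]
  have T: "tri z a b = ?T1 \<union> ?T2" by (rule tri_eq_Un_children)
  have i1: "set_integrable lebesgue ?T1 g" and i2: "set_integrable lebesgue ?T2 g" using IH1 IH2 by auto
  have i: "set_integrable lebesgue (tri z a b) g"
    unfolding T by (rule set_integrable_Un[OF i1 i2]) simp_all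
  have I: "(LINT x:tri z a b|lebesgue. g x) = (LINT x:?T1|lebesgue. g x) + (LINT x:?T2|lebesgue. g x)"
    unfolding T
  proof (rule set_integral_Un_AE[OF _ _ _ i1 i2])
    show "AE x in lebesgue. \<not> (x \<in> ?T1 \<and> x \<in> ?T2)"
      using AE_not_in_negligible[OF negligible_segment[of z ?m]]
      by eventually_elim (use children_Int[OF node.prems(2)] in blast)
  qed simp_all
  define I1 where "I1 = (LINT x:?T1|lebesgue. g x)"
  define I2 where "I2 = (LINT x:?T2|lebesgue. g x)"
  have e1: "I1 \<bullet> (z - ?m) = \<mu> * (side_mean v z a - side_mean v ?m a)" "I1 \<bullet> (a - ?m) = \<mu> * (side_mean v z a - side_mean v ?m z)"
    using IH1 by (simp_all add: mm I1_def)
  have e2: "I2 \<bullet> (z - ?m) = \<mu> * (side_mean v z b - side_mean v ?m b)" "I2 \<bullet> (b - ?m) = \<mu> * (side_mean v z b - side_mean v ?m z)"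
    using IH2 by (simp_all add: mm I2_def)
  have half: "2 * side_mean v a b = side_mean v ?m a + side_mean v ?m b"
    using side_mean_halves[OF node.prems(2) Q tree_union[OF node.hyps(1)] tree_union[OF node.hyps(2)], of v]
    by (simp add: side_mean_commute[of v a ?m])
  have d: "a - z = (a - ?m) - (z - ?m)" "a - z = - (b - ?m) - (z - ?m)"
    "b - z = (b - ?m) - (z - ?m)" "b - z = - (a - ?m) - (z - ?m)"
    by (simp_all add: vec_eq_iff midpoint_nth field_simps)
  have "I1 \<bullet> (a - z) = \<mu> * (side_mean v ?m a - side_mean v ?m z)"
  proof -
    have "I1 \<bullet> (a - z) = I1 \<bullet> (a - ?m) - I1 \<bullet> (z - ?m)"
      by (subst d(1)) (simp only: inner_diff_right inner_minus_right)
    then show ?thesis unfolding e1 by (simp add: algebra_simps)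
  qed
  moreover have "I2 \<bullet> (a - z) = \<mu> * (side_mean v ?m z + side_mean v ?m b - 2 * side_mean v z b)"
  proof -
    have "I2 \<bullet> (a - z) = - (I2 \<bullet> (b - ?m)) - I2 \<bullet> (z - ?m)"
      by (subst d(2)) (simp only: inner_diff_right inner_minus_right)
    then show ?thesis unfolding e2 by (simp add: algebra_simps)
  qed
  \<comment> \<open>the mean over the common edge \<open>[z, ?m]\<close> has cancelled\<close>
  ultimately have A: "(I1 + I2) \<bullet> (a - z) = \<mu> * (side_mean v ?m a + side_mean v ?m b - 2 * side_mean v z b)"
    by (simp add: inner_add_left algebra_simps)
  have "I2 \<bullet> (b - z) = \<mu> * (side_mean v ?m b - side_mean v ?m z)"
  proof -
    have "I2 \<bullet> (b - z) = I2 \<bullet> (b - ?m) - I2 \<bullet> (z - ?m)"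
      by (subst d(3)) (simp only: inner_diff_right inner_minus_right)
    then show ?thesis unfolding e2 by (simp add: algebra_simps)
  qed
  moreover have "I1 \<bullet> (b - z) = \<mu> * (side_mean v ?m z + side_mean v ?m a - 2 * side_mean v z a)"
  proof -
    have "I1 \<bullet> (b - z) = - (I1 \<bullet> (a - ?m)) - I1 \<bullet> (z - ?m)"
      by (subst d(4)) (simp only: inner_diff_right inner_minus_right)
    then show ?thesis unfolding e1 by (simp add: algebra_simps)
  qed
  ultimately have B: "(I1 + I2) \<bullet> (b - z) = \<mu> * (side_mean v ?m a + side_mean v ?m b - 2 * side_mean v z a)"
    by (simp add: inner_add_left algebra_simps)
  show ?case
    unfolding I I1_def[symmetric] I2_def[symmetric] \<mu>_def[symmetric] A B half[symmetric]
    using i by (simp add: algebra_simps)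
qed

end

section \<open>Piecewise gradients\<close>

text \<open>
  The compact set \<open>K \<inter> V\<close> lies in the open set \<open>V\<close>, and \<open>f\<close> vanishes on the rest of \<open>V\<close>.  The
  product is therefore zero near the frontier of \<open>V\<close> and inherits the smoothness of \<open>f\<close>.
\<close>

lemma C_k_cutoff:
  assumes "open V" "compact K" "compact (K \<inter> V)" "C_k k f" "\<And>x. x \<notin> K \<Longrightarrow> f x = 0"
  shows "C_k k (\<lambda>x. indicator V x * f x)"
  using assms(4,5)
proof (induction k arbitrary: f)
  case 0
  have cf: "continuous_on UNIV f" using 0 by simp
  have "continuous_on V (\<lambda>x. indicator V x * f x)"
    using continuous_on_subset[OF cf, of V] by (subst continuous_on_cong[of V V _ f]) auto
  moreover have "continuous_on (- (K \<inter> V)) (\<lambda>x. indicator V x * f x)"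
    by (subst continuous_on_cong[of "- (K \<inter> V)" "- (K \<inter> V)" _ "\<lambda>x. 0"]) (auto simp: 0(2) indicator_def)
  moreover have "open (- (K \<inter> V))" using assms(3) by (intro open_Compl compact_imp_closed)
  ultimately have "continuous_on (V \<union> - (K \<inter> V)) (\<lambda>x. indicator V x * f x)"
    using assms(1) by (intro continuous_on_open_Un)
  moreover have "V \<union> - (K \<inter> V) = UNIV" by auto
  ultimately show ?case by simp
next
  case (Suc k)
  then obtain g where g: "\<And>x. GDERIV f x :> g x" "\<And>i. C_k k (\<lambda>x. g x $ i)" by auto
  have g0: "g x = 0" if "x \<notin> K" for x
  proof (rule GDERIV_vanish[OF g(1)])
    show "open (- K)" using assms(2) by (intro open_Compl compact_imp_closed)
  qed (use that Suc.prems(2) in auto)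
  show ?case
  proof (rule C_k_SucI)
    fix x
    show "GDERIV (\<lambda>x. indicator V x * f x) x :> indicator V x *\<^sub>R g x"
    proof (cases "x \<in> V")
      case True
      have "(f has_derivative (\<lambda>h. h \<bullet> g x)) (at x)" using g(1) by (simp add: gderiv_def)
      then have "((\<lambda>x. indicator V x * f x) has_derivative (\<lambda>h. h \<bullet> g x)) (at x)"
        by (rule has_derivative_transform_within_open[OF _ assms(1) True]) simp
      then show ?thesis using True by (simp add: gderiv_def)
    next
      case False
      have o: "open (- (K \<inter> V))" using assms(3) by (intro open_Compl compact_imp_closed)
      have "((\<lambda>x. 0) has_derivative (\<lambda>h. 0)) (at x)" by simp
      then have "((\<lambda>x. indicator V x * f x) has_derivative (\<lambda>h. 0)) (at x)"
        by (rule has_derivative_transform_within_open[OF _ o]) (use False Suc.prems(2) in \<open>auto simp: indicator_def\<close>)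
      then show ?thesis using False by (simp add: gderiv_def)
    qed
  next
    fix i
    have "C_k k (\<lambda>x. indicator V x * (g x $ i))" by (rule Suc.IH[OF g(2)]) (simp add: g0)
    then show "C_k k (\<lambda>x. (indicator V x *\<^sub>R g x) $ i)" by simp
  qed
qed

context domain_mesh
begin

text \<open>Removing the other open triangles from \<open>K\<close> leaves a compact set.\<close>

lemma compact_Int_interior:
  assumes "compact K" "K \<subseteq> cells" "T \<in> tris \<T>"
  shows "compact (K \<inter> interior T)"
proof -
  have "K \<inter> interior T = K - (\<Union>T'\<in>tris \<T> - {T}. interior T')"
  proof (intro equalityI subsetI)
    fix x assume x: "x \<in> K \<inter> interior T"
    have "x \<notin> interior T'" if T': "T' \<in> tris \<T> - {T}" for T'
    proof
      assume "x \<in> interior T'"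
      then have "T = T'" using interior_unique[OF assms(3), of T' x] T' x subsetD[OF interior_subset, of x T'] by blast
      then show False using T' by simp
    qed
    then show "x \<in> K - (\<Union>T'\<in>tris \<T> - {T}. interior T')" using x by blast
  next
    fix x assume x: "x \<in> K - (\<Union>T'\<in>tris \<T> - {T}. interior T')"
    then have "x \<in> cells" using assms(2) by (intro subsetD[OF assms(2)]) simp
    then obtain T' where T': "T' \<in> tris \<T>" "x \<in> interior T'" unfolding cells_def by (rule UN_E)
    have "T' = T"
    proof (rule ccontr)
      assume "T' \<noteq> T"
      then have "x \<in> (\<Union>T'\<in>tris \<T> - {T}. interior T')" using T' by (rule_tac UN_I[of T']) simp_all
      then show False using x by blast
    qed
    then show "x \<in> K \<inter> interior T" using x T'(2) by blast
  qed
  moreover have "open (\<Union>T'\<in>tris \<T> - {T}. interior T')" by auto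
  ultimately show ?thesis using assms(1) by (simp add: compact_diff)
qed

lemma cells_sum:
  fixes f :: "R2 \<Rightarrow> 'b::euclidean_space"
  assumes "\<And>T. T \<in> tris \<T> \<Longrightarrow> set_integrable lebesgue (interior T) f"
  shows "(LINT x:cells|lebesgue. f x) = (\<Sum>T\<in>tris \<T>. LINT x:interior T|lebesgue. f x)"
  unfolding cells_def
  by (rule set_integral_finite_Union[OF tris_finite disjoint_interiors[OF order_refl] assms]) simp_all

text \<open>
  The support of a test function on the union of the open triangles splits into separate compact
  pieces, one in each triangle, and each piece is the support of a test function there.
\<close>

lemma has_weak_grad_cells:
  assumes w: "\<And>T. T \<in> tris \<T> \<Longrightarrow> has_weak_grad (interior T) v g"
  shows "has_weak_grad cells v g"
  unfolding has_weak_grad_def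
proof (intro conjI allI impI)
  fix K assume K: "compact K \<and> K \<subseteq> cells"
  have KT: "compact (K \<inter> interior T)" if "T \<in> tris \<T>" for T
    using compact_Int_interior[OF _ _ that] K by blast
  have eq: "K = (\<Union>T\<in>tris \<T>. K \<inter> interior T)" using K unfolding cells_def by blast
  have i: "set_integrable lebesgue (K \<inter> interior T) v" "set_integrable lebesgue (K \<inter> interior T) g" if "T \<in> tris \<T>" for T
    using w[OF that] KT[OF that] unfolding has_weak_grad_def by blast+
  have m: "K \<inter> interior T \<in> sets lebesgue" if "T \<in> tris \<T>" for T
    by (rule fmeasurableD[OF lmeasurable_compact[OF KT[OF that]]])
  have "set_integrable lebesgue (\<Union>T\<in>tris \<T>. K \<inter> interior T) v" "set_integrable lebesgue (\<Union>T\<in>tris \<T>. K \<inter> interior T) g"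
    by (rule set_integrable_UN[OF tris_finite i(1) m] set_integrable_UN[OF tris_finite i(2) m]; assumption)+
  then show "set_integrable lebesgue K v" "set_integrable lebesgue K g" unfolding eq[symmetric] by blast+
next
  fix \<phi> assume t: "test_fun cells \<phi>"
  obtain K where K: "compact K" "K \<subseteq> cells" "\<forall>x. x \<notin> K \<longrightarrow> \<phi> x = 0" "\<forall>x. x \<notin> K \<longrightarrow> grad \<phi> x = 0" "smooth \<phi>"
    using test_fun_support[OF t] by (elim exE conjE) (rule that)
  define \<psi> where "\<psi> T x = indicator (interior T) x * \<phi> x" for T x
  have test: "test_fun (interior T) (\<psi> T)" if T: "T \<in> tris \<T>" for T
  proof (rule test_funI)
    show "compact (K \<inter> interior T)" using compact_Int_interior[OF K(1,2) T] .
    show "smooth (\<psi> T)" unfolding smooth_def \<psi>_def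
    proof
      fix k show "C_k k (\<lambda>x. indicator (interior T) x * \<phi> x)"
        by (rule C_k_cutoff[OF open_interior K(1) \<open>compact (K \<inter> interior T)\<close>])
          (use K in \<open>auto simp: smooth_def\<close>)
    qed
  qed (use K(3) in \<open>auto simp: \<psi>_def indicator_def\<close>)
  have gr: "grad (\<psi> T) x = grad \<phi> x" if "x \<in> interior T" for T x
  proof (rule grad_eqI)
    have "(\<phi> has_derivative (\<lambda>h. h \<bullet> grad \<phi> x)) (at x)"
      using smooth_GDERIV(1)[OF K(5)] by (simp add: gderiv_def)
    then have "(\<psi> T has_derivative (\<lambda>h. h \<bullet> grad \<phi> x)) (at x)"
      by (rule has_derivative_transform_within_open[OF _ open_interior that]) (simp add: \<psi>_def)
    then show "GDERIV (\<psi> T) x :> grad \<phi> x" by (simp add: gderiv_def)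
  qed
  have c1: "set_integrable lebesgue (interior T) (\<lambda>x. v x *\<^sub>R grad \<phi> x) = set_integrable lebesgue (interior T) (\<lambda>x. v x *\<^sub>R grad (\<psi> T) x)"
    "(LINT x:interior T|lebesgue. v x *\<^sub>R grad \<phi> x) = (LINT x:interior T|lebesgue. v x *\<^sub>R grad (\<psi> T) x)"
    "set_integrable lebesgue (interior T) (\<lambda>x. \<phi> x *\<^sub>R g x) = set_integrable lebesgue (interior T) (\<lambda>x. \<psi> T x *\<^sub>R g x)"
    "(LINT x:interior T|lebesgue. \<phi> x *\<^sub>R g x) = (LINT x:interior T|lebesgue. \<psi> T x *\<^sub>R g x)" for T
    by (intro set_integrable_cong set_lebesgue_integral_cong; simp add: gr \<psi>_def)+
  have i: "set_integrable lebesgue (interior T) (\<lambda>x. v x *\<^sub>R grad \<phi> x)" "set_integrable lebesgue (interior T) (\<lambda>x. \<phi> x *\<^sub>R g x)"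
    if T: "T \<in> tris \<T>" for T
    unfolding c1 using weak_grad_test_integrable[OF w[OF T] test[OF T]] by blast+
  have "(LINT x:cells|lebesgue. v x *\<^sub>R grad \<phi> x) = (\<Sum>T\<in>tris \<T>. LINT x:interior T|lebesgue. v x *\<^sub>R grad \<phi> x)"
    by (rule cells_sum[OF i(1)])
  also have "\<dots> = (\<Sum>T\<in>tris \<T>. - (LINT x:interior T|lebesgue. \<phi> x *\<^sub>R g x))"
    by (rule sum.cong[OF refl]) (use w test in \<open>simp add: c1 has_weak_grad_def\<close>)
  also have "\<dots> = - (\<Sum>T\<in>tris \<T>. LINT x:interior T|lebesgue. \<phi> x *\<^sub>R g x)" by (rule sum_negf)
  also have "(\<Sum>T\<in>tris \<T>. LINT x:interior T|lebesgue. \<phi> x *\<^sub>R g x) = (LINT x:cells|lebesgue. \<phi> x *\<^sub>R g x)"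
    by (rule cells_sum[OF i(2), symmetric])
  finally show "(LINT x:cells|lebesgue. v x *\<^sub>R grad \<phi> x) = - (LINT x:cells|lebesgue. \<phi> x *\<^sub>R g x)" .
qed

lemma nc_grad_eq: "nc_grad \<T> v = weak_grad cells v"
  by (simp add: nc_grad_def cells_def)

lemma piecewise_L2:
  fixes g :: "R2 \<Rightarrow> 'b::euclidean_space"
  assumes "\<And>T. T \<in> tris \<T> \<Longrightarrow> \<exists>h. h \<in> L2 \<Omega> \<and> (AE x in lebesgue. x \<in> T \<longrightarrow> g x = h x)"
  shows "g \<in> L2 \<Omega>"
proof -
  have "\<forall>T\<in>tris \<T>. \<exists>h. h \<in> L2 \<Omega> \<and> (AE x in lebesgue. x \<in> T \<longrightarrow> g x = h x)"
    by (intro ballI) (rule assms)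
  from bchoice[OF this] obtain h where h0: "\<forall>T\<in>tris \<T>. h T \<in> L2 \<Omega> \<and> (AE x in lebesgue. x \<in> T \<longrightarrow> g x = h T x)"
    by (rule exE)
  have h: "h T \<in> L2 \<Omega>" "AE x in lebesgue. x \<in> T \<longrightarrow> g x = h T x" if "T \<in> tris \<T>" for T
    using bspec[OF h0 that] by simp_all
  define f where "f x = (\<Sum>T\<in>tris \<T>. indicat_real (interior T) x *\<^sub>R h T x)" for x
  have sum: "(\<lambda>x. \<Sum>T\<in>U. indicat_real (interior T) x *\<^sub>R h T x) \<in> L2 \<Omega>" if "finite U" "U \<subseteq> tris \<T>" for U
    using that
  proof (induction rule: finite_induct)
    case empty show ?case by (simp add: L2_zero)
  next
    case (insert T U)
    have "(\<lambda>x. indicat_real (interior T) x *\<^sub>R h T x) \<in> L2 \<Omega>"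
    proof (rule L2_mult_bounded[OF domain_sets _ _ AE_I2])
      show "h T \<in> L2 \<Omega>" using h(1) insert.prems by simp
      show "set_borel_measurable lebesgue \<Omega> (indicat_real (interior T))"
        unfolding set_borel_measurable_def by (intro borel_measurable_scaleR borel_measurable_indicator domain_sets) simp
      show "x \<in> \<Omega> \<longrightarrow> \<bar>indicat_real (interior T) x\<bar> \<le> 1" for x by simp
    qed
    moreover have "(\<lambda>x. \<Sum>T\<in>U. indicat_real (interior T) x *\<^sub>R h T x) \<in> L2 \<Omega>"
      by (rule insert.IH) (use insert.prems in simp)
    ultimately show ?case unfolding sum.insert[OF insert.hyps] by (rule L2_add)
  qed
  have "f \<in> L2 \<Omega>" unfolding f_def by (rule sum[OF tris_finite order_refl])
  moreover have "AE x in lebesgue. x \<in> \<Omega> \<longrightarrow> f x = g x"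
  proof -
    have "AE x in lebesgue. \<forall>T\<in>tris \<T>. x \<in> T \<longrightarrow> g x = h T x"
      using h(2) by (subst AE_ball_countable[OF countable_finite[OF tris_finite]]) blast
    then show ?thesis using AE_cells
    proof eventually_elim
      fix x assume a: "\<forall>T\<in>tris \<T>. x \<in> T \<longrightarrow> g x = h T x" and b: "x \<in> cells \<longleftrightarrow> x \<in> \<Omega>"
      show "x \<in> \<Omega> \<longrightarrow> f x = g x"
      proof
        assume "x \<in> \<Omega>"
        then have "x \<in> cells" using b by simp
        then obtain T where T: "T \<in> tris \<T>" "x \<in> interior T" unfolding cells_def by (rule UN_E)
        have "f x = (\<Sum>T'\<in>tris \<T>. if T' = T then h T x else 0)"
          unfolding f_def
        proof (rule sum.cong[OF refl])
          fix T' assume T': "T' \<in> tris \<T>"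
          have "x \<notin> interior T'" if "T' \<noteq> T"
            using interior_unique[OF T' T(1), of x] subsetD[OF interior_subset T(2)] that by blast
          then show "indicat_real (interior T') x *\<^sub>R h T' x = (if T' = T then h T x else 0)"
            using T(2) by (cases "T' = T") auto
        qed
        also have "\<dots> = h T x" using T(1) tris_finite by simp
        also have "\<dots> = g x" using bspec[OF a T(1)] subsetD[OF interior_subset T(2)] by simp
        finally show "f x = g x" .
      qed
    qed
  qed
  ultimately show ?thesis using L2_cong_AE by blast
qed

lemma CR_D:
  assumes "v \<in> CR \<Omega> \<T>"
  shows "v \<in> L2 \<Omega>" "\<forall>T\<in>tris \<T>. \<exists>a b. AE x in lebesgue. x \<in> T \<longrightarrow> v x = a \<bullet> x + b"
    "\<forall>T1\<in>tris \<T>. \<forall>T2\<in>tris \<T>. \<forall>S\<in>sides \<T>. T1 \<noteq> T2 \<and> S = T1 \<inter> T2 \<longrightarrow>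
       seg_integral S (\<lambda>x. trace_on T1 S v x - trace_on T2 S v x) = 0"
    "\<forall>T\<in>tris \<T>. \<forall>S. S edge_of T \<and> S \<subseteq> frontier \<Omega> \<longrightarrow> seg_integral S (trace_on T S v) = 0"
proof -
  note A = assms[unfolded CR_def mem_Collect_eq]
  show "v \<in> L2 \<Omega>" by (rule A[THEN conjunct1])
  show "\<forall>T\<in>tris \<T>. \<exists>a b. AE x in lebesgue. x \<in> T \<longrightarrow> v x = a \<bullet> x + b"
    by (rule A[THEN conjunct2, THEN conjunct1])
  show "\<forall>T1\<in>tris \<T>. \<forall>T2\<in>tris \<T>. \<forall>S\<in>sides \<T>. T1 \<noteq> T2 \<and> S = T1 \<inter> T2 \<longrightarrow>
       seg_integral S (\<lambda>x. trace_on T1 S v x - trace_on T2 S v x) = 0"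
    by (rule A[THEN conjunct2, THEN conjunct2, THEN conjunct1])
  show "\<forall>T\<in>tris \<T>. \<forall>S. S edge_of T \<and> S \<subseteq> frontier \<Omega> \<longrightarrow> seg_integral S (trace_on T S v) = 0"
    by (rule A[THEN conjunct2, THEN conjunct2, THEN conjunct2])
qed

lemma CR_affine:
  assumes "v \<in> CR \<Omega> \<T>"
  shows "\<exists>\<alpha> \<beta>. \<forall>T\<in>tris \<T>. AE x in lebesgue. x \<in> T \<longrightarrow> v x = \<alpha> T \<bullet> x + \<beta> T"
proof -
  have "\<forall>T\<in>tris \<T>. \<exists>p. AE x in lebesgue. x \<in> T \<longrightarrow> v x = fst p \<bullet> x + snd p"
  proof
    fix T assume "T \<in> tris \<T>"
    from bspec[OF CR_D(2)[OF assms] this]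
    obtain a b where "AE x in lebesgue. x \<in> T \<longrightarrow> v x = a \<bullet> x + b" by (elim exE)
    then show "\<exists>p. AE x in lebesgue. x \<in> T \<longrightarrow> v x = fst p \<bullet> x + snd p" by (intro exI[of _ "(a, b)"]) simp
  qed
  from bchoice[OF this] obtain p where
    "\<forall>T\<in>tris \<T>. AE x in lebesgue. x \<in> T \<longrightarrow> v x = fst (p T) \<bullet> x + snd (p T)" by (rule exE)
  then show ?thesis by (intro exI[of _ "\<lambda>T. fst (p T)"] exI[of _ "\<lambda>T. snd (p T)"])
qed

lemma interior_cells: "T \<in> tris \<T> \<Longrightarrow> interior T \<subseteq> cells"
  unfolding cells_def by (rule UN_upper)

lemma affine_nc_grad:
  assumes "\<And>T. T \<in> tris \<T> \<Longrightarrow> AE x in lebesgue. x \<in> T \<longrightarrow> v x = \<alpha> T \<bullet> x + \<beta> T"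
  shows "has_weak_grad cells v (nc_grad \<T> v)"
    and "T \<in> tris \<T> \<Longrightarrow> AE x in lebesgue. x \<in> T \<longrightarrow> nc_grad \<T> v x = \<alpha> T"
    and "nc_grad \<T> v \<in> L2 \<Omega>"
proof -
  define g where "g x = \<alpha> (THE T. T \<in> tris \<T> \<and> x \<in> interior T)" for x
  have g: "g x = \<alpha> T" if "T \<in> tris \<T>" "x \<in> interior T" for x T
    using the_cell[OF that] by (simp add: g_def)
  have wT: "has_weak_grad (interior T) v g" if T: "T \<in> tris \<T>" for T
  proof -
    obtain z a b where "T = tri z a b" using tris_shape[OF T] by blast
    then have "has_weak_grad (interior T) v (\<lambda>x. \<alpha> T)"
      using affine_H1_approx(2)[of z a b v "\<alpha> T" "\<beta> T"] assms[OF T] by simp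
    then show ?thesis by (rule has_weak_grad_cong_AE) (use g[OF T] in auto)
  qed
  have wc: "has_weak_grad cells v g" by (rule has_weak_grad_cells[OF wT])
  show "has_weak_grad cells v (nc_grad \<T> v)" unfolding nc_grad_eq by (rule weak_grad_AE_eq(2)[OF open_cells wc])
  have ae: "AE x in lebesgue. x \<in> cells \<longrightarrow> nc_grad \<T> v x = g x"
    unfolding nc_grad_eq by (rule weak_grad_AE_eq(1)[OF open_cells wc])
  show aeT: "AE x in lebesgue. x \<in> T \<longrightarrow> nc_grad \<T> v x = \<alpha> T" if T: "T \<in> tris \<T>" for T
    using ae tris_facts(6)[OF T]
  proof eventually_elim
    fix x assume "x \<in> cells \<longrightarrow> nc_grad \<T> v x = g x" "x \<in> interior T \<longleftrightarrow> x \<in> T"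
    moreover have "x \<in> interior T \<Longrightarrow> x \<in> cells" unfolding cells_def using T by (rule_tac UN_I)
    ultimately show "x \<in> T \<longrightarrow> nc_grad \<T> v x = \<alpha> T" using g[OF T] by simp
  qed
  show "nc_grad \<T> v \<in> L2 \<Omega>"
    by (rule piecewise_L2) (use aeT L2_const[OF domain_lmeasurable] in blast)
qed

lemma CR_nc_grad:
  assumes "v \<in> CR \<Omega> \<T>"
  shows "has_weak_grad cells v (nc_grad \<T> v)"
    and "T \<in> tris \<T> \<Longrightarrow> \<exists>\<alpha>. AE x in lebesgue. x \<in> T \<longrightarrow> nc_grad \<T> v x = \<alpha>"
    and "nc_grad \<T> v \<in> L2 \<Omega>"
proof -
  obtain \<alpha> \<beta> where "\<forall>T\<in>tris \<T>. AE x in lebesgue. x \<in> T \<longrightarrow> v x = \<alpha> T \<bullet> x + \<beta> T"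
    using CR_affine[OF assms] by (elim exE)
  note ab = bspec[OF this]
  show "has_weak_grad cells v (nc_grad \<T> v)" "nc_grad \<T> v \<in> L2 \<Omega>"
    using affine_nc_grad(1,3)[OF ab] by blast+
  show "\<exists>\<alpha>. AE x in lebesgue. x \<in> T \<longrightarrow> nc_grad \<T> v x = \<alpha>" if "T \<in> tris \<T>"
    using affine_nc_grad(2)[OF ab that] by blast
qed

lemma L2_integrable_tri:
  assumes "g \<in> L2 \<Omega>" "T \<in> tris \<T>"
  shows "set_integrable lebesgue T (g :: R2 \<Rightarrow> 'b::euclidean_space)" "g \<in> L2 T"
proof -
  have "g \<in> L2 (interior T)" using L2_subset[OF assms(1) interior_subset_domain[OF assms(2)]] by simp
  then show "g \<in> L2 T" using L2_cong_set_AE[OF tris_facts(6)[OF assms(2)]] by blast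
  then show "set_integrable lebesgue T g" using L2_imp_set_integrable[OF tris_facts(2)[OF assms(2)]] by blast
qed

lemma regularI:
  assumes gL: "g \<in> L2 \<Omega>" and wg: "has_weak_grad cells v g"
    and ap: "\<And>T. T \<in> tris \<T> \<Longrightarrow> H1_approx T v (\<phi> T)"
    and jump: "\<And>T1 T2 S. T1 \<in> tris \<T> \<Longrightarrow> T2 \<in> tris \<T> \<Longrightarrow> T1 \<noteq> T2 \<Longrightarrow> S edge_of T1 \<Longrightarrow> S edge_of T2 \<Longrightarrow>
      seg_integral S (trace_on T1 S v) = seg_integral S (trace_on T2 S v)"
    and bd: "\<And>T S. T \<in> tris \<T> \<Longrightarrow> S edge_of T \<Longrightarrow> S \<subseteq> frontier \<Omega> \<Longrightarrow> seg_integral S (trace_on T S v) = 0"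
  shows "regular v g"
  unfolding regular_def
proof (intro conjI ballI allI impI)
  fix z a b assume T: "tri z a b \<in> tris \<T>" and c: "cross2 (a - z) (b - z) \<noteq> 0"
  have "has_weak_grad (interior (tri z a b)) v g"
    by (rule has_weak_grad_subset[OF wg interior_cells[OF T]])
  then show "(LINT x:tri z a b|lebesgue. g x \<bullet> (a - z))
        = 2 * measure lebesgue (tri z a b) * (edge_mean (tri z a b) v a b - edge_mean (tri z a b) v z b)"
    by (rule green_H1[OF c ap[OF T]])
next
  fix T1 T2 S assume h: "T1 \<in> tris \<T>" "T2 \<in> tris \<T>" "S edge_of T1" "S edge_of T2"
  show "seg_integral S (trace_on T1 S v) = seg_integral S (trace_on T2 S v)"
  proof (cases "T1 = T2")
    case False
    then show ?thesis by (rule jump[OF h(1,2) _ h(3,4)])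
  qed simp
next
  fix T S assume "T \<in> tris \<T>" "S edge_of T" "S \<subseteq> frontier \<Omega>"
  then show "seg_integral S (trace_on T S v) = 0" by (rule bd)
qed (rule L2_integrable_tri(1)[OF gL])

lemma edge_trace:
  assumes "T \<in> tris \<T>" "S edge_of T" "H1_approx T v \<phi>"
  shows "is_trace T S v (trace_on T S v)"
    and "(\<lambda>n. seg_integral S (\<phi> n)) \<longlonglongrightarrow> seg_integral S (trace_on T S v)"
proof -
  obtain z a b where T: "T = tri z a b" "S = closed_segment a b" "cross2 (a - z) (b - z) \<noteq> 0"
    by (rule edge_segment[OF assms(1,2)])
  show "is_trace T S v (trace_on T S v)"
    using trace_on_is_trace[OF T(3), of v \<phi>] assms(3) T(1,2) by simp
  show "(\<lambda>n. seg_integral S (\<phi> n)) \<longlonglongrightarrow> seg_integral S (trace_on T S v)"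
    using tendsto_mult_left[OF edge_mean_limit[OF T(3), of v \<phi>], of "dist a b"] assms(3) T(1,2)
    by (simp add: seg_integral_eq seg_mean_eq edge_mean_def)
qed

lemma seg_integral_diff_trace:
  assumes "T1 \<in> tris \<T>" "T2 \<in> tris \<T>" "S edge_of T1" "S edge_of T2" "H1_approx T1 v \<phi>1" "H1_approx T2 v \<phi>2"
  shows "seg_integral S (\<lambda>x. trace_on T1 S v x - trace_on T2 S v x)
    = seg_integral S (trace_on T1 S v) - seg_integral S (trace_on T2 S v)"
proof -
  obtain z a b where S: "T1 = tri z a b" "S = closed_segment a b" by (rule edge_segment[OF assms(1,3)])
  have "trace_on T1 S v \<in> seg_L2 S" "trace_on T2 S v \<in> seg_L2 S"
    using edge_trace(1)[OF assms(1,3,5)] edge_trace(1)[OF assms(2,4,6)] unfolding is_trace_iff by blast+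
  from seg_mean_diff[OF this] show ?thesis
    unfolding S(2) seg_integral_eq by (simp add: right_diff_distrib)
qed

lemma affine_tri_approx:
  assumes "T \<in> tris \<T>" "AE x in lebesgue. x \<in> T \<longrightarrow> v x = \<alpha> \<bullet> x + \<beta>"
  shows "H1_approx T v (\<lambda>n x. \<alpha> \<bullet> x + \<beta>)"
proof -
  obtain z a b where "T = tri z a b" using tris_shape[OF assms(1)] by blast
  then show ?thesis using affine_H1_approx(1)[of z a b v \<alpha> \<beta>] assms(2) by simp
qed

text \<open>
  The prescribed integral \<open>J S\<close> depends on the edge only.  Traces from both sides thus have the same
  integral, and jumps have mean zero.
\<close>

lemma CR_I:
  assumes w: "w \<in> L2 \<Omega>"
    and ae: "\<And>T. T \<in> tris \<T> \<Longrightarrow> AE x in lebesgue. x \<in> T \<longrightarrow> w x = \<alpha> T \<bullet> x + \<beta> T"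
    and tr: "\<And>T S. T \<in> tris \<T> \<Longrightarrow> S edge_of T \<Longrightarrow> seg_integral S (trace_on T S w) = J S"
    and bd: "\<And>S. S \<subseteq> frontier \<Omega> \<Longrightarrow> J S = 0"
  shows "w \<in> CR \<Omega> \<T>"
  unfolding CR_def mem_Collect_eq
proof (intro conjI ballI allI impI)
  note ap = affine_tri_approx[OF _ ae]
  show "\<exists>a b. AE x in lebesgue. x \<in> T \<longrightarrow> w x = a \<bullet> x + b" if "T \<in> tris \<T>" for T
    using ae[OF that] by (intro exI)
  show "seg_integral S (\<lambda>x. trace_on T1 S w x - trace_on T2 S w x) = 0"
    if h: "T1 \<in> tris \<T>" "T2 \<in> tris \<T>" "S \<in> sides \<T>" "T1 \<noteq> T2 \<and> S = T1 \<inter> T2" for T1 T2 S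
  proof -
    have "aff_dim S = 1" using h(3) unfolding sides_def edge_of_def by blast
    then have e: "S edge_of T1" "S edge_of T2"
      using face[OF h(1,2)] face[OF h(2,1)] h(4) unfolding edge_of_def by (simp_all add: Int_commute)
    show ?thesis
      using seg_integral_diff_trace[OF h(1,2) e ap[OF h(1,1)] ap[OF h(2,2)]] tr[OF h(1) e(1)] tr[OF h(2) e(2)] by simp
  qed
  show "seg_integral S (trace_on T S w) = 0" if h: "T \<in> tris \<T>" "S edge_of T \<and> S \<subseteq> frontier \<Omega>" for T S
    using tr[OF h(1) conjunct1[OF h(2)]] bd[OF conjunct2[OF h(2)]] by simp
qed (rule w)

lemma CR_regular:
  assumes v: "v \<in> CR \<Omega> \<T>"
  shows "regular v (nc_grad \<T> v)"
proof -
  obtain \<alpha> \<beta> where "\<forall>T\<in>tris \<T>. AE x in lebesgue. x \<in> T \<longrightarrow> v x = \<alpha> T \<bullet> x + \<beta> T"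
    using CR_affine[OF v] by (elim exE)
  note ab = bspec[OF this]
  have ap: "H1_approx T v (\<lambda>n x. \<alpha> T \<bullet> x + \<beta> T)" if "T \<in> tris \<T>" for T
    by (rule affine_tri_approx[OF that ab[OF that]])
  show ?thesis
  proof (rule regularI[OF CR_nc_grad(3)[OF v] CR_nc_grad(1)[OF v] ap])
    fix T1 T2 S assume h: "T1 \<in> tris \<T>" "T2 \<in> tris \<T>" "T1 \<noteq> T2" "S edge_of T1" "S edge_of T2"
    have "S \<in> sides \<T>" using h(1,4) unfolding sides_def by blast
    from CR_D(3)[OF v, rule_format, OF h(1,2) this] h(3) common_edge[OF h]
    have "seg_integral S (\<lambda>x. trace_on T1 S v x - trace_on T2 S v x) = 0" by blast
    then show "seg_integral S (trace_on T1 S v) = seg_integral S (trace_on T2 S v)"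
      using seg_integral_diff_trace[OF h(1,2,4,5) ap[OF h(1)] ap[OF h(2)]] by simp
  next
    fix T S assume h: "T \<in> tris \<T>" "S edge_of T" "S \<subseteq> frontier \<Omega>"
    show "seg_integral S (trace_on T S v) = 0"
      by (rule CR_D(4)[OF v, rule_format, OF h(1) conjI[OF h(2,3)]])
  qed
qed

lemma H10_facts:
  assumes "v \<in> H10 \<Omega>"
  shows "v \<in> H1 \<Omega>" "v \<in> L2 \<Omega>" "weak_grad \<Omega> v \<in> L2 \<Omega>" "has_weak_grad \<Omega> v (weak_grad \<Omega> v)"
  using H1_weak_grad[OF open_domain] assms unfolding H10_def by blast+

text \<open>
  A single sequence of test functions approximates \<open>v\<close> on all triangles.  On a common edge it gives
  the same limit from both sides, and on the boundary it vanishes.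
\<close>

lemma H10_regular:
  assumes v: "v \<in> H10 \<Omega>"
  shows "regular v (weak_grad \<Omega> v)"
proof -
  note vf = H10_facts[OF v]
  obtain \<phi> where \<phi>: "\<And>n. test_fun \<Omega> (\<phi> n)" "(\<lambda>n. H1_norm \<Omega> (\<lambda>x. \<phi> n x - v x)) \<longlonglongrightarrow> 0"
    using v unfolding H10_def by blast
  have s: "smooth (\<phi> n)" for n using \<phi>(1) unfolding test_fun_def by blast
  have ap: "H1_approx T v \<phi>" if T: "T \<in> tris \<T>" for T
  proof -
    have sub: "interior T \<subseteq> \<Omega>" by (rule interior_subset_domain[OF T])
    have wT: "has_weak_grad (interior T) v (weak_grad \<Omega> v)" by (rule has_weak_grad_subset[OF vf(4) sub])
    have "v \<in> L2 (interior T)" "weak_grad \<Omega> v \<in> L2 (interior T)"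
      using L2_subset[OF vf(2) sub] L2_subset[OF vf(3) sub] by simp_all
    then have vT: "v \<in> H1 (interior T)" using wT unfolding H1_def by blast
    have le: "H1_norm (interior T) (\<lambda>x. \<phi> n x - v x) \<le> H1_norm \<Omega> (\<lambda>x. \<phi> n x - v x)" for n
    proof (rule power2_le_imp_le)
      note L = smooth_L2[OF s[of n] bounded_domain domain_sets]
      show "(H1_norm (interior T) (\<lambda>x. \<phi> n x - v x))\<^sup>2 \<le> (H1_norm \<Omega> (\<lambda>x. \<phi> n x - v x))\<^sup>2"
        unfolding H1_norm_diff_power2[OF open_interior s wT] H1_norm_diff_power2[OF open_domain s vf(4)]
        by (intro add_mono power_mono L2_norm_mono L2_diff L vf sub) simp_all
    qed simp
    have "(\<lambda>n. H1_norm (interior T) (\<lambda>x. \<phi> n x - v x)) \<longlonglongrightarrow> 0"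
      by (rule tendsto_sandwich[of "\<lambda>_. 0", OF _ _ tendsto_const \<phi>(2)]) (use le in auto)
    then show ?thesis using vT s unfolding H1_approx_def by blast
  qed
  show ?thesis
  proof (rule regularI[OF vf(3) has_weak_grad_subset[OF vf(4) cells_subset] ap])
    fix T1 T2 S assume h: "T1 \<in> tris \<T>" "T2 \<in> tris \<T>" "T1 \<noteq> T2" "S edge_of T1" "S edge_of T2"
    show "seg_integral S (trace_on T1 S v) = seg_integral S (trace_on T2 S v)"
      using edge_trace(2)[OF h(1,4) ap[OF h(1)]] edge_trace(2)[OF h(2,5) ap[OF h(2)]] by (rule LIMSEQ_unique)
  next
    fix T S assume h: "T \<in> tris \<T>" "S edge_of T" "S \<subseteq> frontier \<Omega>"
    obtain z a b where "T = tri z a b" and S: "S = closed_segment a b" by (rule edge_segment[OF h(1,2)])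
    have "\<phi> n x = 0" if "x \<in> S" for n x
    proof -
      have "x \<notin> \<Omega>" using that h(3) open_domain by (auto simp: frontier_def interior_open)
      then show ?thesis using \<phi>(1)[of n] closure_subset[of "{x. \<phi> n x \<noteq> 0}"] unfolding test_fun_def by blast
    qed
    then have "lin_mean a b (\<phi> n) = lin_mean a b (\<lambda>x. 0)" for n using S by (intro lin_mean_cong) simp
    then have "seg_integral S (\<phi> n) = 0" for n unfolding S seg_integral_eq seg_mean_eq by (simp add: lin_mean_def)
    then have "(\<lambda>n. 0) \<longlonglongrightarrow> seg_integral S (trace_on T S v)" using edge_trace(2)[OF h(1,2) ap[OF h(1)]] by simp
    then show "seg_integral S (trace_on T S v) = 0" by (simp add: LIMSEQ_const_iff)
  qed
qed

end

section \<open>The interpolation operator\<close>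

text \<open>
  Differences of the midpoints are half edges, so the gradient has prescribed inner products with
  two independent edges.
\<close>

lemma affine_with_midpoint_values:
  assumes c: "cross2 (a - z) (b - z) \<noteq> 0"
  shows "\<exists>\<alpha> \<beta>. \<alpha> \<bullet> midpoint a b + \<beta> = A \<and> \<alpha> \<bullet> midpoint z a + \<beta> = B \<and> \<alpha> \<bullet> midpoint z b + \<beta> = C"
proof -
  define d where "d = cross2 (a - z) (b - z)"
  define \<alpha> where "\<alpha> = (2 * (A - C) / d) *\<^sub>R perp (b - z) - (2 * (A - B) / d) *\<^sub>R perp (a - z)"
  define \<beta> where "\<beta> = A - \<alpha> \<bullet> midpoint a b"
  have p: "\<alpha> \<bullet> (a - z) = 2 * (A - C)" "\<alpha> \<bullet> (b - z) = 2 * (A - B)"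
    using c unfolding \<alpha>_def inner_diff_left inner_scaleR_left inner_perp
    by (simp_all add: cross2_swap[of b z a] d_def) (simp_all add: cross2_def)
  have m: "midpoint z a = midpoint a b - (1/2) *\<^sub>R (b - z)" "midpoint z b = midpoint a b - (1/2) *\<^sub>R (a - z)"
    by (simp_all add: vec_eq_iff midpoint_nth field_simps)
  have "\<alpha> \<bullet> midpoint z a + \<beta> = B" "\<alpha> \<bullet> midpoint z b + \<beta> = C"
    unfolding m inner_diff_right[of \<alpha> "midpoint a b"] inner_scaleR_right p \<beta>_def by (simp_all add: field_simps)
  then show ?thesis unfolding \<beta>_def by (intro exI[of _ \<alpha>] exI[of _ "A - \<alpha> \<bullet> midpoint a b"]) simp
qed

lemma vector_zero_of_inner:
  assumes "cross2 p q \<noteq> 0" "u \<bullet> p = 0" "u \<bullet> q = 0" shows "u = (0::R2)"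
proof -
  have 1: "u $ 1 * p $ 1 + u $ 2 * p $ 2 = 0" "u $ 1 * q $ 1 + u $ 2 * q $ 2 = 0" using assms(2,3) by (simp_all add: inner_2)
  then have "u $ 1 * cross2 p q = 0" "u $ 2 * cross2 p q = 0" unfolding cross2_def by algebra+
  then show ?thesis using assms(1) by (simp add: vec_eq_iff forall_2)
qed

text \<open>
  The continuous problem is treated in this setting with \<open>\<T>' = \<T>\<close>, since functions in \<open>H10\<close> are
  regular on every mesh.
\<close>

locale refined_mesh = domain_mesh \<Omega> \<sigma> \<T> + fine: domain_mesh \<Omega> \<sigma> \<T>'
  for \<Omega> \<sigma> \<T> \<T>' +
  assumes refines: "refinement \<T> \<T>'"
begin

lemma forest:
  shows "\<exists>A B F. (\<forall>t\<in>\<T>. snd t = tri (fst t) (A t) (B t) \<and> shaped \<sigma> (fst t) (A t) (B t) \<and> tree (fst t) (A t) (B t) (F t))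
    \<and> \<T>' = (\<Union>t\<in>\<T>. F t)"
proof -
  have "\<forall>t\<in>\<T>. marked_shape \<sigma> t" using shape by (rule ballI)
  from marked_shape_choice[OF this] obtain A B where
    AB: "\<forall>t\<in>\<T>. snd t = tri (fst t) (A t) (B t) \<and> shaped \<sigma> (fst t) (A t) (B t)" by (elim exE)
  have "\<exists>F. \<T>' = (\<Union>t\<in>\<T>. F t) \<and> (\<forall>t\<in>\<T>. tree (fst t) (A t) (B t) (F t))"
    by (rule refinement_trees[OF refines]) (use AB in \<open>auto simp: shaped_def\<close>)
  then obtain F where F: "\<T>' = (\<Union>t\<in>\<T>. F t)" "\<forall>t\<in>\<T>. tree (fst t) (A t) (B t) (F t)" by (elim exE conjE)
  show ?thesis
    by (rule exI[of _ A], rule exI[of _ B], rule exI[of _ F], rule conjI[OF _ F(1)])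
      (use bspec[OF AB] bspec[OF F(2)] in blast)
qed

lemma tri_tree:
  assumes "T \<in> tris \<T>"
  obtains z a b Q where "T = tri z a b" "shaped \<sigma> z a b" "(z, tri z a b) \<in> \<T>" "tree z a b Q" "Q \<subseteq> \<T>'"
proof -
  obtain A B F where F: "\<forall>t\<in>\<T>. snd t = tri (fst t) (A t) (B t) \<and> shaped \<sigma> (fst t) (A t) (B t) \<and> tree (fst t) (A t) (B t) (F t)"
    "\<T>' = (\<Union>t\<in>\<T>. F t)" using forest by (elim exE conjE)
  obtain t where t: "t \<in> \<T>" "T = snd t" using assms by (rule imageE)
  note Ft = bspec[OF F(1) t(1)]
  show ?thesis
  proof (rule that[of "fst t" "A t" "B t" "F t"])
    show "(fst t, tri (fst t) (A t) (B t)) \<in> \<T>" using t(1) conjunct1[OF Ft] by (metis prod.collapse)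
    show "F t \<subseteq> \<T>'" unfolding F(2) using t(1) by (rule UN_upper)
  qed (use Ft t(2) in simp_all)
qed

lemma fine_tri_parent:
  assumes "T' \<in> tris \<T>'" shows "\<exists>T\<in>tris \<T>. T' \<subseteq> T"
proof -
  obtain A B F where F: "\<forall>t\<in>\<T>. snd t = tri (fst t) (A t) (B t) \<and> shaped \<sigma> (fst t) (A t) (B t) \<and> tree (fst t) (A t) (B t) (F t)"
    "\<T>' = (\<Union>t\<in>\<T>. F t)" using forest by (elim exE conjE)
  obtain t' where t': "t' \<in> \<T>'" "T' = snd t'" using assms by (rule imageE)
  obtain t where t: "t \<in> \<T>" "t' \<in> F t" using t'(1) unfolding F(2) by (rule UN_E)
  note Ft = bspec[OF F(1) t(1)]
  have "T' \<in> tris (F t)" unfolding t'(2) using t(2) by (rule imageI)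
  then have "T' \<subseteq> \<Union>(tris (F t))" by (rule Union_upper)
  also have "\<dots> = snd t" using tree_union[of "fst t" "A t" "B t" "F t"] Ft by simp
  finally show ?thesis using t(1) by (intro bexI[of _ "snd t"]) auto
qed

lemma fine_cells_subset: "fine.cells \<subseteq> cells"
proof
  fix x assume "x \<in> fine.cells"
  then obtain T' where T': "T' \<in> tris \<T>'" "x \<in> interior T'" unfolding fine.cells_def by (rule UN_E)
  obtain T where T: "T \<in> tris \<T>" "T' \<subseteq> T" using fine_tri_parent[OF T'(1)] by (rule bexE)
  show "x \<in> cells" by (rule subsetD[OF interior_cells[OF T(1)] subsetD[OF interior_mono[OF T(2)] T'(2)]])
qed

text \<open>A triangle that does not survive has been bisected at least once, which halves the area.\<close>

lemma fine_cell_cases: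
  assumes T: "T \<in> tris \<T>" "x \<in> interior T" and T': "T' \<in> tris \<T>'" "x \<in> interior T'"
  shows "T \<in> tris \<T>' \<Longrightarrow> T' = T"
    and "T \<notin> tris \<T>' \<Longrightarrow> measure lebesgue T' \<le> measure lebesgue T / 2"
proof -
  have x: "x \<in> T" "x \<in> T'" using T(2) T'(2) interior_subset by (rule_tac [!] subsetD)
  show "T' = T" if "T \<in> tris \<T>'" by (rule fine.interior_unique[OF T'(1) that T'(2) x(1)])
  obtain z a b Q where Q: "T = tri z a b" "shaped \<sigma> z a b" "tree z a b Q" "Q \<subseteq> \<T>'"
    by (rule tri_tree[OF T(1)])
  have "x \<in> \<Union>(tris Q)" using x(1) tree_union[OF Q(3)] Q(1) by simp
  then obtain T'' where T'': "T'' \<in> tris Q" "x \<in> T''" by (rule UnionE)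
  have "T'' \<in> tris \<T>'" using T''(1) Q(4) image_mono subsetD by metis
  then have eq: "T' = T''" using fine.interior_unique[OF T'(1) _ T'(2) T''(2)] by blast
  show "measure lebesgue T' \<le> measure lebesgue T / 2" if n: "T \<notin> tris \<T>'"
    using tree_measure[OF Q(3)] Q(2) unfolding shaped_def
  proof (elim conjE meta_impE disjE)
    assume "Q = {(z, tri z a b)}"
    then have "T'' = T" using T''(1) Q(1) by simp
    then show ?thesis using n \<open>T'' \<in> tris \<T>'\<close> by simp
  next
    assume "\<forall>T\<in>tris Q. measure lebesgue T \<le> measure lebesgue (tri z a b) / 2"
    from bspec[OF this T''(1)] show ?thesis unfolding eq Q(1) .
  qed
qed

text \<open>
  On each triangle the means over the three edges determine an affine function, through its values
  at the midpoints.  Neighbouring triangles use the same mean on a common edge, so the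
  function belongs to \<open>CR\<close>.
\<close>

lemma interpolant_exists:
  assumes v: "fine.regular v g"
  shows "\<exists>w. is_interpolant \<Omega> \<T> \<T>' v w"
proof -
  have "\<forall>T\<in>tris \<T>. \<exists>p. \<forall>a b. closed_segment a b edge_of T \<longrightarrow> fst p \<bullet> midpoint a b + snd p = fine.side_mean v a b"
  proof
    fix T assume "T \<in> tris \<T>"
    then obtain z a b where T: "T = tri z a b" "cross2 (a - z) (b - z) \<noteq> 0"
      using tris_shape unfolding shaped_def by blast
    obtain \<alpha> \<beta> where ab: "\<alpha> \<bullet> midpoint a b + \<beta> = fine.side_mean v a b"
      "\<alpha> \<bullet> midpoint z a + \<beta> = fine.side_mean v z a" "\<alpha> \<bullet> midpoint z b + \<beta> = fine.side_mean v z b"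
      using affine_with_midpoint_values[OF T(2)] by blast
    have "\<alpha> \<bullet> midpoint p q + \<beta> = fine.side_mean v p q" if "closed_segment p q edge_of T" for p q
    proof -
      have *: "\<alpha> \<bullet> midpoint p q + \<beta> = fine.side_mean v p q"
        if "closed_segment p q = closed_segment x y" "\<alpha> \<bullet> midpoint x y + \<beta> = fine.side_mean v x y" for x y
      proof -
        have "(p = x \<and> q = y) \<or> (p = y \<and> q = x)" using that(1) by (simp add: closed_segment_eq doubleton_eq_iff)
        then show ?thesis using that(2) midpoint_sym[of p q] fine.side_mean_commute[of v p q] by auto
      qed
      from that have "closed_segment p q = closed_segment z a \<or> closed_segment p q = closed_segment z b \<or> closed_segment p q = closed_segment a b"
        unfolding T(1) edge_of_tri_iff[OF T(2)] .
      then show ?thesis using *[OF _ ab(1)] *[OF _ ab(2)] *[OF _ ab(3)] by (elim disjE)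
    qed
    then show "\<exists>p. \<forall>a b. closed_segment a b edge_of T \<longrightarrow> fst p \<bullet> midpoint a b + snd p = fine.side_mean v a b"
      by (intro exI[of _ "(\<alpha>, \<beta>)"]) simp
  qed
  from bchoice[OF this] obtain p where p: "\<forall>T\<in>tris \<T>. \<forall>a b. closed_segment a b edge_of T \<longrightarrow>
      fst (p T) \<bullet> midpoint a b + snd (p T) = fine.side_mean v a b" by (rule exE)
  define \<alpha> where "\<alpha> T = fst (p T)" for T
  define \<beta> where "\<beta> T = snd (p T)" for T
  define w where "w x = (let T = THE T. T \<in> tris \<T> \<and> x \<in> interior T in \<alpha> T \<bullet> x + \<beta> T)" for x
  have w_eq: "w x = \<alpha> T \<bullet> x + \<beta> T" if "T \<in> tris \<T>" "x \<in> interior T" for x T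
    using the_cell[OF that] by (simp add: w_def)
  have ae: "AE x in lebesgue. x \<in> T \<longrightarrow> w x = \<alpha> T \<bullet> x + \<beta> T" if T: "T \<in> tris \<T>" for T
    using tris_facts(6)[OF T] by eventually_elim (use w_eq[OF T] in simp)
  have tr: "seg_integral S (trace_on T S w) = side_integral \<T>' S v" if T: "T \<in> tris \<T>" "S edge_of T" for T S
  proof -
    obtain z a b where zab: "T = tri z a b" "S = closed_segment a b" "cross2 (a - z) (b - z) \<noteq> 0"
      by (rule edge_segment[OF T])
    have "edge_mean T w a b = \<alpha> T \<bullet> midpoint a b + \<beta> T"
      using edge_mean_affine[OF zab(3), of w "\<alpha> T" "\<beta> T"] ae[OF T(1)] unfolding zab(1) by blast
    also have "\<dots> = fine.side_mean v a b"
      using bspec[OF p T(1)] T(2) unfolding zab(2) \<alpha>_def \<beta>_def by blast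
    finally show ?thesis
      using distinct_of_cross2[OF zab(3)] unfolding zab(2) seg_integral_eq edge_mean_def fine.side_mean_def by simp
  qed
  have "w \<in> L2 \<Omega>"
  proof (rule piecewise_L2)
    fix T assume T: "T \<in> tris \<T>"
    show "\<exists>h. h \<in> L2 \<Omega> \<and> (AE x in lebesgue. x \<in> T \<longrightarrow> w x = h x)"
      using smooth_L2(1)[OF smooth_affine bounded_domain domain_sets] ae[OF T] by (intro exI conjI)
  qed
  then have wCR: "w \<in> CR \<Omega> \<T>"
    by (rule CR_I[OF _ ae tr fine.side_integral_boundary[OF v]])
  have "side_integral \<T> S w = side_integral \<T>' S v" if hS: "S \<in> sides \<T>" for S
  proof -
    obtain T where T: "T \<in> tris \<T>" "S edge_of T" using hS unfolding sides_def by blast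
    show ?thesis using side_integral_edge[OF CR_regular[OF wCR] T] tr[OF T] by simp
  qed
  then show ?thesis using wCR unfolding is_interpolant_def by blast
qed

text \<open>
  The inner products of both integrals with two independent edges are given by means over the
  coarse sides, which are the same for a function and its interpolant.
\<close>

lemma interpolant_mean_grad:
  assumes v: "fine.regular v g" and w: "is_interpolant \<Omega> \<T> \<T>' v w" and T: "T \<in> tris \<T>"
  shows "(LINT x:T|lebesgue. g x) = (LINT x:T|lebesgue. nc_grad \<T> w x)"
proof -
  obtain z a b Q where Q: "T = tri z a b" "shaped \<sigma> z a b" "(z, tri z a b) \<in> \<T>" "tree z a b Q" "Q \<subseteq> \<T>'"
    by (rule tri_tree[OF T])
  have c: "cross2 (a - z) (b - z) \<noteq> 0" using Q(2) by (simp add: shaped_def)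
  have wCR: "w \<in> CR \<Omega> \<T>" and J: "\<forall>S\<in>sides \<T>. side_integral \<T> S w = side_integral \<T>' S v"
    using w unfolding is_interpolant_def by blast+
  have single: "{(z, tri z a b)} \<subseteq> \<T>" using Q(3) by simp
  note F = fine.green_tree[OF v Q(4,5) c]
  note C = green_tree[OF CR_regular[OF wCR] tree.leaf single c]
  have e: "side_mean w p q = fine.side_mean v p q" if "closed_segment p q edge_of (tri z a b)" for p q
  proof -
    have "closed_segment p q \<in> sides \<T>" using that T unfolding Q(1) sides_def by blast
    then show ?thesis using J unfolding side_mean_def fine.side_mean_def by simp
  qed
  have ee: "side_mean w a b = fine.side_mean v a b" "side_mean w z b = fine.side_mean v z b" "side_mean w z a = fine.side_mean v z a"
    using e edge_of_tri_iff[OF c] by blast+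
  let ?u = "(LINT x:T|lebesgue. g x) - (LINT x:T|lebesgue. nc_grad \<T> w x)"
  have "?u \<bullet> (a - z) = 0" "?u \<bullet> (b - z) = 0"
    using F C unfolding Q(1) ee inner_diff_left by simp_all
  from vector_zero_of_inner[OF c this] show ?thesis by simp
qed

end

section \<open>Energy differences\<close>

context domain_mesh
begin

lemma mesh_size_AE:
  assumes T: "T \<in> tris \<T>"
  shows "AE x in lebesgue. x \<in> T \<longrightarrow> mesh_size \<T> x = sqrt (measure lebesgue T)"
  using tris_facts(6)[OF T] by eventually_elim (use mesh_size_eq[OF T] in simp)

lemma mesh_size_L2:
  assumes f: "(f :: R2 \<Rightarrow> real) \<in> L2 \<Omega>"
  shows "(\<lambda>x. mesh_size \<T> x * f x) \<in> L2 \<Omega>" "(\<lambda>x. inverse (mesh_size \<T> x) * f x) \<in> L2 \<Omega>"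
proof -
  show "(\<lambda>x. mesh_size \<T> x * f x) \<in> L2 \<Omega>"
  proof (rule piecewise_L2)
    fix T assume T: "T \<in> tris \<T>"
    have "AE x in lebesgue. x \<in> T \<longrightarrow> mesh_size \<T> x * f x = sqrt (measure lebesgue T) *\<^sub>R f x"
      using mesh_size_AE[OF T] by eventually_elim simp
    then show "\<exists>h. h \<in> L2 \<Omega> \<and> (AE x in lebesgue. x \<in> T \<longrightarrow> mesh_size \<T> x * f x = h x)"
      using L2_scaleR[OF f] by (intro exI conjI)
  qed
  show "(\<lambda>x. inverse (mesh_size \<T> x) * f x) \<in> L2 \<Omega>"
  proof (rule piecewise_L2)
    fix T assume T: "T \<in> tris \<T>"
    have "AE x in lebesgue. x \<in> T \<longrightarrow> inverse (mesh_size \<T> x) * f x = inverse (sqrt (measure lebesgue T)) *\<^sub>R f x"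
      using mesh_size_AE[OF T] by eventually_elim simp
    then show "\<exists>h. h \<in> L2 \<Omega> \<and> (AE x in lebesgue. x \<in> T \<longrightarrow> inverse (mesh_size \<T> x) * f x = h x)"
      using L2_scaleR[OF f] by (intro exI conjI)
  qed
qed

lemma region_subset: "\<U> \<subseteq> tris \<T> \<Longrightarrow> region \<U> \<subseteq> \<Omega>"
proof -
  assume "\<U> \<subseteq> tris \<T>"
  then have "\<Union>\<U> \<subseteq> closure \<Omega>" using Union_mono cover by metis
  then show "region \<U> \<subseteq> \<Omega>" unfolding region_def using interior_mono regular_domain by metis
qed

lemma region_sets: "region \<U> \<in> sets lebesgue" by (simp add: region_def)

lemma L2_norm_region:
  fixes F :: "R2 \<Rightarrow> 'b::euclidean_space"
  assumes "\<U> \<subseteq> tris \<T>" "F \<in> L2 \<Omega>"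
  shows "(L2_norm (region \<U>) F)\<^sup>2 = (\<Sum>T\<in>\<U>. (L2_norm T F)\<^sup>2)"
  unfolding L2_norm_power2
proof (rule region_integral(1)[OF assms(1)])
  fix T assume "T \<in> \<U>"
  then show "set_integrable lebesgue T (\<lambda>x. (norm (F x))\<^sup>2)"
    by (rule L2_norm_integrable[OF L2_integrable_tri(2)[OF assms(2) subsetD[OF assms(1)]]])
qed

lemmas L2_norm_domain = L2_norm_region[OF order_refl, unfolded region_all]

lemma piecewise_orthogonal:
  assumes h: "h \<in> L2 \<Omega>" and k: "k \<in> L2 \<Omega>"
    and z: "\<And>T. T \<in> tris \<T> \<Longrightarrow> (LINT x:T|lebesgue. h x) = (0::R2)"
    and c: "\<And>T. T \<in> tris \<T> \<Longrightarrow> \<exists>c. AE x in lebesgue. x \<in> T \<longrightarrow> k x = c"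
  shows "(LINT x:\<Omega>|lebesgue. h x \<bullet> k x) = 0"
proof -
  have "(LINT x:\<Omega>|lebesgue. h x \<bullet> k x) = (\<Sum>T\<in>tris \<T>. LINT x:T|lebesgue. h x \<bullet> k x)"
    by (rule domain_integral(1)) (rule L2_inner_integrable[OF L2_integrable_tri(2)[OF h] L2_integrable_tri(2)[OF k]])
  also have "\<dots> = 0"
  proof (rule sum.neutral, rule ballI)
    fix T assume T: "T \<in> tris \<T>"
    obtain c where "AE x in lebesgue. x \<in> T \<longrightarrow> k x = c" using c[OF T] by (rule exE)
    then have "AE x in lebesgue. x \<in> T \<longrightarrow> h x \<bullet> k x = h x \<bullet> c" by eventually_elim simp
    then have "(LINT x:T|lebesgue. h x \<bullet> k x) = (LINT x:T|lebesgue. h x \<bullet> c)" by (rule set_LINT_cong_AE)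
    then show "(LINT x:T|lebesgue. h x \<bullet> k x) = 0"
      using set_LINT_inner[OF L2_integrable_tri(1)[OF h T]] z[OF T] by simp
  qed
  finally show ?thesis .
qed

lemma AE_in_some_cell: "AE x in lebesgue. x \<in> \<Omega> \<longrightarrow> (\<exists>T\<in>tris \<T>. x \<in> interior T)"
  using AE_cells by eventually_elim (simp add: cells_def)

end

context refined_mesh
begin

lemma nc_grad_diff:
  assumes "has_weak_grad fine.cells v g" "w \<in> CR \<Omega> \<T>"
  shows "AE x in lebesgue. x \<in> \<Omega> \<longrightarrow> nc_grad \<T>' (\<lambda>x. v x - w x) x = g x - nc_grad \<T> w x"
proof -
  have "has_weak_grad fine.cells w (nc_grad \<T> w)"
    by (rule has_weak_grad_subset[OF CR_nc_grad(1)[OF assms(2)] fine_cells_subset])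
  from weak_grad_AE_eq(1)[OF fine.open_cells has_weak_grad_diff[OF assms(1) this]] fine.AE_cells
  show ?thesis unfolding fine.nc_grad_eq by eventually_elim simp
qed

text \<open>
  The function \<open>v\<close> with piecewise gradient \<open>g\<close> stands for the fine or the continuous solution, \<open>u\<close> for
  the coarse one, and \<open>\<U>\<close> for the refined triangles.  With the interpolant \<open>w\<close> of \<open>v\<close>, the term \<open>X\<close>
  is the integral of \<open>f * (v - w)\<close>: the only part of the energy difference without a sign.  It is
  supported on \<open>\<U>\<close>, where the interpolation estimate and the minimality of \<open>g - \<nabla> w\<close> among all
  differences of \<open>g\<close> and piecewise gradients bound it.
\<close>

lemma energy_comparison:
  assumes v: "fine.regular v g" "g \<in> L2 \<Omega>" "has_weak_grad fine.cells v g" "v \<in> L2 \<Omega>"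
    and Lam: "\<Lambda> > 0" "\<And>w T. is_interpolant \<Omega> \<T> \<T>' v w \<Longrightarrow> T \<in> tris \<T> \<Longrightarrow>
        L2_norm T (\<lambda>x. inverse (mesh_size \<T> x) * (v x - w x)) \<le> \<Lambda> * L2_norm T (nc_grad \<T>' (\<lambda>x. v x - w x))"
    and f: "f \<in> L2 \<Omega>" and vf: "(LINT x:\<Omega>|lebesgue. g x \<bullet> g x) = (LINT x:\<Omega>|lebesgue. f x * v x)"
    and u: "CR_solution \<Omega> \<T> f u"
    and U: "\<U> \<subseteq> tris \<T>" "\<And>T. T \<in> tris \<T> \<Longrightarrow> T \<notin> \<U> \<Longrightarrow> \<exists>c. AE x in lebesgue. x \<in> T \<longrightarrow> g x = c"
  shows "\<exists>X. \<bar>X\<bar> \<le> \<Lambda> * L2_norm (region \<U>) (\<lambda>x. mesh_size \<T> x * f x) * L2_norm \<Omega> (\<lambda>x. g x - nc_grad \<T> u x)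
    \<and> (1/2) * (L2_norm \<Omega> (nc_grad \<T> u))\<^sup>2 - (1/2) * (L2_norm \<Omega> g)\<^sup>2
      = (1/2) * (L2_norm \<Omega> (\<lambda>x. g x - nc_grad \<T> u x))\<^sup>2 - X"
proof -
  obtain w where w: "is_interpolant \<Omega> \<T> \<T>' v w" using interpolant_exists[OF v(1)] by (rule exE)
  have wCR: "w \<in> CR \<Omega> \<T>" using w unfolding is_interpolant_def by (rule conjunct1)
  note u' = u[unfolded CR_solution_def]
  note uCR = conjunct1[OF u'] and sol = bspec[OF conjunct2[OF u']]
  define gu where "gu = nc_grad \<T> u"
  define gw where "gw = nc_grad \<T> w"
  have L: "gu \<in> L2 \<Omega>" "gw \<in> L2 \<Omega>" "w \<in> L2 \<Omega>"
    unfolding gu_def gw_def using CR_nc_grad(3) uCR wCR CR_D(1) by blast+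
  have cw: "\<exists>c. AE x in lebesgue. x \<in> T \<longrightarrow> gw x = c" and cu: "\<exists>c. AE x in lebesgue. x \<in> T \<longrightarrow> gu x = c" if "T \<in> tris \<T>" for T
    unfolding gw_def gu_def using CR_nc_grad(2)[OF wCR that] CR_nc_grad(2)[OF uCR that] .
  have Z: "(LINT x:T|lebesgue. g x - gw x) = 0" if T: "T \<in> tris \<T>" for T
    using set_integral_diff(2)[OF L2_integrable_tri(1)[OF v(2) T] L2_integrable_tri(1)[OF L(2) T]]
      interpolant_mean_grad[OF v(1) w T] by (simp add: gw_def)
  have dL: "(\<lambda>x. g x - gw x) \<in> L2 \<Omega>" "(\<lambda>x. gw x - gu x) \<in> L2 \<Omega>" "(\<lambda>x. g x - gu x) \<in> L2 \<Omega>" "(\<lambda>x. v x - w x) \<in> L2 \<Omega>"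
    by (intro L2_diff v L)+
  have o1: "(LINT x:\<Omega>|lebesgue. (g x - gw x) \<bullet> gu x) = 0"
    by (rule piecewise_orthogonal[OF dL(1) L(1) Z cu])
  then have ggu: "(LINT x:\<Omega>|lebesgue. g x \<bullet> gu x) = (LINT x:\<Omega>|lebesgue. gw x \<bullet> gu x)"
    using set_integral_diff(2)[OF L2_inner_integrable[OF v(2) L(1)] L2_inner_integrable[OF L(2,1)]]
    by (simp add: inner_diff_left)
  have fw: "(LINT x:\<Omega>|lebesgue. gw x \<bullet> gu x) = (LINT x:\<Omega>|lebesgue. f x * w x)"
    using sol[OF wCR] by (simp add: gw_def gu_def inner_commute)
  define X where "X = (LINT x:\<Omega>|lebesgue. f x * (v x - w x))"
  have "X = (LINT x:\<Omega>|lebesgue. f x * v x) - (LINT x:\<Omega>|lebesgue. f x * w x)"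
    unfolding X_def
    using set_integral_diff(2)[OF L2_inner_integrable[OF f v(4)] L2_inner_integrable[OF f L(3)]]
    by (simp add: right_diff_distrib)
  moreover have "(LINT x:\<Omega>|lebesgue. f x * v x) = (L2_norm \<Omega> g)\<^sup>2"
    unfolding vf[symmetric] L2_norm_power2 by (simp add: dot_square_norm)
  moreover have "(L2_norm \<Omega> (\<lambda>x. g x - gu x))\<^sup>2 = (L2_norm \<Omega> g)\<^sup>2 - 2 * (LINT x:\<Omega>|lebesgue. f x * w x) + (L2_norm \<Omega> gu)\<^sup>2"
    using L2_norm_diff_power2[OF v(2) L(1)] ggu fw by simp
  ultimately have ident: "(1/2) * (L2_norm \<Omega> gu)\<^sup>2 - (1/2) * (L2_norm \<Omega> g)\<^sup>2 = (1/2) * (L2_norm \<Omega> (\<lambda>x. g x - gu x))\<^sup>2 - X"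
    by (simp add: field_simps)
  define D where "D = L2_norm \<Omega> (\<lambda>x. g x - gu x)"
  \<comment> \<open>\<open>g - gw\<close> is orthogonal to \<open>gw - gu\<close>, which is piecewise constant\<close>
  have proj: "L2_norm \<Omega> (\<lambda>x. g x - gw x) \<le> D"
  proof (rule power2_le_imp_le)
    have "(LINT x:\<Omega>|lebesgue. (g x - gw x) \<bullet> (gw x - gu x)) = 0"
    proof (rule piecewise_orthogonal[OF dL(1,2) Z])
      fix T assume T: "T \<in> tris \<T>"
      obtain c1 c2 where "AE x in lebesgue. x \<in> T \<longrightarrow> gw x = c1" "AE x in lebesgue. x \<in> T \<longrightarrow> gu x = c2"
        using cw[OF T] cu[OF T] by (elim exE)
      then have "AE x in lebesgue. x \<in> T \<longrightarrow> gw x - gu x = c1 - c2" by eventually_elim simp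
      then show "\<exists>c. AE x in lebesgue. x \<in> T \<longrightarrow> gw x - gu x = c" by (rule exI)
    qed
    then have "(L2_norm \<Omega> (\<lambda>x. (g x - gw x) + (gw x - gu x)))\<^sup>2
        = (L2_norm \<Omega> (\<lambda>x. g x - gw x))\<^sup>2 + (L2_norm \<Omega> (\<lambda>x. gw x - gu x))\<^sup>2"
      using L2_norm_add_power2[OF dL(1,2)] by simp
    then show "(L2_norm \<Omega> (\<lambda>x. g x - gw x))\<^sup>2 \<le> D\<^sup>2" by (simp add: D_def)
  qed (simp add: D_def)
  define hf where "hf x = mesh_size \<T> x * f x" for x
  define hv where "hv x = inverse (mesh_size \<T> x) * (v x - w x)" for x
  have hL: "hf \<in> L2 \<Omega>" "hv \<in> L2 \<Omega>"
    using mesh_size_L2(1)[OF f] mesh_size_L2(2)[OF dL(4)] unfolding hf_def[abs_def] hv_def[abs_def] .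
  have hvT: "L2_norm T hv \<le> \<Lambda> * L2_norm T (\<lambda>x. g x - gw x)" if T: "T \<in> tris \<T>" for T
  proof -
    have "AE x in lebesgue. x \<in> T \<longrightarrow> nc_grad \<T>' (\<lambda>x. v x - w x) x = g x - gw x"
      using nc_grad_diff[OF v(3) wCR] tris_facts(6)[OF T]
    proof eventually_elim
      fix x assume "x \<in> \<Omega> \<longrightarrow> nc_grad \<T>' (\<lambda>x. v x - w x) x = g x - nc_grad \<T> w x" "x \<in> interior T \<longleftrightarrow> x \<in> T"
      then show "x \<in> T \<longrightarrow> nc_grad \<T>' (\<lambda>x. v x - w x) x = g x - gw x"
        using subsetD[OF interior_subset_domain[OF T], of x] by (simp add: gw_def)
    qed
    from L2_norm_cong_AE[OF this] Lam(2)[OF w T] show ?thesis by (simp add: hv_def[abs_def])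
  qed
  \<comment> \<open>where \<open>g\<close> is constant, so is \<open>g - gw\<close>, and its integral vanishes\<close>
  have zero: "AE x in lebesgue. x \<in> T \<longrightarrow> hv x = 0" if T: "T \<in> tris \<T>" "T \<notin> \<U>" for T
  proof -
    obtain c1 c2 where c: "AE x in lebesgue. x \<in> T \<longrightarrow> gw x = c1" "AE x in lebesgue. x \<in> T \<longrightarrow> g x = c2"
      using cw[OF T(1)] U(2)[OF T] by (elim exE)
    then have ae: "AE x in lebesgue. x \<in> T \<longrightarrow> g x - gw x = c2 - c1" by eventually_elim simp
    have "0 = (LINT x:T|lebesgue. c2 - c1)" using set_LINT_cong_AE[OF ae] Z[OF T(1)] by simp
    also have "\<dots> = measure lebesgue T *\<^sub>R (c2 - c1)"
      using tris_facts(2)[OF T(1)] unfolding set_lebesgue_integral_def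
      by (subst integral_scaleR_left) (auto simp: fmeasurable_def)
    finally have "c2 - c1 = 0" using measure_pos[OF T(1)] by simp
    then have "AE x in lebesgue. x \<in> T \<longrightarrow> g x - gw x = 0" using ae by simp
    from L2_norm_cong_AE[OF this] have "L2_norm T (\<lambda>x. g x - gw x) = 0" by (simp add: L2_norm_def)
    then have "L2_norm T hv = 0" using hvT[OF T(1)] L2_norm_nonneg[of T hv] by simp
    then show ?thesis by (rule L2_AE_zero[OF L2_integrable_tri(2)[OF hL(2) T(1)]])
  qed
  have AE_U: "AE x in lebesgue. x \<in> \<Omega> \<longrightarrow> x \<notin> region \<U> \<longrightarrow> hv x = 0"
  proof -
    have "AE x in lebesgue. \<forall>T\<in>tris \<T> - \<U>. x \<in> T \<longrightarrow> hv x = 0"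
      using zero by (subst AE_ball_countable[OF countable_finite]) (use tris_finite in auto)
    then show ?thesis using AE_in_some_cell AE_region[OF U(1)]
    proof eventually_elim
      fix x assume a: "\<forall>T\<in>tris \<T> - \<U>. x \<in> T \<longrightarrow> hv x = 0" and b: "x \<in> \<Omega> \<longrightarrow> (\<exists>T\<in>tris \<T>. x \<in> interior T)"
        and c: "x \<in> region \<U> \<longleftrightarrow> x \<in> (\<Union>T\<in>\<U>. interior T)"
      show "x \<in> \<Omega> \<longrightarrow> x \<notin> region \<U> \<longrightarrow> hv x = 0"
      proof (intro impI)
        assume x: "x \<in> \<Omega>" "x \<notin> region \<U>"
        obtain T where T: "T \<in> tris \<T>" "x \<in> interior T" using b x(1) by (elim impE bexE)
        have "T \<notin> \<U>" using x(2) T(2) unfolding c by (auto)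
        then show "hv x = 0" using bspec[OF a, of T] T(1) subsetD[OF interior_subset T(2)] by blast
      qed
    qed
  qed
  have Xeq: "X = (LINT x:region \<U>|lebesgue. hf x \<bullet> hv x)"
    unfolding X_def set_lebesgue_integral_def
  proof (rule integral_lebesgue_cong_AE)
    show "AE x in lebesgue. indicator \<Omega> x *\<^sub>R (f x * (v x - w x)) = indicator (region \<U>) x *\<^sub>R (hf x \<bullet> hv x)"
      using AE_U AE_in_some_cell
    proof eventually_elim
      fix x assume a: "x \<in> \<Omega> \<longrightarrow> x \<notin> region \<U> \<longrightarrow> hv x = 0" and b: "x \<in> \<Omega> \<longrightarrow> (\<exists>T\<in>tris \<T>. x \<in> interior T)"
      show "indicator \<Omega> x *\<^sub>R (f x * (v x - w x)) = indicator (region \<U>) x *\<^sub>R (hf x \<bullet> hv x)"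
      proof (cases "x \<in> \<Omega>")
        case True
        obtain T where T: "T \<in> tris \<T>" "x \<in> interior T" using b True by (elim impE bexE)
        then have "mesh_size \<T> x \<noteq> 0" using mesh_size_eq[OF T] measure_pos[OF T(1)] by simp
        then have "hf x \<bullet> hv x = f x * (v x - w x)" by (simp add: hf_def hv_def)
        moreover have "f x * (v x - w x) = 0" if "x \<notin> region \<U>"
          using a True that \<open>mesh_size \<T> x \<noteq> 0\<close> by (simp add: hv_def)
        ultimately show ?thesis using True by (auto simp: indicator_def)
      next
        case False
        then have "x \<notin> region \<U>" using subsetD[OF region_subset[OF U(1)], of x] by blast
        then show ?thesis using False by simp
      qed
    qed
  qed
  have hR: "hf \<in> L2 (region \<U>)" "hv \<in> L2 (region \<U>)"
    using L2_subset[OF hL(1) region_subset[OF U(1)] region_sets] L2_subset[OF hL(2) region_subset[OF U(1)] region_sets] .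
  have hvR: "L2_norm (region \<U>) hv \<le> \<Lambda> * D"
  proof (rule power2_le_imp_le)
    have "(L2_norm (region \<U>) hv)\<^sup>2 = (\<Sum>T\<in>\<U>. (L2_norm T hv)\<^sup>2)" by (rule L2_norm_region[OF U(1) hL(2)])
    also have "\<dots> \<le> (\<Sum>T\<in>\<U>. \<Lambda>\<^sup>2 * (L2_norm T (\<lambda>x. g x - gw x))\<^sup>2)"
    proof (rule sum_mono)
      fix T assume "T \<in> \<U>"
      then have "(L2_norm T hv)\<^sup>2 \<le> (\<Lambda> * L2_norm T (\<lambda>x. g x - gw x))\<^sup>2"
        by (intro power_mono hvT subsetD[OF U(1)] L2_norm_nonneg)
      then show "(L2_norm T hv)\<^sup>2 \<le> \<Lambda>\<^sup>2 * (L2_norm T (\<lambda>x. g x - gw x))\<^sup>2" by (simp add: power_mult_distrib)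
    qed
    also have "\<dots> = \<Lambda>\<^sup>2 * (L2_norm (region \<U>) (\<lambda>x. g x - gw x))\<^sup>2"
      unfolding L2_norm_region[OF U(1) dL(1)] by (simp add: sum_distrib_left)
    also have "\<dots> \<le> \<Lambda>\<^sup>2 * D\<^sup>2"
      using L2_norm_mono[OF dL(1) region_subset[OF U(1)] region_sets] proj
      by (intro mult_left_mono power_mono) simp_all
    finally show "(L2_norm (region \<U>) hv)\<^sup>2 \<le> (\<Lambda> * D)\<^sup>2" by (simp add: power_mult_distrib)
  qed (use Lam(1) in \<open>simp add: D_def\<close>)
  have "\<bar>X\<bar> \<le> L2_norm (region \<U>) hf * L2_norm (region \<U>) hv"
    unfolding Xeq by (rule L2_Cauchy_Schwarz[OF hR])
  also have "\<dots> \<le> L2_norm (region \<U>) hf * (\<Lambda> * D)" by (rule mult_left_mono[OF hvR L2_norm_nonneg])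
  finally have "\<bar>X\<bar> \<le> \<Lambda> * L2_norm (region \<U>) hf * D" by (simp add: mult.assoc mult.left_commute)
  then show ?thesis using ident unfolding D_def gu_def hf_def[abs_def] by blast
qed

text \<open>
  Pointwise, the squared mesh size is unchanged on triangles that are not refined, and at least
  halved, but nonnegative, on the others.
\<close>

lemma mesh_size_drop:
  assumes f: "f \<in> L2 \<Omega>"
  defines "H \<equiv> L2_norm (region (tris \<T> - tris \<T>')) (\<lambda>x. mesh_size \<T> x * f x)"
  defines "B \<equiv> (L2_norm \<Omega> (\<lambda>x. mesh_size \<T> x * f x))\<^sup>2 - (L2_norm \<Omega> (\<lambda>x. mesh_size \<T>' x * f x))\<^sup>2"
  shows "H\<^sup>2 / 2 \<le> B" "B \<le> H\<^sup>2"
proof -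
  let ?R = "region (tris \<T> - tris \<T>')"
  let ?h = "\<lambda>x. (norm (mesh_size \<T> x * f x))\<^sup>2" and ?h' = "\<lambda>x. (norm (mesh_size \<T>' x * f x))\<^sup>2"
  have U: "tris \<T> - tris \<T>' \<subseteq> tris \<T>" by blast
  have i: "set_integrable lebesgue \<Omega> ?h" "set_integrable lebesgue \<Omega> ?h'"
    using mesh_size_L2(1)[OF f] fine.mesh_size_L2(1)[OF f] L2_norm_integrable by blast+
  have B: "B = (LINT x:\<Omega>|lebesgue. ?h x - ?h' x)"
    unfolding B_def L2_norm_power2 by (rule set_integral_diff(2)[OF i, symmetric])
  have iR: "set_integrable lebesgue ?R ?h" using set_integrable_subset[OF i(1) region_sets region_subset[OF U]] .
  have ind: "(\<lambda>x. indicator \<Omega> x *\<^sub>R (indicator ?R x * ?h x)) = (\<lambda>x. indicator ?R x *\<^sub>R ?h x)"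
    using subsetD[OF region_subset[OF U]] by (auto simp: fun_eq_iff indicator_def)
  have iO: "set_integrable lebesgue \<Omega> (\<lambda>x. indicator ?R x * ?h x)"
    using iR unfolding set_integrable_def ind .
  have H: "H\<^sup>2 = (LINT x:\<Omega>|lebesgue. indicator ?R x * ?h x)"
    unfolding H_def L2_norm_power2 set_lebesgue_integral_def ind ..
  have bounds: "AE x in lebesgue. x \<in> \<Omega> \<longrightarrow> indicator ?R x * ?h x / 2 \<le> ?h x - ?h' x \<and> ?h x - ?h' x \<le> indicator ?R x * ?h x"
    using AE_in_some_cell fine.AE_in_some_cell AE_region[OF U]
  proof eventually_elim
    fix x assume a: "x \<in> \<Omega> \<longrightarrow> (\<exists>T\<in>tris \<T>. x \<in> interior T)" and b: "x \<in> \<Omega> \<longrightarrow> (\<exists>T\<in>tris \<T>'. x \<in> interior T)"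
      and c: "x \<in> ?R \<longleftrightarrow> x \<in> (\<Union>T\<in>tris \<T> - tris \<T>'. interior T)"
    show "x \<in> \<Omega> \<longrightarrow> indicator ?R x * ?h x / 2 \<le> ?h x - ?h' x \<and> ?h x - ?h' x \<le> indicator ?R x * ?h x"
    proof
      assume x: "x \<in> \<Omega>"
      obtain T where T: "T \<in> tris \<T>" "x \<in> interior T" using a x by (elim impE bexE)
      obtain T' where T': "T' \<in> tris \<T>'" "x \<in> interior T'" using b x by (elim impE bexE)
      define m where "m = measure lebesgue T"
      define m' where "m' = measure lebesgue T'"
      have m0: "0 \<le> m'" by (simp add: m'_def)
      have h: "?h x = m * (f x)\<^sup>2" "?h' x = m' * (f x)\<^sup>2"
        using mesh_size_eq[OF T] fine.mesh_size_eq[OF T'] by (simp_all add: power_mult_distrib m_def m'_def)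
      \<comment> \<open>the triangle \<open>T\<close> around \<open>x\<close> is unique, so \<open>x\<close> lies in the refined region iff \<open>T\<close> is refined\<close>
      have R: "x \<in> ?R \<longleftrightarrow> T \<notin> tris \<T>'"
      proof
        assume "x \<in> ?R"
        then obtain S where S: "S \<in> tris \<T> - tris \<T>'" "x \<in> interior S" unfolding c by (rule UN_E)
        have "S = T" using interior_unique[of S T x] S T subsetD[OF interior_subset T(2)] by blast
        then show "T \<notin> tris \<T>'" using S(1) by blast
      next
        assume "T \<notin> tris \<T>'"
        then show "x \<in> ?R" unfolding c using T by (intro UN_I[of T]) simp_all
      qed
      show "indicator ?R x * ?h x / 2 \<le> ?h x - ?h' x \<and> ?h x - ?h' x \<le> indicator ?R x * ?h x"
      proof (cases "T \<in> tris \<T>'")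
        case True
        then have "m' = m" using fine_cell_cases(1)[OF T T' True] by (simp add: m_def m'_def)
        moreover have "x \<notin> ?R" using R True by simp
        ultimately show ?thesis unfolding h by simp
      next
        case False
        have "m' \<le> m / 2" using fine_cell_cases(2)[OF T T' False] by (simp add: m_def m'_def)
        then have "m' * (f x)\<^sup>2 \<le> m / 2 * (f x)\<^sup>2" by (rule mult_right_mono) simp
        moreover have "0 \<le> m' * (f x)\<^sup>2" using m0 by simp
        moreover have "x \<in> ?R" using R False by simp
        ultimately show ?thesis unfolding h by (simp add: field_simps)
      qed
    qed
  qed
  have iB: "set_integrable lebesgue \<Omega> (\<lambda>x. ?h x - ?h' x)" using set_integral_diff(1)[OF i] .
  show "B \<le> H\<^sup>2" unfolding B H
    by (rule set_integral_mono_AE[OF iB iO]) (use bounds in \<open>auto elim: eventually_mono\<close>)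
  have "H\<^sup>2 / 2 = (LINT x:\<Omega>|lebesgue. indicator ?R x * ?h x / 2)" unfolding H by simp
  also have "\<dots> \<le> B" unfolding B
    by (rule set_integral_mono_AE[OF _ iB]) (use bounds iO in \<open>auto elim: eventually_mono\<close>)
  finally show "H\<^sup>2 / 2 \<le> B" .
qed

end

section \<open>Bubble functions\<close>

lemma test_fun_H10:
  assumes "open U" "bounded U" "test_fun U b"
  shows "b \<in> H10 U"
proof -
  have s: "smooth b" using assms(3) unfolding test_fun_def by blast
  have U: "U \<in> sets lebesgue" using assms(1) by simp
  have wg: "has_weak_grad U b (grad b)" by (rule smooth_has_weak_grad[OF s])
  have "b \<in> H1 U" unfolding H1_def using smooth_L2[OF s assms(2) U] wg by blast
  moreover have "(H1_norm U (\<lambda>x. b x - b x))\<^sup>2 = 0"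
    unfolding H1_norm_diff_power2[OF assms(1) s wg] by (simp add: L2_norm_def)
  then have "H1_norm U (\<lambda>x. b x - b x) = 0" by simp
  then have "(\<lambda>n::nat. H1_norm U (\<lambda>x. b x - b x)) \<longlonglongrightarrow> 0" by simp
  ultimately show ?thesis unfolding H10_def using assms(3) by (intro CollectI conjI exI[of _ "\<lambda>n. b"]) auto
qed

text \<open>With \<open>s = 1 / t\<close> this is \<open>s\<^sup>2 \<le> 2 * exp s\<close>.\<close>

lemma flat_2_le: "flat 2 t \<le> 2"
proof (cases "t > 0")
  case True
  have "1 + 1/t + (1/t)\<^sup>2 / 2 \<le> exp (1/t)" using True by (intro exp_lower_Taylor_quadratic) simp
  then have "(1/t)\<^sup>2 \<le> 2 * exp (1/t)"
  proof -
    have "0 < 1/t" using True by simp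
    then show ?thesis using \<open>1 + 1/t + (1/t)\<^sup>2 / 2 \<le> exp (1/t)\<close> by linarith
  qed
  then have "(1/t)\<^sup>2 * exp (- (1/t)) \<le> 2 * exp (1/t) * exp (- (1/t))" by (rule mult_right_mono) simp
  also have "\<dots> = 2" by (simp flip: exp_add)
  finally show ?thesis using True by (simp add: flat_def power_divide)
qed (simp add: flat_def)

lemma grad_flat: "grad (\<lambda>x. flat 0 (\<alpha> \<bullet> x + \<beta>)) x = flat 2 (\<alpha> \<bullet> x + \<beta>) *\<^sub>R \<alpha>"
proof (rule grad_eqI)
  have "GDERIV (\<lambda>x. flat 0 (\<alpha> \<bullet> x + \<beta>)) x :> (- real 0 * flat (0 + 1) (\<alpha> \<bullet> x + \<beta>) + flat (0 + 2) (\<alpha> \<bullet> x + \<beta>)) *\<^sub>R \<alpha>"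
    by (rule GDERIV_DERIV_compose[OF GDERIV_affine flat_DERIV])
  then show "GDERIV (\<lambda>x. flat 0 (\<alpha> \<bullet> x + \<beta>)) x :> flat 2 (\<alpha> \<bullet> x + \<beta>) *\<^sub>R \<alpha>"
    by (simp add: numeral_2_eq_2)
qed

lemma norm_grad_flat: "norm (grad (\<lambda>x. flat 0 (\<alpha> \<bullet> x + \<beta>)) x) \<le> 2 * norm \<alpha>"
  unfolding grad_flat using flat_2_le[of "\<alpha> \<bullet> x + \<beta>"] flat_nonneg[of 2 "\<alpha> \<bullet> x + \<beta>"]
  by (auto intro: mult_right_mono)

text \<open>
  A product of flat functions of the three barycentric coordinates of the reference triangle.
  Requiring each coordinate to be at least \<open>1/6\<close> keeps the support in the interior, and still
  leaves a neighbourhood of the barycentre.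
\<close>

definition ref_bubble :: "R2 \<Rightarrow> real" where
  "ref_bubble v = flat 0 (v $ 1 - 1/6) * (flat 0 (v $ 2 - 1/6) * flat 0 (5/6 - v $ 1 - v $ 2))"

definition bubble_mass :: real where
  "bubble_mass = (LINT v:ref_tri|lebesgue. ref_bubble v)"

lemma continuous_flat: "continuous_on A (flat n)"
proof -
  have "isCont (flat n) t" for t using flat_DERIV[of n t] by (rule DERIV_isCont)
  then show ?thesis by (simp add: continuous_at_imp_continuous_on)
qed

lemma continuous_ref_bubble: "continuous_on UNIV ref_bubble"
  unfolding ref_bubble_def
  by (intro continuous_intros continuous_on_compose2[OF continuous_flat[of UNIV 0]]) auto

lemma bubble_mass_pos: "0 < bubble_mass"
proof -
  have nn: "0 \<le> ref_bubble v" for v by (simp add: ref_bubble_def flat_nonneg)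
  have i: "set_integrable lebesgue ref_tri ref_bubble"
    by (rule compact_set_integrable[OF compact_ref_tri continuous_on_subset[OF continuous_ref_bubble]]) simp
  have "0 \<le> bubble_mass" unfolding bubble_mass_def set_lebesgue_integral_def
    by (rule integral_nonneg_AE) (simp add: nn)
  moreover have "bubble_mass \<noteq> 0"
  proof
    assume "bubble_mass = 0"
    then have "AE v in lebesgue. indicator ref_tri v *\<^sub>R ref_bubble v = 0"
      using i unfolding bubble_mass_def set_lebesgue_integral_def set_integrable_def
      by (subst (asm) integral_nonneg_eq_0_iff_AE) (simp_all add: nn)
    let ?O = "{v::R2. 1/6 < v $ 1 \<and> 1/6 < v $ 2 \<and> v $ 1 + v $ 2 < 5/6}"
    have "open ?O" by (intro open_Collect_conj open_Collect_less continuous_intros)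
    moreover have "ptv (1/3, 1/3) \<in> ?O" by simp
    then have "?O \<noteq> {}" by blast
    ultimately have "\<not> negligible ?O" by (rule open_not_negligible)
    moreover have "AE v in lebesgue. v \<notin> ?O"
      using \<open>AE v in lebesgue. indicator ref_tri v *\<^sub>R ref_bubble v = 0\<close>
    proof eventually_elim
      fix v :: R2 assume z: "indicator ref_tri v *\<^sub>R ref_bubble v = 0"
      show "v \<notin> ?O"
      proof
        assume v: "v \<in> ?O"
        then have "v \<in> ref_tri" by (auto simp: ref_tri_def)
        moreover have "0 < ref_bubble v" unfolding ref_bubble_def using v by (intro mult_pos_pos flat_pos) auto
        ultimately show False using z by simp
      qed
    qed
    then have "negligible ?O"
      using \<open>open ?O\<close> by (simp add: negligible_iff_null_sets AE_iff_null_sets)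
    ultimately show False by simp
  qed
  ultimately show ?thesis by simp
qed

text \<open>
  The bubble function of the reference triangle is transported to \<open>tri z a b\<close>.  The gradients of the
  barycentric coordinates are rotated edges divided by twice the area, so the shape parameter
  controls their size.
\<close>

lemma bubble_exists:
  assumes sh: "shaped \<sigma> z a b"
  shows "\<exists>\<phi>. test_fun (interior (tri z a b)) \<phi> \<and> (\<forall>x. 0 \<le> \<phi> x \<and> \<phi> x \<le> 1)
    \<and> (\<forall>x. (norm (grad \<phi> x))\<^sup>2 \<le> 32 * \<sigma> / \<bar>cross2 (a - z) (b - z)\<bar>)
    \<and> (LINT x:tri z a b|lebesgue. \<phi> x) = \<bar>cross2 (a - z) (b - z)\<bar> * bubble_mass"
proof -
  define p where "p = a - z"
  define q where "q = b - z"
  define d where "d = cross2 p q"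
  have d: "d \<noteq> 0" using sh by (simp add: shaped_def d_def p_def q_def)
  define \<alpha> where "\<alpha> = (1/d) *\<^sub>R perp q"
  define \<beta> where "\<beta> = (- 1/d) *\<^sub>R perp p"
  define la where "la x = \<alpha> \<bullet> (x - z)" for x
  define lb where "lb x = \<beta> \<bullet> (x - z)" for x
  define f1 where "f1 = (\<lambda>x. flat 0 (\<alpha> \<bullet> x + (- (\<alpha> \<bullet> z) - 1/6)))"
  define f2 where "f2 = (\<lambda>x. flat 0 (\<beta> \<bullet> x + (- (\<beta> \<bullet> z) - 1/6)))"
  define f3 where "f3 = (\<lambda>x. flat 0 ((- \<alpha> - \<beta>) \<bullet> x + ((\<alpha> + \<beta>) \<bullet> z + 5/6)))"
  define \<phi> where "\<phi> x = f1 x * (f2 x * f3 x)" for x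
  have f1_eq: "f1 x = flat 0 (la x - 1/6)" and f2_eq: "f2 x = flat 0 (lb x - 1/6)"
    and f3_eq: "f3 x = flat 0 (5/6 - la x - lb x)" for x
    by (simp_all add: f1_def f2_def f3_def la_def lb_def inner_diff_right inner_diff_left inner_add_left algebra_simps)
  have sm: "smooth f1" "smooth f2" "smooth f3" unfolding f1_def f2_def f3_def by (rule smooth_flat)+
  have s23: "smooth (\<lambda>x. f2 x * f3 x)" using sm(2,3) by (rule smooth_mult)
  have s: "smooth \<phi>" unfolding \<phi>_def using sm(1) s23 by (rule smooth_mult)
  have coord: "x = tri_map z a b (ptv (la x, lb x))" for x
  proof -
    have "d *\<^sub>R (x - z) = (perp q \<bullet> (x - z)) *\<^sub>R p - (perp p \<bullet> (x - z)) *\<^sub>R q"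
      by (simp add: vec_eq_iff forall_2 inner_2 d_def cross2_def algebra_simps)
    then have "(1/d) *\<^sub>R (d *\<^sub>R (x - z)) = (1/d) *\<^sub>R ((perp q \<bullet> (x - z)) *\<^sub>R p - (perp p \<bullet> (x - z)) *\<^sub>R q)" by simp
    then have "x - z = la x *\<^sub>R p + lb x *\<^sub>R q" using d
      by (simp add: la_def lb_def \<alpha>_def \<beta>_def scaleR_diff_right)
    then show ?thesis by (simp add: tri_map_def p_def q_def algebra_simps)
  qed
  have la_map: "la (tri_map z a b v) = v $ 1" and lb_map: "lb (tri_map z a b v) = v $ 2" for v
    using d unfolding la_def lb_def \<alpha>_def \<beta>_def tri_map_def p_def[symmetric] q_def[symmetric]
    by (simp_all add: inner_add_right inner_perp d_def) (simp_all add: cross2_def field_simps)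
  have mem: "x \<in> tri z a b" if "0 \<le> la x" "0 \<le> lb x" "la x + lb x \<le> 1" for x
  proof -
    have "ptv (la x, lb x) \<in> ref_tri" using that by (simp add: ref_tri_def)
    then show ?thesis unfolding tri_image using coord[of x] by (rule_tac image_eqI)
  qed
  have cont: "continuous_on UNIV la" "continuous_on UNIV lb"
    unfolding la_def lb_def by (intro continuous_intros)+
  define Oset where "Oset = {x. 0 < la x \<and> 0 < lb x \<and> la x + lb x < 1}"
  define K where "K = {x. 1/6 \<le> la x \<and> 1/6 \<le> lb x \<and> la x + lb x \<le> 5/6}"
  have "open Oset" unfolding Oset_def by (intro open_Collect_conj open_Collect_less continuous_intros cont)
  moreover have "Oset \<subseteq> tri z a b" using mem by (auto simp: Oset_def)
  ultimately have "Oset \<subseteq> interior (tri z a b)" by (rule interior_maximal[rotated])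
  moreover have "K \<subseteq> Oset" by (auto simp: K_def Oset_def)
  ultimately have KT: "K \<subseteq> interior (tri z a b)" by blast
  have "closed K" unfolding K_def by (intro closed_Collect_conj closed_Collect_le continuous_intros cont)
  moreover have "bounded K" using KT interior_tri_facts(1) bounded_subset by blast
  ultimately have K: "compact K" by (simp add: compact_eq_bounded_closed)
  have "test_fun (interior (tri z a b)) \<phi>"
  proof (rule test_funI[OF s K KT])
    fix x assume "x \<notin> K"
    then have "la x - 1/6 \<le> 0 \<or> lb x - 1/6 \<le> 0 \<or> 5/6 - la x - lb x \<le> 0" by (auto simp: K_def)
    then show "\<phi> x = 0" unfolding \<phi>_def f1_eq f2_eq f3_eq using flat_eq_0 by auto
  qed
  moreover have b1: "0 \<le> f1 x \<and> f1 x \<le> 1" "0 \<le> f2 x \<and> f2 x \<le> 1" "0 \<le> f3 x \<and> f3 x \<le> 1" for x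
    unfolding f1_def f2_def f3_def by (simp_all add: flat_nonneg flat_le_1)
  have b01: "0 \<le> f2 x * f3 x \<and> f2 x * f3 x \<le> 1" for x using b1[of x] by (auto intro: mult_le_one)
  moreover have "0 \<le> \<phi> x \<and> \<phi> x \<le> 1" for x unfolding \<phi>_def using b1(1)[of x] b01[of x] by (auto intro: mult_le_one)
  moreover have "(norm (grad \<phi> x))\<^sup>2 \<le> 32 * \<sigma> / \<bar>cross2 (a - z) (b - z)\<bar>" for x
  proof -
    have n: "norm (grad f1 x) \<le> 2 * norm \<alpha>" "norm (grad f2 x) \<le> 2 * norm \<beta>" "norm (grad f3 x) \<le> 2 * norm (- \<alpha> - \<beta>)"
      unfolding f1_def f2_def f3_def by (rule norm_grad_flat)+
    have "grad (\<lambda>x. f2 x * f3 x) x = f2 x *\<^sub>R grad f3 x + f3 x *\<^sub>R grad f2 x" by (rule grad_mult[OF sm(2,3)])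
    moreover have "grad \<phi> x = f1 x *\<^sub>R grad (\<lambda>x. f2 x * f3 x) x + (f2 x * f3 x) *\<^sub>R grad f1 x"
      unfolding \<phi>_def by (rule grad_mult[OF sm(1) s23])
    moreover have le: "norm (c *\<^sub>R y) \<le> norm y" if "0 \<le> c \<and> c \<le> 1" for c :: real and y :: R2
      using that by (simp add: mult_left_le_one_le)
    ultimately have "norm (grad \<phi> x) \<le> (norm (grad f3 x) + norm (grad f2 x)) + norm (grad f1 x)"
      using b1[of x] b01[of x] by (auto intro!: norm_triangle_mono order_trans[OF le norm_triangle_mono])
    also have "\<dots> \<le> 2 * norm (- \<alpha> - \<beta>) + 2 * norm \<beta> + 2 * norm \<alpha>" using n by simp
    also have "norm (- \<alpha> - \<beta>) \<le> norm \<alpha> + norm \<beta>" using norm_triangle_ineq4[of "- \<alpha>" \<beta>] by simp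
    finally have "norm (grad \<phi> x) \<le> 4 * (norm \<alpha> + norm \<beta>)" by simp
    also have "norm \<alpha> + norm \<beta> = (norm p + norm q) / \<bar>d\<bar>" by (simp add: \<alpha>_def \<beta>_def add_divide_distrib)
    finally have "(norm (grad \<phi> x))\<^sup>2 \<le> (4 * ((norm p + norm q) / \<bar>d\<bar>))\<^sup>2" by (rule power_mono) simp
    also have "\<dots> = 16 * (norm p + norm q)\<^sup>2 / (\<bar>d\<bar> * \<bar>d\<bar>)"
    proof -
      have "(4 * (x / y))\<^sup>2 = 16 * x\<^sup>2 / (y * y)" for x y :: real by (simp add: power2_eq_square)
      then show ?thesis .
    qed
    also have "\<dots> \<le> 16 * (2 * (\<sigma> * \<bar>d\<bar>)) / (\<bar>d\<bar> * \<bar>d\<bar>)"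
    proof (intro divide_right_mono mult_left_mono)
      have "(norm p + norm q)\<^sup>2 \<le> 2 * ((norm p)\<^sup>2 + (norm q)\<^sup>2)"
        using zero_le_power2[of "norm p - norm q"] by (simp add: power2_sum power2_diff)
      also have "(norm p)\<^sup>2 + (norm q)\<^sup>2 \<le> \<sigma> * \<bar>d\<bar>" using sh by (simp add: shaped_def p_def q_def d_def)
      finally show "(norm p + norm q)\<^sup>2 \<le> 2 * (\<sigma> * \<bar>d\<bar>)" by simp
    qed simp_all
    also have "\<dots> = 32 * \<sigma> / \<bar>d\<bar>"
    proof -
      have *: "16 * (2 * (\<sigma> * y)) / (y * y) = 32 * \<sigma> / y" if "y \<noteq> 0" for y :: real
        using that by (simp add: field_simps)
      show ?thesis by (rule *) (use d in simp)
    qed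
    finally show ?thesis by (simp add: d_def p_def q_def)
  qed
  moreover have "(LINT x:tri z a b|lebesgue. \<phi> x) = \<bar>cross2 (a - z) (b - z)\<bar> * bubble_mass"
  proof -
    have c: "cross2 (a - z) (b - z) \<noteq> 0" using d by (simp add: d_def p_def q_def)
    have "\<phi> (tri_map z a b v) = ref_bubble v" for v
      unfolding \<phi>_def f1_eq f2_eq f3_eq la_map lb_map ref_bubble_def ..
    then show ?thesis using tri_integral[OF c smooth_GDERIV(2)[OF s]] by (simp add: bubble_mass_def)
  qed
  ultimately show ?thesis by blast
qed

section \<open>Oscillation\<close>

lemma L2_norm_bound:
  fixes F :: "R2 \<Rightarrow> 'b::euclidean_space"
  assumes "T \<in> lmeasurable" "F \<in> L2 T" "\<And>x. (norm (F x))\<^sup>2 \<le> M"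
  shows "(L2_norm T F)\<^sup>2 \<le> M * measure lebesgue T"
proof -
  have T: "T \<in> sets lebesgue" using assms(1) by (rule fmeasurableD)
  have i: "set_integrable lebesgue T (\<lambda>x. M)" by (rule L2_imp_set_integrable[OF assms(1) L2_const[OF assms(1)]])
  have "(L2_norm T F)\<^sup>2 \<le> (LINT x:T|lebesgue. M)"
    unfolding L2_norm_power2 by (rule set_integral_mono[OF L2_norm_integrable[OF assms(2)] i]) (rule assms(3))
  also have "\<dots> = M * measure lebesgue T"
    using assms(1) T unfolding set_lebesgue_integral_def by (simp add: mult.commute)
  finally show ?thesis .
qed

text \<open>
  In the proof of \<open>tri_efficiency\<close> the oscillation enters with the factor \<open>2 + 1 / bubble_mass\<^sup>2\<close> and
  the error with the last summand; the sum is an upper bound for both.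
\<close>

definition efficiency_constant :: "real \<Rightarrow> real" where
  "efficiency_constant \<sigma> = 2 + 1 / bubble_mass\<^sup>2 + 16 * \<bar>\<sigma>\<bar> / bubble_mass\<^sup>2"

context domain_mesh
begin

lemma set_LINT_const: "T \<in> tris \<T> \<Longrightarrow> (LINT x:T|lebesgue. c) = c * measure lebesgue T" for c :: real
  using tris_facts(2,3)[of T] unfolding set_lebesgue_integral_def by (simp add: mult.commute)

text \<open>The mean is the best approximation by constants in the square norm.\<close>

lemma mean_free_norm:
  assumes T: "T \<in> tris \<T>" and f: "f \<in> L2 \<Omega>"
  shows "(L2_norm T (\<lambda>x. f x - mean_value T f))\<^sup>2 \<le> (L2_norm T f)\<^sup>2"
    "(\<lambda>x. f x - mean_value T f) \<in> L2 T"
proof -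
  let ?F = "mean_value T f"
  note fT = L2_integrable_tri[OF f T] and cT = L2_const[OF tris_facts(2)[OF T], of ?F]
  have "(LINT x:T|lebesgue. f x) = ?F * measure lebesgue T" using measure_pos[OF T] by (simp add: mean_value_def)
  then have "(LINT x:T|lebesgue. f x \<bullet> ?F) = ?F\<^sup>2 * measure lebesgue T" by (simp add: power2_eq_square)
  moreover have "(L2_norm T (\<lambda>x. ?F))\<^sup>2 = ?F\<^sup>2 * measure lebesgue T"
    unfolding L2_norm_power2 using set_LINT_const[OF T] by simp
  moreover have "0 \<le> ?F\<^sup>2 * measure lebesgue T" by simp
  ultimately show "(L2_norm T (\<lambda>x. f x - ?F))\<^sup>2 \<le> (L2_norm T f)\<^sup>2"
    using L2_norm_diff_power2[OF fT(2) cT] by simp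
  show "(\<lambda>x. f x - ?F) \<in> L2 T" by (rule L2_diff[OF fT(2) cT])
qed

lemma weighted_norm_sum:
  assumes f: "f \<in> L2 \<Omega>"
  shows "(L2_norm \<Omega> (\<lambda>x. mesh_size \<T> x * f x))\<^sup>2 = (\<Sum>T\<in>tris \<T>. measure lebesgue T * (L2_norm T f)\<^sup>2)"
    "osc_sq \<T> f = (\<Sum>T\<in>tris \<T>. measure lebesgue T * (L2_norm T (\<lambda>x. f x - mean_value T f))\<^sup>2)"
proof -
  have *: "(LINT x:T|lebesgue. (mesh_size \<T> x)\<^sup>2 * (norm (F x))\<^sup>2) = measure lebesgue T * (L2_norm T F)\<^sup>2"
    if T: "T \<in> tris \<T>" for T and F :: "R2 \<Rightarrow> real"
  proof -
    have "AE x in lebesgue. x \<in> T \<longrightarrow> (mesh_size \<T> x)\<^sup>2 * (norm (F x))\<^sup>2 = measure lebesgue T * (norm (F x))\<^sup>2"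
      using mesh_size_AE[OF T] by eventually_elim simp
    from set_LINT_cong_AE[OF this] show ?thesis unfolding L2_norm_power2 by simp
  qed
  show "(L2_norm \<Omega> (\<lambda>x. mesh_size \<T> x * f x))\<^sup>2 = (\<Sum>T\<in>tris \<T>. measure lebesgue T * (L2_norm T f)\<^sup>2)"
    unfolding L2_norm_domain[OF mesh_size_L2(1)[OF f]]
  proof (rule sum.cong[OF refl])
    fix T assume "T \<in> tris \<T>"
    from *[OF this, of f] show "(L2_norm T (\<lambda>x. mesh_size \<T> x * f x))\<^sup>2 = measure lebesgue T * (L2_norm T f)\<^sup>2"
      unfolding L2_norm_power2[of T "\<lambda>x. mesh_size \<T> x * f x"] by (simp add: abs_mult power_mult_distrib)
  qed
  show "osc_sq \<T> f = (\<Sum>T\<in>tris \<T>. measure lebesgue T * (L2_norm T (\<lambda>x. f x - mean_value T f))\<^sup>2)"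
    unfolding osc_sq_def
  proof (rule sum.cong[OF refl])
    fix T assume "T \<in> tris \<T>"
    from *[OF this, of "\<lambda>x. f x - mean_value T f"]
    show "(LINT x:T|lebesgue. (mesh_size \<T> x)\<^sup>2 * \<bar>f x - mean_value T f\<bar>\<^sup>2)
      = measure lebesgue T * (L2_norm T (\<lambda>x. f x - mean_value T f))\<^sup>2" by simp
  qed
qed

lemma osc_le:
  assumes f: "f \<in> L2 \<Omega>"
  shows "osc_sq \<T> f \<le> (L2_norm \<Omega> (\<lambda>x. mesh_size \<T> x * f x))\<^sup>2"
  unfolding weighted_norm_sum[OF f]
  by (intro sum_mono mult_left_mono mean_free_norm(1)[OF _ f]) simp_all

text \<open>
  The bubble function \<open>\<phi>\<close> of \<open>T\<close> is admissible in the continuous problem, and its gradient integrates to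
  zero, so the constant \<open>c\<close> may be subtracted from the gradient of \<open>u\<close>.  Writing \<open>f\<close> as its
  mean plus the deviation from it bounds the mean by the error and the oscillation; adding the
  deviation bounds \<open>f\<close> itself.
\<close>

lemma tri_efficiency:
  assumes T: "T \<in> tris \<T>" and f: "f \<in> L2 \<Omega>" and u: "weak_solution \<Omega> f u" and k: "k \<in> L2 \<Omega>"
    and c: "AE x in lebesgue. x \<in> T \<longrightarrow> k x = c"
  shows "measure lebesgue T * (L2_norm T f)\<^sup>2 \<le> efficiency_constant \<sigma> *
    ((L2_norm T (\<lambda>x. weak_grad \<Omega> u x - k x))\<^sup>2 + measure lebesgue T * (L2_norm T (\<lambda>x. f x - mean_value T f))\<^sup>2)"
proof -
  obtain z a b where zab: "T = tri z a b" "shaped \<sigma> z a b" using tris_shape[OF T] by blast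
  define d where "d = cross2 (a - z) (b - z)"
  have d: "d \<noteq> 0" using zab(2) by (simp add: shaped_def d_def)
  define m where "m = measure lebesgue T"
  have m: "\<bar>d\<bar> = 2 * m" "0 < m" using measure_tri[of a z b] d measure_pos[OF T] by (simp_all add: m_def zab(1) d_def)
  have "0 \<le> \<sigma> * \<bar>d\<bar>" using zab(2) unfolding shaped_def d_def
    by (meson add_nonneg_nonneg order_trans zero_le_power2)
  then have \<sigma>: "0 \<le> \<sigma>" using d by (simp add: zero_le_mult_iff)
  obtain \<phi> where \<phi>: "test_fun (interior T) \<phi>" "\<forall>x. 0 \<le> \<phi> x \<and> \<phi> x \<le> 1"
    "\<forall>x. (norm (grad \<phi> x))\<^sup>2 \<le> 32 * \<sigma> / \<bar>d\<bar>" "(LINT x:T|lebesgue. \<phi> x) = \<bar>d\<bar> * bubble_mass"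
    using bubble_exists[OF zab(2)] unfolding zab(1) d_def by (elim exE conjE)
  define \<kappa> where "\<kappa> = bubble_mass"
  have \<kappa>: "0 < \<kappa>" unfolding \<kappa>_def by (rule bubble_mass_pos)
  define F where "F = mean_value T f"
  define gu where "gu = weak_grad \<Omega> u"
  have uH: "u \<in> H10 \<Omega>" and sol: "\<And>y. y \<in> H10 \<Omega> \<Longrightarrow>
      (LINT x:\<Omega>|lebesgue. weak_grad \<Omega> u x \<bullet> weak_grad \<Omega> y x) = (LINT x:\<Omega>|lebesgue. f x * y x)"
    using u unfolding weak_solution_def by blast+
  have guL: "gu \<in> L2 \<Omega>" unfolding gu_def by (rule H10_facts(3)[OF uH])
  have t\<Omega>: "test_fun \<Omega> \<phi>" by (rule test_fun_mono[OF \<phi>(1) interior_subset_domain[OF T]])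
  have s: "smooth \<phi>" using \<phi>(1) unfolding test_fun_def by blast
  obtain K where K: "compact K" "K \<subseteq> interior T" "\<forall>x. x \<notin> K \<longrightarrow> \<phi> x = 0" "\<forall>x. x \<notin> K \<longrightarrow> grad \<phi> x = 0" "smooth \<phi>"
    using test_fun_support[OF \<phi>(1)] by (elim exE conjE) (rule that)
  have outT: "\<phi> x = 0" "grad \<phi> x = 0" if "x \<notin> interior T" for x using K(3,4) subsetD[OF K(2), of x] that by blast+
  have pL: "\<phi> \<in> L2 \<Omega>" "grad \<phi> \<in> L2 \<Omega>" using smooth_L2[OF s bounded_domain domain_sets] .
  note pT = L2_integrable_tri(2)[OF pL(1) T] L2_integrable_tri(2)[OF pL(2) T]
  have toT: "(LINT x:\<Omega>|lebesgue. h x) = (LINT x:T|lebesgue. h x)" if "\<And>x. x \<notin> interior T \<Longrightarrow> h x = 0" for h :: "R2 \<Rightarrow> real"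
  proof -
    have "(LINT x:\<Omega>|lebesgue. h x) = (LINT x:interior T|lebesgue. h x)"
      by (rule set_LINT_outside_0[OF _ interior_subset_domain[OF T]]) (rule that)
    also have "\<dots> = (LINT x:T|lebesgue. h x)" by (rule set_LINT_cong_set_AE[OF tris_facts(6)[OF T]])
    finally show ?thesis .
  qed
  have weak: "(LINT x:T|lebesgue. gu x \<bullet> grad \<phi> x) = (LINT x:T|lebesgue. f x * \<phi> x)"
  proof -
    have "AE x in lebesgue. x \<in> \<Omega> \<longrightarrow> gu x \<bullet> weak_grad \<Omega> \<phi> x = gu x \<bullet> grad \<phi> x"
      using weak_grad_AE_eq(1)[OF open_domain smooth_has_weak_grad[OF s]] by eventually_elim simp
    from set_LINT_cong_AE[OF this]
    have "(LINT x:\<Omega>|lebesgue. gu x \<bullet> grad \<phi> x) = (LINT x:\<Omega>|lebesgue. f x * \<phi> x)"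
      using sol[OF test_fun_H10[OF open_domain bounded_domain t\<Omega>]] by (simp add: gu_def)
    then show ?thesis using toT[of "\<lambda>x. gu x \<bullet> grad \<phi> x"] toT[of "\<lambda>x. f x * \<phi> x"] outT by simp
  qed
  have "(LINT x|lebesgue. grad \<phi> x) = 0"
    by (rule integral_GDERIV_eq_0(2)[OF smooth_GDERIV(1)[OF s] smooth_GDERIV(3)[OF s] K(1)]) (use K(3) in blast)
  moreover have "(LINT x|lebesgue. grad \<phi> x) = (LINT x:interior T|lebesgue. grad \<phi> x)"
    unfolding set_lebesgue_integral_def
    by (rule arg_cong[where f="integral\<^sup>L lebesgue"]) (use outT(2) in \<open>auto simp: fun_eq_iff indicator_def\<close>)
  ultimately have g0: "(LINT x:T|lebesgue. grad \<phi> x) = 0"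
    using set_LINT_cong_set_AE[OF tris_facts(6)[OF T], of "grad \<phi>"] by simp
  have "(LINT x:T|lebesgue. k x \<bullet> grad \<phi> x) = (LINT x:T|lebesgue. grad \<phi> x \<bullet> c)"
    by (rule set_LINT_cong_AE) (use c in \<open>auto simp: inner_commute elim!: eventually_mono\<close>)
  also have "\<dots> = 0" using set_LINT_inner[OF L2_imp_set_integrable[OF tris_facts(2)[OF T] pT(2)]] g0 by simp
  finally have k0: "(LINT x:T|lebesgue. k x \<bullet> grad \<phi> x) = 0" .
  note guT = L2_integrable_tri(2)[OF guL T] and kT = L2_integrable_tri(2)[OF k T] and fT = L2_integrable_tri(2)[OF f T]
  have eT: "(\<lambda>x. gu x - k x) \<in> L2 T" by (rule L2_diff[OF guT kT])
  have ffT: "(\<lambda>x. f x - F) \<in> L2 T" unfolding F_def by (rule mean_free_norm(2)[OF T f])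
  have 1: "(LINT x:T|lebesgue. (gu x - k x) \<bullet> grad \<phi> x) = (LINT x:T|lebesgue. f x * \<phi> x)"
    using set_integral_diff(2)[OF L2_inner_integrable[OF guT pT(2)] L2_inner_integrable[OF kT pT(2)]] weak k0
    by (simp add: inner_diff_left)
  have 2: "(LINT x:T|lebesgue. (f x - F) \<bullet> \<phi> x) = (LINT x:T|lebesgue. f x * \<phi> x) - F * (\<bar>d\<bar> * \<kappa>)"
  proof -
    have "set_integrable lebesgue T (\<lambda>x. F * \<phi> x)" using L2_imp_set_integrable[OF tris_facts(2)[OF T] pT(1)] by simp
    from set_integral_diff(2)[OF L2_inner_integrable[OF fT pT(1)] this] show ?thesis
      using \<phi>(4) by (simp add: left_diff_distrib \<kappa>_def)
  qed
  define e where "e = L2_norm T (\<lambda>x. gu x - k x)"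
  define r where "r = L2_norm T (\<lambda>x. f x - F)"
  have er: "0 \<le> e" "0 \<le> r" by (simp_all add: e_def r_def)
  have nphi: "(L2_norm T \<phi>)\<^sup>2 \<le> 1 * m" unfolding m_def
    by (rule L2_norm_bound[OF tris_facts(2)[OF T] pT(1)]) (use \<phi>(2) in \<open>simp add: power_le_one\<close>)
  have ngrad: "(L2_norm T (grad \<phi>))\<^sup>2 \<le> 16 * \<sigma>"
  proof -
    have "(L2_norm T (grad \<phi>))\<^sup>2 \<le> 32 * \<sigma> / \<bar>d\<bar> * m" unfolding m_def
      by (rule L2_norm_bound[OF tris_facts(2)[OF T] pT(2)]) (use \<phi>(3) in blast)
    also have "\<dots> = 16 * \<sigma>" using m by simp
    finally show ?thesis .
  qed
  have "F * (\<bar>d\<bar> * \<kappa>) = (LINT x:T|lebesgue. (gu x - k x) \<bullet> grad \<phi> x) - (LINT x:T|lebesgue. (f x - F) \<bullet> \<phi> x)"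
    using 1 2 by simp
  then have "\<bar>F * (\<bar>d\<bar> * \<kappa>)\<bar> \<le> e * L2_norm T (grad \<phi>) + r * L2_norm T \<phi>"
    using L2_Cauchy_Schwarz[OF eT pT(2)] L2_Cauchy_Schwarz[OF ffT pT(1)] unfolding e_def r_def by linarith
  then have "\<bar>F * (\<bar>d\<bar> * \<kappa>)\<bar>\<^sup>2 \<le> (e * L2_norm T (grad \<phi>) + r * L2_norm T \<phi>)\<^sup>2" by (rule power_mono) simp
  also have "\<dots> \<le> 2 * (e * L2_norm T (grad \<phi>))\<^sup>2 + 2 * (r * L2_norm T \<phi>)\<^sup>2"
    using zero_le_power2[of "e * L2_norm T (grad \<phi>) - r * L2_norm T \<phi>"] by (simp add: power2_sum power2_diff)
  also have "\<dots> \<le> 2 * (e\<^sup>2 * (16 * \<sigma>)) + 2 * (r\<^sup>2 * m)"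
    unfolding power_mult_distrib using ngrad nphi by (intro add_mono mult_left_mono) simp_all
  \<comment> \<open>here \<open>\<bar>d\<bar> = 2 * m\<close>\<close>
  finally have key: "4 * m\<^sup>2 * \<kappa>\<^sup>2 * F\<^sup>2 \<le> 32 * \<sigma> * e\<^sup>2 + 2 * m * r\<^sup>2"
    unfolding m(1) by (simp add: power_mult_distrib mult_ac)
  have mF: "m\<^sup>2 * F\<^sup>2 \<le> 8 * \<sigma> / \<kappa>\<^sup>2 * e\<^sup>2 + m * r\<^sup>2 / (2 * \<kappa>\<^sup>2)"
    using key \<kappa> by (simp add: field_simps)
  have "L2_norm T f \<le> r + L2_norm T (\<lambda>x. F)"
    using L2_norm_triangle[OF ffT L2_const[OF tris_facts(2)[OF T], of F]] by (simp add: r_def)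
  then have "(L2_norm T f)\<^sup>2 \<le> (r + L2_norm T (\<lambda>x. F))\<^sup>2" by (rule power_mono) simp
  also have "\<dots> \<le> 2 * r\<^sup>2 + 2 * (L2_norm T (\<lambda>x. F))\<^sup>2"
    using zero_le_power2[of "r - L2_norm T (\<lambda>x. F)"] by (simp add: power2_sum power2_diff)
  also have "(L2_norm T (\<lambda>x. F))\<^sup>2 = F\<^sup>2 * m"
    unfolding L2_norm_power2 m_def using set_LINT_const[OF T] by simp
  finally have "m * (L2_norm T f)\<^sup>2 \<le> m * (2 * r\<^sup>2 + 2 * (F\<^sup>2 * m))" by (rule mult_left_mono) (use m in simp)
  also have "\<dots> = 2 * (m * r\<^sup>2) + 2 * (m\<^sup>2 * F\<^sup>2)" by (simp add: power2_eq_square algebra_simps)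
  also have "\<dots> \<le> 2 * (m * r\<^sup>2) + 2 * (8 * \<sigma> / \<kappa>\<^sup>2 * e\<^sup>2 + m * r\<^sup>2 / (2 * \<kappa>\<^sup>2))"
    by (intro add_left_mono mult_left_mono mF) simp
  also have "\<dots> = (2 + 1 / \<kappa>\<^sup>2) * (m * r\<^sup>2) + 16 * \<sigma> / \<kappa>\<^sup>2 * e\<^sup>2" by (simp add: algebra_simps)
  also have "\<dots> \<le> efficiency_constant \<sigma> * (m * r\<^sup>2) + efficiency_constant \<sigma> * e\<^sup>2"
  proof (rule add_mono; rule mult_right_mono)
    show "2 + 1 / \<kappa>\<^sup>2 \<le> efficiency_constant \<sigma>" "16 * \<sigma> / \<kappa>\<^sup>2 \<le> efficiency_constant \<sigma>"
      unfolding efficiency_constant_def \<kappa>_def[symmetric] using \<sigma> by simp_all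
  qed (use m in simp_all)
  finally show ?thesis unfolding m_def e_def r_def gu_def F_def by (simp add: algebra_simps)
qed

lemma efficiency:
  assumes f: "f \<in> L2 \<Omega>" and u: "weak_solution \<Omega> f u" and w: "w \<in> CR \<Omega> \<T>"
  shows "(L2_norm \<Omega> (\<lambda>x. mesh_size \<T> x * f x))\<^sup>2
    \<le> efficiency_constant \<sigma> * ((L2_norm \<Omega> (\<lambda>x. weak_grad \<Omega> u x - nc_grad \<T> w x))\<^sup>2 + osc_sq \<T> f)"
proof -
  have uH: "u \<in> H10 \<Omega>" using u unfolding weak_solution_def by blast
  note kL = CR_nc_grad(3)[OF w]
  have dL: "(\<lambda>x. weak_grad \<Omega> u x - nc_grad \<T> w x) \<in> L2 \<Omega>" by (rule L2_diff[OF H10_facts(3)[OF uH] kL])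
  have "(L2_norm \<Omega> (\<lambda>x. mesh_size \<T> x * f x))\<^sup>2 \<le> (\<Sum>T\<in>tris \<T>. efficiency_constant \<sigma> *
    ((L2_norm T (\<lambda>x. weak_grad \<Omega> u x - nc_grad \<T> w x))\<^sup>2 + measure lebesgue T * (L2_norm T (\<lambda>x. f x - mean_value T f))\<^sup>2))"
    unfolding weighted_norm_sum(1)[OF f]
  proof (rule sum_mono)
    fix T assume T: "T \<in> tris \<T>"
    obtain c where "AE x in lebesgue. x \<in> T \<longrightarrow> nc_grad \<T> w x = c" using CR_nc_grad(2)[OF w T] by (rule exE)
    from tri_efficiency[OF T f u kL this]
    show "measure lebesgue T * (L2_norm T f)\<^sup>2 \<le> efficiency_constant \<sigma> *
    ((L2_norm T (\<lambda>x. weak_grad \<Omega> u x - nc_grad \<T> w x))\<^sup>2 + measure lebesgue T * (L2_norm T (\<lambda>x. f x - mean_value T f))\<^sup>2)" .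
  qed
  also have "\<dots> = efficiency_constant \<sigma> * ((L2_norm \<Omega> (\<lambda>x. weak_grad \<Omega> u x - nc_grad \<T> w x))\<^sup>2 + osc_sq \<T> f)"
    unfolding weighted_norm_sum(2)[OF f] L2_norm_domain[OF dL] sum.distrib[symmetric] sum_distrib_left ..
  finally show ?thesis .
qed

end

section \<open>Equivalence of energy differences and errors\<close>

text \<open>
  Here \<open>D\<close> is the error, \<open>H\<close> the weighted norm of \<open>f\<close> over the refined triangles, \<open>X\<close> the term of
  \<open>energy_comparison\<close> and \<open>B\<close> the loss of the weighted norm.  Young's inequality
  \<open>\<Lambda> * H * D \<le> D\<^sup>2 / 4 + \<Lambda>\<^sup>2 * H\<^sup>2\<close> leaves the positive factors \<open>1 / 4\<close> of \<open>D\<^sup>2\<close>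
  and \<open>\<gamma> / 2 - \<Lambda>\<^sup>2\<close> of \<open>H\<^sup>2\<close>.
\<close>

lemma energy_difference_equiv:
  fixes D H X B \<Lambda> \<gamma> :: real
  assumes g: "\<gamma> > 2 * \<Lambda>\<^sup>2" and X: "\<bar>X\<bar> \<le> \<Lambda> * H * D" and B: "H\<^sup>2 / 2 \<le> B" "B \<le> H\<^sup>2"
  defines "c \<equiv> 4 + \<Lambda>\<^sup>2 + \<gamma> + 2 / (\<gamma> - 2 * \<Lambda>\<^sup>2)"
  shows "D\<^sup>2 / 2 - X + \<gamma> * B \<le> c * (D\<^sup>2 + H\<^sup>2)" "D\<^sup>2 + H\<^sup>2 \<le> c * (D\<^sup>2 / 2 - X + \<gamma> * B)"
proof -
  define \<delta> where "\<delta> = \<gamma> - 2 * \<Lambda>\<^sup>2"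
  have \<delta>: "0 < \<delta>" using g by (simp add: \<delta>_def)
  have L: "0 \<le> \<Lambda>\<^sup>2" by simp
  have \<gamma>: "0 < \<gamma>" using g L by linarith
  have "0 \<le> (D / 2 - \<Lambda> * H)\<^sup>2" by simp
  then have "\<Lambda> * H * D \<le> D\<^sup>2 / 4 + \<Lambda>\<^sup>2 * H\<^sup>2" by (simp add: power2_diff power_mult_distrib power_divide algebra_simps)
  then have X': "\<bar>X\<bar> \<le> D\<^sup>2 / 4 + \<Lambda>\<^sup>2 * H\<^sup>2" using X by linarith
  have c: "1 \<le> c" "4 \<le> c" "\<Lambda>\<^sup>2 + \<gamma> \<le> c" "2 / \<delta> \<le> c"
    using L \<gamma> \<delta> unfolding c_def \<delta>_def[symmetric] by (simp_all add: add_nonneg_nonneg add_increasing)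
  have "D\<^sup>2 / 2 - X + \<gamma> * B \<le> D\<^sup>2 / 2 + (D\<^sup>2 / 4 + \<Lambda>\<^sup>2 * H\<^sup>2) + \<gamma> * H\<^sup>2"
    using X' mult_left_mono[OF B(2), of \<gamma>] \<gamma> by linarith
  also have "\<dots> \<le> 1 * D\<^sup>2 + (\<Lambda>\<^sup>2 + \<gamma>) * H\<^sup>2" by (simp add: algebra_simps)
  also have "\<dots> \<le> c * D\<^sup>2 + c * H\<^sup>2" using c by (intro add_mono mult_right_mono) simp_all
  finally show "D\<^sup>2 / 2 - X + \<gamma> * B \<le> c * (D\<^sup>2 + H\<^sup>2)" by (simp add: distrib_left)
  have low: "D\<^sup>2 / 4 + \<delta> / 2 * H\<^sup>2 \<le> D\<^sup>2 / 2 - X + \<gamma> * B"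
  proof -
    have "\<gamma> * (H\<^sup>2 / 2) \<le> \<gamma> * B" using B(1) \<gamma> by (intro mult_left_mono) simp_all
    moreover have "\<delta> / 2 * H\<^sup>2 = \<gamma> * (H\<^sup>2 / 2) - \<Lambda>\<^sup>2 * H\<^sup>2" by (simp add: \<delta>_def field_simps)
    ultimately show ?thesis using X' by linarith
  qed
  have "D\<^sup>2 + H\<^sup>2 = 4 * (D\<^sup>2 / 4) + 2 / \<delta> * (\<delta> / 2 * H\<^sup>2)" using \<delta> by simp
  also have "\<dots> \<le> c * (D\<^sup>2 / 4) + c * (\<delta> / 2 * H\<^sup>2)"
    using c \<delta> by (intro add_mono mult_right_mono) simp_all
  also have "\<dots> \<le> c * (D\<^sup>2 / 2 - X + \<gamma> * B)"
    unfolding distrib_left[symmetric] using low c by (intro mult_left_mono) simp_all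
  finally show "D\<^sup>2 + H\<^sup>2 \<le> c * (D\<^sup>2 / 2 - X + \<gamma> * B)" .
qed

lemma equiv_uptoI:
  assumes "0 < c1" "c1 \<le> c" "A \<le> c1 * B" "B \<le> c1 * A" "0 \<le> A" "0 \<le> B"
  shows "equiv_upto c A B"
proof -
  have "A \<le> c * B" "B \<le> c * A" using assms mult_right_mono[OF assms(2), of A] mult_right_mono[OF assms(2), of B] by linarith+
  then show ?thesis using assms(1,2) by (simp add: equiv_upto_def inverse_eq_divide divide_le_eq mult.commute)
qed

context domain_mesh
begin

text \<open>
  Together with \<open>zero_H10\<close> this embeds both \<open>H10\<close> and \<open>CR\<close> into the sum \<open>H10_plus_CR\<close>, for whose
  members the interpolation estimate is assumed.
\<close>

lemma zero_CR: "(\<lambda>x. 0) \<in> CR \<Omega> \<T>"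
proof -
  let ?z = "\<lambda>x::R2. 0::real"
  have ae: "AE x in lebesgue. x \<in> T \<longrightarrow> ?z x = 0 \<bullet> x + 0" for T by simp
  have tr: "seg_integral S (trace_on T S ?z) = 0" if T: "T \<in> tris \<T>" "S edge_of T" for T S
  proof -
    obtain z a b where zab: "T = tri z a b" "S = closed_segment a b" "cross2 (a - z) (b - z) \<noteq> 0"
      by (rule edge_segment[OF T])
    have "edge_mean T ?z a b = 0" unfolding zab(1) edge_mean_affine[OF zab(3) ae] by simp
    then show ?thesis unfolding zab(2) seg_integral_eq edge_mean_def by simp
  qed
  show ?thesis by (rule CR_I[OF L2_zero ae tr]) simp_all
qed

lemma zero_H10: "(\<lambda>x. 0) \<in> H10 \<Omega>"
proof (rule test_fun_H10[OF open_domain bounded_domain])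
  show "test_fun \<Omega> (\<lambda>x. 0)" by (rule test_funI[of _ "{}"]) auto
qed

text \<open>
  Testing the equation with the solution itself identifies the load term with the squared norm of
  the gradient, so the energy is half of that norm.
\<close>

lemma energy_value:
  assumes f: "f \<in> L2 \<Omega>" and v: "v \<in> L2 \<Omega>" and g: "(g :: R2 \<Rightarrow> R2) \<in> L2 \<Omega>"
    and e: "(LINT x:\<Omega>|lebesgue. g x \<bullet> g x) = (LINT x:\<Omega>|lebesgue. f x * v x)"
  shows "- (LINT x:\<Omega>|lebesgue. (1/2) * (norm (g x))\<^sup>2 - f x * v x) = (1/2) * (L2_norm \<Omega> g)\<^sup>2"
proof -
  have i: "set_integrable lebesgue \<Omega> (\<lambda>x. (1/2) * (norm (g x))\<^sup>2)" "set_integrable lebesgue \<Omega> (\<lambda>x. f x * v x)"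
    using L2_norm_integrable[OF g] L2_inner_integrable[OF f v] by simp_all
  have "(LINT x:\<Omega>|lebesgue. f x * v x) = (L2_norm \<Omega> g)\<^sup>2"
    unfolding e[symmetric] L2_norm_power2 by (simp add: dot_square_norm)
  moreover have "(LINT x:\<Omega>|lebesgue. (1/2) * (norm (g x))\<^sup>2) = (1/2) * (L2_norm \<Omega> g)\<^sup>2"
    unfolding L2_norm_power2 by (rule set_integral_mult_right)
  ultimately show ?thesis using set_integral_diff(2)[OF i] by simp
qed

lemma CR_energy_value:
  assumes f: "f \<in> L2 \<Omega>" and u: "CR_solution \<Omega> \<T> f v"
  shows "- (LINT x:\<Omega>|lebesgue. (1/2) * (norm (nc_grad \<T> v x))\<^sup>2 - f x * v x) = (1/2) * (L2_norm \<Omega> (nc_grad \<T> v))\<^sup>2"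
    and "(LINT x:\<Omega>|lebesgue. nc_grad \<T> v x \<bullet> nc_grad \<T> v x) = (LINT x:\<Omega>|lebesgue. f x * v x)"
    and "v \<in> CR \<Omega> \<T>"
proof -
  note u' = u[unfolded CR_solution_def]
  show v: "v \<in> CR \<Omega> \<T>" using conjunct1[OF u'] .
  show e: "(LINT x:\<Omega>|lebesgue. nc_grad \<T> v x \<bullet> nc_grad \<T> v x) = (LINT x:\<Omega>|lebesgue. f x * v x)"
    by (rule bspec[OF conjunct2[OF u'] v])
  show "- (LINT x:\<Omega>|lebesgue. (1/2) * (norm (nc_grad \<T> v x))\<^sup>2 - f x * v x) = (1/2) * (L2_norm \<Omega> (nc_grad \<T> v))\<^sup>2"
    by (rule energy_value[OF f CR_D(1)[OF v] CR_nc_grad(3)[OF v] e])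
qed

end

theorem lemma3p4:
  fixes \<Omega> :: "R2 set" and \<T>0 :: mesh and \<Lambda> \<gamma> :: real
  assumes "polygonal_domain \<Omega>"
    and "initial_mesh \<Omega> \<T>0"
    and "interpolation_constant \<Omega> \<T>0 \<Lambda>"
    and "\<gamma> > 2 * \<Lambda>\<^sup>2"
  shows "\<exists>c>0. \<forall>(f :: R2 \<Rightarrow> real) (u :: xmesh \<Rightarrow> R2 \<Rightarrow> real).
    f \<in> L2 \<Omega> \<and> (\<forall>\<X> \<in> xmeshes \<T>0. solves \<Omega> f \<X> (u \<X>)) \<longrightarrow>
    (\<forall>\<T> \<in> meshes \<T>0.
      (\<forall>\<X> \<in> xmeshes \<T>0. xrefinement \<T> \<X> \<longrightarrow>
        equiv_upto c
          (energy \<Omega> \<gamma> f u (Mesh \<T>) - energy \<Omega> \<gamma> f u \<X>)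
          ((L2_norm \<Omega> (nc_grad (finer_mesh \<T> \<X>) (\<lambda>x. u \<X> x - u (Mesh \<T>) x)))\<^sup>2
            + (L2_norm (region (refined_tris \<T> \<X>)) (\<lambda>x. mesh_size \<T> x * f x))\<^sup>2)) \<and>
      equiv_upto c
        (energy \<Omega> \<gamma> f u (Mesh \<T>) - energy \<Omega> \<gamma> f u Top)
        ((L2_norm \<Omega> (nc_grad \<T> (\<lambda>x. u Top x - u (Mesh \<T>) x)))\<^sup>2 + osc_sq \<T> f))"
proof -
  obtain \<sigma> where \<sigma>: "\<forall>t\<in>\<T>0. marked_shape \<sigma> t" using initial_shapes[OF assms(2)] by (rule exE)
  have Lam: "\<Lambda> > 0" and interp: "\<And>\<T> \<T>' v w T. \<T> \<in> meshes \<T>0 \<Longrightarrow> \<T>' \<in> meshes \<T>0 \<Longrightarrow> refinement \<T> \<T>' \<Longrightarrow>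
      v \<in> H10_plus_CR \<Omega> \<T>' \<Longrightarrow> is_interpolant \<Omega> \<T> \<T>' v w \<Longrightarrow> T \<in> tris \<T> \<Longrightarrow>
      L2_norm T (\<lambda>x. inverse (mesh_size \<T> x) * (v x - w x)) \<le> \<Lambda> * L2_norm T (nc_grad \<T>' (\<lambda>x. v x - w x))"
    using assms(3) unfolding interpolation_constant_def by blast+
  define c1 where "c1 = 4 + \<Lambda>\<^sup>2 + \<gamma> + 2 / (\<gamma> - 2 * \<Lambda>\<^sup>2)"
  define K where "K = efficiency_constant \<sigma>"
  \<comment> \<open>\<open>c1\<close> serves the comparison with \<open>D\<^sup>2 + H\<^sup>2\<close>; the factor \<open>1 + K\<close> pays for replacing \<open>H\<^sup>2\<close> by the oscillation\<close>
  define c where "c = c1 * (1 + K)"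
  have g0: "0 < \<gamma>" using assms(4) zero_le_power2[of \<Lambda>] by linarith
  have c1: "0 < c1" using assms(4) g0 unfolding c1_def by (intro add_pos_pos add_pos_nonneg divide_pos_pos) simp_all
  have K: "0 \<le> K" unfolding K_def efficiency_constant_def by simp
  have cc: "c1 \<le> c" unfolding c_def using c1 K by simp
  then have c: "0 < c" using c1 by linarith
  show ?thesis
  proof (intro exI[of _ c] conjI allI impI ballI c)
    fix f :: "R2 \<Rightarrow> real" and u :: "xmesh \<Rightarrow> R2 \<Rightarrow> real" and \<T> :: mesh
    assume fu: "f \<in> L2 \<Omega> \<and> (\<forall>\<X> \<in> xmeshes \<T>0. solves \<Omega> f \<X> (u \<X>))" and M: "\<T> \<in> meshes \<T>0"
    have f: "f \<in> L2 \<Omega>" using fu by (rule conjunct1)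
    have sol: "CR_solution \<Omega> \<S> f (u (Mesh \<S>))" if "\<S> \<in> meshes \<T>0" for \<S>
      using bspec[OF conjunct2[OF fu], of "Mesh \<S>"] that by (simp add: xmeshes_def)
    have solT: "weak_solution \<Omega> f (u Top)"
      using bspec[OF conjunct2[OF fu], of Top] by (simp add: xmeshes_def)
    interpret coarse: domain_mesh \<Omega> \<sigma> \<T> by (rule domain_mesh_of_mesh[OF assms(1,2) \<sigma> M])
    define w where "w = u (Mesh \<T>)"
    note w = sol[OF M, folded w_def]
    have Ew: "energy \<Omega> \<gamma> f u (Mesh \<T>) = (1/2) * (L2_norm \<Omega> (nc_grad \<T> w))\<^sup>2
        + \<gamma> * (L2_norm \<Omega> (\<lambda>x. mesh_size \<T> x * f x))\<^sup>2"
      using coarse.CR_energy_value(1)[OF f w] by (simp add: w_def)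
    \<comment> \<open>functions in \<open>H10\<close> are regular on the coarse mesh itself, and every triangle counts as refined\<close>
    have top: "\<exists>X. \<bar>X\<bar> \<le> \<Lambda> * L2_norm \<Omega> (\<lambda>x. mesh_size \<T> x * f x) * L2_norm \<Omega> (nc_grad \<T> (\<lambda>x. u Top x - w x))
        \<and> energy \<Omega> \<gamma> f u (Mesh \<T>) - energy \<Omega> \<gamma> f u Top
          = (L2_norm \<Omega> (nc_grad \<T> (\<lambda>x. u Top x - w x)))\<^sup>2 / 2 - X + \<gamma> * (L2_norm \<Omega> (\<lambda>x. mesh_size \<T> x * f x))\<^sup>2"
      and top_diff: "L2_norm \<Omega> (nc_grad \<T> (\<lambda>x. u Top x - w x)) = L2_norm \<Omega> (\<lambda>x. weak_grad \<Omega> (u Top) x - nc_grad \<T> w x)"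
    proof -
      interpret refined_mesh \<Omega> \<sigma> \<T> \<T> by unfold_locales (simp add: refinement_def)
      note sT = solT[unfolded weak_solution_def]
      have v: "u Top \<in> H10 \<Omega>" by (rule conjunct1[OF sT])
      note vf = coarse.H10_facts[OF v]
      have e: "(LINT x:\<Omega>|lebesgue. weak_grad \<Omega> (u Top) x \<bullet> weak_grad \<Omega> (u Top) x) = (LINT x:\<Omega>|lebesgue. f x * u Top x)"
        by (rule bspec[OF conjunct2[OF sT] v])
      have wg: "has_weak_grad coarse.cells (u Top) (weak_grad \<Omega> (u Top))" by (rule has_weak_grad_subset[OF vf(4) coarse.cells_subset])
      have "(\<lambda>x. u Top x + 0) \<in> H10_plus_CR \<Omega> \<T>" unfolding H10_plus_CR_def mem_Collect_eq
        by (rule exI[of _ "u Top"], rule exI[of _ "\<lambda>x. 0"]) (use v coarse.zero_CR in simp)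
      then have plus: "u Top \<in> H10_plus_CR \<Omega> \<T>" by simp
      have dif: "L2_norm \<Omega> (nc_grad \<T> (\<lambda>x. u Top x - w x)) = L2_norm \<Omega> (\<lambda>x. weak_grad \<Omega> (u Top) x - nc_grad \<T> w x)"
        by (rule L2_norm_cong_AE[OF nc_grad_diff[OF wg coarse.CR_energy_value(3)[OF f w]]])
      then show "L2_norm \<Omega> (nc_grad \<T> (\<lambda>x. u Top x - w x)) = L2_norm \<Omega> (\<lambda>x. weak_grad \<Omega> (u Top) x - nc_grad \<T> w x)" .
      have "\<exists>X. \<bar>X\<bar> \<le> \<Lambda> * L2_norm (region (tris \<T>)) (\<lambda>x. mesh_size \<T> x * f x) * L2_norm \<Omega> (\<lambda>x. weak_grad \<Omega> (u Top) x - nc_grad \<T> w x)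
        \<and> (1/2) * (L2_norm \<Omega> (nc_grad \<T> w))\<^sup>2 - (1/2) * (L2_norm \<Omega> (weak_grad \<Omega> (u Top)))\<^sup>2
          = (1/2) * (L2_norm \<Omega> (\<lambda>x. weak_grad \<Omega> (u Top) x - nc_grad \<T> w x))\<^sup>2 - X"
        by (rule energy_comparison[OF coarse.H10_regular[OF v] vf(3) wg vf(2) Lam interp[OF M M refines plus] f e w order_refl])
          (assumption | blast)+
      then obtain X where X: "\<bar>X\<bar> \<le> \<Lambda> * L2_norm (region (tris \<T>)) (\<lambda>x. mesh_size \<T> x * f x) * L2_norm \<Omega> (\<lambda>x. weak_grad \<Omega> (u Top) x - nc_grad \<T> w x)"
        "(1/2) * (L2_norm \<Omega> (nc_grad \<T> w))\<^sup>2 - (1/2) * (L2_norm \<Omega> (weak_grad \<Omega> (u Top)))\<^sup>2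
          = (1/2) * (L2_norm \<Omega> (\<lambda>x. weak_grad \<Omega> (u Top) x - nc_grad \<T> w x))\<^sup>2 - X"
        by (elim exE conjE)
      have "energy \<Omega> \<gamma> f u Top = (1/2) * (L2_norm \<Omega> (weak_grad \<Omega> (u Top)))\<^sup>2"
        using coarse.energy_value[OF f vf(2,3) e] by simp
      then show "\<exists>X. \<bar>X\<bar> \<le> \<Lambda> * L2_norm \<Omega> (\<lambda>x. mesh_size \<T> x * f x) * L2_norm \<Omega> (nc_grad \<T> (\<lambda>x. u Top x - w x))
        \<and> energy \<Omega> \<gamma> f u (Mesh \<T>) - energy \<Omega> \<gamma> f u Top
          = (L2_norm \<Omega> (nc_grad \<T> (\<lambda>x. u Top x - w x)))\<^sup>2 / 2 - X + \<gamma> * (L2_norm \<Omega> (\<lambda>x. mesh_size \<T> x * f x))\<^sup>2"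
        using X unfolding dif Ew coarse.region_all by (intro exI[of _ X] conjI) simp_all
    qed
    define H where "H = L2_norm \<Omega> (\<lambda>x. mesh_size \<T> x * f x)"
    define D where "D = L2_norm \<Omega> (nc_grad \<T> (\<lambda>x. u Top x - w x))"
    define A where "A = energy \<Omega> \<gamma> f u (Mesh \<T>) - energy \<Omega> \<gamma> f u Top"
    obtain X where X: "\<bar>X\<bar> \<le> \<Lambda> * H * D" "A = D\<^sup>2 / 2 - X + \<gamma> * H\<^sup>2"
      using top unfolding A_def H_def[symmetric] D_def[symmetric] by (elim exE conjE)
    \<comment> \<open>the continuous energy has no weighted term, so the whole of \<open>H\<^sup>2\<close> is lost\<close>
    have HH: "H\<^sup>2 / 2 \<le> H\<^sup>2" by simp
    note T1 = energy_difference_equiv[OF assms(4) X(1) HH order_refl, folded c1_def, folded X(2)]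
    have "0 \<le> D\<^sup>2 + H\<^sup>2" by simp
    then have A0: "0 \<le> A" using T1(2) c1 by (metis order_trans zero_le_mult_iff not_le)
    have eff: "H\<^sup>2 \<le> K * (D\<^sup>2 + osc_sq \<T> f)"
      unfolding H_def D_def K_def top_diff by (rule coarse.efficiency[OF f solT coarse.CR_energy_value(3)[OF f w]])
    have oscH: "osc_sq \<T> f \<le> H\<^sup>2" unfolding H_def by (rule coarse.osc_le[OF f])
    have osc0: "0 \<le> osc_sq \<T> f" unfolding coarse.weighted_norm_sum(2)[OF f] by (intro sum_nonneg) simp
    have T2: "equiv_upto c A (D\<^sup>2 + osc_sq \<T> f)"
    proof (rule equiv_uptoI[OF c order_refl])
      have "A \<le> c1 * (D\<^sup>2 + K * (D\<^sup>2 + osc_sq \<T> f))"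
        using T1(1) mult_left_mono[OF add_left_mono[OF eff, of "D\<^sup>2"], of c1] c1 by linarith
      also have "\<dots> \<le> c1 * ((1 + K) * (D\<^sup>2 + osc_sq \<T> f))"
        using c1 osc0 by (intro mult_left_mono) (simp_all add: algebra_simps)
      finally show "A \<le> c * (D\<^sup>2 + osc_sq \<T> f)" by (simp add: c_def mult.assoc)
      have "D\<^sup>2 + osc_sq \<T> f \<le> c1 * A" using T1(2) oscH by linarith
      also have "\<dots> \<le> c * A" by (rule mult_right_mono[OF cc A0])
      finally show "D\<^sup>2 + osc_sq \<T> f \<le> c * A" .
      show "0 \<le> A" "0 \<le> D\<^sup>2 + osc_sq \<T> f" using A0 osc0 by simp_all
    qed
    then show "equiv_upto c (energy \<Omega> \<gamma> f u (Mesh \<T>) - energy \<Omega> \<gamma> f u Top)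
        ((L2_norm \<Omega> (nc_grad \<T> (\<lambda>x. u Top x - u (Mesh \<T>) x)))\<^sup>2 + osc_sq \<T> f)"
      by (simp only: A_def D_def w_def)
    fix \<X> assume xm: "\<X> \<in> xmeshes \<T>0" and xr: "xrefinement \<T> \<X>"
    show "equiv_upto c (energy \<Omega> \<gamma> f u (Mesh \<T>) - energy \<Omega> \<gamma> f u \<X>)
          ((L2_norm \<Omega> (nc_grad (finer_mesh \<T> \<X>) (\<lambda>x. u \<X> x - u (Mesh \<T>) x)))\<^sup>2
            + (L2_norm (region (refined_tris \<T> \<X>)) (\<lambda>x. mesh_size \<T> x * f x))\<^sup>2)"
    proof (cases \<X>)
      case Top
      have "equiv_upto c A (D\<^sup>2 + H\<^sup>2)" by (rule equiv_uptoI[OF c1 cc T1 A0]) simp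
      then show ?thesis unfolding Top by (simp add: A_def D_def H_def w_def coarse.region_all)
    next
      case (Mesh \<T>')
      have M': "\<T>' \<in> meshes \<T>0" using xm Mesh by (auto simp: xmeshes_def)
      interpret fine: domain_mesh \<Omega> \<sigma> \<T>' by (rule domain_mesh_of_mesh[OF assms(1,2) \<sigma> M'])
      interpret refined_mesh \<Omega> \<sigma> \<T> \<T>' by unfold_locales (use xr Mesh in simp)
      define v where "v = u (Mesh \<T>')"
      note vs = sol[OF M', folded v_def]
      note vCR = fine.CR_energy_value(3)[OF f vs]
      note wg = fine.CR_nc_grad(1)[OF vCR]
      have "(\<lambda>x. 0 + v x) \<in> H10_plus_CR \<Omega> \<T>'" unfolding H10_plus_CR_def mem_Collect_eq
        by (rule exI[of _ "\<lambda>x. 0"], rule exI[of _ v]) (use vCR coarse.zero_H10 in simp)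
      then have plus: "v \<in> H10_plus_CR \<Omega> \<T>'" by simp
      have unref: "\<exists>c. AE x in lebesgue. x \<in> T \<longrightarrow> nc_grad \<T>' v x = c" if "T \<in> tris \<T>" "T \<notin> tris \<T> - tris \<T>'" for T
      proof -
        have "T \<in> tris \<T>'" using that by blast
        then show ?thesis by (rule fine.CR_nc_grad(2)[OF vCR])
      qed
      define H' where "H' = L2_norm (region (tris \<T> - tris \<T>')) (\<lambda>x. mesh_size \<T> x * f x)"
      define D' where "D' = L2_norm \<Omega> (nc_grad \<T>' (\<lambda>x. v x - w x))"
      define B where "B = (L2_norm \<Omega> (\<lambda>x. mesh_size \<T> x * f x))\<^sup>2 - (L2_norm \<Omega> (\<lambda>x. mesh_size \<T>' x * f x))\<^sup>2"
      define A' where "A' = energy \<Omega> \<gamma> f u (Mesh \<T>) - energy \<Omega> \<gamma> f u (Mesh \<T>')"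
      have dif: "D' = L2_norm \<Omega> (\<lambda>x. nc_grad \<T>' v x - nc_grad \<T> w x)" unfolding D'_def
        by (rule L2_norm_cong_AE[OF nc_grad_diff[OF wg coarse.CR_energy_value(3)[OF f w]]])
      have "\<exists>X. \<bar>X\<bar> \<le> \<Lambda> * H' * D'
        \<and> (1/2) * (L2_norm \<Omega> (nc_grad \<T> w))\<^sup>2 - (1/2) * (L2_norm \<Omega> (nc_grad \<T>' v))\<^sup>2 = (1/2) * D'\<^sup>2 - X"
        unfolding dif H'_def
        by (rule energy_comparison[OF fine.CR_regular[OF vCR] fine.CR_nc_grad(3)[OF vCR] wg fine.CR_D(1)[OF vCR] Lam
            interp[OF M M' refines plus] f fine.CR_energy_value(2)[OF f vs] w Diff_subset unref])
      then obtain X' where X': "\<bar>X'\<bar> \<le> \<Lambda> * H' * D'"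
        "(1/2) * (L2_norm \<Omega> (nc_grad \<T> w))\<^sup>2 - (1/2) * (L2_norm \<Omega> (nc_grad \<T>' v))\<^sup>2 = (1/2) * D'\<^sup>2 - X'"
        by (elim exE conjE)
      have "energy \<Omega> \<gamma> f u (Mesh \<T>') = (1/2) * (L2_norm \<Omega> (nc_grad \<T>' v))\<^sup>2
          + \<gamma> * (L2_norm \<Omega> (\<lambda>x. mesh_size \<T>' x * f x))\<^sup>2"
        using fine.CR_energy_value(1)[OF f vs] by (simp add: v_def)
      then have A': "A' = D'\<^sup>2 / 2 - X' + \<gamma> * B" using X'(2) unfolding A'_def Ew B_def by (simp add: algebra_simps)
      note T1' = energy_difference_equiv[OF assms(4) X'(1) mesh_size_drop[OF f, folded H'_def B_def], folded c1_def, folded A']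
      have "0 \<le> D'\<^sup>2 + H'\<^sup>2" by simp
      then have A0': "0 \<le> A'" using T1'(2) c1 by (metis order_trans zero_le_mult_iff not_le)
      have "equiv_upto c A' (D'\<^sup>2 + H'\<^sup>2)" by (rule equiv_uptoI[OF c1 cc T1' A0']) simp
      then show ?thesis unfolding Mesh by (simp add: A'_def D'_def H'_def w_def v_def)
    qed
  qed
qed

end
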